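(* Let $d\ge 2$ and suppose that $\mathbf a$ is a coarse-grained elliptic coefficient field on the unit cube $\square_0=(-\frac12,\frac12)^d$. Let $s,t\in(0,1)$ with $s+t<1$ and set $\sigma:=1-s-t>0$. There exists a constant $C=C(s,t,d)<\infty$ (depending only on $s,t,d$) such that, for every $u\in H^1_{\mathbf a}(\square_0)$ satisfying $-\nabla\cdot\mathbf a\nabla u\le 0$ in $\square_0$ (that is, $u\in\mathcal A_-(\square_0)$), we have $$\sup_{\frac12\square_0}u\;\le\; C\,\Theta_{s,t}(\square_0;\mathcal K_{\mathrm{sub}})^{\frac{d}{4\sigma}}\;\|u_+\|_{L^2(\square_0)}.$$
   Context: Notation: $\square_m=(-\frac12 3^m,\frac12 3^m)^d$ for $m\in\mathbb Z$; $\rho\square_0=(-\frac\rho2,\frac\rho2)^d$; $\fint_U$ denotes the average over $U$; $u_+=\max\{u,0\}$; $\sup$ is the essential supremum. Coefficient field: a measurable map $\mathbf a$ from a bounded Lipschitz domain $U$ to symmetric positive semi-definite $d\times d$ matrices, invertible a.e., with $\mathbf a,\mathbf a^{-1}\in L^1(U)$. $H^1_{\mathbf a}(U)$ is the completion of $C^\infty(\overline U)$ in the norm $\|u\|_{H^1_{\mathbf a}(U)}=(\|u\|_{L^2(U)}^2+\int_U\nabla u\cdot\mathbf a\nabla u)^{1/2}$; then $\nabla u,\mathbf a\nabla u\in L^1(U)$. $\mathcal A(U)$ is the set of $u\in H^1_{\mathbf a}(U)$ with $\int_U\nabla\psi\cdot\mathbf a\nabla u=0$ for all $\psi\in C_c^\infty(U)$;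 $\mathcal A_-(U)$ (subsolutions) is the set of $u\in H^1_{\mathbf a}(U)$ with $\int_U\nabla\psi\cdot\mathbf a\nabla u\le0$ for all $0\le\psi\in C^\infty_c(U)$. Cones: $\mathcal K_{\mathrm{sub}}(U)=\mathcal A_-(U)$; $\mathcal K_{\mathrm{trunc}}(U)=\{(u-k)_+: u\in\mathcal A(U),k\in\mathbb R\}$; $\mathcal K_{\mathrm{pow}}(U)$ is the set of $\Phi(u)\in H^1_{\mathbf a}(U)$ with $u\in\mathcal A(U)$, $u\ge0$, $\Phi:u(U)\to\mathbb R$ convex and monotone with $\Phi'(u)=Cu^{r}$ for some $C,r\in\mathbb R$. Coarse-grained quantities: for a cone $\mathcal K$ and $p\in\mathbb R^d$, $\mathbf a(U,p;\mathcal K)=\sup_{u\in\mathcal K(U)}\fint_U(-\nabla u\cdot\mathbf a\nabla u+2p\cdot\mathbf a\nabla u)$ and $\|\mathbf a(U;\mathcal K)\|=\sup_{|p|=1}\mathbf a(U,p;\mathcal K)$. The symmetric positive matrix $\mathbf a_*^{-1}(U)$ is defined by $q\cdot\mathbf a_*^{-1}(U)q=\sup_{u\in\mathcal A(U)}\fint_U(-\nabla u\cdot\mathbf a\nabla u+2q\cdot\nabla u)$, $q\in\mathbb R^d$; $|\cdot|$ is the spectral norm. With $\mathfrak c_s=1-3^{-s}$, $$\Lambda_s(\square_m;\mathcal K)=\Bigl(\mathfrak c_s\sum_{k=-\infty}^m3^{-s(m-k)}\max_{z\in3^k\mathbb Z^d\cap\square_m}\|\mathbf a(z+\square_k;\mathcal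 K)\|^{1/2}\Bigr)^2,$$ $$\lambda_s(\square_m)=\Bigl(\mathfrak c_s\sum_{k=-\infty}^m3^{-s(m-k)}\max_{z\in3^k\mathbb Z^d\cap\square_m}|\mathbf a_*^{-1}(z+\square_k)|^{1/2}\Bigr)^{-2},$$ $\Theta_{s,t}(\square_m;\mathcal K)=\Lambda_s(\square_m;\mathcal K)/\lambda_t(\square_m)\in[1,\infty]$. $\mathbf a$ is coarse-grained elliptic in $\square_m$ if there exist $s,t\in(0,1)$ with $s+t<1$ and $\Theta_{s,t}(\square_m;\mathcal K_{\mathrm{pow}}\cup\mathcal K_{\mathrm{trunc}})<\infty$. (The stated estimate is regarded as trivially true if $\Theta_{s,t}(\square_0;\mathcal K_{\mathrm{sub}})=\infty$.) *)

theory Defs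
  imports "HOL-Analysis.Analysis" "HOL-Probability.Essential_Supremum"
begin

section \<open>Cubes\<close>

text \<open>\<open>cube z r\<close> is \<open>z + r \<box>\<^sub>0\<close>, the open cube of side \<open>r\<close> centred at \<open>z\<close>; thus
  \<open>z + \<box>\<^sub>k\<close> is \<open>cube z (3 powi k)\<close>.\<close>

definition cube :: "real ^ 'n \<Rightarrow> real \<Rightarrow> (real ^ 'n) set" where
  "cube z r = {x. \<forall>i. \<bar>x $ i - z $ i\<bar> < r / 2}"

definition triadic :: "int \<Rightarrow> (real ^ 'n) set" where
  "triadic k = {z. \<forall>i. \<exists>j::int. z $ i = 3 powi k * of_int j}"

definition average :: "(real ^ 'n) set \<Rightarrow> (real ^ 'n \<Rightarrow> real) \<Rightarrow> real" where
  "average U f = (LINT x|lebesgue_on U. f x) / measure lebesgue U"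


section \<open>Smooth functions\<close>

primrec Ck_on :: "nat \<Rightarrow> (real ^ 'n) set \<Rightarrow> (real ^ 'n \<Rightarrow> real) \<Rightarrow> bool" where
  "Ck_on 0 V f \<longleftrightarrow> continuous_on V f"
| "Ck_on (Suc k) V f \<longleftrightarrow>
    (\<exists>G. (\<forall>x\<in>V. GDERIV f x :> G x) \<and> (\<forall>i. Ck_on k V (\<lambda>x. G x $ i)))"

definition smooth_on :: "(real ^ 'n) set \<Rightarrow> (real ^ 'n \<Rightarrow> real) \<Rightarrow> bool" where
  "smooth_on V f \<longleftrightarrow> (\<forall>k. Ck_on k V f)"

definition grad :: "(real ^ 'n \<Rightarrow> real) \<Rightarrow> real ^ 'n \<Rightarrow> real ^ 'n" where
  "grad f x = (THE D. GDERIV f x :> D)"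

definition smooth_up_to_boundary :: "(real ^ 'n) set \<Rightarrow> (real ^ 'n \<Rightarrow> real) set" where
  "smooth_up_to_boundary U = {f. \<exists>V. open V \<and> closure U \<subseteq> V \<and> smooth_on V f}"

definition test_functions :: "(real ^ 'n) set \<Rightarrow> (real ^ 'n \<Rightarrow> real) set" where
  "test_functions U =
    {\<psi>. smooth_on UNIV \<psi> \<and> compact (closure {x. \<psi> x \<noteq> 0}) \<and> closure {x. \<psi> x \<noteq> 0} \<subseteq> U}"


section \<open>Coefficient fields and the energy space\<close>

definition coefficient_field :: "(real ^ 'n) set \<Rightarrow> (real ^ 'n \<Rightarrow> real ^ 'n ^ 'n) \<Rightarrow> bool" where
  "coefficient_field U a \<longleftrightarrow>
    (\<forall>x\<in>U. transpose (a x) = a x \<and> (\<forall>v. 0 \<le> v \<bullet> (a x *v v))) \<and>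
    (AE x in lebesgue_on U. invertible (a x)) \<and>
    integrable (lebesgue_on U) a \<and>
    integrable (lebesgue_on U) (\<lambda>x. matrix_inv (a x))"

definition L2 :: "(real ^ 'n) set \<Rightarrow> (real ^ 'n \<Rightarrow> real) set" where
  "L2 U = {u \<in> borel_measurable (lebesgue_on U). integrable (lebesgue_on U) (\<lambda>x. (u x)\<^sup>2)}"

definition L2_norm_on :: "(real ^ 'n) set \<Rightarrow> (real ^ 'n \<Rightarrow> real) \<Rightarrow> real" where
  "L2_norm_on U u = sqrt (LINT x|lebesgue_on U. (u x)\<^sup>2)"

text \<open>The completion of \<open>C\<^sup>\<infinity>\<close> of the closure of \<open>U\<close> is realised concretely: the limit of a
  Cauchy sequence \<open>\<phi> k\<close> is the \<open>L\<^sup>2\<close>-limit \<open>u\<close> of \<open>\<phi> k\<close> together with the limit \<open>G\<close> of \<open>grad (\<phi> k)\<close>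
  in the energy seminorm.  As \<open>a\<close> is a.e. invertible with integrable inverse, energy convergence of
  the gradients implies \<open>L\<^sup>1\<close> convergence; hence \<open>G\<close> is the weak gradient of \<open>u\<close>, so it is determined
  a.e. by \<open>u\<close>, and elements of the completion may be identified with the functions \<open>u\<close>.
  Functions are not quotiented by a.e. equality.\<close>

definition has_H1a_grad ::
  "(real ^ 'n \<Rightarrow> real ^ 'n ^ 'n) \<Rightarrow> (real ^ 'n) set \<Rightarrow> (real ^ 'n \<Rightarrow> real) \<Rightarrow> (real ^ 'n \<Rightarrow> real ^ 'n) \<Rightarrow> bool"
where
  "has_H1a_grad a U u G \<longleftrightarrow>
    u \<in> L2 U \<and>
    G \<in> borel_measurable (lebesgue_on U) \<and>
    integrable (lebesgue_on U) (\<lambda>x. G x \<bullet> (a x *v G x)) \<and>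
    (\<exists>\<phi>. (\<forall>k::nat. \<phi> k \<in> smooth_up_to_boundary U) \<and>
      (\<lambda>k. LINT x|lebesgue_on U. (\<phi> k x - u x)\<^sup>2) \<longlonglongrightarrow> 0 \<and>
      (\<lambda>k. LINT x|lebesgue_on U. (grad (\<phi> k) x - G x) \<bullet> (a x *v (grad (\<phi> k) x - G x))) \<longlonglongrightarrow> 0)"

definition H1a :: "(real ^ 'n \<Rightarrow> real ^ 'n ^ 'n) \<Rightarrow> (real ^ 'n) set \<Rightarrow> (real ^ 'n \<Rightarrow> real) set" where
  "H1a a U = {u. \<exists>G. has_H1a_grad a U u G}"

definition H1a_grad ::
  "(real ^ 'n \<Rightarrow> real ^ 'n ^ 'n) \<Rightarrow> (real ^ 'n) set \<Rightarrow> (real ^ 'n \<Rightarrow> real) \<Rightarrow> real ^ 'n \<Rightarrow> real ^ 'n" where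
  "H1a_grad a U u = (SOME G. has_H1a_grad a U u G)"

definition solutions ::
  "(real ^ 'n \<Rightarrow> real ^ 'n ^ 'n) \<Rightarrow> (real ^ 'n) set \<Rightarrow> (real ^ 'n \<Rightarrow> real) set" where
  "solutions a U = {u \<in> H1a a U. \<forall>\<psi>\<in>test_functions U.
     (LINT x|lebesgue_on U. grad \<psi> x \<bullet> (a x *v H1a_grad a U u x)) = 0}"

definition subsolutions ::
  "(real ^ 'n \<Rightarrow> real ^ 'n ^ 'n) \<Rightarrow> (real ^ 'n) set \<Rightarrow> (real ^ 'n \<Rightarrow> real) set" where
  "subsolutions a U = {u \<in> H1a a U. \<forall>\<psi>\<in>test_functions U. (\<forall>x. 0 \<le> \<psi> x) \<longrightarrow>
     (LINT x|lebesgue_on U. grad \<psi> x \<bullet> (a x *v H1a_grad a U u x)) \<le> 0}"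


section \<open>Cones\<close>

type_synonym 'n cone = "(real ^ 'n) set \<Rightarrow> (real ^ 'n \<Rightarrow> real) set"

definition K_sub :: "(real ^ 'n \<Rightarrow> real ^ 'n ^ 'n) \<Rightarrow> 'n cone" where
  "K_sub a U = subsolutions a U"

definition K_trunc :: "(real ^ 'n \<Rightarrow> real ^ 'n ^ 'n) \<Rightarrow> 'n cone" where
  "K_trunc a U = {(\<lambda>x. max (u x - k) 0) | u k. u \<in> solutions a U}"

text \<open>As \<open>u\<close> is only defined a.e., its range is represented by an interval \<open>J\<close> containing almost
  all values of \<open>u\<close>.  "Monotone" means nondecreasing or nonincreasing.  The expression \<open>t powr r\<close>
  vanishes at \<open>t = 0\<close> even for \<open>r \<le> 0\<close>, hence the separate treatment of \<open>r = 0\<close> (where \<open>t\<^sup>0 = 1\<close>)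
  and of \<open>r < 0\<close> (where \<open>0\<close> is not in the domain of \<open>\<Phi>\<close>).\<close>

definition power_profile :: "real set \<Rightarrow> (real \<Rightarrow> real) \<Rightarrow> bool" where
  "power_profile J \<Phi> \<longleftrightarrow>
    convex_on J \<Phi> \<and> (mono_on J \<Phi> \<or> antimono_on J \<Phi>) \<and>
    (\<exists>C r. (r < 0 \<longrightarrow> 0 \<notin> J) \<and>
       (\<forall>t\<in>J. (\<Phi> has_real_derivative C * (if r = 0 then 1 else t powr r)) (at t within J)))"

definition K_pow :: "(real ^ 'n \<Rightarrow> real ^ 'n ^ 'n) \<Rightarrow> 'n cone" where
  "K_pow a U = {(\<lambda>x. \<Phi> (u x)) | u \<Phi> J. u \<in> solutions a U \<and>
     is_interval J \<and> J \<subseteq> {0..} \<and> (AE x in lebesgue_on U. u x \<in> J) \<and> power_profile J \<Phi>} \<inter> H1a a U"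


section \<open>Coarse-grained quantities\<close>

definition coarse ::
  "(real ^ 'n \<Rightarrow> real ^ 'n ^ 'n) \<Rightarrow> 'n cone \<Rightarrow> (real ^ 'n) set \<Rightarrow> real ^ 'n \<Rightarrow> ereal" where
  "coarse a K U p = (SUP u\<in>K U. ereal (average U (\<lambda>x.
     - (H1a_grad a U u x \<bullet> (a x *v H1a_grad a U u x)) + 2 * (p \<bullet> (a x *v H1a_grad a U u x)))))"

definition coarse_norm ::
  "(real ^ 'n \<Rightarrow> real ^ 'n ^ 'n) \<Rightarrow> 'n cone \<Rightarrow> (real ^ 'n) set \<Rightarrow> ereal" where
  "coarse_norm a K U = (SUP p\<in>{p. norm p = 1}. coarse a K U p)"

definition a_star_inv ::
  "(real ^ 'n \<Rightarrow> real ^ 'n ^ 'n) \<Rightarrow> (real ^ 'n) set \<Rightarrow> real ^ 'n ^ 'n" where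
  "a_star_inv a U = (THE M. transpose M = M \<and> (\<forall>q. ereal (q \<bullet> (M *v q)) =
     (SUP u\<in>solutions a U. ereal (average U (\<lambda>x.
       - (H1a_grad a U u x \<bullet> (a x *v H1a_grad a U u x)) + 2 * (q \<bullet> H1a_grad a U u x))))))"

definition spectral_norm :: "real ^ 'n ^ 'n \<Rightarrow> real" where
  "spectral_norm M = onorm (\<lambda>v. M *v v)"

text \<open>Applied below only to \<open>coarse_norm\<close>, which is nonnegative because the cones contain \<open>0\<close>.\<close>

definition esqrt :: "ereal \<Rightarrow> ennreal" where
  "esqrt x = (if x = \<infinity> then \<infinity> else ennreal (sqrt (real_of_ereal x)))"

definition Lambda_up ::
  "(real ^ 'n \<Rightarrow> real ^ 'n ^ 'n) \<Rightarrow> 'n cone \<Rightarrow> real \<Rightarrow> int \<Rightarrow> ennreal" where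
  "Lambda_up a K s m =
    (ennreal (1 - 3 powr (- s)) *
      (\<Sum>\<^sub>\<infinity>k\<in>{..m}. ennreal (3 powr (- s * of_int (m - k))) *
        (MAX z\<in>triadic k \<inter> cube 0 (3 powi m). esqrt (coarse_norm a K (cube z (3 powi k))))))\<^sup>2"

definition lambda_low ::
  "(real ^ 'n \<Rightarrow> real ^ 'n ^ 'n) \<Rightarrow> real \<Rightarrow> int \<Rightarrow> ennreal" where
  "lambda_low a s m =
    inverse ((ennreal (1 - 3 powr (- s)) *
      (\<Sum>\<^sub>\<infinity>k\<in>{..m}. ennreal (3 powr (- s * of_int (m - k))) *
        (MAX z\<in>triadic k \<inter> cube 0 (3 powi m).
           ennreal (sqrt (spectral_norm (a_star_inv a (cube z (3 powi k))))))))\<^sup>2)"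

definition Theta ::
  "(real ^ 'n \<Rightarrow> real ^ 'n ^ 'n) \<Rightarrow> 'n cone \<Rightarrow> real \<Rightarrow> real \<Rightarrow> int \<Rightarrow> ennreal" where
  "Theta a K s t m = Lambda_up a K s m / lambda_low a t m"

definition coarse_grained_elliptic :: "(real ^ 'n \<Rightarrow> real ^ 'n ^ 'n) \<Rightarrow> int \<Rightarrow> bool" where
  "coarse_grained_elliptic a m \<longleftrightarrow>
    coefficient_field (cube 0 (3 powi m)) a \<and>
    (\<exists>s t. 0 < s \<and> s < 1 \<and> 0 < t \<and> t < 1 \<and> s + t < 1 \<and>
       Theta a (\<lambda>U. K_pow a U \<union> K_trunc a U) s t m < \<infinity>)"

end

theory Submission
  imports Defs
begin

text \<open>The proof is a De Giorgi iteration in which the ellipticity constants of \<open>a\<close> are replaced by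
  multiscale sums of its coarse-grained quantities.  Finiteness of \<open>Theta\<close> bounds the mean of \<open>grad w\<close>
  (resp. of the flux of a subsolution) over every triadic cube of side \<open>3\<^sup>-\<^sup>n\<close> by \<open>PB 3\<^sup>t\<^sup>n\<close> (resp.
  \<open>PA 3\<^sup>s\<^sup>n\<close>) times the square root of the energy, where \<open>(PA PB)\<^sup>2\<close> is \<open>Theta\<close> up to a constant.
  Telescoping local averages along the tree of triadic cubes turns these bounds into a fractional Poincare
  inequality and into an estimate for the pairing of a flux with \<open>w grad \<eta>\<close>; as \<open>s + t < 1\<close> the
  scales are summable.  Applied to the cross term of the usual cutoff argument, the latter gives a Caccioppoli
  inequality after the energy has been absorbed by choosing the triadic scale.  Inserting it into the Poincare
  inequality on small cubes, for functions with small support, makes the truncations of a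
  subsolution at increasing levels decay geometrically, once the starting scale is at least
  \<open>(PA PB)\<^sup>1\<^sup>/\<^sup>\<sigma>\<close>; this produces the power \<open>d/(4\<sigma>)\<close> of \<open>Theta\<close>.\<close>

text \<open>No Sobolev inequality is available: the gain of the iteration comes from refining the
  scale. If the truncation at one level is small in L2, Chebyshev bounds the support of the next one
  by a fraction of the volume of a cube of the current generation. The Poincare inequality on such
  cubes then needs no mean value, and the next step works on cubes \<open>level_gap\<close>
  generations smaller. The decay is linear, with a factor that keeps up with the shrinking volume,
  and the supremum is bounded by the L2 norm divided by the square root of the volume of a starting
  cube. This fixes the power of \<open>Theta\<close>. With X = PA PB, absorbing the energy costs
  PA^2 X^(2s/sigma), the Poincare inequality contributes PB^2 3^(-2(1-t)N), and the product is
  (X^(1/sigma) / 3^N)^(2(1-t)). Starting cubes of side X^(-1/sigma) have volume X^(-d/sigma), whose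
  inverse square root is X^(d/(2 sigma)). Local averages are taken against a tent function instead
  of an indicator, so that passing from a cube to a child leaves no boundary terms.\<close>

section \<open>Gradients and C^k functions of several variables\<close>

lemma GDERIV_unique:
  assumes "GDERIV f x :> D" "GDERIV f x :> D'" shows "D = D'"
proof -
  have "(\<lambda>h. h \<bullet> D) = (\<lambda>h. h \<bullet> D')"
    using assms has_derivative_unique unfolding gderiv_def by blast
  then show ?thesis by (metis inner_commute vector_eq_ldot)
qed

lemma grad_eq: "GDERIV f x :> D \<Longrightarrow> grad f x = D"
  unfolding grad_def using GDERIV_unique by blast

lemma GDERIV_cong_open:
  assumes "GDERIV f x :> D" "open V" "x \<in> V" "\<And>y. y \<in> V \<Longrightarrow> g y = f y"
  shows "GDERIV g x :> D"
  using assms unfolding gderiv_def by (metis has_derivative_transform_within_open)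

lemma grad_cong_open:
  assumes "open V" "x \<in> V" "\<And>y. y \<in> V \<Longrightarrow> g y = f y"
  shows "grad g x = grad f x"
proof -
  have "gderiv g x = gderiv f x"
    using GDERIV_cong_open[of f x _ V g] GDERIV_cong_open[of g x _ V f] assms by fastforce
  then show ?thesis unfolding grad_def by simp
qed

lemma Ck_on_subset: "Ck_on k V f \<Longrightarrow> W \<subseteq> V \<Longrightarrow> Ck_on k W f"
proof (induction k arbitrary: f)
  case 0 then show ?case using continuous_on_subset by auto
next
  case (Suc k) then show ?case by (simp, meson in_mono)
qed

lemma Ck_on_SucD: "Ck_on (Suc k) V f \<Longrightarrow> Ck_on k V f"
proof (induction k arbitrary: f)
  case 0
  then show ?case
    using continuous_at_imp_continuous_on has_derivative_continuous unfolding gderiv_def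
    by (metis (no_types, lifting) Ck_on.simps gderiv_def)
next
  case (Suc k)
  then obtain G where "\<forall>x\<in>V. GDERIV f x :> G x" "\<forall>i. Ck_on (Suc k) V (\<lambda>x. G x $ i)"
    by (metis Ck_on.simps(2))
  with Suc.IH show ?case by auto
qed

lemma Ck_on_cong:
  assumes "Ck_on k V f" "open V" "\<And>y. y \<in> V \<Longrightarrow> g y = f y"
  shows "Ck_on k V g"
proof (cases k)
  case 0 then show ?thesis using assms by (simp cong: continuous_on_cong)
next
  case (Suc m)
  then show ?thesis using assms GDERIV_cong_open by (simp, meson)
qed

text \<open>On an open set the gradient field hidden in the existential of \<open>Ck_on\<close> is
  forced to be \<open>grad f\<close>. Gluing depends on this: in \<open>Ck_on_local\<close> all
  neighbourhoods must use one and the same field.\<close>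

lemma Ck_on_Suc_grad:
  assumes "open V"
  shows "Ck_on (Suc k) V f \<longleftrightarrow>
    (\<forall>x\<in>V. GDERIV f x :> grad f x) \<and> (\<forall>i. Ck_on k V (\<lambda>x. grad f x $ i))"
proof
  assume "Ck_on (Suc k) V f"
  then obtain G where G: "\<forall>x\<in>V. GDERIV f x :> G x" "\<forall>i. Ck_on k V (\<lambda>x. G x $ i)" by auto
  then have "\<forall>x\<in>V. grad f x = G x" using grad_eq by blast
  then show "(\<forall>x\<in>V. GDERIV f x :> grad f x) \<and> (\<forall>i. Ck_on k V (\<lambda>x. grad f x $ i))"
    using G Ck_on_cong[OF _ assms] by (metis (mono_tags, lifting))
qed auto

lemma Ck_on_local:
  assumes "open V" "\<And>x. x \<in> V \<Longrightarrow> \<exists>W. open W \<and> x \<in> W \<and> Ck_on k W f"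
  shows "Ck_on k V f"
  using assms
proof (induction k arbitrary: f)
  case 0
  then have "\<forall>x\<in>V. isCont f x" by (metis Ck_on.simps(1) continuous_on_eq_continuous_at)
  then show ?case using continuous_at_imp_continuous_on by auto
next
  case (Suc k)
  have "GDERIV f x :> grad f x" if "x \<in> V" for x
    using Suc.prems(2)[OF that] Ck_on_Suc_grad by blast
  moreover have "Ck_on k V (\<lambda>x. grad f x $ i)" for i
  proof (rule Suc.IH[OF Suc.prems(1)])
    fix x assume "x \<in> V"
    then show "\<exists>W. open W \<and> x \<in> W \<and> Ck_on k W (\<lambda>x. grad f x $ i)"
      using Suc.prems(2)[of x] Ck_on_Suc_grad by blast
  qed
  ultimately show ?case using Ck_on_Suc_grad[OF Suc.prems(1)] by blast
qed

lemma Ck_on_const: "Ck_on k V (\<lambda>x. c)"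
proof (induction k arbitrary: c)
  case (Suc k) then show ?case by (auto intro!: exI[of _ "\<lambda>x. 0"] GDERIV_const)
qed auto

lemma GDERIV_coord: "GDERIV (\<lambda>x. x $ i) x :> axis i (1::real)"
proof -
  have "(\<lambda>h. h \<bullet> axis i (1::real)) = (\<lambda>h. h $ i)" by (auto simp: inner_axis)
  then show ?thesis unfolding gderiv_def
    using bounded_linear_imp_has_derivative[OF bounded_linear_vec_nth] by metis
qed

lemma Ck_on_coord: "Ck_on k V (\<lambda>x. x $ i)"
  by (cases k) (auto intro!: continuous_intros GDERIV_coord Ck_on_const exI[of _ "\<lambda>x. axis i (1::real)"])

lemma Ck_on_add: "Ck_on k V f \<Longrightarrow> Ck_on k V g \<Longrightarrow> Ck_on k V (\<lambda>x. f x + g x)"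
proof (induction k arbitrary: f g)
  case 0 then show ?case by (auto intro: continuous_intros)
next
  case (Suc k)
  then obtain F G where F: "\<forall>x\<in>V. GDERIV f x :> F x" "\<forall>i. Ck_on k V (\<lambda>x. F x $ i)"
    and G: "\<forall>x\<in>V. GDERIV g x :> G x" "\<forall>i. Ck_on k V (\<lambda>x. G x $ i)" by auto
  show ?case using F G Suc.IH by (auto intro!: exI[of _ "\<lambda>x. F x + G x"] GDERIV_add)
qed

lemma Ck_on_mult: "Ck_on k V f \<Longrightarrow> Ck_on k V g \<Longrightarrow> Ck_on k V (\<lambda>x. f x * g x)"
proof (induction k arbitrary: f g)
  case 0 then show ?case by (auto intro: continuous_intros)
next
  case (Suc k)
  then obtain F G where F: "\<forall>x\<in>V. GDERIV f x :> F x" "\<forall>i. Ck_on k V (\<lambda>x. F x $ i)"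
    and G: "\<forall>x\<in>V. GDERIV g x :> G x" "\<forall>i. Ck_on k V (\<lambda>x. G x $ i)" by auto
  have "Ck_on k V f" "Ck_on k V g" using Suc.prems Ck_on_SucD by blast+
  then have "Ck_on k V (\<lambda>x. f x * G x $ i + g x * F x $ i)" for i
    using F G Suc.IH by (intro Ck_on_add) auto
  then show ?case using F G
    by (auto intro!: exI[of _ "\<lambda>x. f x *\<^sub>R G x + g x *\<^sub>R F x"] GDERIV_mult)
qed

section \<open>Smooth functions of one real variable: flat exponentials, ramp and truncation\<close>

primrec Ck :: "nat \<Rightarrow> (real \<Rightarrow> real) \<Rightarrow> bool" where
  "Ck 0 F \<longleftrightarrow> continuous_on UNIV F"
| "Ck (Suc k) F \<longleftrightarrow> (\<exists>F'. (\<forall>x. (F has_real_derivative F' x) (at x)) \<and> Ck k F')"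

lemma Ck_on_compose: "Ck k F \<Longrightarrow> Ck_on k V f \<Longrightarrow> Ck_on k V (\<lambda>x. F (f x))"
proof (induction k arbitrary: F f)
  case 0 then show ?case by (auto intro: continuous_on_compose2)
next
  case (Suc k)
  then obtain F' G where F: "\<forall>x. (F has_real_derivative F' x) (at x)" "Ck k F'"
    and G: "\<forall>x\<in>V. GDERIV f x :> G x" "\<forall>i. Ck_on k V (\<lambda>x. G x $ i)" by auto
  have "Ck_on k V f" using Suc.prems Ck_on_SucD by blast
  then have "Ck_on k V (\<lambda>x. F' (f x) * G x $ i)" for i
    using F G Suc.IH by (intro Ck_on_mult) auto
  moreover have "GDERIV (\<lambda>x. F (f x)) x :> F' (f x) *\<^sub>R G x" if "x \<in> V" for x
    by (rule GDERIV_DERIV_compose) (use F G that in auto)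
  ultimately show ?case by (auto intro!: exI[of _ "\<lambda>x. F' (f x) *\<^sub>R G x"])
qed

lemma Ck_const: "Ck k (\<lambda>x. c)"
proof (induction k arbitrary: c)
  case (Suc k) then show ?case by (auto intro!: exI[of _ "\<lambda>x. 0"])
qed auto

lemma Ck_ident: "Ck k (\<lambda>x. x)"
  by (cases k) (auto intro!: continuous_intros DERIV_ident Ck_const exI[of _ "\<lambda>x. 1"])

lemma Ck_add: "Ck k F \<Longrightarrow> Ck k G \<Longrightarrow> Ck k (\<lambda>x. F x + G x)"
proof (induction k arbitrary: F G)
  case 0 then show ?case by (auto intro: continuous_intros)
next
  case (Suc k)
  then obtain F' G' where "\<forall>x. (F has_real_derivative F' x) (at x)" "Ck k F'"
    "\<forall>x. (G has_real_derivative G' x) (at x)" "Ck k G'" by auto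
  with Suc.IH show ?case by (auto intro!: exI[of _ "\<lambda>x. F' x + G' x"] DERIV_add)
qed

lemma Ck_affine: "Ck k F \<Longrightarrow> Ck k (\<lambda>x. c * F (b * x + e))"
proof (induction k arbitrary: F c)
  case 0
  then show ?case by (auto intro!: continuous_intros intro: continuous_on_compose2)
next
  case (Suc k)
  then obtain F' where F: "\<forall>x. (F has_real_derivative F' x) (at x)" "Ck k F'" by auto
  have "((\<lambda>x. c * F (b * x + e)) has_real_derivative (c * b) * F' (b * x + e)) (at x)" for x
  proof -
    have "((\<lambda>x. b * x + e) has_real_derivative b) (at x)" by (auto intro!: derivative_eq_intros)
    from DERIV_cmult[OF DERIV_chain2[OF F(1)[rule_format] this], of c] show ?thesis
      by (simp add: mult_ac)
  qed
  with Suc.IH[OF F(2), of "c * b"] show ?case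
    unfolding Ck.simps by (intro exI[of _ "\<lambda>x. (c * b) * F' (b * x + e)"]) auto
qed

text \<open>The classical flat function exp(-1/x) with a polynomial factor in 1/x. The family is
  closed under differentiation (\<open>pexp_DERIV\<close>), so smoothness, including the point 0, is
  one induction over all polynomials at once. \<open>pexp 1\<close> serves for bumps and cutoffs;
  \<open>pexp [:1,1:]\<close> and \<open>pexp [:0,0,0,1:]\<close> are the first two derivatives of
  \<open>sramp\<close>.\<close>

definition pexp :: "real poly \<Rightarrow> real \<Rightarrow> real" where
  "pexp p x = (if x > 0 then poly p (1 / x) * exp (- (1 / x)) else 0)"

text \<open>A smooth convex substitute for the positive part, bounded by it from above and by its translate
  by 1 from below.\<close>

definition sramp :: "real \<Rightarrow> real" where
  "sramp x = (if x > 0 then x * exp (- (1 / x)) else 0)"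

lemma poly_exp_tendsto_0: "((\<lambda>y::real. poly q y * exp (- y)) \<longlongrightarrow> 0) at_top"
proof -
  have "((\<lambda>y::real. \<Sum>i\<le>degree q. coeff q i * (y ^ i / exp y)) \<longlongrightarrow> (\<Sum>i\<le>degree q. coeff q i * 0)) at_top"
    by (intro tendsto_sum tendsto_mult tendsto_const tendsto_power_div_exp_0)
  then show ?thesis
    by (simp add: poly_altdef sum_distrib_right sum_distrib_left exp_minus divide_inverse mult_ac)
qed

lemma pexp_tendsto_0: "(pexp p \<longlongrightarrow> 0) (at 0)"
proof -
  have "((\<lambda>x. poly p (inverse x) * exp (- inverse x)) \<longlongrightarrow> 0) (at_right 0)"
    by (rule filterlim_compose[OF poly_exp_tendsto_0 filterlim_inverse_at_top_right])
  then have "(pexp p \<longlongrightarrow> 0) (at_right 0)"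
    by (rule Lim_transform_eventually) (auto simp: pexp_def eventually_at_filter divide_inverse)
  moreover have "(pexp p \<longlongrightarrow> 0) (at_left 0)"
    by (rule Lim_transform_eventually[OF tendsto_const]) (auto simp: pexp_def eventually_at_filter)
  ultimately show ?thesis using filterlim_split_at by blast
qed

lemma DERIV_zero_left:
  assumes "x < 0" "\<And>y::real. y \<le> 0 \<Longrightarrow> F y = 0" shows "(F has_real_derivative 0) (at x)"
  by (rule DERIV_cong_ev[THEN iffD1, OF refl _ refl DERIV_const[of 0]])
    (use assms eventually_nhds_in_open[of "{..<0}" x] in \<open>auto elim: eventually_mono\<close>)

lemma pexp_DERIV: "(pexp p has_real_derivative pexp ([:0,0,1:] * (p - pderiv p)) x) (at x)"
proof (cases x "0::real" rule: linorder_cases)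
  case less then show ?thesis using DERIV_zero_left[of x "pexp p"] by (auto simp: pexp_def)
next
  case equal
  \<comment> \<open>Division by h multiplies the polynomial by its variable 1/h, so the difference
    quotient at 0 is again a member of the family, and all members tend to 0 there.\<close>
  have "(\<lambda>h. (pexp p (0 + h) - pexp p 0) / h) = pexp (pCons 0 p)"
    by (auto simp: pexp_def fun_eq_iff)
  then show ?thesis unfolding equal DERIV_def using pexp_tendsto_0 by (simp add: pexp_def)
next
  case greater
  have "((\<lambda>x. poly p (1 / x) * exp (- (1 / x))) has_real_derivative
     pexp ([:0,0,1:] * (p - pderiv p)) x) (at x)"
    using greater by (auto intro!: derivative_eq_intros poly_DERIV[THEN DERIV_chain2]
      simp: pexp_def field_simps power2_eq_square)
  then show ?thesis
    by (rule has_field_derivative_transform_within_open[of _ _ _ "{0<..}"])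
      (use greater in \<open>auto simp: pexp_def\<close>)
qed

lemma Ck_pexp: "Ck k (pexp p)"
proof (induction k arbitrary: p)
  case 0 then show ?case by (auto intro!: continuous_at_imp_continuous_on DERIV_isCont pexp_DERIV)
next
  case (Suc k) then show ?case using pexp_DERIV by auto
qed

lemma sramp_DERIV: "(sramp has_real_derivative pexp [:1,1:] x) (at x)"
proof (cases x "0::real" rule: linorder_cases)
  case less then show ?thesis using DERIV_zero_left[of x sramp] by (auto simp: pexp_def sramp_def)
next
  case equal
  have "(\<lambda>h. (sramp (0 + h) - sramp 0) / h) = pexp [:1:]"
    by (auto simp: pexp_def sramp_def fun_eq_iff)
  then show ?thesis unfolding equal DERIV_def using pexp_tendsto_0 by (simp add: pexp_def)
next
  case greater
  have "((\<lambda>x. x * exp (- (1 / x))) has_real_derivative pexp [:1,1:] x) (at x)"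
    using greater by (auto intro!: derivative_eq_intros simp: pexp_def field_simps power2_eq_square)
  then show ?thesis
    by (rule has_field_derivative_transform_within_open[of _ _ _ "{0<..}"])
      (use greater in \<open>auto simp: sramp_def\<close>)
qed

lemma Ck_sramp: "Ck k sramp"
proof (cases k)
  case 0 then show ?thesis by (auto intro!: continuous_at_imp_continuous_on DERIV_isCont sramp_DERIV)
next
  case (Suc m) then show ?thesis using sramp_DERIV Ck_pexp by auto
qed

lemma sramp_deriv_DERIV: "(pexp [:1,1:] has_real_derivative pexp [:0,0,0,1:] x) (at x)"
  using pexp_DERIV[of "[:1,1:]" x] by (simp add: pderiv_pCons)

lemma sramp_deriv_bounds: "0 \<le> pexp [:1,1:] x" "pexp [:1,1:] x \<le> 1"
proof -
  show "0 \<le> pexp [:1,1:] x" by (auto simp: pexp_def)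
  have "(1 + 1/x) * exp (- (1 / x)) \<le> exp (1 / x) * exp (- (1 / x))"
    by (intro mult_right_mono exp_ge_add_one_self) auto
  then show "pexp [:1,1:] x \<le> 1" by (auto simp: pexp_def mult_exp_exp)
qed

lemma sramp_deriv2_bounds: "0 \<le> pexp [:0,0,0,1:] x" "pexp [:0,0,0,1:] x \<le> 6"
proof -
  show "0 \<le> pexp [:0,0,0,1:] x" by (auto simp: pexp_def)
  have "y ^ 3 \<le> 6 * exp y" if "0 \<le> y" for y::real
  proof -
    have "(\<Sum>n\<in>{3::nat}. inverse (fact n) *\<^sub>R y ^ n) \<le> (\<Sum>n. inverse (fact n) *\<^sub>R y ^ n)"
      by (rule sum_le_suminf) (use that summable_exp_generic[of y] in auto)
    then show ?thesis by (simp add: exp_def fact_numeral)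
  qed
  from this[of "1 / x"] show "pexp [:0,0,0,1:] x \<le> 6"
    by (auto simp: pexp_def exp_minus field_simps power3_eq_cube)
qed

lemma sramp_bounds: "0 \<le> sramp x" "sramp x \<le> max x 0" "max (x - 1) 0 \<le> sramp x"
proof -
  show "0 \<le> sramp x" "sramp x \<le> max x 0" by (auto simp: sramp_def mult_left_le)
  have "x * (1 + - (1/x)) \<le> x * exp (- (1 / x))" if "x > 0"
    using that by (intro mult_left_mono exp_ge_add_one_self) auto
  moreover have "x * (1 + - (1/x)) = x - 1" if "x > 0" using that by (simp add: field_simps)
  ultimately have "x - 1 \<le> x * exp (- (1 / x))" if "x > 0" using that by metis
  then show "max (x - 1) 0 \<le> sramp x" by (auto simp: sramp_def)
qed

lemma sramp_nonpos: "x \<le> 0 \<Longrightarrow> sramp x = 0"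
  by (auto simp: sramp_def)

text \<open>A smooth substitute for truncation to [-M, M]. It keeps a minimising sequence of the
  Dirichlet problem bounded without raising its energy. Since \<open>sramp\<close> lags behind the
  positive part by at most 1, values may reach beyond M, but not beyond M + 1.\<close>

definition strunc :: "real \<Rightarrow> real \<Rightarrow> real" where
  "strunc M x = x - sramp (x - M) + sramp (- x - M)"

definition strunc_deriv :: "real \<Rightarrow> real \<Rightarrow> real" where
  "strunc_deriv M x = 1 - pexp [:1,1:] (x - M) - pexp [:1,1:] (- x - M)"

lemma Ck_strunc: "Ck k (strunc M)"
proof -
  have 1: "Ck k (\<lambda>x. (-1) * sramp (1 * x + (- M)))" "Ck k (\<lambda>x. 1 * sramp ((-1) * x + (- M)))"
    by (rule Ck_affine[OF Ck_sramp])+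
  have "strunc M = (\<lambda>x. (x + (-1) * sramp (1 * x + (- M))) + 1 * sramp ((-1) * x + (- M)))"
    by (auto simp: strunc_def fun_eq_iff)
  then show ?thesis using Ck_add[OF Ck_add[OF Ck_ident 1(1)] 1(2)] by simp
qed

lemma strunc_DERIV: "(strunc M has_real_derivative strunc_deriv M x) (at x)"
proof -
  have 1: "((\<lambda>x. sramp (x - M)) has_real_derivative pexp [:1,1:] (x - M) * 1) (at x)"
    by (rule DERIV_chain2[OF sramp_DERIV]) (auto intro!: derivative_eq_intros)
  have 2: "((\<lambda>x. sramp (- x - M)) has_real_derivative pexp [:1,1:] (- x - M) * (-1)) (at x)"
    by (rule DERIV_chain2[OF sramp_DERIV]) (auto intro!: derivative_eq_intros)
  show ?thesis unfolding strunc_def[abs_def] strunc_deriv_def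
    by (rule DERIV_cong[OF DERIV_add[OF DERIV_diff[OF DERIV_ident 1] 2]]) auto
qed

lemma strunc_bounds:
  assumes "M \<ge> 0"
  shows "\<bar>x\<bar> \<le> M \<Longrightarrow> strunc M x = x" "0 \<le> strunc_deriv M x" "strunc_deriv M x \<le> 1"
    "\<bar>strunc M x\<bar> \<le> M + 1"
proof -
  show "\<bar>x\<bar> \<le> M \<Longrightarrow> strunc M x = x" by (auto simp: strunc_def sramp_nonpos)
  have "pexp [:1,1:] (x - M) = 0 \<or> pexp [:1,1:] (- x - M) = 0" using assms by (auto simp: pexp_def)
  then show "0 \<le> strunc_deriv M x" "strunc_deriv M x \<le> 1"
    using sramp_deriv_bounds[of "x - M"] sramp_deriv_bounds[of "- x - M"] by (auto simp: strunc_deriv_def)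
  show "\<bar>strunc M x\<bar> \<le> M + 1"
    using sramp_bounds[of "x - M"] sramp_bounds[of "- x - M"] sramp_nonpos[of "x - M"]
      sramp_nonpos[of "- x - M"] assms unfolding strunc_def by (smt (verit) max_def)
qed

section \<open>Closure properties of smooth functions and rules for their gradients\<close>

lemma smooth_on_const: "smooth_on V (\<lambda>x. c)"
  and smooth_on_coord: "smooth_on V (\<lambda>x. x $ i)"
  by (auto simp: smooth_on_def Ck_on_const Ck_on_coord)

lemma smooth_on_add: "smooth_on V f \<Longrightarrow> smooth_on V g \<Longrightarrow> smooth_on V (\<lambda>x. f x + g x)"
  and smooth_on_mult: "smooth_on V f \<Longrightarrow> smooth_on V g \<Longrightarrow> smooth_on V (\<lambda>x. f x * g x)"
  by (auto simp: smooth_on_def Ck_on_add Ck_on_mult)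

lemma smooth_on_compose: "(\<And>k. Ck k F) \<Longrightarrow> smooth_on V f \<Longrightarrow> smooth_on V (\<lambda>x. F (f x))"
  by (auto simp: smooth_on_def Ck_on_compose)

lemma smooth_on_cmult: "smooth_on V f \<Longrightarrow> smooth_on V (\<lambda>x. c * f x)"
  by (intro smooth_on_mult smooth_on_const)

lemma smooth_on_diff: "smooth_on V f \<Longrightarrow> smooth_on V g \<Longrightarrow> smooth_on V (\<lambda>x. f x - g x)"
  using smooth_on_add[of V f "\<lambda>x. (-1) * g x"] smooth_on_cmult[of V g "-1"] by simp

lemma smooth_on_prod:
  assumes "\<And>i. i \<in> I \<Longrightarrow> smooth_on V (f i)" shows "smooth_on V (\<lambda>x. \<Prod>i\<in>I. f i x)"
proof (cases "finite I")
  case True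
  then show ?thesis using assms
    by (induction I) (auto intro: smooth_on_const smooth_on_mult)
qed (auto intro: smooth_on_const)

lemma smooth_on_subset: "smooth_on V f \<Longrightarrow> W \<subseteq> V \<Longrightarrow> smooth_on W f"
  unfolding smooth_on_def using Ck_on_subset by blast

lemma smooth_on_cong: "smooth_on V f \<Longrightarrow> open V \<Longrightarrow> (\<And>y. y \<in> V \<Longrightarrow> g y = f y) \<Longrightarrow> smooth_on V g"
  unfolding smooth_on_def using Ck_on_cong by blast

lemma smooth_on_local:
  assumes "open V" "\<And>x. x \<in> V \<Longrightarrow> \<exists>W. open W \<and> x \<in> W \<and> smooth_on W f"
  shows "smooth_on V f"
  using assms Ck_on_local unfolding smooth_on_def by meson

lemma smooth_on_GDERIV:
  assumes "smooth_on V f" "x \<in> V" shows "GDERIV f x :> grad f x"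
proof -
  have "Ck_on (Suc 0) V f" using assms smooth_on_def by blast
  then obtain D where "GDERIV f x :> D" using assms by auto
  then show ?thesis using grad_eq by metis
qed

lemma smooth_on_continuous: "smooth_on V f \<Longrightarrow> continuous_on V f"
  unfolding smooth_on_def using Ck_on.simps(1) by blast

lemma smooth_on_grad_nth: "smooth_on V f \<Longrightarrow> open V \<Longrightarrow> smooth_on V (\<lambda>x. grad f x $ i)"
  unfolding smooth_on_def using Ck_on_Suc_grad by blast

lemma smooth_on_grad_continuous:
  assumes "smooth_on V f" "open V" shows "continuous_on V (grad f)"
proof -
  have "continuous_on V (\<lambda>x. \<chi> i. grad f x $ i)"
    using smooth_on_grad_nth[OF assms] by (intro continuous_on_vec_lambda smooth_on_continuous) auto
  then show ?thesis by simp
qed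

lemma smooth_grad_add:
  assumes "smooth_on V f" "smooth_on V g" "x \<in> V"
  shows "grad (\<lambda>x. f x + g x) x = grad f x + grad g x"
  by (intro grad_eq GDERIV_add smooth_on_GDERIV[OF _ assms(3)] assms)

lemma smooth_grad_mult:
  assumes "smooth_on V f" "smooth_on V g" "x \<in> V"
  shows "grad (\<lambda>x. f x * g x) x = f x *\<^sub>R grad g x + g x *\<^sub>R grad f x"
  by (intro grad_eq GDERIV_mult smooth_on_GDERIV[OF _ assms(3)] assms)

lemma grad_const [simp]: "grad (\<lambda>x. c) x = 0"
  by (intro grad_eq GDERIV_const)

lemma smooth_grad_cmult:
  assumes "smooth_on V f" "x \<in> V"
  shows "grad (\<lambda>x. c * f x) x = c *\<^sub>R grad f x"
  using smooth_grad_mult[OF smooth_on_const assms(1) assms(2), of c] by simp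

lemma smooth_grad_diff:
  assumes "smooth_on V f" "smooth_on V g" "x \<in> V"
  shows "grad (\<lambda>x. f x - g x) x = grad f x - grad g x"
  using smooth_grad_add[OF assms(1) smooth_on_cmult[OF assms(2), of "-1"] assms(3)]
    smooth_grad_cmult[OF assms(2,3), of "-1"] by simp

lemma smooth_grad_compose:
  assumes "(F has_real_derivative F' (f x)) (at (f x))" "smooth_on V f" "x \<in> V"
  shows "grad (\<lambda>x. F (f x)) x = F' (f x) *\<^sub>R grad f x"
  by (intro grad_eq GDERIV_DERIV_compose smooth_on_GDERIV[OF _ assms(3)] assms)

lemma grad_coord: "grad (\<lambda>x. x $ i) x = axis i 1"
  by (intro grad_eq GDERIV_coord)

lemma GDERIV_partial:
  assumes "GDERIV f x :> D"
  shows "((\<lambda>\<tau>. f (x + \<tau> *\<^sub>R v)) has_real_derivative D \<bullet> v) (at 0)"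
proof -
  have "((\<lambda>\<tau>::real. x + \<tau> *\<^sub>R v) has_derivative (\<lambda>h. h *\<^sub>R v)) (at 0)"
    by (auto intro!: derivative_eq_intros)
  moreover have "(f has_derivative (\<lambda>h. h \<bullet> D)) (at (x + 0 *\<^sub>R v))"
    using assms by (simp add: gderiv_def)
  ultimately have "((\<lambda>\<tau>. f (x + \<tau> *\<^sub>R v)) has_derivative (\<lambda>h. (h *\<^sub>R v) \<bullet> D)) (at 0)"
    by (rule has_derivative_compose)
  moreover have "(\<lambda>h. (h *\<^sub>R v) \<bullet> D) = (*) (D \<bullet> v)" by (auto simp: inner_commute)
  ultimately show ?thesis by (simp add: has_field_derivative_def)
qed

lemma GDERIV_partial_eq:
  assumes "GDERIV f x :> D" "((\<lambda>\<tau>. f (x + \<tau> *\<^sub>R axis i 1)) has_real_derivative d) (at 0)"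
  shows "D $ i = d"
  using DERIV_unique[OF GDERIV_partial[OF assms(1), of "axis i 1"] assms(2)]
  by (simp add: inner_axis)

lemma compact_closed_subset: "compact K \<Longrightarrow> closed S \<Longrightarrow> S \<subseteq> K \<Longrightarrow> compact S"
  using compact_Int_closed[of K S] by (simp add: Int_absorb1)

subsection \<open>Cubes\<close>

lemma cube_eq_box:
  "cube z r = box (z - (\<chi> i. r / 2)) (z + (\<chi> i. r / 2))"
proof -
  have "\<bar>x $ i - z $ i\<bar> < r / 2 \<longleftrightarrow> z $ i - r / 2 < x $ i \<and> x $ i < z $ i + r / 2" for x i by linarith
  then show ?thesis by (auto simp: cube_def mem_box_cart)
qed

lemma cube_open [simp]: "open (cube z r)" by (simp add: cube_eq_box open_box)
lemma cube_bounded: "bounded (cube z r)" by (simp add: cube_eq_box bounded_box)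
lemma cube_lmeasurable [simp]: "cube z r \<in> lmeasurable" by (simp add: cube_eq_box)
lemma cube_sets [simp, measurable]: "cube z r \<in> sets lebesgue" by (simp add: cube_eq_box)

lemma cube_centre: "r > 0 \<Longrightarrow> z \<in> cube z r" by (simp add: cube_def)

lemma measure_cube: "0 \<le> r \<Longrightarrow> measure lebesgue (cube (z::real^'n) r) = r ^ CARD('n)"
proof -
  assume "0 \<le> r"
  then have "cbox (z - (\<chi> i. r / 2)) (z + (\<chi> i. r / 2)) \<noteq> {}"
    by (simp add: interval_ne_empty_cart)
  then have "measure lborel (cbox (z - (\<chi> i. r / 2)) (z + (\<chi> i. r / 2))) = (\<Prod>i\<in>(UNIV::'n set). r)"
    by (subst content_cbox_cart) auto
  then show ?thesis unfolding cube_eq_box using \<open>0 \<le> r\<close>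
    by (simp add: measure_lborel_box_eq measure_lborel_cbox_eq)
qed

lemma cube_subset: "\<lbrakk>\<And>i. \<bar>z $ i - w $ i\<bar> \<le> (R - r) / 2\<rbrakk> \<Longrightarrow> cube z r \<subseteq> cube w R"
proof -
  assume *: "\<And>i. \<bar>z $ i - w $ i\<bar> \<le> (R - r) / 2"
  have "\<bar>x $ i - w $ i\<bar> < R / 2" if "\<bar>x $ i - z $ i\<bar> < r / 2" for x i
    using that *[of i] unfolding diff_divide_distrib by linarith
  then show ?thesis unfolding cube_def by auto
qed

subsection \<open>Test functions\<close>

lemma test_functions_smooth: "\<psi> \<in> test_functions U \<Longrightarrow> smooth_on UNIV \<psi>"
  by (simp add: test_functions_def)

lemma test_functions_mono: "U \<subseteq> W \<Longrightarrow> \<psi> \<in> test_functions U \<Longrightarrow> \<psi> \<in> test_functions W"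
  by (auto simp: test_functions_def)

lemma test_functions_grad_outside:
  assumes "\<psi> \<in> test_functions U" "x \<notin> closure {x. \<psi> x \<noteq> 0}" shows "grad \<psi> x = 0"
proof -
  have "grad \<psi> x = grad (\<lambda>x. 0) x"
  proof (rule grad_cong_open[of "- closure {x. \<psi> x \<noteq> 0}"])
    fix y assume "y \<in> - closure {x. \<psi> x \<noteq> 0}"
    then show "\<psi> y = 0" using subsetD[OF closure_subset, of y "{x. \<psi> x \<noteq> 0}"] by auto
  qed (use assms in auto)
  then show ?thesis by simp
qed

lemma test_functions_grad_outside':
  "\<psi> \<in> test_functions U \<Longrightarrow> x \<notin> U \<Longrightarrow> grad \<psi> x = 0"
  using test_functions_grad_outside by (fastforce simp: test_functions_def)

lemma smooth_up_to_boundaryE: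
  assumes "\<phi> \<in> smooth_up_to_boundary U"
  obtains V where "open V" "closure U \<subseteq> V" "U \<subseteq> V" "smooth_on V \<phi>"
  using assms closure_subset unfolding smooth_up_to_boundary_def by blast

lemma smooth_up_to_boundary_subset:
  "\<phi> \<in> smooth_up_to_boundary U \<Longrightarrow> W \<subseteq> U \<Longrightarrow> \<phi> \<in> smooth_up_to_boundary W"
  unfolding smooth_up_to_boundary_def using closure_mono by blast

lemma smooth_up_to_boundary_UNIV: "smooth_on UNIV f \<Longrightarrow> f \<in> smooth_up_to_boundary U"
  unfolding smooth_up_to_boundary_def by blast

lemma smooth_up_to_boundary_add:
  assumes "f \<in> smooth_up_to_boundary U" "g \<in> smooth_up_to_boundary U"
  shows "(\<lambda>x. f x + g x) \<in> smooth_up_to_boundary U"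
proof -
  obtain V W where "open V" "closure U \<subseteq> V" "smooth_on V f" "open W" "closure U \<subseteq> W" "smooth_on W g"
    using assms by (auto simp: smooth_up_to_boundary_def)
  then show ?thesis unfolding smooth_up_to_boundary_def
    by (intro CollectI exI[of _ "V \<inter> W"]) (auto intro!: smooth_on_add elim: smooth_on_subset)
qed

lemma smooth_up_to_boundary_compose:
  "(\<And>k. Ck k F) \<Longrightarrow> f \<in> smooth_up_to_boundary U \<Longrightarrow> (\<lambda>x. F (f x)) \<in> smooth_up_to_boundary U"
  unfolding smooth_up_to_boundary_def using smooth_on_compose by blast

text \<open>The functions that approximate elements of the energy space are smooth only near the
  closure of U, so their products with test functions have to be extended by zero. U and the
  complement of the support form an open cover on which the extension is visibly smooth, and
  smoothness is local.\<close>

lemma test_functions_glue: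
  assumes \<psi>: "\<psi> \<in> test_functions U" and U: "open U" and h: "smooth_on U h"
  shows "(\<lambda>x. if x \<in> U then \<psi> x * h x else 0) \<in> test_functions U"
    (is "?f \<in> _")
proof -
  let ?K = "closure {x. \<psi> x \<noteq> 0}"
  have K: "compact ?K" "?K \<subseteq> U" using \<psi> by (auto simp: test_functions_def)
  have sub: "{x. ?f x \<noteq> 0} \<subseteq> {x. \<psi> x \<noteq> 0}" by auto
  then have sub': "closure {x. ?f x \<noteq> 0} \<subseteq> ?K" by (rule closure_mono)
  have "smooth_on U (\<lambda>x. \<psi> x * h x)"
    by (intro smooth_on_mult h smooth_on_subset[OF test_functions_smooth[OF \<psi>]]) auto
  then have 1: "smooth_on U ?f" by (rule smooth_on_cong[OF _ U]) auto
  have z: "\<psi> y = 0" if "y \<notin> ?K" for y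
    using that subsetD[OF closure_subset, of y "{x. \<psi> x \<noteq> 0}"] by auto
  have 2: "smooth_on (- ?K) ?f"
  proof (rule smooth_on_cong[OF smooth_on_const[of _ 0]])
    fix y assume "y \<in> - ?K"
    then have "\<psi> y = 0" using z by blast
    then show "?f y = 0" by simp
  qed (rule open_Compl[OF closed_closure])
  have "smooth_on UNIV ?f"
  proof (rule smooth_on_local[OF open_UNIV])
    fix x show "\<exists>W. open W \<and> x \<in> W \<and> smooth_on W ?f"
    proof (cases "x \<in> U")
      case True then show ?thesis using 1 U by (intro exI[of _ U] conjI)
    next
      case False
      then have "x \<in> - ?K" using K(2) by blast
      then show ?thesis using 2 by (intro exI[of _ "- ?K"] conjI open_Compl closed_closure)
    qed
  qed
  moreover have "compact (closure {x. ?f x \<noteq> 0})"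
    using compact_closed_subset[OF K(1) closed_closure sub'] by auto
  ultimately show ?thesis unfolding test_functions_def using sub' K(2) by auto
qed

lemma test_functions_mult:
  assumes \<psi>: "\<psi> \<in> test_functions U" and h: "smooth_on UNIV h"
  shows "(\<lambda>x. \<psi> x * h x) \<in> test_functions U"
proof -
  have sub: "closure {x. \<psi> x * h x \<noteq> 0} \<subseteq> closure {x. \<psi> x \<noteq> 0}" by (rule closure_mono) auto
  have c: "compact (closure {x. \<psi> x \<noteq> 0})" using \<psi> by (auto simp: test_functions_def)
  show ?thesis unfolding test_functions_def
    using compact_closed_subset[OF c closed_closure sub] sub \<psi>
      smooth_on_mult[OF test_functions_smooth[OF \<psi>] h] by (auto simp: test_functions_def)
qed

lemma test_functions_add:
  assumes \<psi>: "\<psi> \<in> test_functions U" and \<phi>: "\<phi> \<in> test_functions U"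
  shows "(\<lambda>x. \<psi> x + \<phi> x) \<in> test_functions U"
proof -
  have sub: "closure {x. \<psi> x + \<phi> x \<noteq> 0} \<subseteq> closure {x. \<psi> x \<noteq> 0} \<union> closure {x. \<phi> x \<noteq> 0}"
    by (subst closure_Un[symmetric], rule closure_mono) auto
  have c: "compact (closure {x. \<psi> x \<noteq> 0} \<union> closure {x. \<phi> x \<noteq> 0})"
    using \<psi> \<phi> by (intro compact_Un) (auto simp: test_functions_def)
  show ?thesis unfolding test_functions_def
    using compact_closed_subset[OF c closed_closure sub] sub \<psi> \<phi>
      smooth_on_add[OF test_functions_smooth[OF \<psi>] test_functions_smooth[OF \<phi>]]
    by (fastforce simp: test_functions_def)
qed

lemma test_functions_cmult:
  "\<psi> \<in> test_functions U \<Longrightarrow> (\<lambda>x. c * \<psi> x) \<in> test_functions U"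
  using test_functions_mult[OF _ smooth_on_const, of \<psi> U c] by (simp add: mult.commute)

lemma test_functions_diff:
  assumes "\<psi> \<in> test_functions U" "\<phi> \<in> test_functions U"
  shows "(\<lambda>x. \<psi> x - \<phi> x) \<in> test_functions U"
  using test_functions_add[OF assms(1) test_functions_cmult[OF assms(2), of "-1"]] by simp

lemma test_functions_zero: "(\<lambda>x. 0) \<in> test_functions U"
  by (auto simp: test_functions_def smooth_on_const)

lemma test_functions_bounded:
  assumes \<psi>: "\<psi> \<in> test_functions U"
  obtains B where "B > 0" "\<And>x. \<bar>\<psi> x\<bar> \<le> B" "\<And>x. norm (grad \<psi> x) \<le> B"
proof -
  let ?K = "closure {x. \<psi> x \<noteq> 0}"
  have K: "compact ?K" using \<psi> by (auto simp: test_functions_def)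
  have "bounded (\<psi> ` ?K)" "bounded (grad \<psi> ` ?K)"
    using smooth_on_continuous[OF test_functions_smooth[OF \<psi>]]
      smooth_on_grad_continuous[OF test_functions_smooth[OF \<psi>]]
    by (auto intro!: compact_imp_bounded compact_continuous_image K intro: continuous_on_subset)
  then obtain A B where AB: "\<forall>x\<in>?K. norm (\<psi> x) \<le> A" "\<forall>x\<in>?K. norm (grad \<psi> x) \<le> B"
    unfolding bounded_iff by auto
  show thesis
  proof (rule that[of "max 1 (max A B)"])
    fix x
    have "x \<notin> ?K \<Longrightarrow> \<psi> x = 0" using subsetD[OF closure_subset, of x "{x. \<psi> x \<noteq> 0}"] by auto
    then show "\<bar>\<psi> x\<bar> \<le> max 1 (max A B)" using AB(1) by (cases "x \<in> ?K") fastforce+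
    show "norm (grad \<psi> x) \<le> max 1 (max A B)"
      using AB(2) test_functions_grad_outside[OF \<psi>] by (cases "x \<in> ?K") fastforce+
  qed auto
qed

lemma smooth_up_to_boundary_bounded:
  assumes "\<phi> \<in> smooth_up_to_boundary U" "bounded U"
  obtains B where "B > 0" "\<And>x. x \<in> U \<Longrightarrow> \<bar>\<phi> x\<bar> \<le> B" "\<And>x. x \<in> U \<Longrightarrow> norm (grad \<phi> x) \<le> B"
proof -
  obtain V where V: "open V" "closure U \<subseteq> V" "smooth_on V \<phi>"
    using assms by (auto elim: smooth_up_to_boundaryE)
  have K: "compact (closure U)" using assms compact_closure by blast
  have "bounded (\<phi> ` closure U)" "bounded (grad \<phi> ` closure U)"
    using smooth_on_continuous[OF V(3)] smooth_on_grad_continuous[OF V(3,1)] V(2)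
    by (auto intro!: compact_imp_bounded compact_continuous_image K intro: continuous_on_subset)
  then obtain A B where AB: "\<forall>x\<in>closure U. norm (\<phi> x) \<le> A" "\<forall>x\<in>closure U. norm (grad \<phi> x) \<le> B"
    unfolding bounded_iff by auto
  show thesis
    by (rule that[of "max 1 (max A B)"]) (use AB closure_subset[of U] in \<open>fastforce+\<close>)
qed

subsection \<open>Integration by parts\<close>

lemma lipschitz_of_grad_bound:
  assumes "smooth_on V f" "convex S" "S \<subseteq> V" "\<And>x. x \<in> S \<Longrightarrow> norm (grad f x) \<le> B" "x \<in> S" "y \<in> S"
  shows "\<bar>f x - f y\<bar> \<le> B * norm (x - y)"
proof -
  have "norm (f x - f y) \<le> B * norm (x - y)"
  proof (rule differentiable_bound[OF assms(2) _ _ assms(5,6)])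
    fix x assume x: "x \<in> S"
    then show "(f has_derivative (\<lambda>h. h \<bullet> grad f x)) (at x within S)"
      using smooth_on_GDERIV[OF assms(1)] assms(3) has_derivative_at_withinI
      unfolding gderiv_def by blast
    show "onorm (\<lambda>h. h \<bullet> grad f x) \<le> B"
    proof (rule onorm_bound)
      show "0 \<le> B" using assms(4)[OF x] norm_ge_zero order_trans by blast
      fix h show "norm (h \<bullet> grad f x) \<le> B * norm h"
        using order_trans[OF Cauchy_Schwarz_ineq2[of h "grad f x"] mult_left_mono[OF assms(4)[OF x] norm_ge_zero]]
        by (simp add: mult.commute)
    qed
  qed
  then show ?thesis by simp
qed

lemma lborel_integral_translate:
  fixes f :: "'a::euclidean_space \<Rightarrow> real"
  assumes [measurable]: "f \<in> borel_measurable borel"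
  shows "(LINT x|lborel. f (x + c)) = (LINT x|lborel. f x)"
proof -
  have "(LINT x|lborel. f x) = (LINT x|distr lborel borel ((+) c). f x)"
    by (simp add: lborel_distr_plus)
  also have "\<dots> = (LINT x|lborel. f (c + x))" by (subst integral_distr) auto
  finally show ?thesis by (simp add: add.commute)
qed

lemma integrable_bounded_support:
  fixes f :: "'a::euclidean_space \<Rightarrow> real"
  assumes "f \<in> borel_measurable borel" "\<And>x. \<bar>f x\<bar> \<le> B" "\<And>x. f x \<noteq> 0 \<Longrightarrow> x \<in> cball 0 R"
  shows "integrable lborel f"
proof (rule Bochner_Integration.integrable_bound)
  show "integrable lborel (\<lambda>x::'a. B * indicator (cball 0 R) x)"
    by (intro integrable_mult_right integrable_real_indicator) (use emeasure_lborel_cball_finite in \<open>auto simp: top.not_eq_extremum[symmetric] infinity_ennreal_def\<close>)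
  show "AE x in lborel. norm (f x) \<le> norm (B * indicator (cball 0 R) x)"
  proof (intro AE_I2)
    fix x show "norm (f x) \<le> norm (B * indicator (cball 0 R) x)"
    proof (cases "x \<in> cball 0 R")
      case True
      then show ?thesis using assms(2)[of x] by simp
    next
      case False
      then have "f x = 0" using assms(3) by blast
      then show ?thesis by simp
    qed
  qed
qed (use assms in auto)

text \<open>Difference quotients have integral zero by translation invariance of Lebesgue measure.
  They are dominated thanks to the gradient bound and the bounded support, so the limit has integral
  zero as well.\<close>

lemma integral_grad_zero:
  assumes \<psi>: "\<psi> \<in> test_functions U"
  shows "(LINT x|lborel. grad \<psi> x $ i) = 0"
proof -
  note sm = test_functions_smooth[OF \<psi>]
  obtain B where B: "B > 0" "\<And>x. \<bar>\<psi> x\<bar> \<le> B" "\<And>x. norm (grad \<psi> x) \<le> B"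
    using test_functions_bounded[OF \<psi>] by metis
  have "bounded {x. \<psi> x \<noteq> 0}"
    using \<psi> compact_imp_bounded bounded_subset[OF _ closure_subset] by (auto simp: test_functions_def)
  then obtain R where R: "\<And>x. \<psi> x \<noteq> 0 \<Longrightarrow> norm x \<le> R" unfolding bounded_iff by blast
  define h where "h n = 1 / real (Suc n)" for n
  have h: "h n > 0" "h n \<le> 1" for n by (auto simp: h_def)
  define D where "D n x = (\<psi> (x + h n *\<^sub>R axis i 1) - \<psi> x) / h n" for n x
  have [measurable]: "\<psi> \<in> borel_measurable borel"
    using smooth_on_continuous[OF sm] by (rule borel_measurable_continuous_onI)
  have gm: "(\<lambda>x. grad \<psi> x $ i) \<in> borel_measurable borel"
    using smooth_on_continuous[OF smooth_on_grad_nth[OF sm]] by (intro borel_measurable_continuous_onI) auto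
  have Dm: "D n \<in> borel_measurable borel" for n unfolding D_def by measurable
  have "(\<lambda>n. integral\<^sup>L lborel (D n)) \<longlonglongrightarrow> (LINT x|lborel. grad \<psi> x $ i)"
  proof (rule integral_dominated_convergence[where w="\<lambda>x. B * indicator (cball 0 (R + 1)) x"])
    show "integrable lborel (\<lambda>x::real^'a. B * indicator (cball 0 (R + 1)) x)"
      by (intro integrable_mult_right integrable_real_indicator) (use emeasure_lborel_cball_finite in \<open>auto simp: top.not_eq_extremum[symmetric] infinity_ennreal_def\<close>)
    show "AE x in lborel. (\<lambda>n. D n x) \<longlonglongrightarrow> grad \<psi> x $ i"
    proof (intro AE_I2)
      fix x
      have "((\<lambda>\<tau>. \<psi> (x + \<tau> *\<^sub>R axis i 1)) has_real_derivative grad \<psi> x \<bullet> axis i 1) (at 0)"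
        using GDERIV_partial smooth_on_GDERIV[OF sm] by blast
      then have lim: "((\<lambda>\<tau>. (\<psi> (x + \<tau> *\<^sub>R axis i 1) - \<psi> x) / \<tau>) \<longlongrightarrow> grad \<psi> x $ i) (at 0)"
        by (simp add: DERIV_def inner_axis)
      have "filterlim h (at 0) sequentially"
        using h(1) LIMSEQ_inverse_real_of_nat unfolding filterlim_at h_def
        by (auto simp: inverse_eq_divide)
      from filterlim_compose[OF lim this] show "(\<lambda>n. D n x) \<longlonglongrightarrow> grad \<psi> x $ i"
        by (simp add: D_def)
    qed
    fix n show "AE x in lborel. norm (D n x) \<le> B * indicator (cball 0 (R + 1)) x"
    proof (intro AE_I2)
      fix x :: "real^'a"
      have "\<bar>\<psi> (x + h n *\<^sub>R axis i 1) - \<psi> x\<bar> \<le> B * norm (x + h n *\<^sub>R axis i 1 - x)"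
        by (rule lipschitz_of_grad_bound[OF sm, of UNIV]) (use B in auto)
      then have 1: "\<bar>D n x\<bar> \<le> B" using h[of n] by (simp add: D_def field_simps norm_axis_1)
      have 2: "D n x = 0" if "norm x > R + 1"
      proof -
        have "norm x - norm (h n *\<^sub>R axis i 1 :: real^'a) \<le> norm (x + h n *\<^sub>R axis i 1)"
          using norm_diff_ineq by blast
        then have "norm (x + h n *\<^sub>R axis i 1) > R" using that h[of n] by (simp add: norm_axis_1)
        then show ?thesis using R[of x] R[of "x + h n *\<^sub>R axis i 1"] that unfolding D_def by force
      qed
      show "norm (D n x) \<le> B * indicator (cball 0 (R + 1)) x"
        using 1 2 B(1) by (cases "x \<in> cball 0 (R + 1)") auto
    qed
  qed (use gm Dm in auto)
  moreover have "integral\<^sup>L lborel (D n) = 0" for n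
  proof -
    have i1: "integrable lborel \<psi>"
      by (rule integrable_bounded_support[of _ B R]) (use B R in auto)
    have i2: "integrable lborel (\<lambda>x. \<psi> (x + h n *\<^sub>R axis i 1))"
    proof (rule integrable_bounded_support[of _ B "R + 1"])
      fix x assume "\<psi> (x + h n *\<^sub>R axis i 1) \<noteq> 0"
      then have "norm (x + h n *\<^sub>R axis i 1) \<le> R" using R by blast
      moreover have "norm x - norm (h n *\<^sub>R axis i 1 :: real^'a) \<le> norm (x + h n *\<^sub>R axis i 1)"
        using norm_diff_ineq by blast
      ultimately show "x \<in> cball 0 (R + 1)" using h[of n] by (simp add: norm_axis_1)
    qed (use B in auto)
    show ?thesis unfolding D_def
      using i1 i2 lborel_integral_translate[of \<psi> "h n *\<^sub>R axis i 1"] by simp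
  qed
  ultimately show ?thesis using LIMSEQ_unique[OF _ tendsto_const] by fastforce
qed

lemma integral_grad_zero_on:
  assumes \<psi>: "\<psi> \<in> test_functions U" and U: "U \<in> sets lebesgue"
  shows "(LINT x|lebesgue_on U. grad \<psi> x $ i) = 0"
proof -
  have m: "(\<lambda>x. grad \<psi> x $ i) \<in> borel_measurable borel"
    using smooth_on_continuous[OF smooth_on_grad_nth[OF test_functions_smooth[OF \<psi>]]]
    by (intro borel_measurable_continuous_onI) auto
  have "(LINT x|lebesgue_on U. grad \<psi> x $ i) = (LINT x|lebesgue. indicator U x *\<^sub>R grad \<psi> x $ i)"
    by (rule integral_restrict_space) (use U in auto)
  also have "\<dots> = (LINT x|lebesgue. grad \<psi> x $ i)"
    by (rule Bochner_Integration.integral_cong)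
      (use test_functions_grad_outside'[OF \<psi>] in \<open>auto simp: indicator_def\<close>)
  also have "\<dots> = (LINT x|lborel. grad \<psi> x $ i)"
    by (rule integral_completion) (use m in auto)
  finally show ?thesis using integral_grad_zero[OF \<psi>] by simp
qed

subsection \<open>Energy forms\<close>

text \<open>The common core of the Cauchy-Schwarz type inequalities below. It covers degenerate
  forms: for q = 0 an affine function of t that is bounded below must be constant.\<close>

lemma discriminant_le:
  fixes p q b :: real
  assumes "\<And>t. 0 \<le> p + 2 * t * b + t\<^sup>2 * q" "0 \<le> q"
  shows "b\<^sup>2 \<le> p * q"
proof (cases "q = 0")
  case True
  have "b = 0"
  proof (rule ccontr)
    assume "b \<noteq> 0"
    then have "p + 2 * (- (p + 1) / (2 * b)) * b = - 1" by (simp add: field_simps)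
    then show False using assms(1)[of "- (p + 1) / (2 * b)"] True by simp
  qed
  then show ?thesis using True by simp
next
  case False
  have "0 \<le> p + 2 * (- b / q) * b + (- b / q)\<^sup>2 * q" by (rule assms(1))
  also have "\<dots> = p - b\<^sup>2 / q" using False by (simp add: field_simps power2_eq_square)
  finally show ?thesis using False assms(2) by (simp add: field_simps)
qed

lemma abs_le_sqrt_mult:
  fixes b p q :: real
  assumes "b\<^sup>2 \<le> p * q" shows "\<bar>b\<bar> \<le> sqrt p * sqrt q"
  using real_sqrt_le_mono[OF assms] by (simp add: real_sqrt_mult)

lemma abs_mult_le_squares: "\<bar>s * t\<bar> \<le> s\<^sup>2 + t\<^sup>2" for s t :: real
proof -
  have "2 * \<bar>s\<bar> * \<bar>t\<bar> \<le> s\<^sup>2 + t\<^sup>2" using sum_squares_bound[of "\<bar>s\<bar>" "\<bar>t\<bar>"] by simp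
  moreover have "0 \<le> \<bar>s\<bar> * \<bar>t\<bar>" by simp
  ultimately show ?thesis unfolding abs_mult by linarith
qed

lemma integral_Cauchy_Schwarz:
  fixes f g :: "'a \<Rightarrow> real"
  assumes [measurable]: "f \<in> borel_measurable M" "g \<in> borel_measurable M"
    and i: "integrable M (\<lambda>x. (f x)\<^sup>2)" "integrable M (\<lambda>x. (g x)\<^sup>2)"
  shows "integrable M (\<lambda>x. f x * g x)"
    and "\<bar>LINT x|M. f x * g x\<bar> \<le> sqrt (LINT x|M. (f x)\<^sup>2) * sqrt (LINT x|M. (g x)\<^sup>2)"
proof -
  show *: "integrable M (\<lambda>x. f x * g x)"
  proof (rule Bochner_Integration.integrable_bound[OF Bochner_Integration.integrable_add[OF i]])
    show "AE x in M. norm (f x * g x) \<le> norm ((f x)\<^sup>2 + (g x)\<^sup>2)"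
      using abs_mult_le_squares by (intro AE_I2) simp
  qed measurable
  have "0 \<le> (LINT x|M. (f x)\<^sup>2) + 2 * t * (LINT x|M. f x * g x) + t\<^sup>2 * (LINT x|M. (g x)\<^sup>2)" for t
  proof -
    have "0 \<le> (LINT x|M. (f x + t * g x)\<^sup>2)" by simp
    also have "(\<lambda>x. (f x + t * g x)\<^sup>2) = (\<lambda>x. (f x)\<^sup>2 + (2 * t) * (f x * g x) + t\<^sup>2 * (g x)\<^sup>2)"
      by (auto simp: power2_eq_square algebra_simps)
    also have "(LINT x|M. (f x)\<^sup>2 + (2 * t) * (f x * g x) + t\<^sup>2 * (g x)\<^sup>2) =
      (LINT x|M. (f x)\<^sup>2) + 2 * t * (LINT x|M. f x * g x) + t\<^sup>2 * (LINT x|M. (g x)\<^sup>2)"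
      using i * by simp
    finally show ?thesis .
  qed
  from discriminant_le[OF this] show "\<bar>LINT x|M. f x * g x\<bar> \<le> sqrt (LINT x|M. (f x)\<^sup>2) * sqrt (LINT x|M. (g x)\<^sup>2)"
    by (intro abs_le_sqrt_mult) simp
qed

lemma symmetric_form:
  fixes A :: "real^'n^'n"
  assumes "transpose A = A" shows "v \<bullet> (A *v w) = w \<bullet> (A *v v)"
proof -
  have "v \<bullet> (A *v w) = (v v* A) \<bullet> w" by (simp add: dot_lmul_matrix)
  also have "v v* A = transpose A *v v" by simp
  finally show ?thesis using assms by (simp add: inner_commute)
qed

lemma psd_Cauchy_Schwarz:
  fixes A :: "real^'n^'n"
  assumes "transpose A = A" "\<And>v. 0 \<le> v \<bullet> (A *v v)"
  shows "(v \<bullet> (A *v w))\<^sup>2 \<le> (v \<bullet> (A *v v)) * (w \<bullet> (A *v w))"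
proof (rule discriminant_le[OF _ assms(2)])
  fix t
  have "0 \<le> (v + t *\<^sub>R w) \<bullet> (A *v (v + t *\<^sub>R w))" by (rule assms(2))
  also have "\<dots> = v \<bullet> (A *v v) + 2 * t * (v \<bullet> (A *v w)) + t\<^sup>2 * (w \<bullet> (A *v w))"
    using symmetric_form[OF assms(1), of w v]
    by (simp add: matrix_vector_right_distrib matrix_vector_mult_scaleR inner_add_left inner_add_right
        algebra_simps power2_eq_square)
  finally show "0 \<le> v \<bullet> (A *v v) + 2 * t * (v \<bullet> (A *v w)) + t\<^sup>2 * (w \<bullet> (A *v w))" .
qed

lemma psd_inverse_Cauchy_Schwarz:
  fixes A :: "real^'n^'n"
  assumes A: "transpose A = A" "\<And>v. 0 \<le> v \<bullet> (A *v v)" "invertible A"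
  shows "(v \<bullet> w)\<^sup>2 \<le> (v \<bullet> (A *v v)) * (w \<bullet> (matrix_inv A *v w))" "0 \<le> w \<bullet> (matrix_inv A *v w)"
proof -
  have *: "A *v (matrix_inv A *v w) = w"
    using A(3) someI_ex[OF A(3)[unfolded invertible_def]]
    by (simp add: matrix_vector_mul_assoc matrix_inv_def)
  then show "(v \<bullet> w)\<^sup>2 \<le> (v \<bullet> (A *v v)) * (w \<bullet> (matrix_inv A *v w))" "0 \<le> w \<bullet> (matrix_inv A *v w)"
    using psd_Cauchy_Schwarz[OF A(1,2), of v "matrix_inv A *v w"] A(2)[of "matrix_inv A *v w"]
    by (simp_all add: inner_commute)
qed

lemma borel_measurable_vec_nth:
  fixes F :: "'a \<Rightarrow> 'b::real_normed_vector^'n"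
  shows "F \<in> borel_measurable M \<Longrightarrow> (\<lambda>x. F x $ i) \<in> borel_measurable M"
  by (rule measurable_compose[OF _ borel_measurable_continuous_onI]) (auto intro: continuous_intros)

lemma borel_measurable_vec:
  fixes F :: "'a \<Rightarrow> real^'n"
  assumes "\<And>i. (\<lambda>x. F x $ i) \<in> borel_measurable M" shows "F \<in> borel_measurable M"
proof (subst borel_measurable_euclidean_space, safe)
  fix b :: "real^'n" assume "b \<in> Basis"
  then obtain i where "b = axis i 1" by (auto simp: Basis_vec_def)
  then show "(\<lambda>x. F x \<bullet> b) \<in> borel_measurable M" using assms[of i] by (simp add: inner_axis)
qed

definition bil :: "(real^'n \<Rightarrow> real^'n^'n) \<Rightarrow> (real^'n) set \<Rightarrow> (real^'n \<Rightarrow> real^'n) \<Rightarrow> (real^'n \<Rightarrow> real^'n) \<Rightarrow> real"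
  where "bil a U F G = (LINT x|lebesgue_on U. F x \<bullet> (a x *v G x))"

abbreviation energy :: "(real^'n \<Rightarrow> real^'n^'n) \<Rightarrow> (real^'n) set \<Rightarrow> (real^'n \<Rightarrow> real^'n) \<Rightarrow> real"
  where "energy a U F \<equiv> bil a U F F"

definition fin_energy :: "(real^'n \<Rightarrow> real^'n^'n) \<Rightarrow> (real^'n) set \<Rightarrow> (real^'n \<Rightarrow> real^'n) \<Rightarrow> bool"
  where "fin_energy a U F \<longleftrightarrow> F \<in> borel_measurable (lebesgue_on U) \<and>
    integrable (lebesgue_on U) (\<lambda>x. F x \<bullet> (a x *v F x))"

locale coefficients =
  fixes a :: "real^'n \<Rightarrow> real^'n^'n" and U :: "(real^'n) set"
  assumes field: "coefficient_field U a" and U_open: "open U" and U_bounded: "bounded U"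
begin

lemma U_sets [simp, measurable]: "U \<in> sets lebesgue" using U_open by auto

lemma U_lmeasurable: "U \<in> lmeasurable"
  using U_open U_bounded by (simp add: bounded_set_imp_lmeasurable)

lemma const_integrable: "integrable (lebesgue_on U) (\<lambda>x. c::real)"
  using finite_measure.integrable_const[OF finite_measure_lebesgue_on[OF U_lmeasurable]] by blast

lemma a_sym: "x \<in> U \<Longrightarrow> transpose (a x) = a x" and a_psd: "x \<in> U \<Longrightarrow> 0 \<le> v \<bullet> (a x *v v)"
  and a_inv: "AE x in lebesgue_on U. invertible (a x)"
  and a_int: "integrable (lebesgue_on U) a" "integrable (lebesgue_on U) (\<lambda>x. matrix_inv (a x))"
  using field by (auto simp: coefficient_field_def)

lemma matvec_measurable:
  assumes "F \<in> borel_measurable (lebesgue_on U)"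
  shows "(\<lambda>x. a x *v F x) \<in> borel_measurable (lebesgue_on U)"
proof (rule borel_measurable_vec)
  fix i
  have "(\<lambda>x. (a x *v F x) $ i) = (\<lambda>x. \<Sum>j\<in>UNIV. a x $ i $ j * F x $ j)"
    by (auto simp: matrix_vector_mult_def)
  moreover have "(\<lambda>x. a x $ i $ j) \<in> borel_measurable (lebesgue_on U)" for j
    using a_int(1) by (intro borel_measurable_vec_nth) auto
  ultimately show "(\<lambda>x. (a x *v F x) $ i) \<in> borel_measurable (lebesgue_on U)"
    using borel_measurable_vec_nth[OF assms] by simp
qed

lemma form_measurable:
  "F \<in> borel_measurable (lebesgue_on U) \<Longrightarrow> G \<in> borel_measurable (lebesgue_on U) \<Longrightarrow>
    (\<lambda>x. F x \<bullet> (a x *v G x)) \<in> borel_measurable (lebesgue_on U)"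
  by (intro borel_measurable_inner matvec_measurable)

lemma fin_measurable: "fin_energy a U F \<Longrightarrow> F \<in> borel_measurable (lebesgue_on U)"
  by (simp add: fin_energy_def)

lemma form_abs_le:
  assumes "x \<in> U" shows "\<bar>v \<bullet> (a x *v w)\<bar> \<le> v \<bullet> (a x *v v) + w \<bullet> (a x *v w)"
proof -
  have "\<bar>v \<bullet> (a x *v w)\<bar> \<le> sqrt (v \<bullet> (a x *v v)) * sqrt (w \<bullet> (a x *v w))"
    by (rule abs_le_sqrt_mult[OF psd_Cauchy_Schwarz]) (use assms a_sym a_psd in auto)
  also have "\<dots> \<le> v \<bullet> (a x *v v) + w \<bullet> (a x *v w)"
    using abs_mult_le_squares[of "sqrt (v \<bullet> (a x *v v))" "sqrt (w \<bullet> (a x *v w))"] a_psd[OF assms]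
    by (simp add: abs_mult)
  finally show ?thesis .
qed

lemma bil_integrable:
  assumes "fin_energy a U F" "fin_energy a U G"
  shows "integrable (lebesgue_on U) (\<lambda>x. F x \<bullet> (a x *v G x))"
proof (rule Bochner_Integration.integrable_bound)
  show "integrable (lebesgue_on U) (\<lambda>x. F x \<bullet> (a x *v F x) + G x \<bullet> (a x *v G x))"
    using assms by (auto simp: fin_energy_def)
  show "AE x in lebesgue_on U. norm (F x \<bullet> (a x *v G x)) \<le> norm (F x \<bullet> (a x *v F x) + G x \<bullet> (a x *v G x))"
  proof (rule AE_I2)
    fix x assume "x \<in> space (lebesgue_on U)"
    then show "norm (F x \<bullet> (a x *v G x)) \<le> norm (F x \<bullet> (a x *v F x) + G x \<bullet> (a x *v G x))"
      using form_abs_le[of x "F x" "G x"] by simp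
  qed
qed (use assms form_measurable in \<open>auto simp: fin_energy_def\<close>)

lemma bil_sym: "bil a U F G = bil a U G F"
  unfolding bil_def by (rule Bochner_Integration.integral_cong) (auto simp: symmetric_form a_sym)

lemma energy_nonneg: "0 \<le> energy a U F"
  unfolding bil_def by (rule Bochner_Integration.integral_nonneg) (simp add: a_psd)

lemma fin_scaleR:
  assumes "fin_energy a U F" shows "fin_energy a U (\<lambda>x. c *\<^sub>R F x)"
  using assms by (auto simp: fin_energy_def matrix_vector_mult_scaleR)

lemma fin_add:
  assumes "fin_energy a U F" "fin_energy a U G" shows "fin_energy a U (\<lambda>x. F x + G x)"
proof -
  have "(\<lambda>x. (F x + G x) \<bullet> (a x *v (F x + G x))) =
    (\<lambda>x. (F x \<bullet> (a x *v F x) + F x \<bullet> (a x *v G x)) + (G x \<bullet> (a x *v F x) + G x \<bullet> (a x *v G x)))"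
    by (simp add: matrix_vector_right_distrib inner_add_left inner_add_right fun_eq_iff)
  then show ?thesis unfolding fin_energy_def using assms fin_measurable
    by (auto intro!: Bochner_Integration.integrable_add bil_integrable)
qed

lemma fin_diff:
  assumes "fin_energy a U F" "fin_energy a U G" shows "fin_energy a U (\<lambda>x. F x - G x)"
  using fin_add[OF assms(1) fin_scaleR[OF assms(2), of "-1"]] by simp

lemma bil_add_right:
  assumes "fin_energy a U F" "fin_energy a U G" "fin_energy a U H"
  shows "bil a U F (\<lambda>x. G x + H x) = bil a U F G + bil a U F H"
  unfolding bil_def using bil_integrable assms
  by (simp add: matrix_vector_right_distrib inner_add_right)

lemma bil_scaleR_right: "bil a U F (\<lambda>x. c *\<^sub>R G x) = c * bil a U F G"
  unfolding bil_def by (simp add: matrix_vector_mult_scaleR)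

lemma bil_diff_right:
  assumes "fin_energy a U F" "fin_energy a U G" "fin_energy a U H"
  shows "bil a U F (\<lambda>x. G x - H x) = bil a U F G - bil a U F H"
  unfolding bil_def using bil_integrable assms
  by (simp add: matrix_vector_mult_diff_distrib inner_diff_right)

lemma energy_add:
  assumes "fin_energy a U F" "fin_energy a U G"
  shows "energy a U (\<lambda>x. F x + G x) = energy a U F + 2 * bil a U F G + energy a U G"
proof -
  have "energy a U (\<lambda>x. F x + G x) = bil a U (\<lambda>x. F x + G x) F + bil a U (\<lambda>x. F x + G x) G"
    by (rule bil_add_right) (use assms fin_add in auto)
  also have "\<dots> = bil a U F (\<lambda>x. F x + G x) + bil a U G (\<lambda>x. F x + G x)"
    using bil_sym by metis
  also have "\<dots> = energy a U F + bil a U F G + (bil a U G F + energy a U G)"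
    using assms by (simp add: bil_add_right)
  finally show ?thesis by (simp add: bil_sym[of G F])
qed

lemma energy_scaleR: "energy a U (\<lambda>x. c *\<^sub>R F x) = c\<^sup>2 * energy a U F"
  by (simp add: bil_scaleR_right bil_sym[of "\<lambda>x. c *\<^sub>R F x"] power2_eq_square)

lemma energy_diff:
  assumes "fin_energy a U F" "fin_energy a U G"
  shows "energy a U (\<lambda>x. F x - G x) = energy a U F - 2 * bil a U F G + energy a U G"
  using energy_add[OF assms(1) fin_scaleR[OF assms(2), of "-1"]] energy_scaleR[of "-1" G]
    bil_scaleR_right[of F "-1" G] by simp

lemma bil_Cauchy_Schwarz:
  assumes "fin_energy a U F" "fin_energy a U G"
  shows "\<bar>bil a U F G\<bar> \<le> sqrt (energy a U F) * sqrt (energy a U G)"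
proof (rule abs_le_sqrt_mult[OF discriminant_le])
  fix t
  have "0 \<le> energy a U (\<lambda>x. F x + t *\<^sub>R G x)" by (rule energy_nonneg)
  then show "0 \<le> energy a U F + 2 * t * bil a U F G + t\<^sup>2 * energy a U G"
    using assms by (simp add: energy_add fin_scaleR energy_scaleR bil_scaleR_right)
qed (rule energy_nonneg)

lemma energy_add_le:
  assumes "fin_energy a U F" "fin_energy a U G"
  shows "energy a U (\<lambda>x. F x + G x) \<le> 2 * energy a U F + 2 * energy a U G"
  using energy_add[OF assms] energy_diff[OF assms] energy_nonneg[of "\<lambda>x. F x - G x"] by simp

lemma fin_mult:
  assumes F: "fin_energy a U F" and [measurable]: "h \<in> borel_measurable (lebesgue_on U)"
    and h: "\<And>x. x \<in> U \<Longrightarrow> \<bar>h x\<bar> \<le> C"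
  shows "fin_energy a U (\<lambda>x. h x *\<^sub>R F x)" "energy a U (\<lambda>x. h x *\<^sub>R F x) \<le> C\<^sup>2 * energy a U F"
proof -
  have Fm[measurable]: "F \<in> borel_measurable (lebesgue_on U)" using F by (simp add: fin_energy_def)
  have eq: "(\<lambda>x. (h x *\<^sub>R F x) \<bullet> (a x *v (h x *\<^sub>R F x))) = (\<lambda>x. (h x)\<^sup>2 * (F x \<bullet> (a x *v F x)))"
    by (auto simp: matrix_vector_mult_scaleR power2_eq_square)
  have i: "integrable (lebesgue_on U) (\<lambda>x. C\<^sup>2 * (F x \<bullet> (a x *v F x)))"
    using F by (auto simp: fin_energy_def)
  have le: "(h x)\<^sup>2 * (F x \<bullet> (a x *v F x)) \<le> C\<^sup>2 * (F x \<bullet> (a x *v F x))" if "x \<in> U" for x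
    using h[OF that] a_psd[OF that] by (intro mult_right_mono) (auto simp: abs_le_square_iff[symmetric])
  have i2: "integrable (lebesgue_on U) (\<lambda>x. (h x)\<^sup>2 * (F x \<bullet> (a x *v F x)))"
    by (rule Bochner_Integration.integrable_bound[OF i])
      (use form_measurable[OF Fm Fm] le a_psd in \<open>auto simp: abs_mult\<close>)
  then show "fin_energy a U (\<lambda>x. h x *\<^sub>R F x)" unfolding fin_energy_def eq by auto
  show "energy a U (\<lambda>x. h x *\<^sub>R F x) \<le> C\<^sup>2 * energy a U F"
    unfolding bil_def eq Bochner_Integration.integral_mult_right_zero[symmetric]
    by (rule integral_mono[OF i2 i]) (use le in auto)
qed

lemma fin_bounded:
  assumes F: "F \<in> borel_measurable (lebesgue_on U)" and C: "\<And>x. x \<in> U \<Longrightarrow> norm (F x) \<le> C"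
  shows "fin_energy a U F"
proof -
  have int: "integrable (lebesgue_on U) (\<lambda>x. a x $ i $ j)" for i j
    using integrable_bounded_linear[OF bounded_linear_compose[OF bounded_linear_vec_nth bounded_linear_vec_nth] a_int(1)] .
  have eq: "F x \<bullet> (a x *v F x) = (\<Sum>i\<in>UNIV. \<Sum>j\<in>UNIV. F x $ i * (a x $ i $ j * F x $ j))" for x
    by (simp add: inner_vec_def matrix_vector_mult_def sum_distrib_left)
  have "integrable (lebesgue_on U) (\<lambda>x. F x $ i * (a x $ i $ j * F x $ j))" for i j
  proof (rule Bochner_Integration.integrable_bound)
    show "integrable (lebesgue_on U) (\<lambda>x. C * (\<bar>a x $ i $ j\<bar> * C))" using int by auto
    show "(\<lambda>x. F x $ i * (a x $ i $ j * F x $ j)) \<in> borel_measurable (lebesgue_on U)"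
      using borel_measurable_vec_nth[OF F] int[of i j] by auto
    have le: "\<bar>F x $ i * (a x $ i $ j * F x $ j)\<bar> \<le> C * (\<bar>a x $ i $ j\<bar> * C)" if "x \<in> U" for x
    proof -
      have "\<bar>F x $ k\<bar> \<le> C" for k
        using order_trans[OF component_le_norm_cart C[OF that]] .
      moreover have "0 \<le> C" using order_trans[OF norm_ge_zero C[OF that]] .
      ultimately show ?thesis unfolding abs_mult by (intro mult_mono) auto
    qed
    show "AE x in lebesgue_on U. norm (F x $ i * (a x $ i $ j * F x $ j)) \<le> norm (C * (\<bar>a x $ i $ j\<bar> * C))"
    proof (intro AE_I2)
      fix x assume "x \<in> space (lebesgue_on U)"
      then have "\<bar>F x $ i * (a x $ i $ j * F x $ j)\<bar> \<le> C * (\<bar>a x $ i $ j\<bar> * C)"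
        using le by simp
      then show "norm (F x $ i * (a x $ i $ j * F x $ j)) \<le> norm (C * (\<bar>a x $ i $ j\<bar> * C))"
        unfolding real_norm_def by (rule order_trans[OF _ abs_ge_self])
    qed
  qed
  then show ?thesis unfolding fin_energy_def eq using F by auto
qed

lemma energy_integrable_nth:
  assumes "fin_energy a U F"
  shows "integrable (lebesgue_on U) (\<lambda>x. (a x *v F x) $ i)"
proof -
  have "fin_energy a U (\<lambda>x. axis i 1)" by (rule fin_bounded[where C=1]) auto
  from bil_integrable[OF this assms] show ?thesis by (simp add: inner_axis')
qed

text \<open>Pointwise, the square of the i-th component of F is at most (F . a F) times the i-th
  diagonal entry of the inverse of a. Integrability of the inverse and Cauchy-Schwarz then control F
  in L1. Since a may degenerate, L1 is all that the energy gives for gradients.\<close>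

lemma energy_L1:
  obtains K where "K \<ge> 0" "\<And>F. fin_energy a U F \<Longrightarrow> integrable (lebesgue_on U) F"
    "\<And>F. fin_energy a U F \<Longrightarrow> (LINT x|lebesgue_on U. norm (F x)) \<le> K * sqrt (energy a U F)"
proof -
  define q where "q i x = \<bar>matrix_inv (a x) $ i $ i\<bar>" for i x
  have q: "integrable (lebesgue_on U) (q i)" for i
    unfolding q_def using integrable_bounded_linear[OF bounded_linear_compose[OF bounded_linear_vec_nth bounded_linear_vec_nth] a_int(2)]
    by (auto intro!: integrable_abs)
  have sq: "(sqrt (q i x))\<^sup>2 = q i x" for i x by (simp add: q_def)
  define K where "K = (\<Sum>i\<in>UNIV. sqrt (integral\<^sup>L (lebesgue_on U) (q i)))"
  have main: "integrable (lebesgue_on U) F \<and> (LINT x|lebesgue_on U. norm (F x)) \<le> K * sqrt (energy a U F)"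
    if F: "fin_energy a U F" for F
  proof -
    have Fm: "F \<in> borel_measurable (lebesgue_on U)" using F by (rule fin_measurable)
    define p where "p x = F x \<bullet> (a x *v F x)" for x
    have p: "integrable (lebesgue_on U) p" using F by (simp add: fin_energy_def p_def[abs_def])
    have CS1: "integrable (lebesgue_on U) (\<lambda>x. sqrt \<bar>p x\<bar> * sqrt (q i x))"
      and CS2: "\<bar>LINT x|lebesgue_on U. sqrt \<bar>p x\<bar> * sqrt (q i x)\<bar> \<le>
        sqrt (LINT x|lebesgue_on U. (sqrt \<bar>p x\<bar>)\<^sup>2) * sqrt (LINT x|lebesgue_on U. (sqrt (q i x))\<^sup>2)" for i
      by (rule integral_Cauchy_Schwarz; use p q[of i] in \<open>auto simp: sq\<close>)+
    have "AE x in lebesgue_on U. \<forall>i. \<bar>F x $ i\<bar> \<le> sqrt \<bar>p x\<bar> * sqrt (q i x)"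
      using a_inv AE_space[of "lebesgue_on U"]
    proof eventually_elim
      case (elim x)
      show ?case
      proof
        fix i
        have "(F x \<bullet> axis i 1)\<^sup>2 \<le> p x * (axis i 1 \<bullet> (matrix_inv (a x) *v axis i 1))"
          unfolding p_def by (rule psd_inverse_Cauchy_Schwarz) (use elim a_sym a_psd in auto)
        also have "axis i 1 \<bullet> (matrix_inv (a x) *v axis i 1) = matrix_inv (a x) $ i $ i"
          by (simp add: inner_axis inner_axis' matrix_vector_mult_basis column_def)
        also have "p x * \<dots> \<le> \<bar>p x\<bar> * q i x"
          unfolding q_def abs_mult[symmetric] by simp
        finally have "(F x $ i)\<^sup>2 \<le> \<bar>p x\<bar> * q i x" by (simp add: inner_axis)
        then show "\<bar>F x $ i\<bar> \<le> sqrt \<bar>p x\<bar> * sqrt (q i x)" by (rule abs_le_sqrt_mult)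
      qed
    qed
    then have "AE x in lebesgue_on U. norm (F x) \<le> (\<Sum>i\<in>UNIV. sqrt \<bar>p x\<bar> * sqrt (q i x))"
    proof eventually_elim
      case (elim x)
      have "norm (F x) \<le> (\<Sum>i\<in>UNIV. \<bar>F x $ i\<bar>)" by (rule norm_le_l1_cart)
      also have "\<dots> \<le> (\<Sum>i\<in>UNIV. sqrt \<bar>p x\<bar> * sqrt (q i x))" using elim by (intro sum_mono) auto
      finally show ?case .
    qed
    note AE = this
    have i2: "integrable (lebesgue_on U) (\<lambda>x. \<Sum>i\<in>UNIV. sqrt \<bar>p x\<bar> * sqrt (q i x))" using CS1 by auto
    have i1: "integrable (lebesgue_on U) F"
      by (rule Bochner_Integration.integrable_bound[OF i2 Fm]) (use AE in \<open>eventually_elim, auto\<close>)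
    have "(LINT x|lebesgue_on U. norm (F x)) \<le> (LINT x|lebesgue_on U. (\<Sum>i\<in>UNIV. sqrt \<bar>p x\<bar> * sqrt (q i x)))"
      by (rule integral_mono_AE[OF integrable_norm[OF i1] i2 AE])
    also have "\<dots> = (\<Sum>i\<in>UNIV. LINT x|lebesgue_on U. sqrt \<bar>p x\<bar> * sqrt (q i x))"
      using CS1 by simp
    also have "\<dots> \<le> (\<Sum>i\<in>UNIV. sqrt (energy a U F) * sqrt (integral\<^sup>L (lebesgue_on U) (q i)))"
    proof (rule sum_mono)
      fix i
      have "(LINT x|lebesgue_on U. (sqrt \<bar>p x\<bar>)\<^sup>2) = energy a U F"
        unfolding bil_def p_def by (rule Bochner_Integration.integral_cong) (auto simp: a_psd)
      then show "(LINT x|lebesgue_on U. sqrt \<bar>p x\<bar> * sqrt (q i x)) \<le> sqrt (energy a U F) * sqrt (integral\<^sup>L (lebesgue_on U) (q i))"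
        using CS2[of i] by (simp add: sq)
    qed
    finally show ?thesis using i1 by (simp add: K_def sum_distrib_left mult.commute)
  qed
  have "K \<ge> 0" unfolding K_def
    by (intro sum_nonneg real_sqrt_ge_zero Bochner_Integration.integral_nonneg) (simp add: q_def)
  with main that show thesis by blast
qed

lemma fin_integrable: "fin_energy a U F \<Longrightarrow> integrable (lebesgue_on U) F"
  using energy_L1 by metis

lemma bil_tendsto:
  assumes "\<And>k. fin_energy a U (F k)" "fin_energy a U H" "fin_energy a U G"
    and "(\<lambda>k. energy a U (\<lambda>x. F k x - H x)) \<longlonglongrightarrow> 0"
  shows "(\<lambda>k. bil a U G (F k)) \<longlonglongrightarrow> bil a U G H"
proof (rule Lim_null[THEN iffD2], rule Lim_null_comparison)
  show "\<forall>\<^sub>F k in sequentially. norm (bil a U G (F k) - bil a U G H) \<le>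
      sqrt (energy a U G) * sqrt (energy a U (\<lambda>x. F k x - H x))"
    using bil_Cauchy_Schwarz[OF assms(3) fin_diff[OF assms(1,2)]] assms
    by (auto simp: bil_diff_right)
  show "(\<lambda>k. sqrt (energy a U G) * sqrt (energy a U (\<lambda>x. F k x - H x))) \<longlonglongrightarrow> 0"
    using tendsto_mult[OF tendsto_const[of "sqrt (energy a U G)"] tendsto_real_sqrt[OF assms(4)]] by simp
qed

lemma energy_tendsto:
  assumes "\<And>k. fin_energy a U (F k)" "fin_energy a U H"
    and "(\<lambda>k. energy a U (\<lambda>x. F k x - H x)) \<longlonglongrightarrow> 0"
  shows "(\<lambda>k. energy a U (F k)) \<longlonglongrightarrow> energy a U H"
proof -
  have "energy a U (F k) = energy a U (\<lambda>x. F k x - H x) + 2 * bil a U H (F k) - energy a U H" for k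
    using energy_diff[OF assms(1,2), of k] bil_sym[of "F k" H] by simp
  moreover have "(\<lambda>k. energy a U (\<lambda>x. F k x - H x) + 2 * bil a U H (F k) - energy a U H) \<longlonglongrightarrow>
     0 + 2 * bil a U H H - energy a U H"
    by (intro tendsto_intros assms(3) bil_tendsto assms(1,2))
  ultimately show ?thesis by simp
qed

lemma energy_mult_tendsto:
  assumes F: "fin_energy a U F"
    and [measurable]: "\<And>k. h k \<in> borel_measurable (lebesgue_on U)" "g \<in> borel_measurable (lebesgue_on U)"
    and C: "\<And>k x. x \<in> U \<Longrightarrow> \<bar>h k x\<bar> \<le> C" "\<And>x. x \<in> U \<Longrightarrow> \<bar>g x\<bar> \<le> C"
    and AE: "AE x in lebesgue_on U. (\<lambda>k. h k x) \<longlonglongrightarrow> g x"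
  shows "(\<lambda>k. energy a U (\<lambda>x. (h k x - g x) *\<^sub>R F x)) \<longlonglongrightarrow> 0"
proof -
  have Fm[measurable]: "F \<in> borel_measurable (lebesgue_on U)" using F by (rule fin_measurable)
  have [measurable]: "(\<lambda>x. F x \<bullet> (a x *v F x)) \<in> borel_measurable (lebesgue_on U)" by (rule form_measurable[OF Fm Fm])
  have eq: "(\<lambda>x. ((h k x - g x) *\<^sub>R F x) \<bullet> (a x *v ((h k x - g x) *\<^sub>R F x))) = (\<lambda>x. (h k x - g x)\<^sup>2 * (F x \<bullet> (a x *v F x)))" for k
    by (auto simp: matrix_vector_mult_scaleR power2_eq_square)
  have "(\<lambda>k. LINT x|lebesgue_on U. (h k x - g x)\<^sup>2 * (F x \<bullet> (a x *v F x))) \<longlonglongrightarrow> (LINT x|lebesgue_on U. 0)"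
  proof (rule integral_dominated_convergence[where w="\<lambda>x. (2 * C)\<^sup>2 * (F x \<bullet> (a x *v F x))"])
    show "integrable (lebesgue_on U) (\<lambda>x. (2 * C)\<^sup>2 * (F x \<bullet> (a x *v F x)))"
      using F by (auto simp: fin_energy_def)
    show "AE x in lebesgue_on U. (\<lambda>k. (h k x - g x)\<^sup>2 * (F x \<bullet> (a x *v F x))) \<longlonglongrightarrow> 0"
      using AE
    proof eventually_elim
      case (elim x)
      have "(\<lambda>k. (h k x - g x)\<^sup>2 * (F x \<bullet> (a x *v F x))) \<longlonglongrightarrow> (g x - g x)\<^sup>2 * (F x \<bullet> (a x *v F x))"
        by (intro tendsto_intros elim)
      then show ?case by simp
    qed
    fix k
    have le: "(h k x - g x)\<^sup>2 * (F x \<bullet> (a x *v F x)) \<le> (2 * C)\<^sup>2 * (F x \<bullet> (a x *v F x))" if "x \<in> U" for x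
    proof (rule mult_right_mono[OF _ a_psd[OF that]])
      show "(h k x - g x)\<^sup>2 \<le> (2 * C)\<^sup>2"
        using C(1)[OF that, of k] C(2)[OF that] by (intro abs_le_square_iff[THEN iffD1]) linarith
    qed
    show "AE x in lebesgue_on U. norm ((h k x - g x)\<^sup>2 * (F x \<bullet> (a x *v F x))) \<le> (2 * C)\<^sup>2 * (F x \<bullet> (a x *v F x))"
    proof (intro AE_I2)
      fix x assume x: "x \<in> space (lebesgue_on U)"
      then have "0 \<le> (h k x - g x)\<^sup>2 * (F x \<bullet> (a x *v F x))" by (simp add: a_psd)
      with le[of x] x show "norm ((h k x - g x)\<^sup>2 * (F x \<bullet> (a x *v F x))) \<le> (2 * C)\<^sup>2 * (F x \<bullet> (a x *v F x))"
        unfolding real_norm_def space_lebesgue_on by linarith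
    qed
  qed auto
  then show ?thesis unfolding bil_def eq by simp
qed

end

subsection \<open>Restriction to subdomains\<close>

lemma integrable_lebesgue_on_subset:
  fixes f :: "'a::euclidean_space \<Rightarrow> 'b::{banach, second_countable_topology}"
  assumes "integrable (lebesgue_on U) f" "W \<subseteq> U" "U \<in> sets lebesgue" "W \<in> sets lebesgue"
  shows "integrable (lebesgue_on W) f"
proof -
  have "integrable lebesgue (\<lambda>x. indicator U x *\<^sub>R f x)"
    using assms by (simp add: integrable_restrict_space)
  from integrable_mult_indicator[OF assms(4) this]
  have "integrable lebesgue (\<lambda>x. indicator W x *\<^sub>R indicator U x *\<^sub>R f x)" .
  moreover have "(\<lambda>x. indicator W x *\<^sub>R indicator U x *\<^sub>R f x) = (\<lambda>x. indicator W x *\<^sub>R f x)"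
    using assms(2) by (auto simp: indicator_def fun_eq_iff)
  ultimately show ?thesis using assms by (simp add: integrable_restrict_space)
qed

lemma AE_lebesgue_on_subset:
  assumes "AE x in lebesgue_on U. P x" "W \<subseteq> U" "U \<in> sets lebesgue" "W \<in> sets lebesgue"
  shows "AE x in lebesgue_on W. P x"
proof -
  have "AE x in lebesgue. x \<in> U \<longrightarrow> P x" using assms by (simp add: AE_restrict_space_iff)
  then have "AE x in lebesgue. x \<in> W \<longrightarrow> P x" by eventually_elim (use assms(2) in auto)
  then show ?thesis using assms by (simp add: AE_restrict_space_iff)
qed

lemma integral_lebesgue_on_mono_set:
  fixes f :: "'a::euclidean_space \<Rightarrow> real"
  assumes "integrable (lebesgue_on U) f" "W \<subseteq> U" "U \<in> sets lebesgue" "W \<in> sets lebesgue"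
    and "\<And>x. x \<in> U \<Longrightarrow> 0 \<le> f x"
  shows "(LINT x|lebesgue_on W. f x) \<le> (LINT x|lebesgue_on U. f x)"
  by (rule integral_mono_lebesgue_on_AE[OF assms(1)]) (use assms in auto)

lemma integral_lebesgue_on_zero_outside:
  fixes f :: "'a::euclidean_space \<Rightarrow> real"
  assumes "W \<subseteq> U" "U \<in> sets lebesgue" "W \<in> sets lebesgue" "\<And>x. x \<in> U - W \<Longrightarrow> f x = 0"
  shows "(LINT x|lebesgue_on U. f x) = (LINT x|lebesgue_on W. f x)"
proof -
  have "(LINT x|lebesgue_on U. f x) = (LINT x|lebesgue_on U. (if x \<in> W then f x else 0))"
    by (rule Bochner_Integration.integral_cong) (use assms in auto)
  then show ?thesis using integral_restrict[OF assms(1,3,2), of f] by simp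
qed

lemma coefficients_subset:
  assumes "coefficients a U" "W \<subseteq> U" "open W"
  shows "coefficients a W"
proof -
  interpret coefficients a U by fact
  have W: "W \<in> sets lebesgue" using assms(3) by auto
  have "coefficient_field W a" unfolding coefficient_field_def
    using a_sym a_psd AE_lebesgue_on_subset[OF a_inv assms(2) U_sets W]
      integrable_lebesgue_on_subset[OF a_int(1) assms(2) U_sets W]
      integrable_lebesgue_on_subset[OF a_int(2) assms(2) U_sets W] assms(2) by (auto simp del: transpose_matrix_vector)
  then show ?thesis using assms bounded_subset[OF U_bounded] by unfold_locales auto
qed

lemma fin_energy_subset:
  assumes "fin_energy a U F" "W \<subseteq> U" "U \<in> sets lebesgue" "W \<in> sets lebesgue"
  shows "fin_energy a W F"
  using assms integrable_lebesgue_on_subset[OF _ assms(2-4)] measurable_restrict_mono[OF _ assms(2)]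
  unfolding fin_energy_def by blast

lemma bil_zero_outside:
  assumes "W \<subseteq> U" "U \<in> sets lebesgue" "W \<in> sets lebesgue" "\<And>x. x \<in> U - W \<Longrightarrow> F x = 0"
  shows "bil a U F G = bil a W F G"
  unfolding bil_def by (rule integral_lebesgue_on_zero_outside) (use assms in auto)

lemma L2_subset:
  assumes "u \<in> L2 U" "W \<subseteq> U" "U \<in> sets lebesgue" "W \<in> sets lebesgue"
  shows "u \<in> L2 W"
  using assms(1) integrable_lebesgue_on_subset[OF _ assms(2-4)] measurable_restrict_mono[OF _ assms(2)]
  unfolding L2_def by blast

lemma energy_subset_le:
  assumes "coefficients a U" "fin_energy a U F" "W \<subseteq> U" "W \<in> sets lebesgue"
  shows "energy a W F \<le> energy a U F"
proof -
  interpret coefficients a U by fact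
  show ?thesis unfolding bil_def
    by (rule integral_lebesgue_on_mono_set) (use assms a_psd in \<open>auto simp: fin_energy_def\<close>)
qed

lemma H1a_grad_subset:
  assumes "coefficients a U" "has_H1a_grad a U u G" "W \<subseteq> U" "open W"
  shows "has_H1a_grad a W u G"
proof -
  interpret U: coefficients a U by fact
  interpret W: coefficients a W using coefficients_subset assms by blast
  note [simp] = U.U_sets W.U_sets
  obtain \<phi> where \<phi>: "\<And>k. \<phi> k \<in> smooth_up_to_boundary U"
    and l: "(\<lambda>k. LINT x|lebesgue_on U. (\<phi> k x - u x)\<^sup>2) \<longlonglongrightarrow> 0"
      "(\<lambda>k. LINT x|lebesgue_on U. (grad (\<phi> k) x - G x) \<bullet> (a x *v (grad (\<phi> k) x - G x))) \<longlonglongrightarrow> 0"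
    and u: "u \<in> L2 U" "fin_energy a U G"
    using assms(2) unfolding has_H1a_grad_def fin_energy_def by blast
  have sm: "\<phi> k \<in> borel_measurable (lebesgue_on U)" "grad (\<phi> k) \<in> borel_measurable (lebesgue_on U)"
    "(\<lambda>x. \<phi> k x) \<in> L2 U" "fin_energy a U (grad (\<phi> k))" for k
  proof -
    obtain V where V: "open V" "U \<subseteq> V" "smooth_on V (\<phi> k)" using smooth_up_to_boundaryE[OF \<phi>] by metis
    show 1: "\<phi> k \<in> borel_measurable (lebesgue_on U)" "grad (\<phi> k) \<in> borel_measurable (lebesgue_on U)"
      using smooth_on_continuous[OF V(3)] smooth_on_grad_continuous[OF V(3,1)] V(2)
      by (auto intro!: continuous_imp_measurable_on_sets_lebesgue elim: continuous_on_subset)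
    obtain B where B: "\<And>x. x \<in> U \<Longrightarrow> \<bar>\<phi> k x\<bar> \<le> B" "\<And>x. x \<in> U \<Longrightarrow> norm (grad (\<phi> k) x) \<le> B"
      using smooth_up_to_boundary_bounded[OF \<phi> U.U_bounded] by metis
    show "fin_energy a U (grad (\<phi> k))" by (rule U.fin_bounded[OF 1(2)]) (use B in auto)
    have "integrable (lebesgue_on U) (\<lambda>x. (\<phi> k x)\<^sup>2)"
      by (rule Bochner_Integration.integrable_bound[OF U.const_integrable[of "B\<^sup>2"]])
        (use 1 B(1) in \<open>auto simp: abs_le_square_iff[symmetric] intro!: AE_I2 order_trans[OF _ abs_ge_self]\<close>)
    then show "(\<lambda>x. \<phi> k x) \<in> L2 U" using 1 by (simp add: L2_def)
  qed
  have i: "integrable (lebesgue_on U) (\<lambda>x. (\<phi> k x - u x)\<^sup>2)" for k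
  proof (rule Bochner_Integration.integrable_bound)
    show "integrable (lebesgue_on U) (\<lambda>x. 2 * (\<phi> k x)\<^sup>2 + 2 * (u x)\<^sup>2)"
      using sm(3) u(1) by (auto simp: L2_def)
    have "(s - t)\<^sup>2 \<le> 2 * s\<^sup>2 + 2 * t\<^sup>2" for s t :: real
      using sum_squares_bound[of s "-t"] by (simp add: power2_diff)
    then show "AE x in lebesgue_on U. norm ((\<phi> k x - u x)\<^sup>2) \<le> norm (2 * (\<phi> k x)\<^sup>2 + 2 * (u x)\<^sup>2)"
      by (intro AE_I2) simp
  qed (use sm u in \<open>auto simp: L2_def\<close>)
  have "(\<lambda>k. LINT x|lebesgue_on W. (\<phi> k x - u x)\<^sup>2) \<longlonglongrightarrow> 0"
    by (rule tendsto_sandwich[OF _ _ tendsto_const l(1)])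
      (use integral_lebesgue_on_mono_set[OF i assms(3)] in auto)
  moreover have "(\<lambda>k. LINT x|lebesgue_on W. (grad (\<phi> k) x - G x) \<bullet> (a x *v (grad (\<phi> k) x - G x))) \<longlonglongrightarrow> 0"
    unfolding bil_def[symmetric]
    by (rule tendsto_sandwich[OF _ _ tendsto_const l(2)[folded bil_def]])
      (use energy_subset_le[OF assms(1) U.fin_diff[OF sm(4) u(2)] assms(3)] W.energy_nonneg in auto)
  moreover have "fin_energy a W G" "u \<in> L2 W"
    using u fin_energy_subset L2_subset assms(3) U.U_sets W.U_sets by blast+
  moreover have "\<phi> k \<in> smooth_up_to_boundary W" for k
    using smooth_up_to_boundary_subset \<phi> assms(3) by blast
  ultimately show ?thesis unfolding has_H1a_grad_def fin_energy_def by blast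
qed

subsection \<open>The energy space\<close>

context coefficients
begin

lemma bounded_integrable:
  fixes f :: "real^'n \<Rightarrow> real"
  assumes "f \<in> borel_measurable (lebesgue_on U)" "\<And>x. x \<in> U \<Longrightarrow> \<bar>f x\<bar> \<le> C"
  shows "integrable (lebesgue_on U) f"
  by (rule Bochner_Integration.integrable_bound[OF const_integrable[of C]])
    (use assms in \<open>auto intro!: AE_I2 order_trans[OF _ abs_ge_self]\<close>)

lemma bounded_L2:
  assumes "f \<in> borel_measurable (lebesgue_on U)" "\<And>x. x \<in> U \<Longrightarrow> \<bar>f x\<bar> \<le> C"
  shows "f \<in> L2 U"
proof -
  have "integrable (lebesgue_on U) (\<lambda>x. (f x)\<^sup>2)"
    by (rule bounded_integrable[where C="C\<^sup>2"])
      (use assms in \<open>auto simp: abs_le_square_iff[symmetric] intro: order_trans[OF _ abs_ge_self]\<close>)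
  then show ?thesis using assms by (simp add: L2_def)
qed

lemma L2_add:
  assumes "u \<in> L2 U" "v \<in> L2 U" shows "(\<lambda>x. u x + v x) \<in> L2 U"
proof -
  have "integrable (lebesgue_on U) (\<lambda>x. (u x + v x)\<^sup>2)"
  proof (rule Bochner_Integration.integrable_bound)
    show "integrable (lebesgue_on U) (\<lambda>x. 2 * (u x)\<^sup>2 + 2 * (v x)\<^sup>2)"
      using assms by (auto simp: L2_def)
    have "(s + t)\<^sup>2 \<le> 2 * s\<^sup>2 + 2 * t\<^sup>2" for s t :: real
      using sum_squares_bound[of s t] by (simp add: power2_sum)
    then show "AE x in lebesgue_on U. norm ((u x + v x)\<^sup>2) \<le> norm (2 * (u x)\<^sup>2 + 2 * (v x)\<^sup>2)"
      by (intro AE_I2) simp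
  qed (use assms in \<open>auto simp: L2_def\<close>)
  then show ?thesis using assms by (auto simp: L2_def)
qed

lemma L2_cmult: "u \<in> L2 U \<Longrightarrow> (\<lambda>x. c * u x) \<in> L2 U"
  by (auto simp: L2_def power_mult_distrib)

lemma L2_diff: "u \<in> L2 U \<Longrightarrow> v \<in> L2 U \<Longrightarrow> (\<lambda>x. u x - v x) \<in> L2 U"
  using L2_add[of u "\<lambda>x. (-1) * v x"] L2_cmult[of v "-1"] by simp

lemma L2_bound:
  assumes "u \<in> L2 U" "f \<in> borel_measurable (lebesgue_on U)" "\<And>x. x \<in> U \<Longrightarrow> \<bar>f x\<bar> \<le> \<bar>u x\<bar>"
  shows "f \<in> L2 U"
proof -
  have "integrable (lebesgue_on U) (\<lambda>x. (f x)\<^sup>2)"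
    by (rule Bochner_Integration.integrable_bound[where f="\<lambda>x. (u x)\<^sup>2"])
      (use assms in \<open>auto simp: L2_def abs_le_square_iff\<close>)
  then show ?thesis using assms by (auto simp: L2_def)
qed

lemma L2_measurable: "u \<in> L2 U \<Longrightarrow> u \<in> borel_measurable (lebesgue_on U)"
  and L2_integrable_square: "u \<in> L2 U \<Longrightarrow> integrable (lebesgue_on U) (\<lambda>x. (u x)\<^sup>2)"
  by (auto simp: L2_def)

lemma L2_mult_integrable: "u \<in> L2 U \<Longrightarrow> v \<in> L2 U \<Longrightarrow> integrable (lebesgue_on U) (\<lambda>x. u x * v x)"
  and L2_Cauchy_Schwarz: "u \<in> L2 U \<Longrightarrow> v \<in> L2 U \<Longrightarrow> \<bar>LINT x|lebesgue_on U. u x * v x\<bar> \<le>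
     sqrt (LINT x|lebesgue_on U. (u x)\<^sup>2) * sqrt (LINT x|lebesgue_on U. (v x)\<^sup>2)"
  using integral_Cauchy_Schwarz[of u "lebesgue_on U" v] by (auto simp: L2_def)

lemma L2_integrable: "u \<in> L2 U \<Longrightarrow> integrable (lebesgue_on U) u"
  using L2_mult_integrable[OF _ bounded_L2[of "\<lambda>x. 1" 1]] by simp

lemma
  assumes "\<phi> \<in> smooth_up_to_boundary U"
  shows smooth_measurable: "\<phi> \<in> borel_measurable (lebesgue_on U)"
    and smooth_grad_measurable: "grad \<phi> \<in> borel_measurable (lebesgue_on U)"
    and smooth_fin_energy: "fin_energy a U (grad \<phi>)"
    and smooth_L2: "\<phi> \<in> L2 U"
proof -
  obtain V where V: "open V" "U \<subseteq> V" "smooth_on V \<phi>" using smooth_up_to_boundaryE[OF assms] by metis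
  show 1: "\<phi> \<in> borel_measurable (lebesgue_on U)" "grad \<phi> \<in> borel_measurable (lebesgue_on U)"
    using smooth_on_continuous[OF V(3)] smooth_on_grad_continuous[OF V(3,1)] V(2)
    by (auto intro!: continuous_imp_measurable_on_sets_lebesgue elim: continuous_on_subset)
  obtain B where B: "\<And>x. x \<in> U \<Longrightarrow> \<bar>\<phi> x\<bar> \<le> B" "\<And>x. x \<in> U \<Longrightarrow> norm (grad \<phi> x) \<le> B"
    using smooth_up_to_boundary_bounded[OF assms U_bounded] by metis
  show "fin_energy a U (grad \<phi>)" by (rule fin_bounded[OF 1(2)]) (use B in auto)
  show "\<phi> \<in> L2 U" by (rule bounded_L2[OF 1(1) B(1)])
qed

lemma test_smooth_up: "\<psi> \<in> test_functions W \<Longrightarrow> \<psi> \<in> smooth_up_to_boundary U"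
  using smooth_up_to_boundary_UNIV test_functions_smooth by blast

lemma smooth_H1a: "\<phi> \<in> smooth_up_to_boundary U \<Longrightarrow> has_H1a_grad a U \<phi> (grad \<phi>)"
  using smooth_L2 smooth_fin_energy unfolding has_H1a_grad_def fin_energy_def
  by (auto intro!: exI[of _ "\<lambda>k. \<phi>"])

lemma H1a_fin_energy: "has_H1a_grad a U u G \<Longrightarrow> fin_energy a U G"
  and H1a_L2: "has_H1a_grad a U u G \<Longrightarrow> u \<in> L2 U"
  by (auto simp: has_H1a_grad_def fin_energy_def)

text \<open>A defining sequence of the completion that in addition converges a.e., which a
  subsequence achieves. The nonlinear compositions need it to pass to the limit in F'(phi) by
  dominated convergence.\<close>

definition approximates :: "(nat \<Rightarrow> real^'n \<Rightarrow> real) \<Rightarrow> (real^'n \<Rightarrow> real) \<Rightarrow> (real^'n \<Rightarrow> real^'n) \<Rightarrow> bool" where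
  "approximates \<phi> u G \<longleftrightarrow> (\<forall>k. \<phi> k \<in> smooth_up_to_boundary U) \<and>
     (\<lambda>k. LINT x|lebesgue_on U. (\<phi> k x - u x)\<^sup>2) \<longlonglongrightarrow> 0 \<and>
     (\<lambda>k. energy a U (\<lambda>x. grad (\<phi> k) x - G x)) \<longlonglongrightarrow> 0 \<and>
     (AE x in lebesgue_on U. (\<lambda>k. \<phi> k x) \<longlonglongrightarrow> u x)"

lemma H1a_approximates:
  assumes "has_H1a_grad a U u G"
  obtains \<phi> where "approximates \<phi> u G"
proof -
  obtain \<phi> where \<phi>: "\<And>k. \<phi> k \<in> smooth_up_to_boundary U"
    and l: "(\<lambda>k. LINT x|lebesgue_on U. (\<phi> k x - u x)\<^sup>2) \<longlonglongrightarrow> 0"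
      "(\<lambda>k. energy a U (\<lambda>x. grad (\<phi> k) x - G x)) \<longlonglongrightarrow> 0"
    using assms unfolding has_H1a_grad_def bil_def by blast
  have int: "integrable (lebesgue_on U) (\<lambda>x. (\<phi> k x - u x)\<^sup>2)" for k
    by (rule L2_integrable_square[OF L2_diff[OF smooth_L2[OF \<phi>] H1a_L2[OF assms]]])
  have "\<exists>r. strict_mono r \<and> (AE x in lebesgue_on U. (\<lambda>k. (\<phi> (r k) x - u x)\<^sup>2) \<longlonglongrightarrow> 0)"
    using tendsto_L1_AE_subseq[OF int] l(1) by simp
  then obtain r where r: "strict_mono r"
    "AE x in lebesgue_on U. (\<lambda>k. (\<phi> (r k) x - u x)\<^sup>2) \<longlonglongrightarrow> 0"
    by blast
  have "AE x in lebesgue_on U. (\<lambda>k. \<phi> (r k) x) \<longlonglongrightarrow> u x"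
    using r(2)
  proof eventually_elim
    case (elim x)
    then have "(\<lambda>k. \<bar>\<phi> (r k) x - u x\<bar>) \<longlonglongrightarrow> 0" using tendsto_real_sqrt by fastforce
    then show ?case by (rule LIM_zero_cancel[OF tendsto_rabs_zero_cancel])
  qed
  then have "approximates (\<lambda>k. \<phi> (r k)) u G" unfolding approximates_def
    using \<phi> LIMSEQ_subseq_LIMSEQ[OF l(1) r(1)] LIMSEQ_subseq_LIMSEQ[OF l(2) r(1)] by (auto simp: o_def)
  then show thesis by (rule that)
qed

lemma approximates_H1a:
  assumes "approximates \<phi> u G" "u \<in> L2 U" "fin_energy a U G"
  shows "has_H1a_grad a U u G"
  using assms unfolding approximates_def has_H1a_grad_def fin_energy_def bil_def by blast

lemma integral_test_derivative:
  assumes \<xi>: "\<xi> \<in> test_functions U" and \<phi>: "\<phi> \<in> smooth_up_to_boundary U"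
  shows "(LINT x|lebesgue_on U. \<xi> x * grad \<phi> x $ i) = - (LINT x|lebesgue_on U. \<phi> x * grad \<xi> x $ i)"
proof -
  obtain V where V: "open V" "U \<subseteq> V" "smooth_on V \<phi>" using smooth_up_to_boundaryE[OF \<phi>] by metis
  have \<phi>U: "smooth_on U \<phi>" using V smooth_on_subset by blast
  let ?f = "\<lambda>x. if x \<in> U then \<xi> x * \<phi> x else 0"
  have t: "?f \<in> test_functions U" by (rule test_functions_glue[OF \<xi> U_open \<phi>U])
  have g: "grad ?f x = \<xi> x *\<^sub>R grad \<phi> x + \<phi> x *\<^sub>R grad \<xi> x" if "x \<in> U" for x
  proof -
    have "grad ?f x = grad (\<lambda>x. \<xi> x * \<phi> x) x" by (rule grad_cong_open[OF U_open that]) auto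
    then show ?thesis
      using smooth_grad_mult[OF smooth_on_subset[OF test_functions_smooth[OF \<xi>]] \<phi>U that] by auto
  qed
  obtain B where B: "\<And>x. \<bar>\<xi> x\<bar> \<le> B" "\<And>x. norm (grad \<xi> x) \<le> B"
    using test_functions_bounded[OF \<xi>] by metis
  obtain C where C: "\<And>x. x \<in> U \<Longrightarrow> \<bar>\<phi> x\<bar> \<le> C" "\<And>x. x \<in> U \<Longrightarrow> norm (grad \<phi> x) \<le> C"
    using smooth_up_to_boundary_bounded[OF \<phi> U_bounded] by metis
  note \<xi>s = test_smooth_up[OF \<xi>]
  have L: "(\<lambda>x. grad \<phi> x $ i) \<in> L2 U" "(\<lambda>x. grad \<xi> x $ i) \<in> L2 U" "\<phi> \<in> L2 U" "\<xi> \<in> L2 U"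
    by (rule bounded_L2[OF borel_measurable_vec_nth[OF smooth_grad_measurable[OF \<phi>]] order_trans[OF component_le_norm_cart C(2)]]
        bounded_L2[OF borel_measurable_vec_nth[OF smooth_grad_measurable[OF \<xi>s]] order_trans[OF component_le_norm_cart B(2)]]
        smooth_L2[OF \<phi>] smooth_L2[OF \<xi>s], assumption?)+
  have "0 = (LINT x|lebesgue_on U. grad ?f x $ i)" using integral_grad_zero_on[OF t U_sets] by simp
  also have "\<dots> = (LINT x|lebesgue_on U. \<xi> x * grad \<phi> x $ i + \<phi> x * grad \<xi> x $ i)"
    by (rule Bochner_Integration.integral_cong) (simp_all add: g)
  also have "\<dots> = (LINT x|lebesgue_on U. \<xi> x * grad \<phi> x $ i) + (LINT x|lebesgue_on U. \<phi> x * grad \<xi> x $ i)"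
    by (rule Bochner_Integration.integral_add) (rule L2_mult_integrable; use L in blast)+
  finally show ?thesis by simp
qed

text \<open>Both sides pass to the limit along the approximants: the left one because convergence in
  energy implies convergence of the gradients in L1, the right one by convergence in L2.\<close>

lemma weak_derivative:
  assumes u: "has_H1a_grad a U u G" and \<xi>: "\<xi> \<in> test_functions U"
  shows "(LINT x|lebesgue_on U. \<xi> x * G x $ i) = - (LINT x|lebesgue_on U. u x * grad \<xi> x $ i)"
proof -
  obtain \<phi> where "approximates \<phi> u G" using H1a_approximates[OF u] by metis
  then have \<phi>: "\<And>k. \<phi> k \<in> smooth_up_to_boundary U"
    and l: "(\<lambda>k. LINT x|lebesgue_on U. (\<phi> k x - u x)\<^sup>2) \<longlonglongrightarrow> 0"
      "(\<lambda>k. energy a U (\<lambda>x. grad (\<phi> k) x - G x)) \<longlonglongrightarrow> 0" by (auto simp: approximates_def)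
  obtain B where B: "B > 0" "\<And>x. \<bar>\<xi> x\<bar> \<le> B" "\<And>x. norm (grad \<xi> x) \<le> B"
    using test_functions_bounded[OF \<xi>] by metis
  obtain K where K: "\<And>F. fin_energy a U F \<Longrightarrow> (LINT x|lebesgue_on U. norm (F x)) \<le> K * sqrt (energy a U F)"
    using energy_L1 by metis
  note \<xi>s = test_smooth_up[OF \<xi>]
  note \<xi>m = smooth_measurable[OF \<xi>s] and \<xi>gm = borel_measurable_vec_nth[OF smooth_grad_measurable[OF \<xi>s], of i]
  have L: "(\<lambda>x. grad \<xi> x $ i) \<in> L2 U"
    by (rule bounded_L2[OF \<xi>gm order_trans[OF component_le_norm_cart B(3)]])
  have int: "integrable (lebesgue_on U) (\<lambda>x. \<xi> x * F x $ i)" 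
    and bd: "\<bar>LINT x|lebesgue_on U. \<xi> x * F x $ i\<bar> \<le> B * (K * sqrt (energy a U F))" if F: "fin_energy a U F" for F
  proof -
    note Fi = fin_integrable[OF F]
    have i1: "integrable (lebesgue_on U) (\<lambda>x. B * norm (F x))" using Fi by auto
    have le: "\<bar>\<xi> x * F x $ i\<bar> \<le> B * norm (F x)" for x
      unfolding abs_mult by (intro mult_mono B component_le_norm_cart) (use B in auto)
    show i2: "integrable (lebesgue_on U) (\<lambda>x. \<xi> x * F x $ i)"
      by (rule Bochner_Integration.integrable_bound[OF i1])
        (use \<xi>m borel_measurable_vec_nth[OF fin_measurable[OF F]] le in \<open>auto intro!: AE_I2 order_trans[OF _ abs_ge_self]\<close>)
    have "\<bar>LINT x|lebesgue_on U. \<xi> x * F x $ i\<bar> \<le> (LINT x|lebesgue_on U. \<bar>\<xi> x * F x $ i\<bar>)"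
      by (rule integral_abs_bound)
    also have "\<dots> \<le> (LINT x|lebesgue_on U. B * norm (F x))"
      by (rule integral_mono[OF integrable_abs[OF i2] i1]) (use le in auto)
    also have "\<dots> = B * (LINT x|lebesgue_on U. norm (F x))" by simp
    also have "\<dots> \<le> B * (K * sqrt (energy a U F))" using K[OF F] B(1) by (intro mult_left_mono) auto
    finally show "\<bar>LINT x|lebesgue_on U. \<xi> x * F x $ i\<bar> \<le> B * (K * sqrt (energy a U F))" .
  qed
  note fG = H1a_fin_energy[OF u] and f\<phi> = smooth_fin_energy[OF \<phi>]
  have "(\<lambda>k. LINT x|lebesgue_on U. \<xi> x * grad (\<phi> k) x $ i) \<longlonglongrightarrow> (LINT x|lebesgue_on U. \<xi> x * G x $ i)"
  proof (rule Lim_null[THEN iffD2], rule Lim_null_comparison)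
    have "(LINT x|lebesgue_on U. \<xi> x * grad (\<phi> k) x $ i) - (LINT x|lebesgue_on U. \<xi> x * G x $ i) =
       (LINT x|lebesgue_on U. \<xi> x * (grad (\<phi> k) x - G x) $ i)" for k
      using int[OF fG] int[OF f\<phi>] by (simp add: right_diff_distrib)
    then show "\<forall>\<^sub>F k in sequentially. norm ((LINT x|lebesgue_on U. \<xi> x * grad (\<phi> k) x $ i) - (LINT x|lebesgue_on U. \<xi> x * G x $ i)) \<le>
      B * (K * sqrt (energy a U (\<lambda>x. grad (\<phi> k) x - G x)))"
      using bd[OF fin_diff[OF f\<phi> fG]] by (simp del: vector_minus_component)
    have "(\<lambda>k. B * (K * sqrt (energy a U (\<lambda>x. grad (\<phi> k) x - G x)))) \<longlonglongrightarrow> B * (K * sqrt 0)"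
      by (intro tendsto_intros l)
    then show "(\<lambda>k. B * (K * sqrt (energy a U (\<lambda>x. grad (\<phi> k) x - G x)))) \<longlonglongrightarrow> 0" by simp
  qed
  moreover have "(\<lambda>k. LINT x|lebesgue_on U. \<phi> k x * grad \<xi> x $ i) \<longlonglongrightarrow> (LINT x|lebesgue_on U. u x * grad \<xi> x $ i)"
  proof (rule Lim_null[THEN iffD2], rule Lim_null_comparison)
    note u2 = H1a_L2[OF u] and p2 = smooth_L2[OF \<phi>]
    have "(LINT x|lebesgue_on U. \<phi> k x * grad \<xi> x $ i) - (LINT x|lebesgue_on U. u x * grad \<xi> x $ i) =
       (LINT x|lebesgue_on U. (\<phi> k x - u x) * grad \<xi> x $ i)" for k
      using L2_mult_integrable[OF u2 L] L2_mult_integrable[OF p2 L] by (simp add: left_diff_distrib)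
    then show "\<forall>\<^sub>F k in sequentially. norm ((LINT x|lebesgue_on U. \<phi> k x * grad \<xi> x $ i) - (LINT x|lebesgue_on U. u x * grad \<xi> x $ i)) \<le>
      sqrt (LINT x|lebesgue_on U. (\<phi> k x - u x)\<^sup>2) * sqrt (LINT x|lebesgue_on U. (grad \<xi> x $ i)\<^sup>2)"
      using L2_Cauchy_Schwarz[OF L2_diff[OF p2 u2] L] by simp
    have "(\<lambda>k. sqrt (LINT x|lebesgue_on U. (\<phi> k x - u x)\<^sup>2) * sqrt (LINT x|lebesgue_on U. (grad \<xi> x $ i)\<^sup>2)) \<longlonglongrightarrow> sqrt 0 * sqrt (LINT x|lebesgue_on U. (grad \<xi> x $ i)\<^sup>2)"
      by (intro tendsto_intros l)
    then show "(\<lambda>k. sqrt (LINT x|lebesgue_on U. (\<phi> k x - u x)\<^sup>2) * sqrt (LINT x|lebesgue_on U. (grad \<xi> x $ i)\<^sup>2)) \<longlonglongrightarrow> 0" by simp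
  qed
  from tendsto_minus[OF this]
  have "(\<lambda>k. LINT x|lebesgue_on U. \<xi> x * grad (\<phi> k) x $ i) \<longlonglongrightarrow> - (LINT x|lebesgue_on U. u x * grad \<xi> x $ i)"
    by (simp add: integral_test_derivative[OF \<xi> \<phi>])
  ultimately show ?thesis by (rule LIMSEQ_unique)
qed

end

section \<open>Smooth bumps on boxes and uniqueness of the weak gradient\<close>

lemma pexp_one_tendsto:
  assumes "c > 0" shows "(\<lambda>m. pexp 1 (real m * c - 1)) \<longlonglongrightarrow> 1"
proof -
  have lim: "filterlim (\<lambda>m. real m * c - 1) at_top sequentially"
    using filterlim_tendsto_add_at_top[OF tendsto_const[of "-1"]
      filterlim_at_top_mult_tendsto_pos[OF tendsto_const[of c] assms filterlim_real_sequentially]]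
    by (simp add: algebra_simps)
  have "((\<lambda>x::real. exp (- (1 / x))) \<longlongrightarrow> exp (- 0)) at_top"
    by (intro tendsto_exp tendsto_minus tendsto_divide_0[OF tendsto_const] filterlim_ident
        filterlim_at_top_imp_at_infinity)
  then have "((pexp 1) \<longlongrightarrow> 1) at_top"
    by (rule Lim_transform_eventually[THEN tendsto_eq_rhs])
      (auto simp: pexp_def intro!: eventually_mono[OF eventually_gt_at_top[of 0]])
  from filterlim_compose[OF this lim] show ?thesis .
qed

lemma pexp_one_bounds: "0 \<le> pexp 1 x" "pexp 1 x \<le> 1"
  by (auto simp: pexp_def)

text \<open>Smooth approximation of the indicator of a box from below: each factor vanishes within
  distance 1/m of its face and tends to 1 at interior points as m grows. The symmetric case is also
  the cutoff of the Caccioppoli inequality, with m as the steepness.\<close>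

definition box_bump :: "real^'n \<Rightarrow> real^'n \<Rightarrow> nat \<Rightarrow> real^'n \<Rightarrow> real" where
  "box_bump l u m x = (\<Prod>i\<in>UNIV. pexp 1 (real m * (u $ i - x $ i) - 1) * pexp 1 (real m * (x $ i - l $ i) - 1))"

lemma box_bump_smooth: "smooth_on UNIV (box_bump l u m)"
proof -
  have 1: "Ck k (\<lambda>y. pexp 1 (real m * (c - y) - 1))" "Ck k (\<lambda>y. pexp 1 (real m * (y - c) - 1))" for k c
    using Ck_affine[OF Ck_pexp[of k 1], of 1 "- real m" "real m * c - 1"]
      Ck_affine[OF Ck_pexp[of k 1], of 1 "real m" "- real m * c - 1"] by (simp_all add: algebra_simps)
  show ?thesis unfolding box_bump_def
    by (intro smooth_on_prod smooth_on_mult smooth_on_compose[OF 1(1) smooth_on_coord]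
        smooth_on_compose[OF 1(2) smooth_on_coord])
qed

lemma box_bump_outside:
  assumes "x \<notin> box l u" shows "box_bump l u m x = 0"
proof -
  obtain i where "x $ i \<le> l $ i \<or> u $ i \<le> x $ i" using assms by (auto simp: mem_box_cart not_less)
  then have "real m * (u $ i - x $ i) - 1 \<le> 0 \<or> real m * (x $ i - l $ i) - 1 \<le> 0"
    by (smt (verit) mult_nonneg_nonneg mult_minus_right of_nat_0_le_iff)
  then have "pexp 1 (real m * (u $ i - x $ i) - 1) * pexp 1 (real m * (x $ i - l $ i) - 1) = 0"
    by (auto simp: pexp_def)
  then show ?thesis unfolding box_bump_def by (intro prod_zero) auto
qed

lemma box_bump_test:
  assumes "cbox l u \<subseteq> U" shows "box_bump l u m \<in> test_functions U"
proof -
  have "closure {x. box_bump l u m x \<noteq> 0} \<subseteq> cbox l u"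
  proof (rule closure_minimal[OF subsetI closed_cbox])
    fix x assume "x \<in> {x. box_bump l u m x \<noteq> 0}"
    then have "x \<in> box l u" using box_bump_outside[of x l u m] by auto
    then show "x \<in> cbox l u" using box_subset_cbox by blast
  qed
  then show ?thesis unfolding test_functions_def
    using box_bump_smooth assms compact_closed_subset[OF compact_cbox closed_closure] by blast
qed

lemma box_bump_bounds: "0 \<le> box_bump l u m x" "box_bump l u m x \<le> 1"
  unfolding box_bump_def by (auto intro!: prod_nonneg prod_le_1 mult_le_one simp: pexp_one_bounds)

lemma box_bump_tendsto: "(\<lambda>m. box_bump l u m x) \<longlonglongrightarrow> indicator (box l u) x"
proof (cases "x \<in> box l u")
  case True
  have "(\<lambda>m. box_bump l u m x) \<longlonglongrightarrow> (\<Prod>i\<in>(UNIV::'a set). 1 * 1)"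
    unfolding box_bump_def
    by (intro tendsto_prod tendsto_mult pexp_one_tendsto) (use True in \<open>auto simp: mem_box_cart\<close>)
  then show ?thesis using True by simp
qed (simp add: box_bump_outside)

text \<open>Testing with \<open>box_bump\<close> shows that f has integral zero over every box whose
  closure lies in U. Lebesgue differentiation along small boxes with corner x then gives f x = 0 for
  almost every x.\<close>

lemma (in coefficients) AE_zero_of_test:
  fixes f :: "real^'n \<Rightarrow> real"
  assumes f: "integrable (lebesgue_on U) f"
    and z: "\<And>\<xi>. \<xi> \<in> test_functions U \<Longrightarrow> (LINT x|lebesgue_on U. \<xi> x * f x) = 0"
  shows "AE x in lebesgue_on U. f x = 0"
proof -
  have box0: "(LINT x|lebesgue_on (box l u). f x) = 0" if "cbox l u \<subseteq> U" for l u
  proof -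
    have "(\<lambda>m. LINT x|lebesgue_on U. box_bump l u m x * f x) \<longlonglongrightarrow> (LINT x|lebesgue_on U. indicator (box l u) x * f x)"
    proof (rule integral_dominated_convergence[where w="\<lambda>x. \<bar>f x\<bar>"])
      show "AE x in lebesgue_on U. (\<lambda>m. box_bump l u m x * f x) \<longlonglongrightarrow> indicator (box l u) x * f x"
        by (intro AE_I2 tendsto_intros box_bump_tendsto)
      show "(\<lambda>x. box_bump l u m x * f x) \<in> borel_measurable (lebesgue_on U)" for m
        using smooth_measurable[OF test_smooth_up[OF box_bump_test[OF that]]] f by auto
      show "AE x in lebesgue_on U. norm (box_bump l u m x * f x) \<le> \<bar>f x\<bar>" for m
        using box_bump_bounds[of l u m] by (intro AE_I2) (auto simp: abs_mult mult_left_le_one_le)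
      show "(\<lambda>x. indicator (box l u) x * f x) \<in> borel_measurable (lebesgue_on U)"
        using borel_measurable_integrable[OF f]
        by (intro borel_measurable_times borel_measurable_indicator)
          (use subset_trans[OF box_subset_cbox that] in \<open>auto simp: sets_restrict_space_iff\<close>)
    qed (use f in auto)
    then have "(LINT x|lebesgue_on U. indicator (box l u) x * f x) = 0"
      using LIMSEQ_unique[OF _ tendsto_const[of 0]] unfolding z[OF box_bump_test[OF that]] by blast
    moreover have "(LINT x|lebesgue_on U. indicator (box l u) x * f x) = (LINT x|lebesgue_on (box l u). indicator (box l u) x * f x)"
      by (rule integral_lebesgue_on_zero_outside) (use that box_subset_cbox in \<open>auto simp: indicator_def\<close>)
    moreover have "\<dots> = (LINT x|lebesgue_on (box l u). f x)"
      by (rule Bochner_Integration.integral_cong) auto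
    ultimately show ?thesis by simp
  qed
  let ?f = "\<lambda>x. if x \<in> U then f x else 0"
  have fi: "integrable (lebesgue_on UNIV) ?f"
    using Lebesgue_Measure.integrable_restrict_UNIV[of U f] f by (simp add: lebesgue_on_UNIV_eq)
  have fcb: "?f integrable_on cbox l u" for l u
    by (rule integrable_on_lebesgue_on[OF integrable_lebesgue_on_subset[OF fi]]) auto
  obtain N where N: "negligible N"
    "\<And>x e. x \<notin> N \<Longrightarrow> 0 < e \<Longrightarrow> \<exists>d>0. \<forall>h. 0 < h \<and> h < d \<longrightarrow>
      norm (integral (cbox x (x + h *\<^sub>R One)) ?f /\<^sub>R h ^ DIM(real^'n) - ?f x) < e"
    by (rule integrable_ccontinuous_explicit[OF fcb]) (rule that, assumption+)
  have "f x = 0" if x: "x \<in> U" "x \<notin> N" for x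
  proof -
    have "norm (f x) \<le> e" if e: "e > 0" for e
    proof -
      obtain d where d: "d > 0" "\<And>h. 0 < h \<Longrightarrow> h < d \<Longrightarrow>
        norm (integral (cbox x (x + h *\<^sub>R One)) ?f /\<^sub>R h ^ DIM(real^'n) - ?f x) < e"
        using N(2)[OF x(2) e] by blast
      obtain r where r: "r > 0" "cball x r \<subseteq> U" using U_open x open_contains_cball by blast
      define h where "h = min (d / 2) (r / real CARD('n))"
      have h: "0 < h" "h < d" "h * real CARD('n) \<le> r" using d r by (auto simp: h_def min_def field_simps)
      have sub: "cbox x (x + h *\<^sub>R One) \<subseteq> U"
      proof
        fix y assume y: "y \<in> cbox x (x + h *\<^sub>R One)"
        have "\<bar>(y - x) $ i\<bar> \<le> h" for i
        proof -
          have ai: "axis i 1 \<in> (Basis :: (real^'n) set)" by (simp add: axis_in_Basis_iff)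
          have "(One::real^'n) \<bullet> axis i 1 = 1" using ai by (simp add: inner_sum_left_Basis)
          then show ?thesis using y ai by (auto simp: mem_box inner_add_left inner_axis dest!: bspec[of _ _ "axis i 1"])
        qed
        then have "norm (y - x) \<le> (\<Sum>i\<in>(UNIV::'n set). h)"
          by (intro order_trans[OF norm_le_l1_cart] sum_mono) auto
        then have "y \<in> cball x r" using h(3) by (simp add: dist_norm norm_minus_commute mult.commute)
        then show "y \<in> U" using r by blast
      qed
      have "integral (cbox x (x + h *\<^sub>R One)) ?f = integral (box x (x + h *\<^sub>R One)) ?f"
        by (simp add: integral_open_interval)
      also have "\<dots> = integral (box x (x + h *\<^sub>R One)) f"
        by (rule Henstock_Kurzweil_Integration.integral_cong) (use sub box_subset_cbox in auto)
      also have "\<dots> = (LINT x|lebesgue_on (box x (x + h *\<^sub>R One)). f x)"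
        by (rule lebesgue_integral_eq_integral[symmetric])
          (use integrable_lebesgue_on_subset[OF f subset_trans[OF box_subset_cbox sub]] in auto)
      also have "\<dots> = 0" by (rule box0[OF sub])
      finally show ?thesis using d(2)[OF h(1,2)] x(1) by simp
    qed
    then show ?thesis by (metis dense_ge norm_le_zero_iff)
  qed
  moreover have "AE x in lebesgue. x \<notin> N"
    using N(1) by (simp add: negligible_iff_null_sets AE_not_in)
  ultimately show ?thesis using U_sets by (subst AE_restrict_space_iff) (auto elim: eventually_mono)
qed

text \<open>This makes the arbitrary choice in \<open>H1a_grad\<close> harmless: any admissible
  gradient yields the same integrals.\<close>

lemma (in coefficients) H1a_grad_unique:
  assumes "has_H1a_grad a U u G" "has_H1a_grad a U u H"
  shows "AE x in lebesgue_on U. G x = H x"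
proof -
  note G = fin_integrable[OF H1a_fin_energy[OF assms(1)]] and H = fin_integrable[OF H1a_fin_energy[OF assms(2)]]
  have nth: "integrable (lebesgue_on U) (\<lambda>x. F x $ i)" if "integrable (lebesgue_on U) F" for F :: "real^'n \<Rightarrow> real^'n" and i
    using integrable_bounded_linear[OF bounded_linear_vec_nth that] .
  have "AE x in lebesgue_on U. G x $ i - H x $ i = 0" for i
  proof (rule AE_zero_of_test)
    show "integrable (lebesgue_on U) (\<lambda>x. G x $ i - H x $ i)" using nth G H by auto
    fix \<xi> assume \<xi>: "\<xi> \<in> test_functions U"
    obtain B where B: "\<And>x. \<bar>\<xi> x\<bar> \<le> B" using test_functions_bounded[OF \<xi>] by metis
    have "integrable (lebesgue_on U) (\<lambda>x. \<xi> x * F x $ i)" if "integrable (lebesgue_on U) F" for F :: "real^'n \<Rightarrow> real^'n"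
    proof (rule Bochner_Integration.integrable_bound)
      show "integrable (lebesgue_on U) (\<lambda>x. B * F x $ i)" using nth[OF that] by auto
      show "(\<lambda>x. \<xi> x * F x $ i) \<in> borel_measurable (lebesgue_on U)"
        using smooth_measurable[OF test_smooth_up[OF \<xi>]] nth[OF that] by auto
      show "AE x in lebesgue_on U. norm (\<xi> x * F x $ i) \<le> norm (B * F x $ i)"
        using B by (intro AE_I2) (auto simp: abs_mult intro!: mult_right_mono intro: order_trans[OF _ abs_ge_self])
    qed
    then show "(LINT x|lebesgue_on U. \<xi> x * (G x $ i - H x $ i)) = 0"
      using weak_derivative[OF assms(1) \<xi>, of i] weak_derivative[OF assms(2) \<xi>, of i] G H
      by (simp add: right_diff_distrib)
  qed
  then have "AE x in lebesgue_on U. \<forall>i. G x $ i - H x $ i = 0" by (simp add: AE_all_countable)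
  then show ?thesis by eventually_elim (simp add: vec_eq_iff)
qed

subsection \<open>Chain rule and subsolutions\<close>

text \<open>Subsolutions with a gradient named explicitly. In \<open>subsolutions\<close> the
  gradient is a choice made separately for every domain; here the same G survives restriction to a
  subdomain, as the multiscale arguments require.\<close>

definition subsol :: "(real^'n \<Rightarrow> real^'n^'n) \<Rightarrow> (real^'n) set \<Rightarrow> (real^'n \<Rightarrow> real) \<Rightarrow> (real^'n \<Rightarrow> real^'n) \<Rightarrow> bool" where
  "subsol a U u G \<longleftrightarrow> has_H1a_grad a U u G \<and>
    (\<forall>\<psi>\<in>test_functions U. (\<forall>x. 0 \<le> \<psi> x) \<longrightarrow> bil a U (grad \<psi>) G \<le> 0)"

lemma subsol_subset:
  assumes "coefficients a U" "subsol a U u G" "W \<subseteq> U" "open W"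
  shows "subsol a W u G"
proof -
  interpret U: coefficients a U by fact
  have "bil a U (grad \<psi>) G = bil a W (grad \<psi>) G" if "\<psi> \<in> test_functions W" for \<psi>
    by (rule bil_zero_outside) (use test_functions_grad_outside'[OF that] assms in auto)
  then show ?thesis
    using assms H1a_grad_subset test_functions_mono unfolding subsol_def by metis
qed

lemma (in coefficients) bil_cong_AE_right:
  assumes "AE x in lebesgue_on U. G x = H x" "G \<in> borel_measurable (lebesgue_on U)"
    "H \<in> borel_measurable (lebesgue_on U)" "F \<in> borel_measurable (lebesgue_on U)"
  shows "bil a U F G = bil a U F H"
  unfolding bil_def
  by (rule integral_cong_AE) (use assms form_measurable in auto)

lemma (in coefficients) H1a_grad_works: "has_H1a_grad a U u G \<Longrightarrow> has_H1a_grad a U u (H1a_grad a U u)"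
  unfolding H1a_grad_def by (rule someI[of "has_H1a_grad a U u"])

lemma (in coefficients) subsolutions_iff: "u \<in> subsolutions a U \<longleftrightarrow> (\<exists>G. subsol a U u G)"
proof
  assume u: "u \<in> subsolutions a U"
  then obtain G where "has_H1a_grad a U u G" by (auto simp: subsolutions_def H1a_def)
  then have "has_H1a_grad a U u (H1a_grad a U u)" by (rule H1a_grad_works)
  then show "\<exists>G. subsol a U u G"
    using u unfolding subsol_def subsolutions_def bil_def by blast
next
  assume "\<exists>G. subsol a U u G"
  then obtain G where G: "subsol a U u G" ..
  then have u: "has_H1a_grad a U u G" by (simp add: subsol_def)
  note w = H1a_grad_works[OF u]
  have "bil a U (grad \<psi>) (H1a_grad a U u) = bil a U (grad \<psi>) G" if "\<psi> \<in> test_functions U" for \<psi>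
    by (rule bil_cong_AE_right[OF H1a_grad_unique[OF w u]])
      (use fin_measurable[OF H1a_fin_energy[OF u]] fin_measurable[OF H1a_fin_energy[OF w]]
        smooth_grad_measurable[OF test_smooth_up[OF that]] in auto)
  then show "u \<in> subsolutions a U"
    using G u unfolding subsolutions_def H1a_def subsol_def bil_def by auto
qed

context coefficients
begin

lemma approximates_smooth:
  assumes "approximates \<phi> u G"
  shows "\<phi> k \<in> smooth_up_to_boundary U" "\<phi> k \<in> borel_measurable (lebesgue_on U)"
    "\<phi> k \<in> L2 U" "fin_energy a U (grad (\<phi> k))"
  using assms smooth_measurable smooth_L2 smooth_fin_energy unfolding approximates_def by auto

lemma smooth_mult_test:
  assumes \<psi>: "\<psi> \<in> test_functions U" and h: "h \<in> smooth_up_to_boundary U"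
  defines "f \<equiv> \<lambda>x. if x \<in> U then \<psi> x * h x else 0"
  shows "f \<in> test_functions U"
    and "bil a U (grad f) G = bil a U (\<lambda>x. \<psi> x *\<^sub>R grad h x + h x *\<^sub>R grad \<psi> x) G"
proof -
  obtain V where V: "open V" "U \<subseteq> V" "smooth_on V h" using smooth_up_to_boundaryE[OF h] by metis
  have hU: "smooth_on U h" using V smooth_on_subset by blast
  show "f \<in> test_functions U" unfolding f_def by (rule test_functions_glue[OF \<psi> U_open hU])
  have "grad f x = \<psi> x *\<^sub>R grad h x + h x *\<^sub>R grad \<psi> x" if "x \<in> U" for x
  proof -
    have "grad f x = grad (\<lambda>x. \<psi> x * h x) x" unfolding f_def by (rule grad_cong_open[OF U_open that]) auto
    then show ?thesis
      using smooth_grad_mult[OF smooth_on_subset[OF test_functions_smooth[OF \<psi>]] hU that] by auto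
  qed
  then show "bil a U (grad f) G = bil a U (\<lambda>x. \<psi> x *\<^sub>R grad h x + h x *\<^sub>R grad \<psi> x) G"
    unfolding bil_def by (intro Bochner_Integration.integral_cong) simp_all
qed

lemma smooth_compose_grad:
  assumes "\<phi> \<in> smooth_up_to_boundary U" "\<And>y. (F has_real_derivative F' y) (at y)" "x \<in> U"
  shows "grad (\<lambda>x. F (\<phi> x)) x = F' (\<phi> x) *\<^sub>R grad \<phi> x"
proof -
  obtain V where V: "open V" "U \<subseteq> V" "smooth_on V \<phi>" using smooth_up_to_boundaryE[OF assms(1)] by metis
  show ?thesis
    by (rule smooth_grad_compose[where F=F and f=\<phi> and F'=F' and V=V]) (use assms V in auto)
qed

lemma smooth_compose_energy:
  assumes \<phi>: "\<phi> \<in> smooth_up_to_boundary U" and F: "\<And>y. (F has_real_derivative F' y) (at y)"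
  shows "energy a U (\<lambda>x. grad (\<lambda>x. F (\<phi> x)) x - H x) = energy a U (\<lambda>x. F' (\<phi> x) *\<^sub>R grad \<phi> x - H x)"
  unfolding bil_def
  by (rule Bochner_Integration.integral_cong) (simp_all add: smooth_compose_grad[OF \<phi> F])

text \<open>Chain rule for F with bounded continuous derivative. The gradient error splits into
  F'(phi) (grad phi - G), which is small since F' is bounded, and (F'(phi) - F'(u)) G, which tends
  to zero in energy by dominated convergence.\<close>

lemma approximates_compose:
  assumes ap: "approximates \<phi> u G" and u: "has_H1a_grad a U u G"
    and sm: "\<And>k. Ck k F" and F: "\<And>y. (F has_real_derivative F' y) (at y)"
    and F': "continuous_on UNIV F'" "\<And>y. \<bar>F' y\<bar> \<le> C"
  shows "approximates (\<lambda>k x. F (\<phi> k x)) (\<lambda>x. F (u x)) (\<lambda>x. F' (u x) *\<^sub>R G x)"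
    and "has_H1a_grad a U (\<lambda>x. F (u x)) (\<lambda>x. F' (u x) *\<^sub>R G x)"
proof -
  note \<phi> = approximates_smooth[OF ap] and fG = H1a_fin_energy[OF u] and u2 = H1a_L2[OF u]
  have C: "C \<ge> 0" using F'(2)[of 0] by simp
  have lip: "\<bar>F x - F y\<bar> \<le> C * \<bar>x - y\<bar>" for x y
  proof -
    have "norm (F x - F y) \<le> C * norm (x - y)"
      by (rule field_differentiable_bound[where S=UNIV and f'=F'])
        (use F F'(2) in \<open>auto intro: has_field_derivative_at_within\<close>)
    then show ?thesis by simp
  qed
  have Fc: "continuous_on UNIV F" using sm[of 0] by simp
  have m: "(\<lambda>x. F (v x)) \<in> borel_measurable (lebesgue_on U)" "(\<lambda>x. F' (v x)) \<in> borel_measurable (lebesgue_on U)"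
    if "v \<in> borel_measurable (lebesgue_on U)" for v
    using that Fc F'(1) by (auto intro: measurable_compose[OF _ borel_measurable_continuous_onI])
  have FL2: "(\<lambda>x. F (v x)) \<in> L2 U" if v: "v \<in> L2 U" for v
  proof -
    have "(\<lambda>x. C * v x) \<in> L2 U" by (rule L2_cmult[OF v])
    then have "(\<lambda>x. F (v x) - F 0) \<in> L2 U"
      by (rule L2_bound) (use m[OF L2_measurable[OF v]] lip[of "v _" 0] C in \<open>auto simp: abs_mult\<close>)
    from L2_add[OF this bounded_L2[of "\<lambda>x. F 0" "\<bar>F 0\<bar>"]] show ?thesis by simp
  qed
  have ae: "AE x in lebesgue_on U. (\<lambda>k. \<phi> k x) \<longlonglongrightarrow> u x"
    and l2: "(\<lambda>k. LINT x|lebesgue_on U. (\<phi> k x - u x)\<^sup>2) \<longlonglongrightarrow> 0"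
    and en: "(\<lambda>k. energy a U (\<lambda>x. grad (\<phi> k) x - G x)) \<longlonglongrightarrow> 0"
    using ap by (auto simp: approximates_def)
  have "(\<lambda>k. LINT x|lebesgue_on U. (F (\<phi> k x) - F (u x))\<^sup>2) \<longlonglongrightarrow> 0"
  proof (rule tendsto_sandwich[OF _ _ tendsto_const])
    show "\<forall>\<^sub>F k in sequentially. (LINT x|lebesgue_on U. (F (\<phi> k x) - F (u x))\<^sup>2) \<le> C\<^sup>2 * (LINT x|lebesgue_on U. (\<phi> k x - u x)\<^sup>2)"
    proof (intro always_eventually allI)
      fix k
      have "(F x - F y)\<^sup>2 \<le> C\<^sup>2 * (x - y)\<^sup>2" for x y
        using lip[of x y] C unfolding power_mult_distrib[symmetric]
        by (intro abs_le_square_iff[THEN iffD1]) (simp add: abs_mult)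
      moreover have "integrable (lebesgue_on U) (\<lambda>x. (F (\<phi> k x) - F (u x))\<^sup>2)"
        by (intro L2_integrable_square L2_diff FL2 \<phi>(3) u2)
      moreover have "integrable (lebesgue_on U) (\<lambda>x. C\<^sup>2 * (\<phi> k x - u x)\<^sup>2)"
        by (intro integrable_mult_right L2_integrable_square L2_diff \<phi>(3) u2)
      ultimately show "(LINT x|lebesgue_on U. (F (\<phi> k x) - F (u x))\<^sup>2) \<le> C\<^sup>2 * (LINT x|lebesgue_on U. (\<phi> k x - u x)\<^sup>2)"
        unfolding Bochner_Integration.integral_mult_right_zero[symmetric] by (intro integral_mono) auto
    qed
    show "(\<lambda>k. C\<^sup>2 * (LINT x|lebesgue_on U. (\<phi> k x - u x)\<^sup>2)) \<longlonglongrightarrow> 0"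
      using tendsto_mult[OF tendsto_const[of "C\<^sup>2"] l2] by simp
  qed auto
  moreover have "(\<lambda>k. energy a U (\<lambda>x. grad (\<lambda>x. F (\<phi> k x)) x - F' (u x) *\<^sub>R G x)) \<longlonglongrightarrow> 0"
  proof (rule tendsto_sandwich[OF _ _ tendsto_const])
    show "\<forall>\<^sub>F k in sequentially. energy a U (\<lambda>x. grad (\<lambda>x. F (\<phi> k x)) x - F' (u x) *\<^sub>R G x) \<le>
      2 * (C\<^sup>2 * energy a U (\<lambda>x. grad (\<phi> k) x - G x)) + 2 * energy a U (\<lambda>x. (F' (\<phi> k x) - F' (u x)) *\<^sub>R G x)"
    proof (intro always_eventually allI)
      fix k
      have 1: "fin_energy a U (\<lambda>x. F' (\<phi> k x) *\<^sub>R (grad (\<phi> k) x - G x))"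
        "energy a U (\<lambda>x. F' (\<phi> k x) *\<^sub>R (grad (\<phi> k) x - G x)) \<le> C\<^sup>2 * energy a U (\<lambda>x. grad (\<phi> k) x - G x)"
        using fin_mult[OF fin_diff[OF \<phi>(4) fG] m(2)[OF \<phi>(2)] F'(2), of k k] by auto
      have 2: "fin_energy a U (\<lambda>x. (F' (\<phi> k x) - F' (u x)) *\<^sub>R G x)"
        by (rule fin_mult[OF fG, where C="C + C"])
          (use m(2)[OF \<phi>(2)] m(2)[OF L2_measurable[OF u2]] order_trans[OF abs_triangle_ineq4 add_mono[OF F'(2) F'(2)]] in auto)
      have "energy a U (\<lambda>x. grad (\<lambda>x. F (\<phi> k x)) x - F' (u x) *\<^sub>R G x) =
        energy a U (\<lambda>x. F' (\<phi> k x) *\<^sub>R (grad (\<phi> k) x - G x) + (F' (\<phi> k x) - F' (u x)) *\<^sub>R G x)"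
        unfolding smooth_compose_energy[OF \<phi>(1) F] by (simp add: algebra_simps)
      also have "\<dots> \<le> 2 * energy a U (\<lambda>x. F' (\<phi> k x) *\<^sub>R (grad (\<phi> k) x - G x)) + 2 * energy a U (\<lambda>x. (F' (\<phi> k x) - F' (u x)) *\<^sub>R G x)"
        by (rule energy_add_le[OF 1(1) 2])
      finally show "energy a U (\<lambda>x. grad (\<lambda>x. F (\<phi> k x)) x - F' (u x) *\<^sub>R G x) \<le>
        2 * (C\<^sup>2 * energy a U (\<lambda>x. grad (\<phi> k) x - G x)) + 2 * energy a U (\<lambda>x. (F' (\<phi> k x) - F' (u x)) *\<^sub>R G x)"
        using 1(2) by linarith
    qed
    have "(\<lambda>k. energy a U (\<lambda>x. (F' (\<phi> k x) - F' (u x)) *\<^sub>R G x)) \<longlonglongrightarrow> 0"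
    proof (rule energy_mult_tendsto[OF fG m(2)[OF \<phi>(2)] m(2)[OF L2_measurable[OF u2]] F'(2) F'(2)])
      show "AE x in lebesgue_on U. (\<lambda>k. F' (\<phi> k x)) \<longlonglongrightarrow> F' (u x)"
        using ae by eventually_elim (use F'(1) in \<open>auto intro: continuous_on_tendsto_compose\<close>)
    qed
    with en have "(\<lambda>k. 2 * (C\<^sup>2 * energy a U (\<lambda>x. grad (\<phi> k) x - G x)) + 2 * energy a U (\<lambda>x. (F' (\<phi> k x) - F' (u x)) *\<^sub>R G x)) \<longlonglongrightarrow> 2 * (C\<^sup>2 * 0) + 2 * 0"
      by (intro tendsto_intros)
    then show "(\<lambda>k. 2 * (C\<^sup>2 * energy a U (\<lambda>x. grad (\<phi> k) x - G x)) + 2 * energy a U (\<lambda>x. (F' (\<phi> k x) - F' (u x)) *\<^sub>R G x)) \<longlonglongrightarrow> 0" by simp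
  qed (simp add: energy_nonneg)
  moreover have "AE x in lebesgue_on U. (\<lambda>k. F (\<phi> k x)) \<longlonglongrightarrow> F (u x)"
    using ae by eventually_elim (use Fc in \<open>auto intro: continuous_on_tendsto_compose\<close>)
  moreover have "(\<lambda>x. F (\<phi> k x)) \<in> smooth_up_to_boundary U" for k
    by (rule smooth_up_to_boundary_compose[OF sm \<phi>(1)])
  ultimately show ap': "approximates (\<lambda>k x. F (\<phi> k x)) (\<lambda>x. F (u x)) (\<lambda>x. F' (u x) *\<^sub>R G x)"
    unfolding approximates_def by blast
  have "fin_energy a U (\<lambda>x. F' (u x) *\<^sub>R G x)"
    using fin_mult[OF fG m(2)[OF L2_measurable[OF u2]] F'(2)] by auto
  then show "has_H1a_grad a U (\<lambda>x. F (u x)) (\<lambda>x. F' (u x) *\<^sub>R G x)"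
    by (intro approximates_H1a[OF ap'] FL2 u2)
qed

lemma subsol_H1a: "subsol a U u G \<Longrightarrow> has_H1a_grad a U u G"
  by (simp add: subsol_def)

text \<open>Convex nondecreasing functions of subsolutions are subsolutions. The formal test
  function psi F'(u) is not smooth, so psi F'(phi) is used for smooth approximants phi of u. The
  term with F'' has a sign up to an error controlled by the bound on F'' and the energy distance
  between phi and u.\<close>

lemma subsol_compose:
  assumes u: "subsol a U u G"
    and sm: "\<And>k. Ck k F" "\<And>k. Ck k F'"
    and F: "\<And>y. (F has_real_derivative F' y) (at y)" "\<And>y. (F' has_real_derivative F'' y) (at y)"
    and F': "continuous_on UNIV F'" "\<And>y. 0 \<le> F' y" "\<And>y. F' y \<le> C"
    and F'': "continuous_on UNIV F''" "\<And>y. 0 \<le> F'' y" "\<And>y. F'' y \<le> D"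
  shows "subsol a U (\<lambda>x. F (u x)) (\<lambda>x. F' (u x) *\<^sub>R G x)"
proof -
  note uH = subsol_H1a[OF u]
  note fG = H1a_fin_energy[OF uH] and u2 = H1a_L2[OF uH]
  obtain \<phi> where ap: "approximates \<phi> u G" using H1a_approximates[OF uH] by metis
  note \<phi> = approximates_smooth[OF ap]
  have ab: "\<bar>F' y\<bar> \<le> C" "\<bar>F'' y\<bar> \<le> D" for y using F' F'' by (auto simp: abs_of_nonneg)
  have D: "0 \<le> D" using ab(2)[of 0] by simp
  have m: "(\<lambda>x. F' (v x)) \<in> borel_measurable (lebesgue_on U)" "(\<lambda>x. F'' (v x)) \<in> borel_measurable (lebesgue_on U)"
    if "v \<in> borel_measurable (lebesgue_on U)" for v
    using that F'(1) F''(1) by (auto intro: measurable_compose[OF _ borel_measurable_continuous_onI])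
  have ae: "AE x in lebesgue_on U. (\<lambda>k. \<phi> k x) \<longlonglongrightarrow> u x"
    and en: "(\<lambda>k. energy a U (\<lambda>x. grad (\<phi> k) x - G x)) \<longlonglongrightarrow> 0"
    using ap by (auto simp: approximates_def)
  have "bil a U (grad \<psi>) (\<lambda>x. F' (u x) *\<^sub>R G x) \<le> 0" if \<psi>: "\<psi> \<in> test_functions U" "\<And>x. 0 \<le> \<psi> x" for \<psi>
  proof -
    obtain B where B: "B > 0" "\<And>x. \<bar>\<psi> x\<bar> \<le> B" using test_functions_bounded[OF \<psi>(1)] by metis
    note \<psi>s = test_smooth_up[OF \<psi>(1)]
    note f\<psi> = smooth_fin_energy[OF \<psi>s] and \<psi>m = smooth_measurable[OF \<psi>s]
    have le: "bil a U G (\<lambda>x. F' (\<phi> k x) *\<^sub>R grad \<psi> x) \<le> (B * D) * sqrt (energy a U (\<lambda>x. grad (\<phi> k) x - G x)) * sqrt (energy a U G)" for k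
    proof -
      define h where "h x = \<psi> x * F'' (\<phi> k x)" for x
      have hm: "h \<in> borel_measurable (lebesgue_on U)" unfolding h_def using \<psi>m m(2)[OF \<phi>(2)] by auto
      have hb: "\<bar>h x\<bar> \<le> B * D" for x
        unfolding h_def abs_mult by (intro mult_mono B ab) (use B D in auto)
      have h0: "0 \<le> h x" for x unfolding h_def using \<psi> F'' by auto
      have sF: "(\<lambda>x. F' (\<phi> k x)) \<in> smooth_up_to_boundary U" by (rule smooth_up_to_boundary_compose[OF sm(2) \<phi>(1)])
      note t = smooth_mult_test[OF \<psi>(1) sF]
      have "0 \<ge> bil a U (grad (\<lambda>x. if x \<in> U then \<psi> x * F' (\<phi> k x) else 0)) G"
        using u t(1) \<psi>(2) F'(2) unfolding subsol_def by auto
      also have "bil a U (grad (\<lambda>x. if x \<in> U then \<psi> x * F' (\<phi> k x) else 0)) G =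
        bil a U G (\<lambda>x. \<psi> x *\<^sub>R grad (\<lambda>x. F' (\<phi> k x)) x + F' (\<phi> k x) *\<^sub>R grad \<psi> x)"
        unfolding t(2) by (rule bil_sym)
      also have "\<dots> = bil a U G (\<lambda>x. (h x *\<^sub>R (grad (\<phi> k) x - G x) + h x *\<^sub>R G x) + F' (\<phi> k x) *\<^sub>R grad \<psi> x)"
        unfolding bil_def
        by (rule Bochner_Integration.integral_cong)
          (simp_all add: smooth_compose_grad[OF \<phi>(1) F(2)] h_def algebra_simps)
      also have "\<dots> = bil a U G (\<lambda>x. h x *\<^sub>R (grad (\<phi> k) x - G x)) + bil a U G (\<lambda>x. h x *\<^sub>R G x) + bil a U G (\<lambda>x. F' (\<phi> k x) *\<^sub>R grad \<psi> x)"
      proof -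
        have 1: "fin_energy a U (\<lambda>x. h x *\<^sub>R (grad (\<phi> k) x - G x))" "fin_energy a U (\<lambda>x. h x *\<^sub>R G x)"
          "fin_energy a U (\<lambda>x. F' (\<phi> k x) *\<^sub>R grad \<psi> x)"
          by (rule fin_mult(1)[OF fin_diff[OF \<phi>(4) fG] hm hb] fin_mult(1)[OF fG hm hb]
              fin_mult(1)[OF f\<psi> m(1)[OF \<phi>(2)] ab(1)])+
        show ?thesis using bil_add_right[OF fG fin_add[OF 1(1,2)] 1(3)] bil_add_right[OF fG 1(1,2)] by simp
      qed
      finally have *: "bil a U G (\<lambda>x. h x *\<^sub>R (grad (\<phi> k) x - G x)) + bil a U G (\<lambda>x. h x *\<^sub>R G x) + bil a U G (\<lambda>x. F' (\<phi> k x) *\<^sub>R grad \<psi> x) \<le> 0" .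
      have "0 \<le> bil a U G (\<lambda>x. h x *\<^sub>R G x)" unfolding bil_def
        by (rule Bochner_Integration.integral_nonneg) (simp add: matrix_vector_mult_scaleR h0 a_psd)
      moreover have "\<bar>bil a U G (\<lambda>x. h x *\<^sub>R (grad (\<phi> k) x - G x))\<bar> \<le> sqrt (energy a U G) * ((B * D) * sqrt (energy a U (\<lambda>x. grad (\<phi> k) x - G x)))"
      proof -
        note f = fin_mult[OF fin_diff[OF \<phi>(4) fG] hm hb, of k]
        have "\<bar>bil a U G (\<lambda>x. h x *\<^sub>R (grad (\<phi> k) x - G x))\<bar> \<le> sqrt (energy a U G) * sqrt (energy a U (\<lambda>x. h x *\<^sub>R (grad (\<phi> k) x - G x)))"
          by (rule bil_Cauchy_Schwarz[OF fG f(1)])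
        also have "\<dots> \<le> sqrt (energy a U G) * sqrt ((B * D)\<^sup>2 * energy a U (\<lambda>x. grad (\<phi> k) x - G x))"
          using f(2) energy_nonneg by (intro mult_left_mono) auto
        also have "sqrt ((B * D)\<^sup>2 * energy a U (\<lambda>x. grad (\<phi> k) x - G x)) = (B * D) * sqrt (energy a U (\<lambda>x. grad (\<phi> k) x - G x))"
          using B D by (simp add: real_sqrt_mult)
        finally show ?thesis .
      qed
      ultimately show ?thesis using * by (simp add: mult_ac)
    qed
    have "(\<lambda>k. bil a U G (\<lambda>x. F' (\<phi> k x) *\<^sub>R grad \<psi> x)) \<longlonglongrightarrow> bil a U G (\<lambda>x. F' (u x) *\<^sub>R grad \<psi> x)"
    proof (rule bil_tendsto[OF _ _ fG])
      show "fin_energy a U (\<lambda>x. F' (\<phi> k x) *\<^sub>R grad \<psi> x)" for k by (rule fin_mult(1)[OF f\<psi> m(1)[OF \<phi>(2)] ab(1)])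
      show "fin_energy a U (\<lambda>x. F' (u x) *\<^sub>R grad \<psi> x)" by (rule fin_mult(1)[OF f\<psi> m(1)[OF L2_measurable[OF u2]] ab(1)])
      have "(\<lambda>k. energy a U (\<lambda>x. (F' (\<phi> k x) - F' (u x)) *\<^sub>R grad \<psi> x)) \<longlonglongrightarrow> 0"
      proof (rule energy_mult_tendsto[OF f\<psi> m(1)[OF \<phi>(2)] m(1)[OF L2_measurable[OF u2]] ab(1) ab(1)])
        show "AE x in lebesgue_on U. (\<lambda>k. F' (\<phi> k x)) \<longlonglongrightarrow> F' (u x)"
          using ae by eventually_elim (use F'(1) in \<open>auto intro: continuous_on_tendsto_compose\<close>)
      qed
      then show "(\<lambda>k. energy a U (\<lambda>x. F' (\<phi> k x) *\<^sub>R grad \<psi> x - F' (u x) *\<^sub>R grad \<psi> x)) \<longlonglongrightarrow> 0"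
        by (simp add: scaleR_left_diff_distrib)
    qed
    moreover have "(\<lambda>k. (B * D) * sqrt (energy a U (\<lambda>x. grad (\<phi> k) x - G x)) * sqrt (energy a U G)) \<longlonglongrightarrow> (B * D) * sqrt 0 * sqrt (energy a U G)"
      by (intro tendsto_intros en)
    ultimately have "bil a U G (\<lambda>x. F' (u x) *\<^sub>R grad \<psi> x) \<le> (B * D) * sqrt 0 * sqrt (energy a U G)"
      by (rule LIMSEQ_le) (use le in auto)
    moreover have "bil a U G (\<lambda>x. F' (u x) *\<^sub>R grad \<psi> x) = bil a U (grad \<psi>) (\<lambda>x. F' (u x) *\<^sub>R G x)"
      unfolding bil_def by (rule Bochner_Integration.integral_cong)
        (simp_all add: matrix_vector_mult_scaleR symmetric_form[OF a_sym, of _ "G _"])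
    ultimately show ?thesis by simp
  qed
  moreover have "has_H1a_grad a U (\<lambda>x. F (u x)) (\<lambda>x. F' (u x) *\<^sub>R G x)"
    by (rule approximates_compose(2)[OF ap uH sm(1) F(1) F'(1) ab(1)])
  ultimately show ?thesis unfolding subsol_def by blast
qed

text \<open>The start of the Caccioppoli argument, tested with eta w for a smooth w close to v. The
  cross term keeps w because the pairing estimate is available for smooth functions; the last term
  is the price and tends to zero as w approaches v in energy. The cutoff appears to the first power,
  since the cross term will be bounded by unweighted energies on a larger cube.\<close>

lemma subsol_energy_test:
  assumes v: "subsol a U v V" and w: "w \<in> smooth_up_to_boundary U" "\<And>x. x \<in> U \<Longrightarrow> 0 \<le> w x"
    and \<eta>: "\<eta> \<in> test_functions U" "\<And>x. 0 \<le> \<eta> x" "\<And>x. \<eta> x \<le> 1"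
  shows "bil a U V (\<lambda>x. \<eta> x *\<^sub>R V x) \<le> - bil a U V (\<lambda>x. w x *\<^sub>R grad \<eta> x) +
    sqrt (energy a U V) * sqrt (energy a U (\<lambda>x. grad w x - V x))"
proof -
  note vH = subsol_H1a[OF v]
  note fV = H1a_fin_energy[OF vH]
  note \<eta>s = test_smooth_up[OF \<eta>(1)]
  note f\<eta> = smooth_fin_energy[OF \<eta>s] and \<eta>m = smooth_measurable[OF \<eta>s]
  note fw = smooth_fin_energy[OF w(1)] and wm = smooth_measurable[OF w(1)]
  have \<eta>b: "\<bar>\<eta> x\<bar> \<le> 1" for x using \<eta>(2,3)[of x] by simp
  obtain C where C: "\<And>x. x \<in> U \<Longrightarrow> \<bar>w x\<bar> \<le> C" using smooth_up_to_boundary_bounded[OF w(1) U_bounded] by metis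
  note t = smooth_mult_test[OF \<eta>(1) w(1)]
  have f: "fin_energy a U (\<lambda>x. \<eta> x *\<^sub>R grad w x)" "fin_energy a U (\<lambda>x. w x *\<^sub>R grad \<eta> x)" "fin_energy a U (\<lambda>x. \<eta> x *\<^sub>R V x)"
    "fin_energy a U (\<lambda>x. \<eta> x *\<^sub>R (grad w x - V x))"
    "energy a U (\<lambda>x. \<eta> x *\<^sub>R (grad w x - V x)) \<le> 1\<^sup>2 * energy a U (\<lambda>x. grad w x - V x)"
    by (rule fin_mult[OF fw \<eta>m \<eta>b] fin_mult[OF fV \<eta>m \<eta>b] fin_mult[OF f\<eta> wm C] fin_mult[OF fin_diff[OF fw fV] \<eta>m \<eta>b]; assumption)+
  have "0 \<ge> bil a U (grad (\<lambda>x. if x \<in> U then \<eta> x * w x else 0)) V"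
    using v t(1) w(2) \<eta>(2) unfolding subsol_def by auto
  also have "bil a U (grad (\<lambda>x. if x \<in> U then \<eta> x * w x else 0)) V = bil a U V (\<lambda>x. \<eta> x *\<^sub>R grad w x + w x *\<^sub>R grad \<eta> x)"
    unfolding t(2) by (rule bil_sym)
  also have "\<dots> = bil a U V (\<lambda>x. \<eta> x *\<^sub>R grad w x) + bil a U V (\<lambda>x. w x *\<^sub>R grad \<eta> x)"
    by (rule bil_add_right[OF fV f(1,2)])
  finally have 1: "bil a U V (\<lambda>x. \<eta> x *\<^sub>R grad w x) + bil a U V (\<lambda>x. w x *\<^sub>R grad \<eta> x) \<le> 0" .
  have "bil a U V (\<lambda>x. \<eta> x *\<^sub>R (grad w x - V x)) = bil a U V (\<lambda>x. \<eta> x *\<^sub>R grad w x) - bil a U V (\<lambda>x. \<eta> x *\<^sub>R V x)"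
    using bil_diff_right[OF fV f(1,3)] by (simp add: scaleR_right_diff_distrib)
  moreover have "\<bar>bil a U V (\<lambda>x. \<eta> x *\<^sub>R (grad w x - V x))\<bar> \<le> sqrt (energy a U V) * sqrt (energy a U (\<lambda>x. grad w x - V x))"
    by (rule order_trans[OF bil_Cauchy_Schwarz[OF fV f(4)]])
      (use f(5) energy_nonneg in \<open>auto intro!: mult_left_mono\<close>)
  ultimately show ?thesis using 1 by linarith
qed

end

subsection \<open>The Dirichlet problem with smooth boundary data\<close>

text \<open>Replacing a smooth function by the solution with the same boundary values preserves the mean
  of its gradient and does not increase its energy, so bounds for solutions transfer to smooth functions.\<close>

lemma Fatou_real:
  fixes f :: "nat \<Rightarrow> 'a \<Rightarrow> real"
  assumes i: "\<And>j. integrable M (f j)" and [measurable]: "g \<in> borel_measurable M"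
    and lim: "AE x in M. (\<lambda>j. f j x) \<longlonglongrightarrow> g x"
    and nn: "\<And>j x. x \<in> space M \<Longrightarrow> 0 \<le> f j x"
    and le: "\<And>j. j \<ge> N \<Longrightarrow> integral\<^sup>L M (f j) \<le> c"
    and nng: "\<And>x. x \<in> space M \<Longrightarrow> 0 \<le> g x"
  shows "integrable M g" "integral\<^sup>L M g \<le> c"
proof -
  have c: "0 \<le> c" using le[of N] Bochner_Integration.integral_nonneg[of M "f N"] nn by fastforce
  have [measurable]: "\<And>j. f j \<in> borel_measurable M" using i by auto
  have "(\<integral>\<^sup>+x. ennreal (g x) \<partial>M) = (\<integral>\<^sup>+x. liminf (\<lambda>j. ennreal (f (j + N) x)) \<partial>M)"
  proof (rule nn_integral_cong_AE, use lim in eventually_elim)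
    case (elim x)
    then have "(\<lambda>j. ennreal (f (j + N) x)) \<longlonglongrightarrow> ennreal (g x)"
      by (intro tendsto_ennrealI LIMSEQ_ignore_initial_segment)
    then show ?case by (simp add: lim_imp_Liminf)
  qed
  also have "\<dots> \<le> liminf (\<lambda>j. \<integral>\<^sup>+x. ennreal (f (j + N) x) \<partial>M)" by (rule nn_integral_liminf) measurable
  also have "\<dots> \<le> liminf (\<lambda>j::nat. ennreal c)"
  proof (rule Liminf_mono, intro always_eventually allI)
    fix j
    have "(\<integral>\<^sup>+x. ennreal (f (j + N) x) \<partial>M) = ennreal (integral\<^sup>L M (f (j + N)))"
      by (rule nn_integral_eq_integral[OF i]) (use nn in auto)
    then show "(\<integral>\<^sup>+x. ennreal (f (j + N) x) \<partial>M) \<le> ennreal c" using le[of "j + N"] by (simp add: ennreal_leI)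
  qed
  also have "\<dots> = ennreal c" by (simp add: Liminf_const)
  finally have *: "(\<integral>\<^sup>+x. ennreal (g x) \<partial>M) \<le> ennreal c" .
  show gi: "integrable M g"
    by (rule integrableI_nonneg) (use * nng in \<open>auto simp: le_less_trans\<close>)
  have "ennreal (integral\<^sup>L M g) = (\<integral>\<^sup>+x. ennreal (g x) \<partial>M)"
    by (rule nn_integral_eq_integral[symmetric, OF gi]) (use nng in auto)
  then have "ennreal (integral\<^sup>L M g) \<le> ennreal c" using * by simp
  then show "integral\<^sup>L M g \<le> c" using c by (simp add: ennreal_le_iff)
qed

context coefficients
begin

text \<open>Integrate the i-th derivative of psi^2 x_i, whose integral is zero. As the energy
  controls gradients only in L1, the missing integrability is supplied by the uniform bound M; for
  this reason the minimising sequence below has to be truncated.\<close>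

lemma test_poincare:
  assumes \<psi>: "\<psi> \<in> test_functions U" and M: "\<And>x. x \<in> U \<Longrightarrow> \<bar>\<psi> x\<bar> \<le> M" and R: "\<And>x. x \<in> U \<Longrightarrow> norm x \<le> R"
    and MR: "0 \<le> M" "0 \<le> R"
  shows "(LINT x|lebesgue_on U. (\<psi> x)\<^sup>2) \<le> 2 * R * M * (LINT x|lebesgue_on U. norm (grad \<psi> x))"
proof -
  note sm = test_functions_smooth[OF \<psi>] and \<psi>s = test_smooth_up[OF \<psi>]
  fix i :: 'n
  let ?f = "\<lambda>x. \<psi> x * (\<psi> x * x $ i)"
  have t: "?f \<in> test_functions U"
    by (intro test_functions_mult \<psi> smooth_on_mult sm smooth_on_coord)
  have g: "grad ?f x $ i = (\<psi> x)\<^sup>2 + 2 * x $ i * \<psi> x * grad \<psi> x $ i" for x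
    unfolding smooth_grad_mult[OF sm smooth_on_mult[OF sm smooth_on_coord] UNIV_I]
      smooth_grad_mult[OF sm smooth_on_coord UNIV_I] grad_coord
    by (simp add: power2_eq_square algebra_simps)
  have i1: "integrable (lebesgue_on U) (\<lambda>x. (\<psi> x)\<^sup>2)" by (rule L2_integrable_square[OF smooth_L2[OF \<psi>s]])
  have gi: "integrable (lebesgue_on U) (grad \<psi>)" by (rule fin_integrable[OF smooth_fin_energy[OF \<psi>s]])
  have le: "\<bar>2 * x $ i * \<psi> x * grad \<psi> x $ i\<bar> \<le> 2 * R * M * norm (grad \<psi> x)" if "x \<in> U" for x
    unfolding abs_mult using order_trans[OF component_le_norm_cart R[OF that]] M[OF that] MR
    by (intro mult_mono component_le_norm_cart) auto
  have i2: "integrable (lebesgue_on U) (\<lambda>x. 2 * R * M * norm (grad \<psi> x))" using gi by auto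
  have coord: "(\<lambda>x. x $ i) \<in> borel_measurable (lebesgue_on U)"
    by (rule smooth_measurable[OF smooth_up_to_boundary_UNIV[OF smooth_on_coord]])
  have i3: "integrable (lebesgue_on U) (\<lambda>x. 2 * x $ i * \<psi> x * grad \<psi> x $ i)"
    by (rule Bochner_Integration.integrable_bound[OF i2])
      (use coord smooth_measurable[OF \<psi>s] borel_measurable_vec_nth[OF smooth_grad_measurable[OF \<psi>s]] le
        in \<open>auto intro!: AE_I2 order_trans[OF _ abs_ge_self]\<close>)
  have "0 = (LINT x|lebesgue_on U. grad ?f x $ i)" using integral_grad_zero_on[OF t U_sets] by simp
  also have "\<dots> = (LINT x|lebesgue_on U. (\<psi> x)\<^sup>2) + (LINT x|lebesgue_on U. 2 * x $ i * \<psi> x * grad \<psi> x $ i)"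
    unfolding g by (rule Bochner_Integration.integral_add[OF i1 i3])
  finally have "(LINT x|lebesgue_on U. (\<psi> x)\<^sup>2) \<le> \<bar>LINT x|lebesgue_on U. 2 * x $ i * \<psi> x * grad \<psi> x $ i\<bar>" by linarith
  also have "\<dots> \<le> (LINT x|lebesgue_on U. \<bar>2 * x $ i * \<psi> x * grad \<psi> x $ i\<bar>)" by (rule integral_abs_bound)
  also have "\<dots> \<le> (LINT x|lebesgue_on U. 2 * R * M * norm (grad \<psi> x))"
    by (rule integral_mono[OF integrable_abs[OF i3] i2]) (use le in auto)
  finally show ?thesis by simp
qed

text \<open>The competitor w + psi is truncated with \<open>strunc\<close>. Where psi vanishes it
  equals w, which lies in [-M, M] and is left unchanged, so the difference from w still has compact
  support. The energy does not grow because the derivative of \<open>strunc\<close> lies between 0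
  and 1.\<close>

lemma truncate_test:
  assumes w: "w \<in> smooth_up_to_boundary U" and M: "M \<ge> 0" "\<And>x. x \<in> U \<Longrightarrow> \<bar>w x\<bar> \<le> M"
    and \<psi>: "\<psi> \<in> test_functions U"
  obtains \<xi> where "\<xi> \<in> test_functions U" "\<And>x. x \<in> U \<Longrightarrow> \<bar>w x + \<xi> x\<bar> \<le> M + 1"
    "energy a U (\<lambda>x. grad w x + grad \<xi> x) \<le> energy a U (\<lambda>x. grad w x + grad \<psi> x)"
proof -
  obtain V where V: "open V" "U \<subseteq> V" "smooth_on V w" using smooth_up_to_boundaryE[OF w] by metis
  have wU: "smooth_on U w" using V smooth_on_subset by blast
  have \<psi>U: "smooth_on U \<psi>" using test_functions_smooth[OF \<psi>] smooth_on_subset by blast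
  let ?K = "closure {x. \<psi> x \<noteq> 0}"
  have K: "compact ?K" "?K \<subseteq> U" using \<psi> by (auto simp: test_functions_def)
  have z: "\<psi> y = 0" if "y \<notin> ?K" for y
    using that subsetD[OF closure_subset, of y "{x. \<psi> x \<noteq> 0}"] by auto
  define f where "f x = strunc M (w x + \<psi> x)" for x
  define \<xi> where "\<xi> x = (if x \<in> U then f x - w x else 0)" for x
  have fU: "smooth_on U f" unfolding f_def by (rule smooth_on_compose[OF Ck_strunc smooth_on_add[OF wU \<psi>U]])
  have \<xi>0: "\<xi> x = 0" if "x \<notin> ?K" for x
    using M(2)[of x] M(1) z[OF that] by (auto simp: \<xi>_def f_def strunc_bounds(1))
  have sub: "closure {x. \<xi> x \<noteq> 0} \<subseteq> ?K"
  proof (rule closure_minimal[OF subsetI closed_closure])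
    fix x assume "x \<in> {x. \<xi> x \<noteq> 0}" then show "x \<in> ?K" using \<xi>0 by blast
  qed
  have 1: "smooth_on U \<xi>" by (rule smooth_on_cong[OF smooth_on_diff[OF fU wU] U_open]) (simp add: \<xi>_def)
  have 2: "smooth_on (- ?K) \<xi>"
  proof (rule smooth_on_cong[OF smooth_on_const[of _ 0]])
    fix y assume "y \<in> - ?K" then show "\<xi> y = 0" by (intro \<xi>0) simp
  qed (rule open_Compl[OF closed_closure])
  have "smooth_on UNIV \<xi>"
  proof (rule smooth_on_local[OF open_UNIV])
    fix x show "\<exists>W. open W \<and> x \<in> W \<and> smooth_on W \<xi>"
    proof (cases "x \<in> U")
      case True then show ?thesis using 1 U_open by (intro exI[of _ U] conjI)
    next
      case False
      then have "x \<in> - ?K" using K(2) by blast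
      then show ?thesis using 2 by (intro exI[of _ "- ?K"] conjI open_Compl closed_closure)
    qed
  qed
  then have \<xi>: "\<xi> \<in> test_functions U" unfolding test_functions_def
    using compact_closed_subset[OF K(1) closed_closure sub] sub K(2) by auto
  have g: "grad w x + grad \<xi> x = strunc_deriv M (w x + \<psi> x) *\<^sub>R (grad w x + grad \<psi> x)" if x: "x \<in> U" for x
  proof -
    have "grad \<xi> x = grad (\<lambda>x. f x - w x) x" by (rule grad_cong_open[OF U_open x]) (simp add: \<xi>_def)
    also have "\<dots> = grad f x - grad w x" by (rule smooth_grad_diff[OF fU wU x])
    also have "grad f x = strunc_deriv M (w x + \<psi> x) *\<^sub>R grad (\<lambda>x. w x + \<psi> x) x"
      unfolding f_def by (rule smooth_grad_compose[where F="strunc M" and F'="strunc_deriv M" and f="\<lambda>x. w x + \<psi> x" and V=U])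
        (use strunc_DERIV smooth_on_add[OF wU \<psi>U] x in auto)
    also have "grad (\<lambda>x. w x + \<psi> x) x = grad w x + grad \<psi> x" by (rule smooth_grad_add[OF wU \<psi>U x])
    finally show ?thesis by simp
  qed
  have fin: "fin_energy a U (\<lambda>x. grad w x + grad \<psi> x)"
    by (rule fin_add[OF smooth_fin_energy[OF w] smooth_fin_energy[OF test_smooth_up[OF \<psi>]]])
  have m: "(\<lambda>x. strunc_deriv M (w x + \<psi> x)) \<in> borel_measurable (lebesgue_on U)"
  proof (rule measurable_compose[where f="\<lambda>x. w x + \<psi> x" and g="strunc_deriv M", OF _ borel_measurable_continuous_onI])
    show "(\<lambda>x. w x + \<psi> x) \<in> borel_measurable (lebesgue_on U)"
      using smooth_measurable w test_smooth_up[OF \<psi>] by auto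
    have "continuous_on UNIV (pexp [:1,1:])" using Ck_pexp[of 0] by simp
    then show "continuous_on UNIV (strunc_deriv M)" unfolding strunc_deriv_def[abs_def]
      by (intro continuous_intros) (auto intro!: continuous_on_compose2[of UNIV "pexp [:1,1:]"] continuous_intros)
  qed
  show thesis
  proof (rule that[OF \<xi>])
    show "\<bar>w x + \<xi> x\<bar> \<le> M + 1" if "x \<in> U" for x
      using that strunc_bounds(4)[OF M(1)] by (simp add: \<xi>_def f_def)
    have "energy a U (\<lambda>x. grad w x + grad \<xi> x) = energy a U (\<lambda>x. strunc_deriv M (w x + \<psi> x) *\<^sub>R (grad w x + grad \<psi> x))"
      unfolding bil_def by (rule Bochner_Integration.integral_cong) (simp_all add: g)
    also have "\<dots> \<le> 1\<^sup>2 * energy a U (\<lambda>x. grad w x + grad \<psi> x)"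
      by (rule fin_mult(2)[OF fin m]) (use strunc_bounds(2,3)[OF M(1)] in \<open>auto simp: abs_of_nonneg\<close>)
    finally show "energy a U (\<lambda>x. grad w x + grad \<xi> x) \<le> energy a U (\<lambda>x. grad w x + grad \<psi> x)" by simp
  qed
qed

definition sol :: "(real^'n \<Rightarrow> real) \<Rightarrow> (real^'n \<Rightarrow> real^'n) \<Rightarrow> bool" where
  "sol u G \<longleftrightarrow> has_H1a_grad a U u G \<and> (\<forall>\<psi>\<in>test_functions U. bil a U (grad \<psi>) G = 0)"

lemma test_grad_diff:
  assumes "\<psi> \<in> test_functions U" "\<xi> \<in> test_functions U"
  shows "grad (\<lambda>x. \<psi> x - \<xi> x) x = grad \<psi> x - grad \<xi> x"
  by (rule smooth_grad_diff[OF assms[THEN test_functions_smooth] UNIV_I])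

theorem dirichlet_problem:
  assumes w: "w \<in> smooth_up_to_boundary U"
  obtains u G where "sol u G" "\<And>i. (LINT x|lebesgue_on U. G x $ i) = (LINT x|lebesgue_on U. grad w x $ i)"
    "energy a U G \<le> energy a U (grad w)" "energy a U G = bil a U G (grad w)"
proof -
  obtain M where M: "M > 0" "\<And>x. x \<in> U \<Longrightarrow> \<bar>w x\<bar> \<le> M"
    using smooth_up_to_boundary_bounded[OF w U_bounded] by metis
  obtain R where R: "R > 0" "\<And>x. x \<in> U \<Longrightarrow> norm x \<le> R" using U_bounded bounded_pos by metis
  obtain K where K: "K \<ge> 0" "\<And>F. fin_energy a U F \<Longrightarrow> (LINT x|lebesgue_on U. norm (F x)) \<le> K * sqrt (energy a U F)"
    using energy_L1 by metis
  define J where "J \<psi> = energy a U (\<lambda>x. grad w x + grad \<psi> x)" for \<psi>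
  define I where "I = Inf (J ` test_functions U)"
  have fw: "fin_energy a U (grad w)" by (rule smooth_fin_energy[OF w])
  have ft: "fin_energy a U (grad \<psi>)" if "\<psi> \<in> test_functions U" for \<psi>
    by (rule smooth_fin_energy[OF test_smooth_up[OF that]])
  have fwt: "fin_energy a U (\<lambda>x. grad w x + grad \<psi> x)" if "\<psi> \<in> test_functions U" for \<psi>
    by (rule fin_add[OF fw ft[OF that]])
  have bdd: "bdd_below (J ` test_functions U)" by (rule bdd_belowI[of _ 0]) (auto simp: J_def energy_nonneg)
  have I_le: "I \<le> J \<psi>" if "\<psi> \<in> test_functions U" for \<psi> unfolding I_def by (rule cInf_lower[OF imageI[OF that] bdd])
  have "\<exists>\<psi>. \<psi> \<in> test_functions U \<and> (\<forall>x\<in>U. \<bar>w x + \<psi> x\<bar> \<le> M + 1) \<and> J \<psi> < I + 1 / real (Suc k)" for k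
  proof -
    have "\<exists>y\<in>J ` test_functions U. y < I + 1 / real (Suc k)"
      by (rule cInf_lessD) (use test_functions_zero in \<open>auto simp: I_def\<close>)
    then obtain \<psi> where \<psi>: "\<psi> \<in> test_functions U" "J \<psi> < I + 1 / real (Suc k)" by blast
    obtain \<xi> where "\<xi> \<in> test_functions U" "\<And>x. x \<in> U \<Longrightarrow> \<bar>w x + \<xi> x\<bar> \<le> M + 1" "J \<xi> \<le> J \<psi>"
      using truncate_test[OF w less_imp_le[OF M(1)] M(2) \<psi>(1)] unfolding J_def by blast
    then show ?thesis using \<psi>(2) by (intro exI[of _ \<xi>]) auto
  qed
  then obtain \<psi> where \<psi>: "\<And>k. \<psi> k \<in> test_functions U" "\<And>k x. x \<in> U \<Longrightarrow> \<bar>w x + \<psi> k x\<bar> \<le> M + 1"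
    "\<And>k. J (\<psi> k) < I + 1 / real (Suc k)" by metis
  have cauchy_E: "energy a U (\<lambda>x. grad (\<psi> i) x - grad (\<psi> j) x) \<le> 2 / real (Suc i) + 2 / real (Suc j)" for i j
  proof -
    \<comment> \<open>The midpoint of two almost minimisers is a competitor, so the parallelogram
      law bounds the energy of their difference.\<close>
    let ?m = "\<lambda>x. (1/2) * (\<psi> i x + \<psi> j x)"
    have m: "?m \<in> test_functions U" by (intro test_functions_cmult test_functions_add \<psi>)
    note s = test_functions_smooth[OF \<psi>(1)]
    have gm: "grad ?m x = (1/2) *\<^sub>R (grad (\<psi> i) x + grad (\<psi> j) x)" for x
      using smooth_grad_cmult[OF smooth_on_add[OF s s] UNIV_I] smooth_grad_add[OF s s UNIV_I] by metis
    have "4 * I \<le> 4 * J ?m" using I_le[OF m] by simp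
    also have "\<dots> = energy a U (\<lambda>x. 2 *\<^sub>R (grad w x + grad ?m x))" unfolding J_def energy_scaleR by simp
    also have "\<dots> = energy a U (\<lambda>x. (grad w x + grad (\<psi> i) x) + (grad w x + grad (\<psi> j) x))"
      unfolding gm by (simp add: algebra_simps scaleR_2)
    also have "\<dots> = 2 * J (\<psi> i) + 2 * J (\<psi> j) - energy a U (\<lambda>x. (grad w x + grad (\<psi> i) x) - (grad w x + grad (\<psi> j) x))"
      unfolding energy_add[OF fwt[OF \<psi>(1)] fwt[OF \<psi>(1)]] energy_diff[OF fwt[OF \<psi>(1)] fwt[OF \<psi>(1)]] J_def by simp
    finally show ?thesis using \<psi>(3)[of i] \<psi>(3)[of j] by simp
  qed
  define c where "c N = 2 / real (Suc N) + 2 / real (Suc N)" for N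
  have c0: "c \<longlonglongrightarrow> 0" unfolding c_def
    using tendsto_add[OF tendsto_mult_right_zero[OF LIMSEQ_inverse_real_of_nat, of 2] tendsto_mult_right_zero[OF LIMSEQ_inverse_real_of_nat, of 2]]
    by (simp add: divide_inverse)
  have c_E: "energy a U (\<lambda>x. grad (\<psi> i) x - grad (\<psi> j) x) \<le> c N" if "i \<ge> N" "j \<ge> N" for i j N
    unfolding c_def by (rule order_trans[OF cauchy_E]) (use that in \<open>intro add_mono divide_left_mono; simp\<close>)
  have c_L1: "(LINT x|lebesgue_on U. norm (grad (\<psi> i) x - grad (\<psi> j) x)) \<le> K * sqrt (c N)" if "i \<ge> N" "j \<ge> N" for i j N
    by (rule order_trans[OF K(2)[OF fin_diff[OF ft[OF \<psi>(1)] ft[OF \<psi>(1)]]]]) (use c_E[OF that] K in \<open>auto intro!: mult_left_mono\<close>)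
  define Q where "Q = 2 * R * (2 * M + 2) * K"
  have Q0: "Q \<ge> 0" unfolding Q_def using R M K by auto
  have c_L2: "(LINT x|lebesgue_on U. (\<psi> i x - \<psi> j x)\<^sup>2) \<le> Q * sqrt (c N)" if "i \<ge> N" "j \<ge> N" for i j N
  proof -
    have b: "\<bar>\<psi> i x - \<psi> j x\<bar> \<le> 2 * M + 2" if "x \<in> U" for x using \<psi>(2)[OF that, of i] \<psi>(2)[OF that, of j] by linarith
    have "(LINT x|lebesgue_on U. (\<psi> i x - \<psi> j x)\<^sup>2) \<le> 2 * R * (2 * M + 2) * (LINT x|lebesgue_on U. norm (grad (\<lambda>x. \<psi> i x - \<psi> j x) x))"
      by (rule test_poincare[OF test_functions_diff[OF \<psi>(1) \<psi>(1)] b R(2)]) (use M R in auto)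
    also have "\<dots> = 2 * R * (2 * M + 2) * (LINT x|lebesgue_on U. norm (grad (\<psi> i) x - grad (\<psi> j) x))"
      by (simp add: test_grad_diff[OF \<psi>(1) \<psi>(1)])
    also have "\<dots> \<le> 2 * R * (2 * M + 2) * (K * sqrt (c N))"
      using c_L1[OF that] R M by (intro mult_left_mono) auto
    finally show ?thesis by (simp add: Q_def mult_ac)
  qed
  define B where "B = sqrt (LINT x|lebesgue_on U. 1\<^sup>2)"
  have B0: "B \<ge> 0" by (simp add: B_def)
  note \<psi>L2 = smooth_L2[OF test_smooth_up[OF \<psi>(1)]]
  have c_L1': "(LINT x|lebesgue_on U. \<bar>\<psi> i x - \<psi> j x\<bar>) \<le> sqrt (Q * sqrt (c N)) * B" if "i \<ge> N" "j \<ge> N" for i j N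
  proof -
    have d: "(\<lambda>x. \<bar>\<psi> i x - \<psi> j x\<bar>) \<in> L2 U"
      by (rule L2_bound[OF L2_diff[OF \<psi>L2[of i] \<psi>L2[of j]]]) (use L2_measurable[OF \<psi>L2] in auto)
    have "(LINT x|lebesgue_on U. \<bar>\<psi> i x - \<psi> j x\<bar>) \<le> \<bar>LINT x|lebesgue_on U. \<bar>\<psi> i x - \<psi> j x\<bar> * 1\<bar>" by simp
    also have "\<dots> \<le> sqrt (LINT x|lebesgue_on U. \<bar>\<psi> i x - \<psi> j x\<bar>\<^sup>2) * B"
      unfolding B_def by (rule L2_Cauchy_Schwarz[OF d bounded_L2[where C=1]]) auto
    also have "\<dots> \<le> sqrt (Q * sqrt (c N)) * B" using c_L2[OF that] B0 by (intro mult_right_mono) auto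
    finally show ?thesis .
  qed
  \<comment> \<open>Functions and gradients are paired in order to extract one subsequence along
    which both converge a.e.\<close>
  define s where "s k x = (\<psi> k x, grad (\<psi> k) x)" for k x
  have s_int: "integrable (lebesgue_on U) (s k)" for k
  proof (rule Bochner_Integration.integrable_bound)
    show "integrable (lebesgue_on U) (\<lambda>x. \<bar>\<psi> k x\<bar> + norm (grad (\<psi> k) x))"
      using L2_integrable[OF \<psi>L2] fin_integrable[OF ft[OF \<psi>(1)]] by auto
    show "s k \<in> borel_measurable (lebesgue_on U)" unfolding s_def
      using L2_measurable[OF \<psi>L2] fin_measurable[OF ft[OF \<psi>(1)]] by (intro borel_measurable_Pair)
    show "AE x in lebesgue_on U. norm (s k x) \<le> norm (\<bar>\<psi> k x\<bar> + norm (grad (\<psi> k) x))"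
      using norm_Pair_le[of "\<psi> k _" "grad (\<psi> k) _"] by (intro AE_I2) (simp add: s_def)
  qed
  have s_C: "\<exists>N. \<forall>i\<ge>N. \<forall>j\<ge>N. (LINT x|lebesgue_on U. norm (s i x - s j x)) < e" if "e > 0" for e
  proof -
    have "(\<lambda>N. sqrt (Q * sqrt (c N)) * B + K * sqrt (c N)) \<longlonglongrightarrow> sqrt (Q * sqrt 0) * B + K * sqrt 0"
      by (intro tendsto_intros c0)
    then have "(\<lambda>N. sqrt (Q * sqrt (c N)) * B + K * sqrt (c N)) \<longlonglongrightarrow> 0" by simp
    from order_tendstoD(2)[OF this that] obtain N where N: "sqrt (Q * sqrt (c N)) * B + K * sqrt (c N) < e"
      by (auto simp: eventually_sequentially)
    have "(LINT x|lebesgue_on U. norm (s i x - s j x)) < e" if "i \<ge> N" "j \<ge> N" for i j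
    proof -
      have i1: "integrable (lebesgue_on U) (\<lambda>x. \<bar>\<psi> i x - \<psi> j x\<bar>)"
        by (intro integrable_abs L2_integrable L2_diff \<psi>L2)
      have i2: "integrable (lebesgue_on U) (\<lambda>x. norm (grad (\<psi> i) x - grad (\<psi> j) x))"
        by (intro integrable_norm fin_integrable fin_diff ft \<psi>(1))
      have "(LINT x|lebesgue_on U. norm (s i x - s j x)) \<le> (LINT x|lebesgue_on U. \<bar>\<psi> i x - \<psi> j x\<bar> + norm (grad (\<psi> i) x - grad (\<psi> j) x))"
      proof (rule integral_mono)
        show "integrable (lebesgue_on U) (\<lambda>x. norm (s i x - s j x))" using s_int by auto
        show "norm (s i x - s j x) \<le> \<bar>\<psi> i x - \<psi> j x\<bar> + norm (grad (\<psi> i) x - grad (\<psi> j) x)" for x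
          using norm_Pair_le[of "\<psi> i x - \<psi> j x" "grad (\<psi> i) x - grad (\<psi> j) x"] by (simp add: s_def)
      qed (use i1 i2 in auto)
      also have "\<dots> \<le> sqrt (Q * sqrt (c N)) * B + K * sqrt (c N)"
        using c_L1'[OF that] c_L1[OF that] i1 i2 by simp
      finally show ?thesis using N by simp
    qed
    then show ?thesis by blast
  qed
  obtain r where r: "strict_mono r" "AE x in lebesgue_on U. Cauchy (\<lambda>i. s (r i) x)"
    by (rule cauchy_L1_AE_cauchy_subseq[OF s_int s_C])
  define p where "p x = lim (\<lambda>i. \<psi> (r i) x)" for x
  define D where "D x = lim (\<lambda>i. grad (\<psi> (r i)) x)" for x
  have lims: "AE x in lebesgue_on U. (\<lambda>i. \<psi> (r i) x) \<longlonglongrightarrow> p x \<and> (\<lambda>i. grad (\<psi> (r i)) x) \<longlonglongrightarrow> D x"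
    using r(2)
  proof eventually_elim
    case (elim x)
    then have "convergent (\<lambda>i. s (r i) x)" by (rule Cauchy_convergent)
    then obtain L where "(\<lambda>i. s (r i) x) \<longlonglongrightarrow> L" by (auto simp: convergent_def)
    from tendsto_fst[OF this] tendsto_snd[OF this] show ?case
      by (auto simp: s_def p_def D_def convergent_LIMSEQ_iff[symmetric] convergent_def)
  qed
  have rge: "r k \<ge> k" for k using seq_suble[OF r(1)] .
  have pm: "p \<in> borel_measurable (lebesgue_on U)" unfolding p_def
    by (rule borel_measurable_lim_metric) (rule L2_measurable[OF \<psi>L2])
  have Dm: "D \<in> borel_measurable (lebesgue_on U)" unfolding D_def
    by (rule borel_measurable_lim_metric) (rule fin_measurable[OF ft[OF \<psi>(1)]])
  \<comment> \<open>The energy seminorm is not known to be complete at this point; Fatou along the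
    a.e. convergent subsequence turns the Cauchy bound into a bound for the distance to the
    pointwise limit D.\<close>
  have En: "fin_energy a U (\<lambda>x. grad (\<psi> (r k)) x - D x) \<and> energy a U (\<lambda>x. grad (\<psi> (r k)) x - D x) \<le> c k" for k
  proof -
    let ?f = "\<lambda>j x. (grad (\<psi> (r k)) x - grad (\<psi> (r j)) x) \<bullet> (a x *v (grad (\<psi> (r k)) x - grad (\<psi> (r j)) x))"
    let ?g = "\<lambda>x. (grad (\<psi> (r k)) x - D x) \<bullet> (a x *v (grad (\<psi> (r k)) x - D x))"
    have m: "(\<lambda>x. grad (\<psi> (r k)) x - D x) \<in> borel_measurable (lebesgue_on U)"
      using Dm fin_measurable[OF ft[OF \<psi>(1)]] by auto
    have i: "integrable (lebesgue_on U) (?f j)" for j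
      using fin_diff[OF ft[OF \<psi>(1)] ft[OF \<psi>(1)]] by (auto simp: fin_energy_def)
    have l: "AE x in lebesgue_on U. (\<lambda>j. ?f j x) \<longlonglongrightarrow> ?g x"
      using lims
    proof eventually_elim
      case (elim x)
      have "continuous_on UNIV ((*v) (a x))" by (rule linear_continuous_on[OF matrix_vector_mul_bounded_linear])
      then show ?case using elim
        by (intro tendsto_inner continuous_on_tendsto_compose[of UNIV "(*v) (a x)"] tendsto_diff tendsto_const) auto
    qed
    have le: "integral\<^sup>L (lebesgue_on U) (?f j) \<le> c k" if "j \<ge> k" for j
      using c_E[OF rge[of k] order_trans[OF that rge[of j]]] by (simp add: bil_def)
    have "integrable (lebesgue_on U) ?g" "integral\<^sup>L (lebesgue_on U) ?g \<le> c k"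
      by (rule Fatou_real[OF i form_measurable[OF m m] l _ le]; simp add: a_psd)+
    then show ?thesis using m by (simp add: fin_energy_def bil_def)
  qed
  have fD: "fin_energy a U D"
    using fin_diff[OF ft[OF \<psi>(1)[of "r 0"]] conjunct1[OF En[of 0]]] by simp
  have p2: "integrable (lebesgue_on U) (\<lambda>x. (\<psi> (r k) x - p x)\<^sup>2) \<and> (LINT x|lebesgue_on U. (\<psi> (r k) x - p x)\<^sup>2) \<le> Q * sqrt (c k)" for k
  proof -
    have i: "integrable (lebesgue_on U) (\<lambda>x. (\<psi> (r k) x - \<psi> (r j) x)\<^sup>2)" for j
      by (intro L2_integrable_square L2_diff \<psi>L2)
    have l: "AE x in lebesgue_on U. (\<lambda>j. (\<psi> (r k) x - \<psi> (r j) x)\<^sup>2) \<longlonglongrightarrow> (\<psi> (r k) x - p x)\<^sup>2"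
      using lims by eventually_elim (auto intro!: tendsto_intros)
    have m: "(\<lambda>x. (\<psi> (r k) x - p x)\<^sup>2) \<in> borel_measurable (lebesgue_on U)" using pm L2_measurable[OF \<psi>L2] by auto
    have le: "(LINT x|lebesgue_on U. (\<psi> (r k) x - \<psi> (r j) x)\<^sup>2) \<le> Q * sqrt (c k)" if "j \<ge> k" for j
      using c_L2[OF rge[of k] order_trans[OF that rge[of j]]] .
    show ?thesis using Fatou_real[OF i m l _ le] by simp
  qed
  have "(\<lambda>x. \<psi> (r 0) x - p x) \<in> L2 U" using p2[of 0] pm L2_measurable[OF \<psi>L2] by (auto simp: L2_def)
  from L2_diff[OF \<psi>L2[of "r 0"] this] have pL2: "p \<in> L2 U" by simp
  define u where "u x = w x + p x" for x
  define G where "G x = grad w x + D x" for x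
  define \<phi> where "\<phi> k x = w x + \<psi> (r k) x" for k x
  have \<phi>s: "\<phi> k \<in> smooth_up_to_boundary U" for k
    unfolding \<phi>_def by (rule smooth_up_to_boundary_add[OF w test_smooth_up[OF \<psi>(1)]])
  have g\<phi>: "grad (\<phi> k) x = grad w x + grad (\<psi> (r k)) x" if "x \<in> U" for k x
  proof -
    obtain V where V: "open V" "U \<subseteq> V" "smooth_on V w" using smooth_up_to_boundaryE[OF w] by metis
    show ?thesis unfolding \<phi>_def
      using smooth_grad_add[OF V(3) smooth_on_subset[OF test_functions_smooth[OF \<psi>(1)]]] V(2) that by blast
  qed
  have fG: "fin_energy a U G" unfolding G_def by (rule fin_add[OF fw fD])
  have uL2: "u \<in> L2 U" unfolding u_def by (rule L2_add[OF smooth_L2[OF w] pL2])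
  have E0: "(\<lambda>k. energy a U (\<lambda>x. grad (\<psi> (r k)) x - D x)) \<longlonglongrightarrow> 0"
    by (rule tendsto_sandwich[OF _ _ tendsto_const c0]) (use En energy_nonneg in auto)
  have H: "has_H1a_grad a U u G"
  proof -
    have "(\<lambda>k. LINT x|lebesgue_on U. (\<phi> k x - u x)\<^sup>2) \<longlonglongrightarrow> 0"
    proof (rule tendsto_sandwich[OF _ _ tendsto_const])
      show "\<forall>\<^sub>F k in sequentially. (LINT x|lebesgue_on U. (\<phi> k x - u x)\<^sup>2) \<le> Q * sqrt (c k)"
        using p2 by (simp add: \<phi>_def u_def)
      have "(\<lambda>k. Q * sqrt (c k)) \<longlonglongrightarrow> Q * sqrt 0" by (intro tendsto_intros c0)
      then show "(\<lambda>k. Q * sqrt (c k)) \<longlonglongrightarrow> 0" by simp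
    qed simp
    moreover have "energy a U (\<lambda>x. grad (\<phi> k) x - G x) = energy a U (\<lambda>x. grad (\<psi> (r k)) x - D x)" for k
      unfolding bil_def by (rule Bochner_Integration.integral_cong) (simp_all add: g\<phi> G_def)
    ultimately show ?thesis using \<phi>s uL2 fG E0 unfolding has_H1a_grad_def fin_energy_def bil_def
      by (auto intro!: exI[of _ \<phi>])
  qed
  have conv: "(\<lambda>k. energy a U (\<lambda>x. (grad w x + grad (\<psi> (r k)) x) - G x)) \<longlonglongrightarrow> 0"
    using E0 by (simp add: G_def)
  have "(\<lambda>k. J (\<psi> (r k))) \<longlonglongrightarrow> energy a U G"
    unfolding J_def by (rule energy_tendsto[OF fwt[OF \<psi>(1)] fG conv])
  moreover have "(\<lambda>k. J (\<psi> (r k))) \<longlonglongrightarrow> I"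
  proof (rule tendsto_sandwich[OF _ _ tendsto_const])
    show "\<forall>\<^sub>F k in sequentially. I \<le> J (\<psi> (r k))" using I_le[OF \<psi>(1)] by simp
    have "J (\<psi> (r k)) \<le> I + 1 / real (Suc k)" for k
    proof -
      have "1 / real (Suc (r k)) \<le> 1 / real (Suc k)" using rge[of k] by (intro divide_left_mono) auto
      then show ?thesis using \<psi>(3)[of "r k"] by linarith
    qed
    then show "\<forall>\<^sub>F k in sequentially. J (\<psi> (r k)) \<le> I + 1 / real (Suc k)" by simp
    show "(\<lambda>k. I + 1 / real (Suc k)) \<longlonglongrightarrow> I"
      using tendsto_add[OF tendsto_const[of I] LIMSEQ_inverse_real_of_nat] by (simp add: inverse_eq_divide)
  qed
  ultimately have EI: "energy a U G = I" by (rule LIMSEQ_unique)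
  have orth: "bil a U (grad \<xi>) G = 0" if \<xi>: "\<xi> \<in> test_functions U" for \<xi>
  proof -
    \<comment> \<open>First variation: by minimality this quadratic polynomial in t is nonnegative,
      and as its constant term is 0, \<open>discriminant_le\<close> forces the linear coefficient to
      vanish.\<close>
    have "0 \<le> 0 + 2 * t * bil a U G (grad \<xi>) + t\<^sup>2 * energy a U (grad \<xi>)" for t
    proof -
      have tx: "(\<lambda>x. \<psi> (r k) x + t * \<xi> x) \<in> test_functions U" for k
        by (intro test_functions_add test_functions_cmult \<psi>(1) \<xi>)
      have "grad (\<lambda>x. \<psi> (r k) x + t * \<xi> x) x = grad (\<psi> (r k)) x + t *\<^sub>R grad \<xi> x" for k x
        using smooth_grad_add[OF test_functions_smooth[OF \<psi>(1)] smooth_on_cmult[OF test_functions_smooth[OF \<xi>]] UNIV_I]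
          smooth_grad_cmult[OF test_functions_smooth[OF \<xi>] UNIV_I] by metis
      then have ge: "I \<le> energy a U (\<lambda>x. (grad w x + grad (\<psi> (r k)) x) + t *\<^sub>R grad \<xi> x)" for k
        using I_le[OF tx, of k] by (simp add: J_def add.assoc)
      have "(\<lambda>k. energy a U (\<lambda>x. (grad w x + grad (\<psi> (r k)) x) + t *\<^sub>R grad \<xi> x)) \<longlonglongrightarrow> energy a U (\<lambda>x. G x + t *\<^sub>R grad \<xi> x)"
        by (rule energy_tendsto) (use conv in \<open>auto intro!: fin_add fin_scaleR fw ft \<psi>(1) \<xi> fG\<close>)
      then have "I \<le> energy a U (\<lambda>x. G x + t *\<^sub>R grad \<xi> x)"
        by (rule LIMSEQ_le_const) (use ge in blast)
      also have "\<dots> = energy a U G + 2 * (t * bil a U G (grad \<xi>)) + t\<^sup>2 * energy a U (grad \<xi>)"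
        by (subst energy_add[OF fG fin_scaleR[OF ft[OF \<xi>]]])
          (simp only: energy_scaleR, simp add: bil_scaleR_right)
      finally show ?thesis using EI by simp
    qed
    from discriminant_le[OF this energy_nonneg] show ?thesis by (simp add: bil_sym)
  qed
  have mean: "(LINT x|lebesgue_on U. G x $ i) = (LINT x|lebesgue_on U. grad w x $ i)" for i
  proof -
    have nth: "integrable (lebesgue_on U) (\<lambda>x. F x $ i)" if "fin_energy a U F" for F
      using integrable_bounded_linear[OF bounded_linear_vec_nth fin_integrable[OF that]] .
    \<comment> \<open>D is an energy limit of gradients of test functions, whose integrals vanish;
      \<open>energy_L1\<close> carries this over to D.\<close>
    have "\<bar>LINT x|lebesgue_on U. D x $ i\<bar> \<le> K * sqrt (c k)" for k
    proof -
      note f = conjunct1[OF En[of k]]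
      have "(LINT x|lebesgue_on U. D x $ i) = - (LINT x|lebesgue_on U. (grad (\<psi> (r k)) x - D x) $ i)"
        using integral_grad_zero_on[OF \<psi>(1)[of "r k"] U_sets, of i] nth[OF fD] nth[OF ft[OF \<psi>(1)]] by simp
      then have "\<bar>LINT x|lebesgue_on U. D x $ i\<bar> \<le> (LINT x|lebesgue_on U. \<bar>(grad (\<psi> (r k)) x - D x) $ i\<bar>)"
        using integral_abs_bound[of "lebesgue_on U" "\<lambda>x. (grad (\<psi> (r k)) x - D x) $ i"] by simp
      also have "\<dots> \<le> (LINT x|lebesgue_on U. norm (grad (\<psi> (r k)) x - D x))"
        by (rule integral_mono[OF integrable_abs[OF nth[OF f]] integrable_norm[OF fin_integrable[OF f]] component_le_norm_cart])
      also have "\<dots> \<le> K * sqrt (c k)"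
        by (rule order_trans[OF K(2)[OF f]]) (use En K in \<open>auto intro!: mult_left_mono\<close>)
      finally show ?thesis .
    qed
    moreover have "(\<lambda>k. K * sqrt (c k)) \<longlonglongrightarrow> K * sqrt 0" by (intro tendsto_intros c0)
    ultimately have "\<bar>LINT x|lebesgue_on U. D x $ i\<bar> \<le> K * sqrt 0" by (intro LIMSEQ_le_const) auto
    then show ?thesis unfolding G_def using nth[OF fw] nth[OF fD] by simp
  qed
  have "(\<lambda>k. bil a U G (grad (\<psi> (r k)))) \<longlonglongrightarrow> bil a U G D"
    by (rule bil_tendsto[OF ft[OF \<psi>(1)] fD fG E0])
  moreover have "bil a U G (grad (\<psi> (r k))) = 0" for k using orth[OF \<psi>(1)] by (simp add: bil_sym)
  ultimately have "bil a U G D = 0" by (simp add: LIMSEQ_const_iff)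
  then have "energy a U G = bil a U G (grad w)"
    using bil_add_right[OF fG fw fD] by (simp add: G_def[abs_def, symmetric])
  moreover have "energy a U G \<le> energy a U (grad w)"
    using I_le[OF test_functions_zero] by (simp add: EI J_def)
  ultimately show thesis using that[of u G] H orth mean by (simp add: sol_def)
qed

end

subsection \<open>Quadratic forms from the parallelogram law\<close>

lemma symmetric_matrix_eqI:
  fixes A B :: "real^'n^'n"
  assumes "transpose A = A" "transpose B = B" "\<And>q. q \<bullet> (A *v q) = q \<bullet> (B *v q)"
  shows "A = B"
proof -
  have pol: "4 * (x \<bullet> (M *v y)) = (x + y) \<bullet> (M *v (x + y)) - (x - y) \<bullet> (M *v (x - y))"
    if "transpose M = M" for M :: "real^'n^'n" and x y
    using symmetric_form[OF that, of y x]
    by (simp add: matrix_vector_right_distrib matrix_vector_mult_diff_distrib inner_add_left inner_add_right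
        inner_diff_left inner_diff_right)
  have "x \<bullet> (A *v y) = x \<bullet> (B *v y)" for x y
    using pol[OF assms(1), of x y] pol[OF assms(2), of x y] assms(3) by simp
  then have "A *v y = B *v y" for y by (metis vector_eq_ldot)
  then show ?thesis by (simp add: matrix_eq)
qed

text \<open>Cauchy's functional equation for locally bounded g: as g vanishes at the integers, m
  g(t) is the value of g at the fractional part of m t, hence bounded in m.\<close>

lemma additive_bounded_real_zero:
  fixes g :: "real \<Rightarrow> real"
  assumes add: "\<And>s t. g (s + t) = g s + g t" and B: "\<And>t. \<bar>t\<bar> \<le> 1 \<Longrightarrow> \<bar>g t\<bar> \<le> B" and 1: "g 1 = 0"
  shows "g t = 0"
proof -
  have g0: "g 0 = 0" using add[of 0 0] by simp
  have n: "g (real m * t) = real m * g t" for m t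
    by (induction m) (simp_all add: g0 add distrib_right)
  have neg: "g (- t) = - g t" for t using add[of t "-t"] g0 by simp
  have int: "g (of_int k) = 0" for k
    by (cases k rule: int_cases2) (use n[of _ 1] neg 1 in auto)
  have le: "real m * \<bar>g t\<bar> \<le> B" for m
  proof -
    have "g (real m * t) = g (of_int \<lfloor>real m * t\<rfloor>) + g (frac (real m * t))"
      unfolding add[symmetric] by (simp add: frac_def)
    then have "real m * g t = g (frac (real m * t))" using int n by simp
    moreover have "\<bar>g (frac (real m * t))\<bar> \<le> B"
      by (rule B) (use frac_ge_0[of "real m * t"] frac_lt_1[of "real m * t"] in simp)
    ultimately show ?thesis by (metis abs_mult abs_of_nat)
  qed
  show ?thesis
  proof (rule ccontr)
    assume "g t \<noteq> 0"
    then obtain m where "B < real m * \<bar>g t\<bar>" using reals_Archimedean3[of "\<bar>g t\<bar>"] by auto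
    then show False using le[of m] by simp
  qed
qed

text \<open>The Jordan-von Neumann argument: polarisation gives a biadditive form. The quadratic
  upper bound takes the place of continuity in proving homogeneity.\<close>

lemma parallelogram_quadratic_form:
  fixes F :: "real^'n \<Rightarrow> real"
  assumes par: "\<And>q r. F (q + r) + F (q - r) = 2 * F q + 2 * F r"
    and nn: "\<And>q. 0 \<le> F q" and bd: "\<And>q. F q \<le> c * (norm q)\<^sup>2"
  obtains M where "transpose M = M" "\<And>q. F q = q \<bullet> (M *v q)"
proof -
  define b where "b x y = (F (x + y) - F (x - y)) / 4" for x y
  have F0: "F 0 = 0" using par[of 0 0] by simp
  have even: "F (- y) = F y" for y using par[of 0 y] F0 by simp
  have sym: "b x y = b y x" for x y using even[of "x - y"] by (simp add: b_def add.commute)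
  have bF: "b x x = F x" for x using par[of x x] F0 by (simp add: b_def)
  have b0: "b 0 y = 0" for y by (simp add: b_def even)
  have b1: "b (x + x') y + b (x - x') y = 2 * b x y" for x x' y
  proof -
    have "x + y + x' = x + x' + y" "x + y - x' = x - x' + y" "x - y + x' = x + x' - y" "x - y - x' = x - x' - y"
      by (simp_all add: algebra_simps)
    then show ?thesis using par[of "x + y" x'] par[of "x - y" x'] by (simp add: b_def field_simps)
  qed
  have badd: "b (s + d) y = b s y + b d y" for s d y
  proof -
    have "b ((1/2) *\<^sub>R (s + d) + (1/2) *\<^sub>R (s - d)) y + b ((1/2) *\<^sub>R (s + d) - (1/2) *\<^sub>R (s - d)) y = 2 * b ((1/2) *\<^sub>R (s + d)) y"
      by (rule b1)
    moreover have "(1/2) *\<^sub>R (s + d) + (1/2) *\<^sub>R (s - d) = s" "(1/2) *\<^sub>R (s + d) - (1/2) *\<^sub>R (s - d) = d"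
      by (simp_all add: vec_eq_iff field_simps)
    moreover have "b ((1/2) *\<^sub>R (s + d) + (1/2) *\<^sub>R (s + d)) y + b 0 y = 2 * b ((1/2) *\<^sub>R (s + d)) y"
      using b1[of "(1/2) *\<^sub>R (s + d)" "(1/2) *\<^sub>R (s + d)" y] by simp
    moreover have "(1/2) *\<^sub>R (s + d) + (1/2) *\<^sub>R (s + d) = s + d" by (simp add: vec_eq_iff)
    ultimately show ?thesis using b0 by simp
  qed
  have c: "0 \<le> c" using nn[of "axis undefined 1"] bd[of "axis undefined 1"] by simp
  have bbd: "\<bar>b x y\<bar> \<le> c * (norm x + norm y)\<^sup>2" for x y
  proof -
    have "F (x + y) \<le> c * (norm x + norm y)\<^sup>2" "F (x - y) \<le> c * (norm x + norm y)\<^sup>2"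
      using order_trans[OF bd mult_left_mono[OF power_mono[OF norm_triangle_ineq norm_ge_zero] c]]
        order_trans[OF bd mult_left_mono[OF power_mono[OF norm_triangle_ineq4 norm_ge_zero] c]] by auto
    then show ?thesis using nn[of "x + y"] nn[of "x - y"] by (simp add: b_def)
  qed
  have bscale: "b (t *\<^sub>R x) y = t * b x y" for t x y
  proof -
    define g where "g t = b (t *\<^sub>R x) y - t * b x y" for t
    have "g t = 0"
    proof (rule additive_bounded_real_zero[where g=g])
      show "g (s + t) = g s + g t" for s t by (simp add: g_def scaleR_add_left badd distrib_right)
      show "g 1 = 0" by (simp add: g_def)
      fix t :: real assume t: "\<bar>t\<bar> \<le> 1"
      have "\<bar>b (t *\<^sub>R x) y\<bar> \<le> c * (norm x + norm y)\<^sup>2"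
        by (rule order_trans[OF bbd mult_left_mono[OF power_mono c]])
          (use t in \<open>auto simp: mult_left_le_one_le\<close>)
      moreover have "\<bar>t * b x y\<bar> \<le> 1 * \<bar>b x y\<bar>" unfolding abs_mult using t by (intro mult_right_mono) auto
      ultimately show "\<bar>g t\<bar> \<le> c * (norm x + norm y)\<^sup>2 + \<bar>b x y\<bar>" unfolding g_def by linarith
    qed
    then show ?thesis by (simp add: g_def)
  qed
  have lin: "linear (\<lambda>x. b x y)" for y by (rule linearI) (simp_all add: badd bscale)
  define v where "v y = adjoint (\<lambda>x. b x y) 1" for y
  have v: "x \<bullet> v y = b x y" for x y using adjoint_works[OF lin, of x y 1] by (simp add: v_def)
  have "linear v"
  proof (rule linearI)
    show "v (x + y) = v x + v y" for x y
      by (subst vector_eq_ldot[symmetric]) (simp add: v inner_add_right sym[of _ "x + y"] sym[of _ x] sym[of _ y] badd)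
    show "v (t *\<^sub>R y) = t *\<^sub>R v y" for t y
      by (subst vector_eq_ldot[symmetric]) (simp add: v sym[of _ "t *\<^sub>R y"] sym[of _ y] bscale)
  qed
  then have M: "matrix v *v y = v y" for y by (simp add: matrix_works)
  have nth: "A $ i $ j = axis i 1 \<bullet> (A *v axis j 1)" for A :: "real^'n^'n" and i j
    by (simp add: inner_axis' matrix_vector_mult_basis column_def)
  show thesis
  proof (rule that)
    show "transpose (matrix v) = matrix v"
    proof (simp only: vec_eq_iff, safe)
      fix i j
      have "matrix v $ j $ i = matrix v $ i $ j" unfolding nth M v by (rule sym)
      then show "transpose (matrix v) $ i $ j = matrix v $ i $ j" by (simp add: transpose_def)
    qed
    show "F q = q \<bullet> (matrix v *v q)" for q by (simp add: M v bF)
  qed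
qed

subsection \<open>Coarse-grained bounds\<close>

context coefficients
begin

lemma H1a_add:
  assumes "has_H1a_grad a U u G" "has_H1a_grad a U v H"
  shows "has_H1a_grad a U (\<lambda>x. u x + v x) (\<lambda>x. G x + H x)"
proof -
  obtain \<phi> \<psi> where ap: "approximates \<phi> u G" "approximates \<psi> v H" using H1a_approximates assms by metis
  note \<phi> = approximates_smooth[OF ap(1)] and \<psi> = approximates_smooth[OF ap(2)]
  note f = assms[THEN H1a_fin_energy] and l = assms[THEN H1a_L2]
  have g: "grad (\<lambda>x. \<phi> k x + \<psi> k x) x = grad (\<phi> k) x + grad (\<psi> k) x" if "x \<in> U" for k x
  proof -
    obtain V W where "U \<subseteq> V" "smooth_on V (\<phi> k)" "U \<subseteq> W" "smooth_on W (\<psi> k)"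
      using smooth_up_to_boundaryE[OF \<phi>(1)] smooth_up_to_boundaryE[OF \<psi>(1)] by metis
    then show ?thesis using smooth_grad_add smooth_on_subset that by blast
  qed
  have "(\<lambda>k. energy a U (\<lambda>x. grad (\<lambda>x. \<phi> k x + \<psi> k x) x - (G x + H x))) \<longlonglongrightarrow> 0"
  proof (rule tendsto_sandwich[OF _ _ tendsto_const])
    show "\<forall>\<^sub>F k in sequentially. energy a U (\<lambda>x. grad (\<lambda>x. \<phi> k x + \<psi> k x) x - (G x + H x)) \<le>
      2 * energy a U (\<lambda>x. grad (\<phi> k) x - G x) + 2 * energy a U (\<lambda>x. grad (\<psi> k) x - H x)"
    proof (intro always_eventually allI)
      fix k
      have "energy a U (\<lambda>x. grad (\<lambda>x. \<phi> k x + \<psi> k x) x - (G x + H x)) = energy a U (\<lambda>x. (grad (\<phi> k) x - G x) + (grad (\<psi> k) x - H x))"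
        unfolding bil_def by (rule Bochner_Integration.integral_cong) (simp_all add: g algebra_simps)
      then show "energy a U (\<lambda>x. grad (\<lambda>x. \<phi> k x + \<psi> k x) x - (G x + H x)) \<le>
        2 * energy a U (\<lambda>x. grad (\<phi> k) x - G x) + 2 * energy a U (\<lambda>x. grad (\<psi> k) x - H x)"
        using energy_add_le[OF fin_diff[OF \<phi>(4) f(1)] fin_diff[OF \<psi>(4) f(2)]] by simp
    qed
    have "(\<lambda>k. 2 * energy a U (\<lambda>x. grad (\<phi> k) x - G x) + 2 * energy a U (\<lambda>x. grad (\<psi> k) x - H x)) \<longlonglongrightarrow> 2 * 0 + 2 * 0"
      by (intro tendsto_intros) (use ap in \<open>auto simp: approximates_def\<close>)
    then show "(\<lambda>k. 2 * energy a U (\<lambda>x. grad (\<phi> k) x - G x) + 2 * energy a U (\<lambda>x. grad (\<psi> k) x - H x)) \<longlonglongrightarrow> 0" by simp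
  qed (simp add: energy_nonneg)
  moreover have "(\<lambda>k. LINT x|lebesgue_on U. (\<phi> k x + \<psi> k x - (u x + v x))\<^sup>2) \<longlonglongrightarrow> 0"
  proof (rule tendsto_sandwich[OF _ _ tendsto_const])
    show "\<forall>\<^sub>F k in sequentially. (LINT x|lebesgue_on U. (\<phi> k x + \<psi> k x - (u x + v x))\<^sup>2) \<le>
      2 * (LINT x|lebesgue_on U. (\<phi> k x - u x)\<^sup>2) + 2 * (LINT x|lebesgue_on U. (\<psi> k x - v x)\<^sup>2)"
    proof (intro always_eventually allI)
      fix k
      note d = L2_diff[OF \<phi>(3) l(1), of k] L2_diff[OF \<psi>(3) l(2), of k]
      have "(LINT x|lebesgue_on U. (\<phi> k x + \<psi> k x - (u x + v x))\<^sup>2) = (LINT x|lebesgue_on U. ((\<phi> k x - u x) + (\<psi> k x - v x))\<^sup>2)"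
        by (simp add: algebra_simps)
      also have "\<dots> \<le> (LINT x|lebesgue_on U. 2 * (\<phi> k x - u x)\<^sup>2 + 2 * (\<psi> k x - v x)\<^sup>2)"
      proof (rule integral_mono)
        show "((\<phi> k x - u x) + (\<psi> k x - v x))\<^sup>2 \<le> 2 * (\<phi> k x - u x)\<^sup>2 + 2 * (\<psi> k x - v x)\<^sup>2" for x
          using sum_squares_bound[of "\<phi> k x - u x" "\<psi> k x - v x"] by (simp only: power2_sum)
      qed (use d[THEN L2_integrable_square] L2_integrable_square[OF L2_add[OF d]] in auto)
      also have "\<dots> = 2 * (LINT x|lebesgue_on U. (\<phi> k x - u x)\<^sup>2) + 2 * (LINT x|lebesgue_on U. (\<psi> k x - v x)\<^sup>2)"
        using d[THEN L2_integrable_square] by simp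
      finally show "(LINT x|lebesgue_on U. (\<phi> k x + \<psi> k x - (u x + v x))\<^sup>2) \<le>
        2 * (LINT x|lebesgue_on U. (\<phi> k x - u x)\<^sup>2) + 2 * (LINT x|lebesgue_on U. (\<psi> k x - v x)\<^sup>2)" .
    qed
    have "(\<lambda>k. 2 * (LINT x|lebesgue_on U. (\<phi> k x - u x)\<^sup>2) + 2 * (LINT x|lebesgue_on U. (\<psi> k x - v x)\<^sup>2)) \<longlonglongrightarrow> 2 * 0 + 2 * 0"
      by (intro tendsto_intros) (use ap in \<open>auto simp: approximates_def\<close>)
    then show "(\<lambda>k. 2 * (LINT x|lebesgue_on U. (\<phi> k x - u x)\<^sup>2) + 2 * (LINT x|lebesgue_on U. (\<psi> k x - v x)\<^sup>2)) \<longlonglongrightarrow> 0" by simp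
  qed simp
  ultimately show ?thesis
    using L2_add[OF l] fin_add[OF f] smooth_up_to_boundary_add[OF \<phi>(1) \<psi>(1)]
    unfolding has_H1a_grad_def fin_energy_def bil_def by (auto intro!: exI[of _ "\<lambda>k x. \<phi> k x + \<psi> k x"])
qed

lemma H1a_scale:
  assumes u: "has_H1a_grad a U u G"
  shows "has_H1a_grad a U (\<lambda>x. c * u x) (\<lambda>x. c *\<^sub>R G x)"
proof -
  obtain \<phi> where ap: "approximates \<phi> u G" using H1a_approximates[OF u] by metis
  have "Ck k (\<lambda>y. c * y)" for k using Ck_affine[OF Ck_ident, of k c 1 0] by simp
  from approximates_compose(2)[OF ap u this, of "\<lambda>y. c" "\<bar>c\<bar>"] show ?thesis
    by (auto intro!: derivative_eq_intros continuous_intros)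
qed

lemma sol_add: "sol u G \<Longrightarrow> sol v H \<Longrightarrow> sol (\<lambda>x. u x + v x) (\<lambda>x. G x + H x)"
  unfolding sol_def
  using H1a_add bil_add_right[OF smooth_fin_energy[OF test_smooth_up] H1a_fin_energy H1a_fin_energy] by fastforce

lemma sol_scale: "sol u G \<Longrightarrow> sol (\<lambda>x. c * u x) (\<lambda>x. c *\<^sub>R G x)"
  unfolding sol_def using H1a_scale bil_scaleR_right by auto

lemma sol_fin: "sol u G \<Longrightarrow> fin_energy a U G"
  unfolding sol_def using H1a_fin_energy by blast

lemma sol_subsol: "sol u G \<Longrightarrow> subsol a U u G"
  unfolding sol_def subsol_def by auto

lemma solutions_iff: "u \<in> solutions a U \<longleftrightarrow> (\<exists>G. sol u G)"
proof
  assume u: "u \<in> solutions a U"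
  then obtain G where "has_H1a_grad a U u G" by (auto simp: solutions_def H1a_def)
  then have "has_H1a_grad a U u (H1a_grad a U u)" by (rule H1a_grad_works)
  then show "\<exists>G. sol u G" using u unfolding sol_def solutions_def bil_def by blast
next
  assume "\<exists>G. sol u G"
  then obtain G where G: "sol u G" ..
  then have u: "has_H1a_grad a U u G" by (simp add: sol_def)
  note w = H1a_grad_works[OF u]
  have "bil a U (grad \<psi>) (H1a_grad a U u) = bil a U (grad \<psi>) G" if "\<psi> \<in> test_functions U" for \<psi>
    by (rule bil_cong_AE_right[OF H1a_grad_unique[OF w u]])
      (use fin_measurable[OF H1a_fin_energy[OF u]] fin_measurable[OF H1a_fin_energy[OF w]]
        smooth_grad_measurable[OF test_smooth_up[OF that]] in auto)
  then show "u \<in> solutions a U"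
    using G u unfolding solutions_def H1a_def sol_def bil_def by auto
qed

lemma sol_zero: "sol (\<lambda>x. 0) (\<lambda>x. 0)"
proof -
  have "has_H1a_grad a U (\<lambda>x. 0) (grad (\<lambda>x. 0))"
    by (rule smooth_H1a[OF smooth_up_to_boundary_UNIV[OF smooth_on_const]])
  moreover have "grad (\<lambda>x. 0) = (\<lambda>x. 0 :: real^'n)" by auto
  ultimately show ?thesis by (simp add: sol_def bil_def)
qed

text \<open>This is the integral of the field G itself, typically a gradient. The integral of a G,
  the flux in the physical sense, is the subject of \<open>coflux_bound\<close>.\<close>

definition flux :: "(real^'n \<Rightarrow> real^'n) \<Rightarrow> real^'n" where "flux G = (LINT x|lebesgue_on U. G x)"

lemma flux_nth: "fin_energy a U G \<Longrightarrow> flux G $ i = (LINT x|lebesgue_on U. G x $ i)"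
  unfolding flux_def using integral_bounded_linear[OF bounded_linear_vec_nth fin_integrable] by metis

lemma flux_inner: "fin_energy a U G \<Longrightarrow> q \<bullet> flux G = (LINT x|lebesgue_on U. q \<bullet> G x)"
  unfolding flux_def using integral_bounded_linear[OF bounded_linear_inner_right fin_integrable] by metis

lemma average_H1a_grad:
  assumes u: "has_H1a_grad a U u G"
  shows "average U (\<lambda>x. - (H1a_grad a U u x \<bullet> (a x *v H1a_grad a U u x)) + 2 * (q \<bullet> H1a_grad a U u x))
      = (2 * (q \<bullet> flux G) - energy a U G) / measure lebesgue U"
    and "average U (\<lambda>x. - (H1a_grad a U u x \<bullet> (a x *v H1a_grad a U u x)) + 2 * (q \<bullet> (a x *v H1a_grad a U u x)))
      = (2 * (LINT x|lebesgue_on U. q \<bullet> (a x *v G x)) - energy a U G) / measure lebesgue U"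
proof -
  note w = H1a_grad_works[OF u]
  let ?H = "H1a_grad a U u"
  note fG = H1a_fin_energy[OF u] and fH = H1a_fin_energy[OF w]
  note Gm = fin_measurable[OF fG] and Hm = fin_measurable[OF fH]
  have ae: "AE x in lebesgue_on U. ?H x = G x" by (rule H1a_grad_unique[OF w u])
  have cb: "fin_energy a U (\<lambda>x. q)" by (rule fin_bounded[where C="norm q"]) auto
  have i0: "integrable (lebesgue_on U) (\<lambda>x. G x \<bullet> (a x *v G x))" using fG by (simp add: fin_energy_def)
  have "(LINT x|lebesgue_on U. - (?H x \<bullet> (a x *v ?H x)) + 2 * (q \<bullet> ?H x)) = (LINT x|lebesgue_on U. - (G x \<bullet> (a x *v G x)) + 2 * (q \<bullet> G x))"
    by (rule integral_cong_AE) (use ae form_measurable[OF Gm Gm] form_measurable[OF Hm Hm] Gm Hm in auto)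
  also have "\<dots> = 2 * (q \<bullet> flux G) - energy a U G"
    unfolding flux_inner[OF fG] bil_def using i0 fin_integrable[OF fG] by simp
  finally show "average U (\<lambda>x. - (?H x \<bullet> (a x *v ?H x)) + 2 * (q \<bullet> ?H x)) = (2 * (q \<bullet> flux G) - energy a U G) / measure lebesgue U"
    by (simp add: average_def)
  have "(LINT x|lebesgue_on U. - (?H x \<bullet> (a x *v ?H x)) + 2 * (q \<bullet> (a x *v ?H x))) = (LINT x|lebesgue_on U. - (G x \<bullet> (a x *v G x)) + 2 * (q \<bullet> (a x *v G x)))"
    by (rule integral_cong_AE) (use ae form_measurable[OF Gm Gm] form_measurable[OF Hm Hm] form_measurable[OF fin_measurable[OF cb] Hm] form_measurable[OF fin_measurable[OF cb] Gm] in auto)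
  also have "\<dots> = 2 * (LINT x|lebesgue_on U. q \<bullet> (a x *v G x)) - energy a U G"
    unfolding bil_def using i0 bil_integrable[OF cb fG] by simp
  finally show "average U (\<lambda>x. - (?H x \<bullet> (a x *v ?H x)) + 2 * (q \<bullet> (a x *v ?H x))) = (2 * (LINT x|lebesgue_on U. q \<bullet> (a x *v G x)) - energy a U G) / measure lebesgue U"
    by (simp add: average_def)
qed

text \<open>\<open>a_star_inv\<close> is a definite description, so the supremum has to be shown to
  be a quadratic form in q. The parallelogram law follows from linearity of the space of solutions,
  and finiteness from \<open>energy_L1\<close>. Afterwards the supremum property is available for
  each single solution.\<close>

lemma a_star_inv_works:
  assumes \<mu>: "measure lebesgue U > 0"
  shows "transpose (a_star_inv a U) = a_star_inv a U"
    and "sol u G \<Longrightarrow> 2 * (q \<bullet> flux G) - energy a U G \<le> measure lebesgue U * (q \<bullet> (a_star_inv a U *v q))"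
proof -
  let ?\<mu> = "measure lebesgue U"
  obtain K where K: "K \<ge> 0" "\<And>F. fin_energy a U F \<Longrightarrow> (LINT x|lebesgue_on U. norm (F x)) \<le> K * sqrt (energy a U F)"
    using energy_L1 by metis
  define J where "J q G = (2 * (q \<bullet> flux G) - energy a U G) / ?\<mu>" for q G
  define S where "S = {G. \<exists>u. sol u G}"
  define F where "F q = (SUP G\<in>S. J q G)" for q
  have S0: "(\<lambda>x. 0) \<in> S" using sol_zero by (auto simp: S_def)
  have Sf: "fin_energy a U G" if "G \<in> S" for G using that sol_fin by (auto simp: S_def)
  have Jle: "J q G \<le> K\<^sup>2 / ?\<mu> * (norm q)\<^sup>2" if "G \<in> S" for q G
  proof -
    have "norm (flux G) \<le> K * sqrt (energy a U G)"
      unfolding flux_def by (rule order_trans[OF integral_norm_bound K(2)[OF Sf[OF that]]])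
    then have "q \<bullet> flux G \<le> norm q * (K * sqrt (energy a U G))"
      using order_trans[OF norm_cauchy_schwarz mult_left_mono[OF _ norm_ge_zero]] by blast
    also have "2 * \<dots> \<le> (norm q * K)\<^sup>2 + energy a U G"
      using sum_squares_bound[of "norm q * K" "sqrt (energy a U G)"] energy_nonneg[of G] by (simp add: mult_ac)
    finally have "(2 * (q \<bullet> flux G) - energy a U G) / ?\<mu> \<le> (norm q * K)\<^sup>2 / ?\<mu>"
      using \<mu> by (intro divide_right_mono) auto
    then show ?thesis unfolding J_def by (simp add: power_mult_distrib mult.commute)
  qed
  have bdd: "bdd_above (J q ` S)" for q by (rule bdd_aboveI2) (rule Jle)
  have JF: "J q G \<le> F q" if "G \<in> S" for q G unfolding F_def by (rule cSUP_upper[OF that bdd])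
  have F_least: "F q \<le> c" if "\<And>G. G \<in> S \<Longrightarrow> J q G \<le> c" for q c
    unfolding F_def by (rule cSUP_least) (use S0 that in auto)
  have F_nn: "0 \<le> F q" for q using JF[OF S0, of q] by (simp add: J_def flux_def bil_def)
  have S_add: "(\<lambda>x. G x + H x) \<in> S" if "G \<in> S" "H \<in> S" for G H
    using that sol_add unfolding S_def by blast
  have S_scale: "(\<lambda>x. c *\<^sub>R G x) \<in> S" if "G \<in> S" for G c
    using that sol_scale unfolding S_def by blast
  have fl_add: "flux (\<lambda>x. G x + H x) = flux G + flux H" if "fin_energy a U G" "fin_energy a U H" for G H
    unfolding flux_def using fin_integrable that by simp
  have fl_diff: "flux (\<lambda>x. G x - H x) = flux G - flux H" if "fin_energy a U G" "fin_energy a U H" for G H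
    unfolding flux_def using fin_integrable that by simp
  have fl_scale: "flux (\<lambda>x. c *\<^sub>R G x) = c *\<^sub>R flux G" for c G unfolding flux_def by simp
  have par1: "F (q + r) + F (q - r) \<le> 2 * F q + 2 * F r" for q r
  proof -
    have main: "J (q + r) G + J (q - r) H \<le> 2 * F q + 2 * F r" if GH: "G \<in> S" "H \<in> S" for G H
    proof -
      \<comment> \<open>In terms of the half sum P and the half difference N, the cross terms of the
        two functionals cancel, leaving twice J at q and P plus twice J at r and N.\<close>
      define P where "P x = (1/2) *\<^sub>R G x + (1/2) *\<^sub>R H x" for x
      define N where "N x = (1/2) *\<^sub>R G x + (- 1/2) *\<^sub>R H x" for x
      have PN: "P \<in> S" "N \<in> S" unfolding P_def N_def using GH S_add S_scale by blast+
      have GP: "G = (\<lambda>x. P x + N x)" "H = (\<lambda>x. P x - N x)"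
        by (simp_all add: P_def N_def fun_eq_iff vec_eq_iff)
      note f = Sf[OF PN(1)] Sf[OF PN(2)]
      have "J (q + r) G + J (q - r) H = 2 * J q P + 2 * J r N"
        unfolding J_def GP fl_add[OF f] fl_diff[OF f] energy_add[OF f] energy_diff[OF f]
        by (simp add: inner_add_left inner_diff_left inner_add_right inner_diff_right
            add_divide_distrib diff_divide_distrib)
      then show ?thesis using JF[OF PN(1), of q] JF[OF PN(2), of r] by linarith
    qed
    have "F (q + r) \<le> 2 * F q + 2 * F r - J (q - r) H" if "H \<in> S" for H
      by (rule F_least) (use main[OF _ that] in \<open>simp add: le_diff_eq\<close>)
    then have "F (q - r) \<le> 2 * F q + 2 * F r - F (q + r)"
      by (intro F_least) (simp add: le_diff_eq add.commute)
    then show ?thesis by simp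
  qed
  have F4: "4 * F q \<le> F (2 *\<^sub>R q)" for q
  proof -
    have "F q \<le> F (2 *\<^sub>R q) / 4"
    proof (rule F_least)
      fix G assume G: "G \<in> S"
      have "4 * J q G = J (2 *\<^sub>R q) (\<lambda>x. 2 *\<^sub>R G x)"
        unfolding J_def fl_scale energy_scaleR by (simp add: field_simps)
      also have "\<dots> \<le> F (2 *\<^sub>R q)" by (rule JF[OF S_scale[OF G]])
      finally show "J q G \<le> F (2 *\<^sub>R q) / 4" by simp
    qed
    then show ?thesis by simp
  qed
  have par: "F (q + r) + F (q - r) = 2 * F q + 2 * F r" for q r
  proof (rule antisym[OF par1])
    \<comment> \<open>The reverse inequality is the one just proved, applied to q + r and q - r,
      together with F (2 q) >= 4 F q.\<close>
    have "F ((q + r) + (q - r)) + F ((q + r) - (q - r)) \<le> 2 * F (q + r) + 2 * F (q - r)" by (rule par1)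
    moreover have "(q + r) + (q - r) = 2 *\<^sub>R q" "(q + r) - (q - r) = 2 *\<^sub>R r" by (simp_all add: scaleR_2)
    ultimately show "2 * F q + 2 * F r \<le> F (q + r) + F (q - r)" using F4[of q] F4[of r] by simp
  qed
  obtain M where M: "transpose M = M" "\<And>q. F q = q \<bullet> (M *v q)"
    by (rule parallelogram_quadratic_form[OF par F_nn F_least[OF Jle]]) (assumption, rule that, assumption+)
  have SUP: "(SUP u\<in>solutions a U. ereal (average U (\<lambda>x.
       - (H1a_grad a U u x \<bullet> (a x *v H1a_grad a U u x)) + 2 * (q \<bullet> H1a_grad a U u x)))) = ereal (F q)" for q
  proof (rule antisym)
    show "(SUP u\<in>solutions a U. ereal (average U (\<lambda>x.
       - (H1a_grad a U u x \<bullet> (a x *v H1a_grad a U u x)) + 2 * (q \<bullet> H1a_grad a U u x)))) \<le> ereal (F q)"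
    proof (rule SUP_least)
      fix u assume "u \<in> solutions a U"
      then obtain G where G: "sol u G" using solutions_iff by blast
      then have H: "G \<in> S" "has_H1a_grad a U u G" by (auto simp: S_def sol_def)
      then show "ereal (average U (\<lambda>x. - (H1a_grad a U u x \<bullet> (a x *v H1a_grad a U u x)) + 2 * (q \<bullet> H1a_grad a U u x))) \<le> ereal (F q)"
        using JF[OF H(1), of q] unfolding average_H1a_grad(1)[OF H(2)] J_def by simp
    qed
    show "ereal (F q) \<le> (SUP u\<in>solutions a U. ereal (average U (\<lambda>x.
       - (H1a_grad a U u x \<bullet> (a x *v H1a_grad a U u x)) + 2 * (q \<bullet> H1a_grad a U u x))))" (is "_ \<le> ?s")
    proof -
      have le: "ereal (J q G) \<le> ?s" if "G \<in> S" for G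
      proof -
        obtain u where u: "sol u G" using \<open>G \<in> S\<close> S_def by auto
        then have H: "u \<in> solutions a U" "has_H1a_grad a U u G" using solutions_iff by (auto simp: sol_def)
        show ?thesis by (rule SUP_upper2[OF H(1)]) (simp only: average_H1a_grad(1)[OF H(2)] J_def order_refl)
      qed
      show ?thesis
      proof (cases ?s)
        case (real c)
        then have "F q \<le> c" by (intro F_least) (use le in simp)
        then show ?thesis using real by simp
      qed (use le[OF S0] in auto)
    qed
  qed
  have "a_star_inv a U = (THE N. transpose N = N \<and> (\<forall>q. ereal (q \<bullet> (N *v q)) = ereal (F q)))"
    unfolding a_star_inv_def by (simp only: SUP)
  also have "\<dots> = M"
  proof (rule the_equality)
    show "transpose M = M \<and> (\<forall>q. ereal (q \<bullet> (M *v q)) = ereal (F q))"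
      using M(1) by (simp only: M(2) simp_thms)
    fix N assume N: "transpose N = N \<and> (\<forall>q. ereal (q \<bullet> (N *v q)) = ereal (F q))"
    show "N = M"
    proof (rule symmetric_matrix_eqI[OF conjunct1[OF N] M(1)])
      show "q \<bullet> (N *v q) = q \<bullet> (M *v q)" for q
        using conjunct2[OF N, rule_format, of q] unfolding M(2)[of q] by (simp only: ereal.inject)
    qed
  qed
  finally have aM: "a_star_inv a U = M" .
  have A: "transpose (a_star_inv a U) = a_star_inv a U" "q \<bullet> (a_star_inv a U *v q) = F q" for q
    unfolding aM by (rule M(1), rule M(2)[symmetric])
  show "transpose (a_star_inv a U) = a_star_inv a U" by (rule A)
  assume "sol u G"
  then have "J q G \<le> F q" by (intro JF) (auto simp: S_def)
  then show "2 * (q \<bullet> flux G) - energy a U G \<le> ?\<mu> * (q \<bullet> (a_star_inv a U *v q))"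
    using \<mu> unfolding A J_def by (simp add: field_simps)
qed

lemma spectral_norm_nonneg: "0 \<le> spectral_norm (A :: real^'n^'n)"
  unfolding spectral_norm_def by (rule onorm_pos_le[OF matrix_vector_mul_bounded_linear])

lemma flux_bound:
  assumes \<mu>: "measure lebesgue U > 0" and G: "sol u G"
  shows "norm (flux G) \<le> sqrt (measure lebesgue U * spectral_norm (a_star_inv a U)) * sqrt (energy a U G)"
proof -
  let ?\<mu> = "measure lebesgue U" and ?A = "a_star_inv a U"
  have form: "q \<bullet> (?A *v q) \<le> spectral_norm ?A * (norm q)\<^sup>2" for q
  proof -
    have "q \<bullet> (?A *v q) \<le> norm q * norm (?A *v q)" by (rule norm_cauchy_schwarz)
    also have "\<dots> \<le> norm q * (spectral_norm ?A * norm q)"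
      unfolding spectral_norm_def by (intro mult_left_mono onorm matrix_vector_mul_bounded_linear) auto
    finally show ?thesis by (simp add: power2_eq_square mult_ac)
  qed
  define n where "n = norm (flux G)"
  \<comment> \<open>The choice q = t \<open>flux G\<close> turns the supremum property into a
    quadratic polynomial in t; its discriminant gives the bound after cancelling a factor
    n^2.\<close>
  have "0 \<le> energy a U G + 2 * t * (- n\<^sup>2) + t\<^sup>2 * (?\<mu> * spectral_norm ?A * n\<^sup>2)" for t
  proof -
    have "2 * ((t *\<^sub>R flux G) \<bullet> flux G) - energy a U G \<le> ?\<mu> * ((t *\<^sub>R flux G) \<bullet> (?A *v (t *\<^sub>R flux G)))"
      by (rule a_star_inv_works(2)[OF \<mu> G])
    also have "\<dots> \<le> ?\<mu> * (spectral_norm ?A * (norm (t *\<^sub>R flux G))\<^sup>2)" using \<mu> by (intro mult_left_mono form) auto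
    finally show ?thesis by (simp add: n_def dot_square_norm power_mult_distrib mult_ac)
  qed
  from discriminant_le[OF this] have "(- n\<^sup>2)\<^sup>2 \<le> energy a U G * (?\<mu> * spectral_norm ?A * n\<^sup>2)"
    using \<mu> spectral_norm_nonneg[of ?A] by simp
  then have "n\<^sup>2 * n\<^sup>2 \<le> (?\<mu> * spectral_norm ?A * energy a U G) * n\<^sup>2" by (simp add: power2_eq_square mult_ac)
  moreover have "0 \<le> ?\<mu> * spectral_norm ?A * energy a U G"
    using \<mu> spectral_norm_nonneg[of ?A] energy_nonneg[of G] by simp
  ultimately have "n\<^sup>2 \<le> (?\<mu> * spectral_norm ?A) * energy a U G"
    using mult_right_le_imp_le[of "n\<^sup>2" "n\<^sup>2" "(?\<mu> * spectral_norm ?A) * energy a U G"]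
    by (cases "n = 0") auto
  from abs_le_sqrt_mult[OF this] show ?thesis by (simp add: n_def)
qed

lemma smooth_flux_bound:
  assumes \<mu>: "measure lebesgue U > 0" and w: "w \<in> smooth_up_to_boundary U"
  shows "\<bar>LINT x|lebesgue_on U. grad w x $ i\<bar> \<le>
    sqrt (measure lebesgue U * spectral_norm (a_star_inv a U)) * sqrt (energy a U (grad w))"
proof -
  obtain u G where G: "sol u G" "\<And>i. (LINT x|lebesgue_on U. G x $ i) = (LINT x|lebesgue_on U. grad w x $ i)"
    "energy a U G \<le> energy a U (grad w)" using dirichlet_problem[OF w] by metis
  have "\<bar>LINT x|lebesgue_on U. grad w x $ i\<bar> \<le> norm (flux G)"
    unfolding G(2)[symmetric] flux_nth[OF sol_fin[OF G(1)], symmetric] by (rule component_le_norm_cart)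
  also have "\<dots> \<le> sqrt (measure lebesgue U * spectral_norm (a_star_inv a U)) * sqrt (energy a U G)"
    by (rule flux_bound[OF \<mu> G(1)])
  also have "\<dots> \<le> sqrt (measure lebesgue U * spectral_norm (a_star_inv a U)) * sqrt (energy a U (grad w))"
    using G(3) spectral_norm_nonneg[of "a_star_inv a U"] by (intro mult_left_mono) auto
  finally show ?thesis .
qed

lemma subsol_scale:
  assumes "subsol a U v V" "0 \<le> c" shows "subsol a U (\<lambda>x. c * v x) (\<lambda>x. c *\<^sub>R V x)"
  using assms H1a_scale unfolding subsol_def by (auto simp: bil_scaleR_right mult_nonneg_nonpos)

lemma coarse_norm_ge:
  assumes v: "subsol a U v V" and p: "norm p = 1" and c: "0 \<le> c"
  shows "ereal ((2 * (c * (LINT x|lebesgue_on U. p \<bullet> (a x *v V x))) - c\<^sup>2 * energy a U V) / measure lebesgue U)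
    \<le> coarse_norm a (K_sub a) U"
proof -
  note s = subsol_scale[OF v c]
  then have "(\<lambda>x. c * v x) \<in> K_sub a U" unfolding K_sub_def using subsolutions_iff by blast
  moreover have "average U (\<lambda>x. - (H1a_grad a U (\<lambda>x. c * v x) x \<bullet> (a x *v H1a_grad a U (\<lambda>x. c * v x) x)) + 2 * (p \<bullet> (a x *v H1a_grad a U (\<lambda>x. c * v x) x)))
    = (2 * (c * (LINT x|lebesgue_on U. p \<bullet> (a x *v V x))) - c\<^sup>2 * energy a U V) / measure lebesgue U"
    unfolding average_H1a_grad(2)[OF subsol_H1a[OF s]] energy_scaleR by (simp add: matrix_vector_mult_scaleR)
  ultimately have "ereal ((2 * (c * (LINT x|lebesgue_on U. p \<bullet> (a x *v V x))) - c\<^sup>2 * energy a U V) / measure lebesgue U) \<le> coarse a (K_sub a) U p"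
    unfolding coarse_def by (intro SUP_upper2[of "\<lambda>x. c * v x"]) auto
  also have "\<dots> \<le> coarse_norm a (K_sub a) U" unfolding coarse_norm_def using p by (intro SUP_upper) auto
  finally show ?thesis .
qed

lemma coarse_norm_nonneg: "0 \<le> coarse_norm a (K_sub a) U"
  using coarse_norm_ge[OF sol_subsol[OF sol_zero], of "axis undefined 1" 0] by (simp add: zero_ereal_def)

lemma coflux_bound:
  assumes \<mu>: "measure lebesgue U > 0" and fin: "coarse_norm a (K_sub a) U = ereal A" and v: "subsol a U v V"
  shows "\<bar>LINT x|lebesgue_on U. (a x *v V x) $ i\<bar> \<le> sqrt (measure lebesgue U * A) * sqrt (energy a U V)"
proof -
  let ?\<mu> = "measure lebesgue U"
  have A0: "0 \<le> A" using coarse_norm_nonneg fin by simp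
  have main: "(LINT x|lebesgue_on U. p \<bullet> (a x *v V x)) \<le> sqrt (?\<mu> * A) * sqrt (energy a U V)" if p: "norm p = 1" for p
  proof -
    define \<beta> where "\<beta> = (LINT x|lebesgue_on U. p \<bullet> (a x *v V x))"
    show ?thesis
    proof (cases "\<beta> \<le> 0")
      case True
      then show ?thesis using A0 energy_nonneg[of V] unfolding \<beta>_def
        by (intro order_trans[OF True[unfolded \<beta>_def]] mult_nonneg_nonneg) auto
    next
      case False
      have "0 \<le> ?\<mu> * A + 2 * t * (- \<beta>) + t\<^sup>2 * energy a U V" for t
      proof (cases "t \<ge> 0")
        case True
        have "(2 * (t * \<beta>) - t\<^sup>2 * energy a U V) / ?\<mu> \<le> A"
          using coarse_norm_ge[OF v p True] unfolding fin \<beta>_def by simp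
        then show ?thesis using \<mu> by (simp add: field_simps)
      next
        \<comment> \<open>Subsolutions form only a cone, so a negative multiple of v is no
          admissible competitor. For positive beta and negative t all three terms are nonnegative
          anyway.\<close>
        case neg: False
        have "0 \<le> t * (- \<beta>)" using False neg by (simp add: mult_nonpos_nonneg)
        moreover have "0 \<le> ?\<mu> * A" "0 \<le> t\<^sup>2 * energy a U V" using A0 energy_nonneg[of V] by auto
        ultimately show ?thesis by simp
      qed
      from abs_le_sqrt_mult[OF discriminant_le[OF this energy_nonneg]] show ?thesis by (simp add: \<beta>_def)
    qed
  qed
  have "(LINT x|lebesgue_on U. (a x *v V x) $ i) \<le> sqrt (?\<mu> * A) * sqrt (energy a U V)"
    using main[of "axis i 1"] by (simp add: inner_axis')
  moreover have "(LINT x|lebesgue_on U. - axis i 1 \<bullet> (a x *v V x)) \<le> sqrt (?\<mu> * A) * sqrt (energy a U V)"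
    by (rule main) simp
  then have "- (LINT x|lebesgue_on U. (a x *v V x) $ i) \<le> sqrt (?\<mu> * A) * sqrt (energy a U V)"
    by (simp add: inner_axis')
  ultimately show ?thesis by linarith
qed

text \<open>Take the solution with boundary data x_i. Its mean gradient is the i-th unit vector, so
  \<open>flux_bound\<close> bounds its energy from below; its energy equals the i-th component of
  the integrated flux, so \<open>coflux_bound\<close> bounds the energy from above. Comparing the
  two gives the claim. It is the source of 1 <= PA PB, on which all choices of scale rely.\<close>

lemma coarse_ellipticity_ratio_ge_1:
  assumes \<mu>: "measure lebesgue U > 0" and fin: "coarse_norm a (K_sub a) U = ereal A"
  shows "1 \<le> sqrt A * sqrt (spectral_norm (a_star_inv a U))"
proof -
  let ?\<mu> = "measure lebesgue U" and ?s = "spectral_norm (a_star_inv a U)"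
  fix i :: 'n
  have w: "(\<lambda>x. x $ i) \<in> smooth_up_to_boundary U" by (rule smooth_up_to_boundary_UNIV[OF smooth_on_coord])
  have gw: "grad (\<lambda>x. x $ i) = (\<lambda>x. axis i 1)" using grad_coord by blast
  obtain u G where G: "sol u G" "\<And>j. (LINT x|lebesgue_on U. G x $ j) = (LINT x|lebesgue_on U. grad (\<lambda>x. x $ i) x $ j)"
    "energy a U G = bil a U G (grad (\<lambda>x. x $ i))" using dirichlet_problem[OF w] by metis
  define e where "e = sqrt (energy a U G)"
  have e0: "0 \<le> e" by (simp add: e_def energy_nonneg)
  have s0: "0 \<le> ?s" by (rule spectral_norm_nonneg)
  have A0: "0 \<le> A" using coarse_norm_nonneg fin by simp
  have "flux G $ i = ?\<mu>"
    unfolding flux_nth[OF sol_fin[OF G(1)]] G(2) gw by (simp add: measure_restrict_space)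
  then have 1: "?\<mu> \<le> sqrt (?\<mu> * ?s) * e"
    using component_le_norm_cart[of "flux G" i] flux_bound[OF \<mu> G(1)] by (simp add: e_def)
  have "energy a U G = (LINT x|lebesgue_on U. (a x *v G x) $ i)"
    using G(3) bil_sym[of G "grad (\<lambda>x. x $ i)"] unfolding gw by (simp add: bil_def inner_axis')
  then have "e * e \<le> sqrt (?\<mu> * A) * e"
    using coflux_bound[OF \<mu> fin sol_subsol[OF G(1)], of i] energy_nonneg[of G] by (simp add: e_def)
  moreover have "e > 0" using 1 \<mu> e0 by (cases "e = 0") auto
  ultimately have 2: "e \<le> sqrt (?\<mu> * A)" by simp
  have "?\<mu> \<le> sqrt (?\<mu> * ?s) * sqrt (?\<mu> * A)"
    by (rule order_trans[OF 1 mult_left_mono[OF 2]]) (use \<mu> s0 in auto)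
  also have "\<dots> = ?\<mu> * (sqrt A * sqrt ?s)" using \<mu> by (simp add: real_sqrt_mult)
  finally show ?thesis using \<mu> by simp
qed

end

subsection \<open>The tree of triadic cubes\<close>

text \<open>Unfolding \<open>step\<close> for m generations produces a geometric series in q and a
  remainder C p^(n+m) f, which disappears as m grows. Therefore C does not enter the conclusion, and
  it may depend on the smoothness of the function at hand. The quantities e and f behave like
  integrals of nonnegative densities: the children together have no more than the parent.\<close>

lemma tree_bound:
  fixes R e f :: "nat \<Rightarrow> 'p \<Rightarrow> real"
  assumes kid: "\<And>n z z'. node n z \<Longrightarrow> z' \<in> kids n z \<Longrightarrow> node (Suc n) z'"
    and step: "\<And>n z. node n z \<Longrightarrow> R n z \<le> (\<Sum>z'\<in>kids n z. R (Suc n) z') + K * q ^ n * e n z"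
    and e: "\<And>n z. node n z \<Longrightarrow> (\<Sum>z'\<in>kids n z. e (Suc n) z') \<le> e n z"
    and f: "\<And>n z. node n z \<Longrightarrow> (\<Sum>z'\<in>kids n z. f (Suc n) z') \<le> f n z"
    and leaf: "\<And>n z. node n z \<Longrightarrow> R n z \<le> C * p ^ n * f n z"
    and nn: "0 \<le> K" "0 \<le> q" "q < 1" "0 \<le> p" "p < 1" "0 \<le> C" and e0: "\<And>n z. 0 \<le> e n z"
    and root: "node n z"
  shows "R n z \<le> K * q ^ n / (1 - q) * e n z"
proof -
  have claim: "\<forall>n z. node n z \<longrightarrow> R n z \<le> K * q ^ n * (\<Sum>j<m. q ^ j) * e n z + C * p ^ (n + m) * f n z" for m
  proof (induction m)
    case 0 then show ?case using leaf by simp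
  next
    case (Suc m)
    show ?case
    proof (intro allI impI)
      fix n z assume z: "node n z"
      have "R n z \<le> (\<Sum>z'\<in>kids n z. R (Suc n) z') + K * q ^ n * e n z" by (rule step[OF z])
      also have "(\<Sum>z'\<in>kids n z. R (Suc n) z') \<le> (\<Sum>z'\<in>kids n z. K * q ^ Suc n * (\<Sum>j<m. q ^ j) * e (Suc n) z' + C * p ^ (Suc n + m) * f (Suc n) z')"
        using Suc kid[OF z] by (intro sum_mono) blast
      also have "\<dots> = K * q ^ Suc n * (\<Sum>j<m. q ^ j) * (\<Sum>z'\<in>kids n z. e (Suc n) z') + C * p ^ (Suc n + m) * (\<Sum>z'\<in>kids n z. f (Suc n) z')"
        by (simp add: sum.distrib sum_distrib_left)
      also have "\<dots> \<le> K * q ^ Suc n * (\<Sum>j<m. q ^ j) * e n z + C * p ^ (Suc n + m) * f n z"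
        using nn by (intro add_mono mult_left_mono e[OF z] f[OF z] mult_nonneg_nonneg sum_nonneg) auto
      finally have "R n z \<le> K * q ^ n * (q * (\<Sum>j<m. q ^ j) + 1) * e n z + C * p ^ (n + Suc m) * f n z"
        by (simp add: algebra_simps)
      also have "q * (\<Sum>j<m. q ^ j) + 1 = (\<Sum>j<Suc m. q ^ j)"
        by (subst sum.lessThan_Suc_shift) (simp add: sum_distrib_left)
      finally show "R n z \<le> K * q ^ n * (\<Sum>j<Suc m. q ^ j) * e n z + C * p ^ (n + Suc m) * f n z" .
    qed
  qed
  have "R n z \<le> K * q ^ n / (1 - q) * e n z + C * p ^ (n + m) * f n z" for m
  proof -
    have "(\<Sum>j<m. q ^ j) \<le> 1 / (1 - q)"
      using nn by (subst sum_gp_strict) (auto simp: divide_right_mono)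
    then have "K * q ^ n * (\<Sum>j<m. q ^ j) * e n z \<le> K * q ^ n * (1 / (1 - q)) * e n z"
      using nn e0 by (intro mult_right_mono mult_left_mono) auto
    then show ?thesis using claim[of m] root by fastforce
  qed
  moreover have "(\<lambda>m. K * q ^ n / (1 - q) * e n z + C * p ^ (n + m) * f n z) \<longlonglongrightarrow> K * q ^ n / (1 - q) * e n z + C * 0 * f n z"
    by (intro tendsto_intros LIMSEQ_power_zero[THEN LIMSEQ_ignore_initial_segment[of _ _ n], unfolded add.commute[of _ n]])
      (use nn in auto)
  ultimately show ?thesis by (intro LIMSEQ_le_const) auto
qed

text \<open>The version with finite depth: an estimate on all cubes of generation N is summed up to
  their common ancestor.\<close>

lemma tree_aggregate:
  fixes R e :: "nat \<Rightarrow> 'p \<Rightarrow> real"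
  assumes kid: "\<And>n z z'. node n z \<Longrightarrow> z' \<in> kids n z \<Longrightarrow> node (Suc n) z'"
    and R: "\<And>n z. node n z \<Longrightarrow> R n z \<le> (\<Sum>z'\<in>kids n z. R (Suc n) z')"
    and e: "\<And>n z. node n z \<Longrightarrow> (\<Sum>z'\<in>kids n z. e (Suc n) z') \<le> e n z"
    and leaf: "\<And>z. node N z \<Longrightarrow> R N z \<le> e N z"
    and "n \<le> N" "node n z"
  shows "R n z \<le> e n z"
proof -
  have "\<forall>z. node n z \<longrightarrow> R n z \<le> e n z" using \<open>n \<le> N\<close>
  proof (induction rule: inc_induct)
    case base then show ?case using leaf by blast
  next
    case (step n)
    show ?case
    proof (intro allI impI)
      fix z assume z: "node n z"
      have "R n z \<le> (\<Sum>z'\<in>kids n z. R (Suc n) z')" by (rule R[OF z])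
      also have "\<dots> \<le> (\<Sum>z'\<in>kids n z. e (Suc n) z')" using step.IH kid[OF z] by (intro sum_mono) blast
      finally show "R n z \<le> e n z" using e[OF z] by linarith
    qed
  qed
  then show ?thesis using assms by blast
qed

text \<open>Cauchy-Schwarz over the children: products of square roots of additive quantities, such
  as volume and energy, again qualify as the quantity e of \<open>tree_bound\<close>.\<close>

lemma sum_sqrt_mult_le:
  fixes x y :: "'p \<Rightarrow> real"
  assumes "\<And>i. i \<in> I \<Longrightarrow> 0 \<le> x i" "\<And>i. i \<in> I \<Longrightarrow> 0 \<le> y i" "(\<Sum>i\<in>I. x i) \<le> X" "(\<Sum>i\<in>I. y i) \<le> Y"
  shows "(\<Sum>i\<in>I. sqrt (x i) * sqrt (y i)) \<le> sqrt X * sqrt Y"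
proof -
  have L2_sqrt: "L2_set (\<lambda>i. sqrt (v i)) I = sqrt (\<Sum>i\<in>I. v i)" if "\<And>i. i \<in> I \<Longrightarrow> 0 \<le> v i" for v :: "'p \<Rightarrow> real"
  proof -
    have "(\<Sum>i\<in>I. (sqrt (v i))\<^sup>2) = (\<Sum>i\<in>I. v i)" by (rule sum.cong) (simp_all add: that)
    then show ?thesis by (simp add: L2_set_def)
  qed
  have "(\<Sum>i\<in>I. \<bar>sqrt (x i)\<bar> * \<bar>sqrt (y i)\<bar>) \<le> L2_set (\<lambda>i. sqrt (x i)) I * L2_set (\<lambda>i. sqrt (y i)) I"
    by (rule L2_set_mult_ineq)
  also have "\<dots> = sqrt (\<Sum>i\<in>I. x i) * sqrt (\<Sum>i\<in>I. y i)"
    by (simp only: L2_sqrt[OF assms(1)] L2_sqrt[OF assms(2)])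
  also have "sqrt (\<Sum>i\<in>I. x i) * sqrt (\<Sum>i\<in>I. y i) \<le> sqrt X * sqrt Y"
  proof -
    have "0 \<le> (\<Sum>i\<in>I. y i)" "0 \<le> (\<Sum>i\<in>I. x i)" using assms(1,2) by (intro sum_nonneg; blast)+
    then show ?thesis using assms(3,4) by (intro mult_mono real_sqrt_le_mono) auto
  qed
  also have "(\<Sum>i\<in>I. \<bar>sqrt (x i)\<bar> * \<bar>sqrt (y i)\<bar>) = (\<Sum>i\<in>I. sqrt (x i) * sqrt (y i))"
    by (rule sum.cong) (simp_all add: assms(1,2))
  finally show ?thesis .
qed

definition offsets :: "(real^'n) set" where "offsets = {k. \<forall>i. k $ i \<in> {-1, 0, 1}}"

lemma finite_offsets: "finite (offsets :: (real^'n) set)"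
proof -
  have "(offsets :: (real^'n) set) \<subseteq> vec_lambda ` (UNIV \<rightarrow>\<^sub>E {-1, 0, 1})"
  proof
    fix k :: "real^'n" assume "k \<in> offsets"
    then have "vec_nth k \<in> UNIV \<rightarrow>\<^sub>E {-1, 0, 1}" by (auto simp: offsets_def)
    then show "k \<in> vec_lambda ` (UNIV \<rightarrow>\<^sub>E {-1, 0, 1})" by (metis imageI vec_nth_inverse)
  qed
  then show ?thesis by (rule finite_subset) (intro finite_imageI finite_PiE; simp)
qed

lemma offsets_abs: "k \<in> offsets \<Longrightarrow> \<bar>k $ i\<bar> \<le> 1"
proof -
  assume "k \<in> offsets"
  then have "k $ i = -1 \<or> k $ i = 0 \<or> k $ i = 1" by (auto simp: offsets_def)
  then show ?thesis by auto
qed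

lemma norm_offsets: "k \<in> offsets \<Longrightarrow> norm k \<le> real CARD('n)" for k :: "real^'n"
  using order_trans[OF norm_le_l1_cart sum_mono[of UNIV "\<lambda>i. \<bar>k $ i\<bar>" "\<lambda>i. 1"]] offsets_abs by fastforce

abbreviation side :: "nat \<Rightarrow> real" where "side n \<equiv> (1 / 3) ^ n"

abbreviation tcube :: "nat \<Rightarrow> real^'n \<Rightarrow> (real^'n) set" where "tcube n z \<equiv> cube z (side n)"

definition kids :: "nat \<Rightarrow> real^'n \<Rightarrow> (real^'n) set" where
  "kids n z = (\<lambda>k. z + side (Suc n) *\<^sub>R k) ` offsets"

text \<open>The centres of the triadic subcubes of the unit cube, with side 3^-n in generation n.
  They are generated along the tree instead of being read off from \<open>triadic\<close>, so that
  inductions follow parent and child.\<close>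

inductive node :: "nat \<Rightarrow> real^'n \<Rightarrow> bool" where
  root: "node 0 0"
| kid: "node n z \<Longrightarrow> z' \<in> kids n z \<Longrightarrow> node (Suc n) z'"

lemma side_pos [simp]: "0 < side n" "0 \<le> side n" by simp_all

lemma finite_kids [simp]: "finite (kids n z)" by (simp add: kids_def finite_offsets)

lemma kids_card_le: "card (kids n z) \<le> card (offsets :: (real^'n) set)" for z :: "real^'n"
  unfolding kids_def by (rule card_image_le[OF finite_offsets])

lemma kids_nth: "z' \<in> kids n z \<Longrightarrow> \<bar>z' $ i - z $ i\<bar> \<le> side (Suc n)"
  unfolding kids_def using offsets_abs[of _ i] by (auto simp: abs_mult)

lemma kids_norm: "z' \<in> kids n z \<Longrightarrow> norm (z' - z) \<le> real CARD('n) * side n" for z :: "real^'n"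
proof -
  assume "z' \<in> kids n z"
  then obtain k :: "real^'n" where k: "k \<in> offsets" "z' - z = side (Suc n) *\<^sub>R k" by (auto simp: kids_def)
  have "norm (z' - z) = side (Suc n) * norm k" using k(2) by simp
  also have "\<dots> \<le> side n * real CARD('n)"
    by (intro mult_mono norm_offsets k) auto
  finally show ?thesis by (simp add: mult.commute)
qed

lemma kids_subset: "z' \<in> kids n z \<Longrightarrow> tcube (Suc n) z' \<subseteq> tcube n z"
  by (rule cube_subset) (use kids_nth[of z' n z] in \<open>simp add: field_simps\<close>)

lemma node_abs: "node n z \<Longrightarrow> \<bar>z $ i\<bar> \<le> (1 - side n) / 2"
proof (induction rule: node.induct)
  case (kid n z z')
  have arith: "\<bar>v\<bar> \<le> (1 - r / 3) / 2" if "\<bar>v - u\<bar> \<le> r / 3" "\<bar>u\<bar> \<le> (1 - r) / 2" for u v r :: real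
  proof -
    have "\<bar>v\<bar> \<le> \<bar>v - u\<bar> + \<bar>u\<bar>" using abs_triangle_ineq[of "v - u" u] by simp
    also have "\<dots> \<le> r / 3 + (1 - r) / 2" by (rule add_mono[OF that])
    finally show ?thesis by (simp add: field_simps)
  qed
  show ?case using arith[of "z' $ i" "z $ i" "side n"] kids_nth[OF kid(2), of i] kid(3) by simp
qed simp

lemma node_subset: "node n z \<Longrightarrow> tcube n z \<subseteq> cube 0 1"
  by (rule cube_subset) (use node_abs[of n z] in simp)

lemma node_triadic: "node n z \<Longrightarrow> z \<in> triadic (- int n) \<inter> cube 0 1"
proof -
  assume n: "node n z"
  have "z \<in> triadic (- int n)" using n
  proof (induction rule: node.induct)
    case root then show ?case by (auto simp: triadic_def intro!: exI[of _ 0])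
  next
    case (kid n z z')
    have p: "3 powi (- int m) = side m" for m :: nat by (simp add: power_int_minus power_one_over inverse_eq_divide)
    obtain k where k: "k \<in> offsets" "z' = z + side (Suc n) *\<^sub>R k" using kid(2) by (auto simp: kids_def)
    show ?case unfolding triadic_def
    proof (intro CollectI allI)
      fix i
      obtain j :: int where j: "z $ i = 3 powi (- int n) * of_int j" using kid(3) by (auto simp: triadic_def)
      have "k $ i = -1 \<or> k $ i = 0 \<or> k $ i = 1" using k(1) by (auto simp: offsets_def)
      then obtain l :: int where l: "k $ i = of_int l" by (metis of_int_0 of_int_1 of_int_minus)
      have "z' $ i = 3 powi (- int (Suc n)) * of_int (3 * j + l)"
        unfolding p k(2) using j l unfolding p by (simp add: algebra_simps)
      then show "\<exists>j. z' $ i = 3 powi - int (Suc n) * of_int j" by blast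
    qed
  qed
  moreover have "z \<in> cube 0 1" using node_subset[OF n] cube_centre[of "side n" z] by auto
  ultimately show ?thesis by blast
qed

lemma kids_disjoint: "disjoint_family_on (tcube (Suc n)) (kids n z)"
  unfolding disjoint_family_on_def
proof safe
  fix w w' x assume w: "w \<in> kids n z" "w' \<in> kids n z" "w \<noteq> w'" and x: "x \<in> tcube (Suc n) w" "x \<in> tcube (Suc n) w'"
  obtain k k' where k: "k \<in> offsets" "w = z + side (Suc n) *\<^sub>R k" "k' \<in> offsets" "w' = z + side (Suc n) *\<^sub>R k'"
    using w by (auto simp: kids_def)
  then have "k \<noteq> k'" using w(3) by auto
  then obtain i where i: "k $ i \<noteq> k' $ i" by (auto simp: vec_eq_iff)
  have "k $ i = -1 \<or> k $ i = 0 \<or> k $ i = 1" "k' $ i = -1 \<or> k' $ i = 0 \<or> k' $ i = 1"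
    using k(1,3) by (auto simp: offsets_def)
  then have "1 \<le> \<bar>k $ i - k' $ i\<bar>" using i by auto
  then have "side (Suc n) * 1 \<le> side (Suc n) * \<bar>k $ i - k' $ i\<bar>" by (intro mult_left_mono) auto
  also have "\<dots> = \<bar>w $ i - w' $ i\<bar>"
  proof -
    have "w $ i - w' $ i = side (Suc n) * (k $ i - k' $ i)" using k by (simp add: algebra_simps)
    then show ?thesis by (simp only: abs_mult) simp
  qed
  also have "\<dots> \<le> \<bar>x $ i - w' $ i\<bar> + \<bar>x $ i - w $ i\<bar>"
    using abs_triangle_ineq4[of "x $ i - w' $ i" "x $ i - w $ i"] by simp
  also have "\<dots> < side (Suc n) / 2 + side (Suc n) / 2"
    using x by (intro add_strict_mono) (auto simp: cube_def)
  finally show "x \<in> {}" by simp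
qed

lemma kids_cover: "negligible (tcube n z - (\<Union>z'\<in>kids n z. tcube (Suc n) z'))" for z :: "real^'n"
proof (rule negligible_subset)
  show "negligible (\<Union>i. {x :: real^'n. x $ i = z $ i + side n / 6} \<union> {x. x $ i = z $ i - side n / 6})"
  proof -
    have "negligible {x :: real^'n. x $ i = b}" for i b
      using negligible_hyperplane[of "axis i 1 :: real^'n" b] by (simp add: inner_axis')
    then show ?thesis by (intro negligible_Union finite_imageI) (auto intro!: negligible_Un)
  qed
  show "tcube n z - (\<Union>z'\<in>kids n z. tcube (Suc n) z') \<subseteq> (\<Union>i. {x. x $ i = z $ i + side n / 6} \<union> {x. x $ i = z $ i - side n / 6})"
  proof (rule subsetI, rule ccontr)
    fix x assume x: "x \<in> tcube n z - (\<Union>z'\<in>kids n z. tcube (Suc n) z')"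
      and "x \<notin> (\<Union>i. {x. x $ i = z $ i + side n / 6} \<union> {x. x $ i = z $ i - side n / 6})"
    then have "x $ i \<noteq> z $ i + side n / 6" "x $ i \<noteq> z $ i - side n / 6" for i by auto
    moreover have "p - r \<noteq> s / 6 \<and> p - r \<noteq> - s / 6" if "p \<noteq> r + s / 6" "p \<noteq> r - s / 6" for p r s :: real
      using that by auto
    ultimately have ne: "x $ i - z $ i \<noteq> side n / 6" "x $ i - z $ i \<noteq> - side n / 6" for i
      by blast+
    define k :: "real^'n" where "k = (\<chi> i. if x $ i - z $ i < - side n / 6 then -1 else if x $ i - z $ i < side n / 6 then 0 else 1)"
    have "\<bar>u - s / 3 * (if u < - s / 6 then -1 else if u < s / 6 then 0 else 1)\<bar> < s / 3 / 2"
      if u: "\<bar>u\<bar> < s / 2" "u \<noteq> s / 6" "u \<noteq> - s / 6" for u s :: real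
    proof -
      have "- s / 2 < u" "u < s / 2" using u(1) by (auto simp: abs_less_iff)
      then show ?thesis using u(2,3) unfolding abs_less_iff by (simp split: if_split) linarith?
    qed
    note arith = this
    have "k \<in> offsets" by (auto simp: offsets_def k_def)
    then have "z + side (Suc n) *\<^sub>R k \<in> kids n z" by (auto simp: kids_def)
    moreover have "x \<in> tcube (Suc n) (z + side (Suc n) *\<^sub>R k)"
      unfolding cube_def
    proof (intro CollectI allI)
      fix i
      have "\<bar>x $ i - z $ i\<bar> < side n / 2" using x by (auto simp: cube_def)
      then show "\<bar>x $ i - (z + side (Suc n) *\<^sub>R k) $ i\<bar> < side (Suc n) / 2"
        using arith[OF _ ne(1)[of i] ne(2)[of i]] by (simp add: k_def algebra_simps)
    qed
    ultimately show False using x by blast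
  qed
qed

lemma integral_kids:
  fixes f :: "real^'n \<Rightarrow> real"
  assumes f: "integrable (lebesgue_on (tcube n z)) f"
  shows "(LINT x|lebesgue_on (tcube n z). f x) = (\<Sum>z'\<in>kids n z. LINT x|lebesgue_on (tcube (Suc n) z'). f x)"
proof -
  let ?W = "\<Union>z'\<in>kids n z. tcube (Suc n) z'"
  have sub: "?W \<subseteq> tcube n z" using kids_subset by blast
  have Ws: "?W \<in> sets lebesgue" by (intro sets.finite_UN) auto
  have I: "(LINT x|lebesgue_on A. f x) = (LINT x:A|lebesgue. f x)" if "A \<in> sets lebesgue" for A
    unfolding set_lebesgue_integral_def using that by (simp add: integral_restrict_space)
  have S: "set_integrable lebesgue A f" if "A \<subseteq> tcube n z" "A \<in> sets lebesgue" for A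
    using integrable_lebesgue_on_subset[OF f that(1) cube_sets that(2)] that(2)
    unfolding set_integrable_def by (simp add: integrable_restrict_space)
  have "(LINT x|lebesgue_on (tcube n z). f x) = (LINT x:tcube n z|lebesgue. f x)" by (rule I) simp
  also have "\<dots> = (LINT x:?W|lebesgue. f x)"
    unfolding set_lebesgue_integral_def
  proof (rule integral_cong_AE)
    have "AE x in lebesgue. x \<notin> tcube n z - ?W"
      by (rule AE_not_in) (use kids_cover[of z n] in \<open>simp only: negligible_iff_null_sets\<close>)
    then show "AE x in lebesgue. indicat_real (tcube n z) x *\<^sub>R f x = indicat_real ?W x *\<^sub>R f x"
      by eventually_elim (use sub in \<open>auto simp: indicator_def\<close>)
  qed (use S[OF subset_refl] S[OF sub Ws] in \<open>auto simp: set_integrable_def\<close>)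
  also have "\<dots> = (\<Sum>z'\<in>kids n z. LINT x:tcube (Suc n) z'|lebesgue. f x)"
    by (rule set_integral_finite_Union[OF finite_kids kids_disjoint S[OF kids_subset cube_sets] cube_sets])
  also have "\<dots> = (\<Sum>z'\<in>kids n z. LINT x|lebesgue_on (tcube (Suc n) z'). f x)"
    by (intro sum.cong refl I[symmetric]) simp
  finally show ?thesis .
qed

definition vol :: "'n::finite itself \<Rightarrow> nat \<Rightarrow> real" where "vol T n = side n ^ CARD('n)"

lemma vol_pos [simp]: "0 < vol T n" "0 \<le> vol T n" by (simp_all add: vol_def)

lemma measure_tcube: "measure lebesgue (tcube n z) = vol TYPE('n) n" for z :: "real^'n"
  unfolding vol_def by (rule measure_cube) simp

lemma vol_kids: "(\<Sum>z'\<in>kids n (z :: real^'n). vol TYPE('n) (Suc n)) \<le> vol TYPE('n) n"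
proof -
  have c: "integrable (lebesgue_on (tcube m w)) (\<lambda>x. 1 :: real)" for m and w :: "real^'n"
    using finite_measure.integrable_const[OF finite_measure_lebesgue_on[OF cube_lmeasurable]] by blast
  have v: "(LINT x|lebesgue_on (tcube m w). (1::real)) = vol TYPE('n) m" for m and w :: "real^'n"
    by (simp add: measure_restrict_space measure_tcube)
  show ?thesis using integral_kids[OF c[of z n]] unfolding v by (simp only: order_refl)
qed

lemma vol_Suc_le: "vol T (Suc n) \<le> vol T n"
  unfolding vol_def by (rule power_mono) auto

lemma tcube_norm: "x \<in> tcube n z \<Longrightarrow> norm (x - z) \<le> real CARD('n) * side n" for z :: "real^'n"
proof -
  assume x: "x \<in> tcube n z"
  have "norm (x - z) \<le> (\<Sum>i\<in>(UNIV::'n set). side n)"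
  proof (rule order_trans[OF norm_le_l1_cart sum_mono])
    fix i :: 'n
    have "\<bar>x $ i - z $ i\<bar> < side n / 2" using x by (simp add: cube_def)
    also have "\<dots> \<le> side n" by simp
    finally show "\<bar>(x - z) $ i\<bar> \<le> side n" by simp
  qed
  then show ?thesis by simp
qed

lemma integrable_tcube:
  fixes f :: "real^'n \<Rightarrow> real"
  assumes "integrable (lebesgue_on (cube 0 1)) f" "node n z"
  shows "integrable (lebesgue_on (tcube n z)) f"
  by (rule integrable_lebesgue_on_subset[OF assms(1) node_subset[OF assms(2)] cube_sets cube_sets])

text \<open>Telescoping \<open>c\<close> along the tree; the remainder at depth \<open>n\<close> vanishes like \<open>D * side n\<close>.\<close>

lemma multiscale_pairing:
  fixes h f :: "real^'n \<Rightarrow> real"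
  assumes f: "integrable (lebesgue_on (cube 0 1)) f"
    and hm: "h \<in> borel_measurable (lebesgue_on (cube 0 1))"
    and hc: "\<And>n z x. node n z \<Longrightarrow> x \<in> tcube n z \<Longrightarrow> \<bar>h x - c n z\<bar> \<le> D * side n"
    and step: "\<And>n z. node n z \<Longrightarrow>
      (\<Sum>z'\<in>kids n z. \<bar>c (Suc n) z' - c n z\<bar> * \<bar>LINT x|lebesgue_on (tcube (Suc n) z'). f x\<bar>) \<le> K * q ^ n * e n z"
    and e: "\<And>n z. node n z \<Longrightarrow> (\<Sum>z'\<in>kids n z. e (Suc n) z') \<le> e n z"
    and e0: "\<And>n z. 0 \<le> e n z"
    and nn: "0 \<le> K" "0 \<le> q" "q < 1" "0 \<le> D"
    and root: "node n z"
  shows "\<bar>(LINT x|lebesgue_on (tcube n z). h x * f x) - c n z * (LINT x|lebesgue_on (tcube n z). f x)\<bar> \<le> K * q ^ n / (1 - q) * e n z"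
proof -
  define R where "R n z = \<bar>LINT x|lebesgue_on (tcube n z). (h x - c n z) * f x\<bar>" for n z
  define g where "g n z = (LINT x|lebesgue_on (tcube n z). \<bar>f x\<bar>)" for n z
  note fi = integrable_tcube[OF f]
  have hm': "h \<in> borel_measurable (lebesgue_on (tcube n z))" if "node n z" for n z
    by (rule measurable_restrict_mono[OF hm node_subset[OF that]])
  have hfi: "integrable (lebesgue_on (tcube n z)) (\<lambda>x. (h x - c n z) * f x)" if z: "node n z" for n z
  proof (rule Bochner_Integration.integrable_bound)
    show "integrable (lebesgue_on (tcube n z)) (\<lambda>x. D * side n * f x)" using fi[OF z] by auto
    show "AE x in lebesgue_on (tcube n z). norm ((h x - c n z) * f x) \<le> norm (D * side n * f x)"
    proof (rule AE_I2)
      fix x assume "x \<in> space (lebesgue_on (tcube n z))"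
      then have "\<bar>h x - c n z\<bar> * \<bar>f x\<bar> \<le> D * side n * \<bar>f x\<bar>" using hc[OF z] by (intro mult_right_mono) auto
      then show "norm ((h x - c n z) * f x) \<le> norm (D * side n * f x)" using nn by (simp add: abs_mult)
    qed
  qed (use hm'[OF z] fi[OF z] in auto)
  have hfi': "integrable (lebesgue_on (tcube n z)) (\<lambda>x. h x * f x)" if z: "node n z" for n z
  proof -
    have "integrable (lebesgue_on (tcube n z)) (\<lambda>x. (h x - c n z) * f x + c n z * f x)"
      using hfi[OF z] fi[OF z] by auto
    then show ?thesis by (simp add: algebra_simps)
  qed
  have "R n z \<le> K * q ^ n / (1 - q) * e n z"
  proof (rule tree_bound[where node=node and kids=kids and f=g and p="1/3" and C=D])
    show "node (Suc n) z'" if "node n z" "z' \<in> kids n z" for n and z z' :: "real^'n" by (rule node.kid[OF that])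
    show "R n z \<le> D * (1 / 3) ^ n * g n z" if z: "node n z" for n z
    proof -
      have "R n z \<le> (LINT x|lebesgue_on (tcube n z). \<bar>(h x - c n z) * f x\<bar>)" unfolding R_def by (rule integral_abs_bound)
      also have "\<dots> \<le> (LINT x|lebesgue_on (tcube n z). D * side n * \<bar>f x\<bar>)"
      proof (rule integral_mono)
        show "\<bar>(h x - c n z) * f x\<bar> \<le> D * side n * \<bar>f x\<bar>" if "x \<in> space (lebesgue_on (tcube n z))" for x
          unfolding abs_mult using hc[OF z] that by (intro mult_right_mono) auto
      qed (use hfi[OF z] fi[OF z] in auto)
      finally show ?thesis by (simp add: g_def)
    qed
    show "(\<Sum>z'\<in>kids n z. g (Suc n) z') \<le> g n z" if "node n z" for n z
      unfolding g_def using integral_kids[OF integrable_abs[OF fi[OF that]]] by simp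
    show "R n z \<le> (\<Sum>z'\<in>kids n z. R (Suc n) z') + K * q ^ n * e n z" if z: "node n z" for n z
    proof -
      have "(LINT x|lebesgue_on (tcube n z). (h x - c n z) * f x) = (\<Sum>z'\<in>kids n z. LINT x|lebesgue_on (tcube (Suc n) z'). (h x - c n z) * f x)"
        by (rule integral_kids[OF hfi[OF z]])
      also have "\<dots> = (\<Sum>z'\<in>kids n z. (LINT x|lebesgue_on (tcube (Suc n) z'). (h x - c (Suc n) z') * f x) + (c (Suc n) z' - c n z) * (LINT x|lebesgue_on (tcube (Suc n) z'). f x))"
      proof (rule sum.cong[OF refl])
        fix z' assume "z' \<in> kids n z"
        then have z': "node (Suc n) z'" by (rule node.kid[OF z])
        have "(LINT x|lebesgue_on (tcube (Suc n) z'). (h x - c n z) * f x) = (LINT x|lebesgue_on (tcube (Suc n) z'). (h x - c (Suc n) z') * f x + (c (Suc n) z' - c n z) * f x)"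
          by (simp add: algebra_simps)
        also have "\<dots> = (LINT x|lebesgue_on (tcube (Suc n) z'). (h x - c (Suc n) z') * f x) + (LINT x|lebesgue_on (tcube (Suc n) z'). (c (Suc n) z' - c n z) * f x)"
          by (rule Bochner_Integration.integral_add[OF hfi[OF z']]) (use fi[OF z'] in auto)
        finally show "(LINT x|lebesgue_on (tcube (Suc n) z'). (h x - c n z) * f x) = (LINT x|lebesgue_on (tcube (Suc n) z'). (h x - c (Suc n) z') * f x) + (c (Suc n) z' - c n z) * (LINT x|lebesgue_on (tcube (Suc n) z'). f x)"
          by simp
      qed
      finally have "R n z \<le> (\<Sum>z'\<in>kids n z. \<bar>(LINT x|lebesgue_on (tcube (Suc n) z'). (h x - c (Suc n) z') * f x) + (c (Suc n) z' - c n z) * (LINT x|lebesgue_on (tcube (Suc n) z'). f x)\<bar>)"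
        unfolding R_def by (simp only: sum_abs)
      also have "\<dots> \<le> (\<Sum>z'\<in>kids n z. R (Suc n) z' + \<bar>c (Suc n) z' - c n z\<bar> * \<bar>LINT x|lebesgue_on (tcube (Suc n) z'). f x\<bar>)"
        unfolding R_def abs_mult[symmetric] by (intro sum_mono abs_triangle_ineq)
      finally show ?thesis using step[OF z] by (simp add: sum.distrib)
    qed
  qed (use e e0 nn root in auto)
  moreover have "(LINT x|lebesgue_on (tcube n z). (h x - c n z) * f x) = (LINT x|lebesgue_on (tcube n z). h x * f x) - c n z * (LINT x|lebesgue_on (tcube n z). f x)"
    using hfi'[OF root] fi[OF root] by (simp add: left_diff_distrib)
  ultimately show ?thesis by (simp add: R_def)
qed

subsection \<open>Mollified averages\<close>

text \<open>The tent that weights local averages. It vanishes on the boundary of the unit box, so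
  translating or shrinking the cube creates no boundary terms. It is Lipschitz, so its product with
  a gradient can be estimated by telescoping (\<open>lipschitz_pairing\<close>).\<close>

definition bump :: "real^'n \<Rightarrow> real" where "bump y = max 0 (1 / 2 - norm y)"

abbreviation ubox :: "(real^'n) set" where "ubox \<equiv> cbox (\<chi> i. - (1 / 2)) (\<chi> i. 1 / 2)"

definition bump_mass :: "'n::finite itself \<Rightarrow> real" where
  "bump_mass T = integral ubox (bump :: real^'n \<Rightarrow> real)"

lemma bump_bounds: "0 \<le> bump y" "bump y \<le> 1 / 2" using norm_ge_zero[of y] by (auto simp: bump_def max_def)

lemma bump_lipschitz: "\<bar>bump x - bump y\<bar> \<le> norm (x - y)"
  using norm_triangle_ineq3[of x y] by (auto simp: bump_def max_def)

lemma bump_continuous: "continuous_on S bump"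
  unfolding bump_def by (intro continuous_intros)

lemma bump_outside: "1 / 2 \<le> \<bar>y $ i\<bar> \<Longrightarrow> bump y = 0"
  using component_le_norm_cart[of y i] by (simp add: bump_def)

lemma coord_bump_bound: "\<bar>y $ i * bump y\<bar> \<le> 1 / 4"
proof (cases "norm y \<le> 1 / 2")
  case True
  have "\<bar>y $ i\<bar> * \<bar>bump y\<bar> \<le> 1 / 2 * (1 / 2)"
    using True component_le_norm_cart[of y i] bump_bounds[of y] by (intro mult_mono) auto
  then show ?thesis by (simp add: abs_mult)
qed (simp add: bump_def)

text \<open>Weights of the form y_i \<open>bump y\<close> arise when an average is differentiated
  with respect to the side of its cube.\<close>

lemma coord_bump_lipschitz: "\<bar>x $ i * bump x - y $ i * bump y\<bar> \<le> norm (x - y)"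
proof -
  have main: "\<bar>x $ i * bump x - y $ i * bump y\<bar> \<le> norm (x - y)" if x: "norm x \<le> 1 / 2" for x y :: "real^'a"
  proof (cases "norm y \<le> 1 / 2")
    case True
    have "x $ i * bump x - y $ i * bump y = (x - y) $ i * bump x + y $ i * (bump x - bump y)"
      by (simp add: algebra_simps)
    also have "\<bar>\<dots>\<bar> \<le> \<bar>(x - y) $ i\<bar> * \<bar>bump x\<bar> + \<bar>y $ i\<bar> * \<bar>bump x - bump y\<bar>"
      unfolding abs_mult[symmetric] by (rule abs_triangle_ineq)
    also have "\<dots> \<le> norm (x - y) * (1 / 2) + (1 / 2) * norm (x - y)"
      using bump_bounds[of x] True component_le_norm_cart[of y i]
      by (intro add_mono mult_mono component_le_norm_cart bump_lipschitz) auto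
    finally show ?thesis by simp
  next
    case False
    then have y0: "bump y = 0" by (simp add: bump_def)
    have "\<bar>x $ i * bump x - y $ i * bump y\<bar> = \<bar>x $ i\<bar> * \<bar>bump x - bump y\<bar>" by (simp add: y0 abs_mult)
    also have "\<dots> \<le> 1 * norm (x - y)"
      using x component_le_norm_cart[of x i] by (intro mult_mono bump_lipschitz) auto
    finally show ?thesis by simp
  qed
  show ?thesis
  proof (cases "norm x \<le> 1 / 2")
    case True then show ?thesis by (rule main)
  next
    case x: False
    show ?thesis
    proof (cases "norm y \<le> 1 / 2")
      case True then show ?thesis using main[of y x] by (simp add: abs_minus_commute norm_minus_commute)
    next
      case False then show ?thesis using x by (simp add: bump_def)
    qed
  qed
qed

lemma bump_mass_pos: "0 < bump_mass TYPE('n::finite)"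
proof -
  have int: "(bump :: real^'n \<Rightarrow> real) integrable_on ubox"
    by (rule integrable_continuous[OF bump_continuous])
  have "0 \<le> bump_mass TYPE('n)" unfolding bump_mass_def by (rule integral_nonneg[OF int]) (simp add: bump_bounds)
  moreover have "bump_mass TYPE('n) \<noteq> 0"
  proof
    assume "bump_mass TYPE('n) = 0"
    then have "((bump :: real^'n \<Rightarrow> real) has_integral 0) ubox"
      using integrable_integral[OF int] by (simp add: bump_mass_def)
    moreover have "box (\<chi> i. - (1 / 2)) (\<chi> i. 1 / 2) \<noteq> ({} :: (real^'n) set)"
      by (simp add: interval_ne_empty_cart)
    moreover have "(0 :: real^'n) \<in> ubox" by (simp add: mem_box_cart)
    ultimately have "bump (0 :: real^'n) = 0"
      by (intro has_integral_0_cbox_imp_0[OF bump_continuous bump_bounds(1)])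
    then show False by (simp add: bump_def)
  qed
  ultimately show ?thesis by simp
qed

lemma integral_ubox_affine:
  fixes f :: "real^'n \<Rightarrow> real"
  assumes r: "0 < r" and f: "continuous_on (cbox (z - (\<chi> i. r / 2)) (z + (\<chi> i. r / 2))) f"
  shows "integral ubox (\<lambda>y. f (z + r *\<^sub>R y)) = (LINT x|lebesgue_on (cube z r). f x) / r ^ CARD('n)"
proof -
  let ?a = "z - (\<chi> i. r / 2)" and ?b = "z + (\<chi> i. r / 2)"
  have i: "(f has_integral integral (cbox ?a ?b) f) (cbox ?a ?b)"
    by (rule integrable_integral[OF integrable_continuous[OF f]])
  have eq: "(?a - z) /\<^sub>R r = (\<chi> i. - (1 / 2))" "(?b - z) /\<^sub>R r = (\<chi> i. 1 / 2)"
    using r by (auto simp: vec_eq_iff)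
  have "((\<lambda>y. f (r *\<^sub>R y + z)) has_integral (integral (cbox ?a ?b) f /\<^sub>R r ^ DIM(real^'n))) ubox"
    using has_integral_affinity'[OF i r, of z] by (simp only: eq)
  then have "integral ubox (\<lambda>y. f (r *\<^sub>R y + z)) = integral (cbox ?a ?b) f /\<^sub>R r ^ DIM(real^'n)"
    by (rule integral_unique)
  moreover have "(\<lambda>y. f (z + r *\<^sub>R y)) = (\<lambda>y. f (r *\<^sub>R y + z))" by (simp only: add.commute)
  ultimately have "integral ubox (\<lambda>y. f (z + r *\<^sub>R y)) = integral (cbox ?a ?b) f / r ^ CARD('n)"
    by (simp only: real_scaleR_def divide_inverse_commute DIM_cart DIM_real mult_1_right)
  also have "integral (cbox ?a ?b) f = integral (box ?a ?b) f" by (simp add: integral_open_interval)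
  also have "\<dots> = (LINT x|lebesgue_on (box ?a ?b). f x)"
  proof (rule lebesgue_integral_eq_integral[symmetric])
    have "integrable (lebesgue_on (cbox ?a ?b)) f"
      by (rule absolutely_integrable_imp_integrable[OF absolutely_integrable_continuous[OF f]]) simp
    then show "integrable (lebesgue_on (box ?a ?b)) f"
      by (rule integrable_lebesgue_on_subset[OF _ box_subset_cbox]) auto
  qed simp
  finally show ?thesis by (simp add: cube_eq_box)
qed

definition mavg :: "(real^'n \<Rightarrow> real) \<Rightarrow> nat \<Rightarrow> real^'n \<Rightarrow> real" where
  "mavg w n z = (LINT x|lebesgue_on (tcube n z). w x * bump ((1 / side n) *\<^sub>R (x - z))) /
     (bump_mass TYPE('n) * vol TYPE('n) n)"

lemma closed_tcube_subset:
  assumes "node n z" shows "cbox (z - (\<chi> i. side n / 2)) (z + (\<chi> i. side n / 2)) \<subseteq> (ubox :: (real^'n) set)"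
proof
  fix x assume x: "x \<in> cbox (z - (\<chi> i. side n / 2)) (z + (\<chi> i. side n / 2))"
  have "\<bar>x $ i\<bar> \<le> 1 / 2" for i
  proof -
    have "z $ i - side n / 2 \<le> x $ i" "x $ i \<le> z $ i + side n / 2" using x by (auto simp: mem_box_cart)
    then have "\<bar>x $ i - z $ i\<bar> \<le> side n / 2" unfolding abs_le_iff by linarith
    then show ?thesis using node_abs[OF assms, of i] abs_triangle_ineq[of "x $ i - z $ i" "z $ i"]
      by (simp add: diff_divide_distrib)
  qed
  then have "- (1 / 2) \<le> x $ i \<and> x $ i \<le> 1 / 2" for i unfolding abs_le_iff by (simp add: minus_le_iff)
  then show "x \<in> ubox" unfolding mem_box_cart vec_lambda_beta by blast
qed

lemma closure_unit_cube: "closure (cube 0 1) = (ubox :: (real^'n) set)"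
proof -
  have "cube 0 1 = box (\<chi> i. - (1 / 2)) ((\<chi> i. 1 / 2) :: real^'n)"
    unfolding cube_eq_box by (rule arg_cong2[where f=box]) (simp_all add: vec_eq_iff)
  moreover have "box (\<chi> i. - (1 / 2)) (\<chi> i. 1 / 2) \<noteq> ({} :: (real^'n) set)"
    by (simp add: interval_ne_empty_cart)
  ultimately show ?thesis by (simp add: closure_box)
qed

lemma smooth_unit_cubeE:
  assumes "w \<in> smooth_up_to_boundary (cube 0 1)"
  obtains V where "open V" "ubox \<subseteq> V" "smooth_on V w"
  using smooth_up_to_boundaryE[OF assms] closure_unit_cube by metis

text \<open>After rescaling to the fixed box \<open>ubox\<close>, centre and side occur only in the
  argument of w, so the average can be differentiated in both under the integral sign.\<close>

lemma mavg_smooth: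
  fixes w :: "real^'n \<Rightarrow> real"
  assumes w: "continuous_on ubox w" and z: "node n z"
  shows "mavg w n z = integral ubox (\<lambda>y. w (z + side n *\<^sub>R y) * bump y) / bump_mass TYPE('n)"
proof -
  have "integral ubox (\<lambda>y. w (z + side n *\<^sub>R y) * bump ((1 / side n) *\<^sub>R (z + side n *\<^sub>R y - z))) =
    (LINT x|lebesgue_on (tcube n z). w x * bump ((1 / side n) *\<^sub>R (x - z))) / side n ^ CARD('n)"
  proof (rule integral_ubox_affine[where f="\<lambda>x. w x * bump ((1 / side n) *\<^sub>R (x - z))"])
    show "continuous_on (cbox (z - (\<chi> i. side n / 2)) (z + (\<chi> i. side n / 2))) (\<lambda>x. w x * bump ((1 / side n) *\<^sub>R (x - z)))"
      by (intro continuous_intros continuous_on_subset[OF w closed_tcube_subset[OF z]]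
          continuous_on_compose2[OF bump_continuous[of UNIV]]) auto
  qed simp
  then show ?thesis by (simp add: mavg_def vol_def)
qed

text \<open>D comes from a Lipschitz bound for w and carries no quantitative information. It serves
  to make the remainder of the telescoping vanish.\<close>

lemma mavg_close:
  fixes w :: "real^'n \<Rightarrow> real"
  assumes w: "w \<in> smooth_up_to_boundary (cube 0 1)"
  obtains D where "D \<ge> 0" "\<And>n z x. node n z \<Longrightarrow> x \<in> tcube n z \<Longrightarrow> \<bar>w x - mavg w n z\<bar> \<le> D * side n"
proof -
  obtain V where V: "open V" "ubox \<subseteq> V" "smooth_on V w" using smooth_unit_cubeE[OF w] by metis
  have wc: "continuous_on ubox w" using smooth_on_continuous[OF V(3)] V(2) continuous_on_subset by blast
  have "bounded (grad w ` ubox)"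
    using smooth_on_grad_continuous[OF V(3,1)] V(2)
    by (intro compact_imp_bounded compact_continuous_image compact_cbox) (auto intro: continuous_on_subset)
  then obtain B where B: "B > 0" "\<And>x. x \<in> ubox \<Longrightarrow> norm (grad w x) \<le> B"
    unfolding bounded_pos by auto
  let ?D = "B * (2 * real CARD('n))"
  have "\<bar>w x - mavg w n z\<bar> \<le> ?D * side n" if z: "node n z" and x: "x \<in> tcube n z" for n z x
  proof -
    let ?I = "bump_mass TYPE('n)"
    have sub: "z + side n *\<^sub>R y \<in> cbox (z - (\<chi> i. side n / 2)) (z + (\<chi> i. side n / 2))" if "y \<in> ubox" for y
      unfolding mem_box_cart
    proof (intro allI conjI)
      fix i
      have "side n * (- (1 / 2)) \<le> side n * y $ i" "side n * y $ i \<le> side n * (1 / 2)"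
        using that by (intro mult_left_mono; simp add: mem_box_cart)+
      then show "(z - (\<chi> i. side n / 2)) $ i \<le> (z + side n *\<^sub>R y) $ i" "(z + side n *\<^sub>R y) $ i \<le> (z + (\<chi> i. side n / 2)) $ i"
        by simp_all
    qed
    have ub: "z + side n *\<^sub>R y \<in> ubox" if "y \<in> ubox" for y using sub[OF that] closed_tcube_subset[OF z] by blast
    have xu: "x \<in> ubox" using node_subset[OF z] x closure_subset[of "cube 0 1 :: (real^'n) set"] closure_unit_cube by blast
    have c1: "continuous_on ubox (\<lambda>y. w (z + side n *\<^sub>R y))"
      by (intro continuous_on_compose2[OF wc] continuous_intros) (use ub in auto)
    have i1: "(\<lambda>y. w (z + side n *\<^sub>R y) * bump y) integrable_on ubox"
      by (intro integrable_continuous continuous_intros c1 bump_continuous)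
    have i2: "(\<lambda>y. bump y) integrable_on (ubox :: (real^'n) set)" by (rule integrable_continuous[OF bump_continuous])
    have i4: "(\<lambda>y. w x * bump y) integrable_on ubox"
      by (intro integrable_continuous continuous_intros bump_continuous)
    have i3: "(\<lambda>y. (w x - w (z + side n *\<^sub>R y)) * bump y) integrable_on ubox"
      by (intro integrable_continuous continuous_intros c1 bump_continuous)
    have "integral ubox (\<lambda>y. (w x - w (z + side n *\<^sub>R y)) * bump y) = w x * ?I - integral ubox (\<lambda>y. w (z + side n *\<^sub>R y) * bump y)"
      using Henstock_Kurzweil_Integration.integral_diff[OF i4 i1] by (simp add: left_diff_distrib bump_mass_def)
    also have "\<dots> = (w x - mavg w n z) * ?I"
      using bump_mass_pos[where 'n='n] by (simp add: mavg_smooth[OF wc z] left_diff_distrib)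
    finally have eq: "(w x - mavg w n z) * ?I = integral ubox (\<lambda>y. (w x - w (z + side n *\<^sub>R y)) * bump y)" ..
    have "norm (integral ubox (\<lambda>y. (w x - w (z + side n *\<^sub>R y)) * bump y)) \<le> integral ubox (\<lambda>y :: real^'n. ?D * side n * bump y)"
    proof (rule Henstock_Kurzweil_Integration.integral_norm_bound_integral[OF i3])
      show "(\<lambda>y :: real^'n. ?D * side n * bump y) integrable_on ubox"
        by (intro integrable_continuous continuous_intros bump_continuous)
      fix y assume y: "y \<in> (ubox :: (real^'n) set)"
      have "\<bar>w x - w (z + side n *\<^sub>R y)\<bar> \<le> B * norm (x - (z + side n *\<^sub>R y))"
        by (rule lipschitz_of_grad_bound[OF V(3) _ V(2) B(2) xu ub[OF y]]) auto
      also have "norm (x - (z + side n *\<^sub>R y)) \<le> norm (x - z) + norm (side n *\<^sub>R y)"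
        using norm_triangle_ineq4[of "x - z" "side n *\<^sub>R y"] by (simp add: diff_diff_add)
      also have "\<dots> \<le> real CARD('n) * side n + side n * real CARD('n)"
      proof (rule add_mono[OF tcube_norm[OF x]])
        have "norm y \<le> (\<Sum>i\<in>(UNIV::'n set). 1)"
        proof (rule order_trans[OF norm_le_l1_cart sum_mono])
          fix i :: 'n
          have "- (1 / 2) \<le> y $ i" "y $ i \<le> 1 / 2" using y by (auto simp: mem_box_cart)
          then show "\<bar>y $ i\<bar> \<le> 1" unfolding abs_le_iff by linarith
        qed
        then show "norm (side n *\<^sub>R y) \<le> side n * real CARD('n)" by simp
      qed
      finally have "\<bar>w x - w (z + side n *\<^sub>R y)\<bar> \<le> ?D * side n" using B(1) by (simp add: algebra_simps)
      then show "norm ((w x - w (z + side n *\<^sub>R y)) * bump y) \<le> ?D * side n * bump y"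
        using bump_bounds(1)[of y] by (simp add: abs_mult mult_right_mono)
    qed
    also have "\<dots> = ?D * side n * ?I" by (simp add: bump_mass_def)
    finally have "\<bar>w x - mavg w n z\<bar> * ?I \<le> ?D * side n * ?I"
      unfolding eq[symmetric] using bump_mass_pos[where 'n='n] by (simp add: abs_mult)
    then show ?thesis using bump_mass_pos[where 'n='n] mult_right_le_imp_le by blast
  qed
  then show thesis using that[of ?D] B(1) by simp
qed

text \<open>If A carries w, the average gains the square root of the measure of A; this is the
  mechanism behind the Poincare inequality for small supports. With A the whole cube it is the plain
  L2 bound. The 2 in the denominator comes from \<open>bump\<close> <= 1/2.\<close>

lemma mavg_L2:
  fixes w :: "real^'n \<Rightarrow> real"
  assumes w: "w \<in> L2 (tcube n z)"
    and A: "A \<in> sets lebesgue" "A \<subseteq> tcube n z" "\<And>x. x \<in> tcube n z - A \<Longrightarrow> w x = 0"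
  shows "\<bar>mavg w n z\<bar> \<le> sqrt (LINT x|lebesgue_on (tcube n z). (w x)\<^sup>2) * sqrt (measure lebesgue A) /
      (2 * bump_mass TYPE('n) * vol TYPE('n) n)"
proof -
  let ?M = "lebesgue_on (tcube n z)"
  let ?g = "\<lambda>x. indicator A x * bump ((1 / side n) *\<^sub>R (x - z))"
  have Am: "A \<in> sets ?M" using A by (auto simp: sets_restrict_space_iff)
  have Afin: "emeasure ?M A < \<infinity>"
    using finite_measure.emeasure_finite[OF finite_measure_lebesgue_on[OF cube_lmeasurable], of z "side n" A]
    by (simp add: less_top[symmetric] infinity_ennreal_def)
  have bm: "(\<lambda>x. bump ((1 / side n) *\<^sub>R (x - z))) \<in> borel_measurable ?M"
    by (intro continuous_imp_measurable_on_sets_lebesgue continuous_on_compose2[OF bump_continuous[of UNIV]] continuous_intros) auto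
  have gm: "?g \<in> borel_measurable ?M" using bm Am by auto
  have ii: "integrable ?M (\<lambda>x. (1/4) * indicator A x :: real)"
    using Am Afin by (intro integrable_mult_right integrable_real_indicator)
  have le: "(?g x)\<^sup>2 \<le> (1/4) * indicator A x" for x
  proof -
    have "(bump ((1 / side n) *\<^sub>R (x - z)))\<^sup>2 \<le> (1/2)\<^sup>2"
      using bump_bounds[of "(1 / side n) *\<^sub>R (x - z)"] by (intro power_mono)
    then show ?thesis by (auto simp: indicator_def power2_eq_square)
  qed
  have gi: "integrable ?M (\<lambda>x. (?g x)\<^sup>2)"
    by (rule Bochner_Integration.integrable_bound[OF ii]) (use gm le in \<open>auto intro!: AE_I2 order_trans[OF _ abs_ge_self]\<close>)
  have g2: "(LINT x|?M. (?g x)\<^sup>2) \<le> measure lebesgue A / 4"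
  proof -
    have "(LINT x|?M. (?g x)\<^sup>2) \<le> (LINT x|?M. (1/4) * indicator A x)"
      by (rule integral_mono[OF gi ii]) (rule le)
    also have "\<dots> = measure ?M A / 4" using Am by (simp add: Int_absorb2[OF A(2)])
    also have "measure ?M A = measure lebesgue A" using A by (intro measure_restrict_space) auto
    finally show ?thesis .
  qed
  have eq: "(LINT x|?M. w x * bump ((1 / side n) *\<^sub>R (x - z))) = (LINT x|?M. w x * ?g x)"
    by (rule Bochner_Integration.integral_cong) (use A(3) in \<open>auto simp: indicator_def\<close>)
  have "\<bar>LINT x|?M. w x * ?g x\<bar> \<le> sqrt (LINT x|?M. (w x)\<^sup>2) * sqrt (LINT x|?M. (?g x)\<^sup>2)"
    by (rule integral_Cauchy_Schwarz(2)) (use w gm gi in \<open>auto simp: L2_def\<close>)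
  also have "\<dots> \<le> sqrt (LINT x|?M. (w x)\<^sup>2) * sqrt (measure lebesgue A / 4)"
    using g2 by (intro mult_left_mono) auto
  also have "sqrt (measure lebesgue A / 4) = sqrt (measure lebesgue A) / 2" by (simp add: real_sqrt_divide)
  finally have "\<bar>LINT x|?M. w x * bump ((1 / side n) *\<^sub>R (x - z))\<bar> \<le> sqrt (LINT x|?M. (w x)\<^sup>2) * sqrt (measure lebesgue A) / 2"
    unfolding eq by simp
  then have "\<bar>LINT x|?M. w x * bump ((1 / side n) *\<^sub>R (x - z))\<bar> / (bump_mass TYPE('n) * vol TYPE('n) n) \<le>
    (sqrt (LINT x|?M. (w x)\<^sup>2) * sqrt (measure lebesgue A) / 2) / (bump_mass TYPE('n) * vol TYPE('n) n)"
    using bump_mass_pos[where 'n='n] by (intro divide_right_mono) auto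
  then show ?thesis using bump_mass_pos[where 'n='n] by (simp add: mavg_def abs_divide abs_mult mult_ac)
qed

subsection \<open>Fractional Poincare estimates and duality\<close>

lemma coefficients_tcube:
  "coefficients a (cube 0 1) \<Longrightarrow> node n z \<Longrightarrow> coefficients a (tcube n z)"
  using coefficients_subset node_subset cube_open by blast

lemma energy_kids:
  assumes "coefficients a (cube 0 1)" "fin_energy a (cube 0 1) F" "node n z"
  shows "(\<Sum>z'\<in>kids n z. energy a (tcube (Suc n) z') F) = energy a (tcube n z) F"
  unfolding bil_def
  by (rule integral_kids[symmetric, OF integrable_tcube[OF _ assms(3)]])
    (use assms(2) in \<open>simp add: fin_energy_def\<close>)

lemma L2_kids:
  assumes "u \<in> L2 (cube 0 1)" "node n z"
  shows "(\<Sum>z'\<in>kids n z. LINT x|lebesgue_on (tcube (Suc n) z'). (u x)\<^sup>2) = (LINT x|lebesgue_on (tcube n z). (u x)\<^sup>2)"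
  by (rule integral_kids[symmetric, OF integrable_tcube[OF _ assms(2)]]) (use assms(1) in \<open>simp add: L2_def\<close>)

lemma energy_tcube_nonneg:
  "coefficients a (cube 0 1) \<Longrightarrow> node n z \<Longrightarrow> 0 \<le> energy a (tcube n z) F"
  using coefficients.energy_nonneg coefficients_tcube by blast

text \<open>The sum of a geometric series of ratio 3^(t-1): per generation a Lipschitz weight gains
  1/3, while the bound on the mean gradient loses 3^t. The factor 3 bounds 3^t for the shift to the
  children, and CARD('n) comes from the distance between the centres of child and parent.\<close>

definition const_lip :: "'n::finite itself \<Rightarrow> real \<Rightarrow> real" where
  "const_lip T t = 3 * real CARD('n) / (1 - 3 powr (t - 1))"

text \<open>From \<open>mavg_kid\<close>: CARD('n) components, 3 ^ CARD('n) from the volume of the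
  smallest intermediate cube, and 1 + 3 \<open>const_lip\<close> from
  \<open>lipschitz_pairing\<close> for a weight bounded by the side with Lipschitz constant
  3.\<close>

definition const_avg :: "'n::finite itself \<Rightarrow> real \<Rightarrow> real" where
  "const_avg T t = real CARD('n) * 3 ^ CARD('n) * (1 + 3 * const_lip T t) / bump_mass T"

text \<open>Again a geometric series, now of ratio 3^(s+t-1). The number of children enters because
  each child is estimated by its parent; the sum in brackets collects the change of the average of w
  and the change of the second factor g.\<close>

definition const_pair :: "'n::finite itself \<Rightarrow> real \<Rightarrow> real \<Rightarrow> real" where
  "const_pair T s t = 3 * real (card (offsets :: (real^'n) set)) *
     (const_avg T t + real CARD('n) / (2 * bump_mass T)) / (1 - 3 powr (s + t - 1))"

lemma powr_less_one: "x < 0 \<Longrightarrow> 3 powr x < (1::real)"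
  using powr_less_mono[of x 0 "3::real"] by simp

lemma const_lip_nonneg: "t < 1 \<Longrightarrow> 0 \<le> const_lip TYPE('n::finite) t"
  unfolding const_lip_def using powr_less_one[of "t - 1"] by simp

lemma const_avg_nonneg: "t < 1 \<Longrightarrow> 0 \<le> const_avg TYPE('n::finite) t"
  unfolding const_avg_def using const_lip_nonneg[where 'n='n] bump_mass_pos[where 'n='n]
  by (intro divide_nonneg_pos mult_nonneg_nonneg add_nonneg_nonneg) auto

lemma const_pair_nonneg: "0 \<le> s \<Longrightarrow> s + t < 1 \<Longrightarrow> 0 \<le> const_pair TYPE('n::finite) s t"
  unfolding const_pair_def using const_avg_nonneg[where 'n='n and t=t] bump_mass_pos[where 'n='n] powr_less_one[of "s + t - 1"]
  by (intro divide_nonneg_pos mult_nonneg_nonneg add_nonneg_nonneg) auto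

lemma powr_side: "(3 powr t) ^ n * side n = (3 powr (t - 1)) ^ n"
  by (simp add: power_mult_distrib[symmetric] powr_diff)

text \<open>PB stands for the multiscale sum in \<open>lambda_low\<close>, freed from its
  normalising factor. \<open>grad_mean\<close> is the form in which its finiteness is used: on a
  cube of generation n the coarse-grained bound may be worse by 3^(t n).\<close>

locale lower_coarse = coefficients a "cube 0 1" for a :: "real^'n \<Rightarrow> real^'n^'n" +
  fixes t PB :: real
  assumes t: "0 < t" "t < 1" and PB: "0 \<le> PB"
    and grad_mean: "\<And>n z w i. node n z \<Longrightarrow> w \<in> smooth_up_to_boundary (cube 0 1) \<Longrightarrow>
      \<bar>LINT x|lebesgue_on (tcube n z). grad w x $ i\<bar> \<le>
        sqrt (vol TYPE('n) n) * (PB * (3 powr t) ^ n) * sqrt (energy a (tcube n z) (grad w))"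
begin

lemma field_unit: "coefficients a (cube 0 1)" by unfold_locales

text \<open>Telescoping of F through its values at the centres. The increments are of the order of
  the side, which beats the growth 3^(t n) of the bound for the mean gradients because t <
  1.\<close>

lemma lipschitz_pairing:
  assumes w: "w \<in> smooth_up_to_boundary (cube 0 1)" and z: "node n z"
    and F: "\<And>x y. \<bar>F x - F y\<bar> \<le> L * norm (x - y)" and L: "0 \<le> L"
  shows "\<bar>LINT x|lebesgue_on (tcube n z). F x * grad w x $ i\<bar> \<le>
    (\<bar>F z\<bar> + const_lip TYPE('n) t * L * side n) * (PB * (3 powr t) ^ n) * (sqrt (vol TYPE('n) n) * sqrt (energy a (tcube n z) (grad w)))"
proof -
  let ?q = "3 powr (t - 1)" and ?d = "real CARD('n)"
  \<comment> \<open>Away from the unit cube a need not be positive, whereas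
    \<open>multiscale_pairing\<close> wants e nonnegative for all indices; hence the case
    distinction.\<close>
  define e where "e n z = (if node n z then sqrt (vol TYPE('n) n) * sqrt (energy a (tcube n z) (grad w)) else 0)" for n z
  have fw: "fin_energy a (cube 0 1) (grad w)" by (rule smooth_fin_energy[OF w])
  have q: "?q < 1" "0 \<le> ?q" using t powr_less_one by auto
  have e0: "0 \<le> e n z" for n z by (simp add: e_def energy_tcube_nonneg[OF field_unit])
  have e_kids: "(\<Sum>z'\<in>kids n z. e (Suc n) z') \<le> e n z" if z: "node n z" for n z
  proof -
    have "(\<Sum>z'\<in>kids n z. e (Suc n) z') = (\<Sum>z'\<in>kids n z. sqrt (vol TYPE('n) (Suc n)) * sqrt (energy a (tcube (Suc n) z') (grad w)))"
      by (rule sum.cong) (use node.kid[OF z] in \<open>auto simp: e_def simp del: power_Suc\<close>)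
    also have "\<dots> \<le> sqrt (vol TYPE('n) n) * sqrt (energy a (tcube n z) (grad w))"
      by (rule sum_sqrt_mult_le) (use vol_kids energy_kids[OF field_unit fw z] energy_tcube_nonneg[OF field_unit node.kid[OF z]] in \<open>auto simp del: power_Suc\<close>)
    finally show ?thesis using z by (simp add: e_def)
  qed
  have "\<bar>(LINT x|lebesgue_on (tcube n z). F x * grad w x $ i) - F z * (LINT x|lebesgue_on (tcube n z). grad w x $ i)\<bar> \<le>
    (3 * L * ?d * PB) * ?q ^ n / (1 - ?q) * e n z"
  proof (rule multiscale_pairing[where c="\<lambda>n z. F z" and D="L * ?d"])
    show "integrable (lebesgue_on (cube 0 1)) (\<lambda>x. grad w x $ i)"
      using integrable_bounded_linear[OF bounded_linear_vec_nth fin_integrable[OF fw]] .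
    have "continuous_on UNIV F"
      by (rule lipschitz_on_continuous_on[of L]) (use F L in \<open>auto simp: lipschitz_on_def dist_norm\<close>)
    then show "F \<in> borel_measurable (lebesgue_on (cube 0 1))"
      by (intro continuous_imp_measurable_on_sets_lebesgue) (auto intro: continuous_on_subset)
    show "\<bar>F x - F z\<bar> \<le> L * ?d * side n" if "node n z" "x \<in> tcube n z" for n z x
      by (rule order_trans[OF F]) (use mult_left_mono[OF tcube_norm[OF that(2)] L] in \<open>simp add: mult.assoc\<close>)
    show "(\<Sum>z'\<in>kids n z. \<bar>F z' - F z\<bar> * \<bar>LINT x|lebesgue_on (tcube (Suc n) z'). grad w x $ i\<bar>) \<le> (3 * L * ?d * PB) * ?q ^ n * e n z"
      if z: "node n z" for n z
    proof -
      have T3: "3 powr t \<le> 3" using powr_mono[of t 1 "3::real"] t by simp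
      have "(\<Sum>z'\<in>kids n z. \<bar>F z' - F z\<bar> * \<bar>LINT x|lebesgue_on (tcube (Suc n) z'). grad w x $ i\<bar>) \<le>
        (\<Sum>z'\<in>kids n z. (L * (?d * side n)) * ((PB * (3 * (3 powr t) ^ n)) * e (Suc n) z'))"
      proof (rule sum_mono)
        fix z' assume z': "z' \<in> kids n z"
        have "\<bar>LINT x|lebesgue_on (tcube (Suc n) z'). grad w x $ i\<bar> \<le> (PB * (3 powr t) ^ Suc n) * e (Suc n) z'"
          using grad_mean[OF node.kid[OF z z'] w, of i] node.kid[OF z z'] by (simp add: e_def mult_ac del: power_Suc)
        also have "\<dots> \<le> (PB * (3 * (3 powr t) ^ n)) * e (Suc n) z'"
          using PB T3 e0 by (intro mult_right_mono mult_left_mono) auto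
        finally have 1: "\<bar>LINT x|lebesgue_on (tcube (Suc n) z'). grad w x $ i\<bar> \<le> (PB * (3 * (3 powr t) ^ n)) * e (Suc n) z'" .
        have "\<bar>F z' - F z\<bar> \<le> L * (?d * side n)"
          by (rule order_trans[OF F mult_left_mono[OF kids_norm[OF z'] L]])
        then show "\<bar>F z' - F z\<bar> * \<bar>LINT x|lebesgue_on (tcube (Suc n) z'). grad w x $ i\<bar> \<le> (L * (?d * side n)) * ((PB * (3 * (3 powr t) ^ n)) * e (Suc n) z')"
          using 1 L by (intro mult_mono) auto
      qed
      also have "\<dots> = (3 * L * ?d * PB) * ((3 powr t) ^ n * side n) * (\<Sum>z'\<in>kids n z. e (Suc n) z')"
        unfolding mult.assoc[symmetric] sum_distrib_left[symmetric] by (simp add: mult_ac)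
      also have "\<dots> \<le> (3 * L * ?d * PB) * ((3 powr t) ^ n * side n) * e n z"
        using L PB by (intro mult_left_mono e_kids[OF z]) auto
      finally show ?thesis unfolding powr_side .
    qed
    show "0 \<le> e n z" for n z by (simp add: e_def energy_tcube_nonneg[OF field_unit])
  qed (use e_kids q L PB z in auto)
  also have "(3 * L * ?d * PB) * ?q ^ n / (1 - ?q) * e n z = const_lip TYPE('n) t * L * side n * (PB * (3 powr t) ^ n) * e n z"
    unfolding const_lip_def powr_side[symmetric] by simp
  finally have 1: "\<bar>(LINT x|lebesgue_on (tcube n z). F x * grad w x $ i) - F z * (LINT x|lebesgue_on (tcube n z). grad w x $ i)\<bar> \<le>
    const_lip TYPE('n) t * L * side n * (PB * (3 powr t) ^ n) * e n z" .
  have "\<bar>F z * (LINT x|lebesgue_on (tcube n z). grad w x $ i)\<bar> \<le> \<bar>F z\<bar> * ((PB * (3 powr t) ^ n) * e n z)"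
    unfolding abs_mult using grad_mean[OF z w, of i] z by (intro mult_left_mono) (auto simp: e_def mult_ac)
  with 1 have "\<bar>LINT x|lebesgue_on (tcube n z). F x * grad w x $ i\<bar> \<le>
    const_lip TYPE('n) t * L * side n * (PB * (3 powr t) ^ n) * e n z + \<bar>F z\<bar> * ((PB * (3 powr t) ^ n) * e n z)" by linarith
  then show ?thesis using z by (simp add: e_def algebra_simps)
qed

text \<open>The parent cube is deformed linearly into its child. The derivative of the weighted
  average along the deformation is an integral of grad w against Lipschitz weights, one for the
  translation and one for the shrinking, and \<open>lipschitz_pairing\<close> bounds it.\<close>

lemma mavg_kid:
  assumes w: "w \<in> smooth_up_to_boundary (cube 0 1)" and z: "node n z" and z': "z' \<in> kids n z"
  shows "\<bar>mavg w (Suc n) z' - mavg w n z\<bar> \<le>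
    const_avg TYPE('n) t * (3 powr (t - 1)) ^ n * PB * sqrt (energy a (tcube n z) (grad w)) / sqrt (vol TYPE('n) n)"
proof -
  let ?d = "real CARD('n)" and ?I = "bump_mass TYPE('n)" and ?E = "energy a (tcube n z) (grad w)"
  obtain V where V: "open V" "ubox \<subseteq> V" "smooth_on V w" using smooth_unit_cubeE[OF w] by metis
  \<comment> \<open>The cube with centre \<open>zz\<close> and side \<open>rr\<close> is the parent
    for parameter 0 and the child for parameter 1; zeta and r' are the velocities of its centre and
    its side.\<close>
  define \<zeta> where "\<zeta> = z' - z"
  define r' where "r' = - (2 / 3) * side n"
  define zz where "zz \<tau> = z + \<tau> *\<^sub>R \<zeta>" for \<tau>
  define rr where "rr \<tau> = side n + \<tau> * r'" for \<tau>
  have \<zeta>: "\<bar>\<zeta> $ i\<bar> \<le> side n / 3" for i using kids_nth[OF z', of i] by (simp add: \<zeta>_def)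
  have rr: "side n / 3 \<le> rr \<tau>" "rr \<tau> > 0" "rr \<tau> \<le> side n" if "\<tau> \<in> {0..1}" for \<tau>
  proof -
    have "\<tau> * side n \<le> 1 * side n" "0 \<le> \<tau> * side n" using that by (auto intro!: mult_right_mono)
    then show 1: "side n / 3 \<le> rr \<tau>" "rr \<tau> \<le> side n" by (auto simp: rr_def r'_def)
    show "rr \<tau> > 0" using 1(1) side_pos(1)[of n] by linarith
  qed
  have coord: "\<bar>x $ i - z $ i\<bar> \<le> side n / 2" if "\<bar>x $ i - zz \<tau> $ i\<bar> \<le> rr \<tau> / 2" "\<tau> \<in> {0..1}" for x i \<tau>
  proof -
    have "\<bar>x $ i - z $ i\<bar> \<le> \<bar>x $ i - zz \<tau> $ i\<bar> + \<bar>\<tau> * \<zeta> $ i\<bar>"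
      using abs_triangle_ineq[of "x $ i - zz \<tau> $ i" "\<tau> * \<zeta> $ i"] by (simp add: zz_def)
    also have "\<bar>\<tau> * \<zeta> $ i\<bar> \<le> \<tau> * (side n / 3)"
      using that(2) mult_left_mono[OF \<zeta>[of i], of \<tau>] by (simp add: abs_mult)
    finally show ?thesis using that(1) by (simp add: rr_def r'_def algebra_simps)
  qed
  have sub: "cube (zz \<tau>) (rr \<tau>) \<subseteq> tcube n z" if "\<tau> \<in> {0..1}" for \<tau>
  proof (rule cube_subset)
    fix i
    have "\<bar>zz \<tau> $ i - z $ i\<bar> \<le> \<tau> * (side n / 3)"
      using that mult_left_mono[OF \<zeta>[of i], of \<tau>] by (simp add: zz_def abs_mult)
    then show "\<bar>zz \<tau> $ i - z $ i\<bar> \<le> (side n - rr \<tau>) / 2" by (simp add: rr_def r'_def algebra_simps)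
  qed
  have csub: "cbox (zz \<tau> - (\<chi> i. rr \<tau> / 2)) (zz \<tau> + (\<chi> i. rr \<tau> / 2)) \<subseteq> ubox" if \<tau>: "\<tau> \<in> {0..1}" for \<tau>
  proof (rule subset_trans[OF subsetI closed_tcube_subset[OF z]])
    fix x assume x: "x \<in> cbox (zz \<tau> - (\<chi> i. rr \<tau> / 2)) (zz \<tau> + (\<chi> i. rr \<tau> / 2))"
    show "x \<in> cbox (z - (\<chi> i. side n / 2)) (z + (\<chi> i. side n / 2))"
      unfolding mem_box_cart
    proof
      fix i
      have "zz \<tau> $ i - rr \<tau> / 2 \<le> x $ i" "x $ i \<le> zz \<tau> $ i + rr \<tau> / 2" using x by (auto simp: mem_box_cart)
      then have "\<bar>x $ i - zz \<tau> $ i\<bar> \<le> rr \<tau> / 2" unfolding abs_le_iff by linarith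
      from coord[OF this \<tau>] show "(z - (\<chi> i. side n / 2)) $ i \<le> x $ i \<and> x $ i \<le> (z + (\<chi> i. side n / 2)) $ i"
        unfolding abs_le_iff by simp
    qed
  qed
  have ysub: "zz \<tau> + rr \<tau> *\<^sub>R y \<in> ubox" if \<tau>: "\<tau> \<in> {0..1}" and y: "y \<in> ubox" for \<tau> y
  proof (rule subsetD[OF csub[OF \<tau>]], unfold mem_box_cart, intro allI conjI)
    fix i
    have "rr \<tau> * (- (1 / 2)) \<le> rr \<tau> * y $ i" "rr \<tau> * y $ i \<le> rr \<tau> * (1 / 2)"
      using y rr(2)[OF \<tau>] by (intro mult_left_mono; simp add: mem_box_cart)+
    then show "(zz \<tau> - (\<chi> i. rr \<tau> / 2)) $ i \<le> (zz \<tau> + rr \<tau> *\<^sub>R y) $ i" "(zz \<tau> + rr \<tau> *\<^sub>R y) $ i \<le> (zz \<tau> + (\<chi> i. rr \<tau> / 2)) $ i"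
      by simp_all
  qed
  define g where "g \<tau> = integral ubox (\<lambda>y. w (zz \<tau> + rr \<tau> *\<^sub>R y) * bump y)" for \<tau>
  define fx where "fx \<tau> y = (grad w (zz \<tau> + rr \<tau> *\<^sub>R y) \<bullet> (\<zeta> + r' *\<^sub>R y)) * bump y" for \<tau> and y :: "real^'n"
  have wc: "continuous_on V w" "continuous_on V (grad w)"
    using smooth_on_continuous[OF V(3)] smooth_on_grad_continuous[OF V(3,1)] by auto
  have deriv: "(g has_field_derivative integral ubox (fx \<tau>)) (at \<tau> within {0..1})" if \<tau>: "\<tau> \<in> {0..1}" for \<tau>
    unfolding g_def
  proof (rule leibniz_rule_field_derivative[OF _ _ _ \<tau>])
    fix \<tau> and y :: "real^'n" assume *: "\<tau> \<in> {0..1::real}" "y \<in> ubox"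
    have d1: "(w has_derivative (\<lambda>h. h \<bullet> grad w (zz \<tau> + rr \<tau> *\<^sub>R y))) (at (zz \<tau> + rr \<tau> *\<^sub>R y))"
      using smooth_on_GDERIV[OF V(3)] ysub[OF *] V(2) unfolding gderiv_def by blast
    have d2: "((\<lambda>\<tau>. zz \<tau> + rr \<tau> *\<^sub>R y) has_derivative (\<lambda>h. h *\<^sub>R (\<zeta> + r' *\<^sub>R y))) (at \<tau>)"
      unfolding zz_def rr_def by (auto intro!: derivative_eq_intros simp: algebra_simps)
    have "((\<lambda>\<tau>. w (zz \<tau> + rr \<tau> *\<^sub>R y)) has_derivative (\<lambda>h. (h *\<^sub>R (\<zeta> + r' *\<^sub>R y)) \<bullet> grad w (zz \<tau> + rr \<tau> *\<^sub>R y))) (at \<tau>)"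
      by (rule has_derivative_compose[OF d2 d1])
    moreover have "(\<lambda>h. (h *\<^sub>R (\<zeta> + r' *\<^sub>R y)) \<bullet> grad w (zz \<tau> + rr \<tau> *\<^sub>R y)) = (*) (grad w (zz \<tau> + rr \<tau> *\<^sub>R y) \<bullet> (\<zeta> + r' *\<^sub>R y))"
      by (auto simp: inner_commute)
    ultimately have "((\<lambda>\<tau>. w (zz \<tau> + rr \<tau> *\<^sub>R y)) has_real_derivative grad w (zz \<tau> + rr \<tau> *\<^sub>R y) \<bullet> (\<zeta> + r' *\<^sub>R y)) (at \<tau>)"
      by (simp add: has_field_derivative_def)
    from DERIV_cmult_right[OF this, of "bump y"]
    show "((\<lambda>\<tau>. w (zz \<tau> + rr \<tau> *\<^sub>R y) * bump y) has_real_derivative fx \<tau> y) (at \<tau> within {0..1})"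
      unfolding fx_def by (rule has_field_derivative_at_within)
  next
    fix \<tau> assume *: "\<tau> \<in> {0..1::real}"
    show "(\<lambda>y. w (zz \<tau> + rr \<tau> *\<^sub>R y) * bump y) integrable_on ubox"
      by (intro integrable_continuous continuous_intros bump_continuous continuous_on_compose2[OF wc(1)])
        (use ysub[OF *] V(2) in auto)
  next
    show "continuous_on ({0..1} \<times> ubox) (\<lambda>(\<tau>, y). fx \<tau> y)"
      unfolding fx_def case_prod_beta zz_def rr_def
    proof (intro continuous_intros continuous_on_compose2[OF wc(2)] continuous_on_compose2[OF bump_continuous[of UNIV]])
      show "(\<lambda>p. z + fst p *\<^sub>R \<zeta> + (side n + fst p * r') *\<^sub>R snd p) ` ({0..1} \<times> ubox) \<subseteq> V"
        using ysub V(2) unfolding zz_def rr_def by auto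
    qed auto
  qed auto
  define Bd where "Bd = 3 ^ CARD('n) / vol TYPE('n) n * (?d * ((side n + 3 * const_lip TYPE('n) t * side n) * (PB * (3 powr t) ^ n) * (sqrt (vol TYPE('n) n) * sqrt ?E)))"
  have bound: "\<bar>integral ubox (fx \<tau>)\<bar> \<le> Bd" if \<tau>: "\<tau> \<in> {0..1}" for \<tau>
  proof -
    \<comment> \<open>Y undoes the rescaling. F i is the i-th component of the velocity zeta + r' y
      of the deformation times the tent, as a function of x; it has Lipschitz constant 3 because the
      side never drops below a third of the side of the parent.\<close>
    define Y where "Y x = (1 / rr \<tau>) *\<^sub>R (x - zz \<tau>)" for x
    define F where "F i x = \<zeta> $ i * bump (Y x) + r' * (Y x $ i * bump (Y x))" for i x
    define H where "H x = (\<Sum>i\<in>UNIV. F i x * grad w x $ i)" for x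
    have Yl: "norm (Y x - Y y) = norm (x - y) / rr \<tau>" for x y
      unfolding Y_def scaleR_diff_right[symmetric] using rr(2)[OF \<tau>] by simp
    have r'a: "\<bar>r'\<bar> = 2 / 3 * side n" by (simp add: r'_def abs_mult)
    have Flip: "\<bar>F i x - F i y\<bar> \<le> 3 * norm (x - y)" for i x y
    proof -
      have "\<bar>F i x - F i y\<bar> = \<bar>\<zeta> $ i * (bump (Y x) - bump (Y y)) + r' * (Y x $ i * bump (Y x) - Y y $ i * bump (Y y))\<bar>"
        by (simp add: F_def algebra_simps)
      also have "\<dots> \<le> \<bar>\<zeta> $ i\<bar> * \<bar>bump (Y x) - bump (Y y)\<bar> + \<bar>r'\<bar> * \<bar>Y x $ i * bump (Y x) - Y y $ i * bump (Y y)\<bar>"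
        unfolding abs_mult[symmetric] by (rule abs_triangle_ineq)
      also have "\<dots> \<le> side n / 3 * norm (Y x - Y y) + 2 / 3 * side n * norm (Y x - Y y)"
        using \<zeta>[of i] by (intro add_mono mult_mono bump_lipschitz coord_bump_lipschitz) (auto simp: r'a)
      also have "\<dots> = side n / rr \<tau> * norm (x - y)" unfolding Yl by (simp add: field_simps)
      also have "\<dots> \<le> 3 * norm (x - y)"
        using rr(1,2)[OF \<tau>] by (intro mult_right_mono) (auto simp: field_simps)
      finally show ?thesis .
    qed
    have Fb: "\<bar>F i x\<bar> \<le> side n" for i x
    proof -
      have "\<bar>F i x\<bar> \<le> \<bar>\<zeta> $ i\<bar> * \<bar>bump (Y x)\<bar> + \<bar>r'\<bar> * \<bar>Y x $ i * bump (Y x)\<bar>"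
        unfolding F_def abs_mult[symmetric] by (rule abs_triangle_ineq)
      also have "\<dots> \<le> side n / 3 * (1 / 2) + 2 / 3 * side n * (1 / 4)"
        using \<zeta>[of i] bump_bounds[of "Y x"] coord_bump_bound[of "Y x" i] by (intro add_mono mult_mono) (auto simp: r'a)
      finally show ?thesis by simp
    qed
    have F0: "F i x = 0" if out: "x \<notin> cube (zz \<tau>) (rr \<tau>)" for i x
    proof -
      obtain j where "\<not> \<bar>x $ j - zz \<tau> $ j\<bar> < rr \<tau> / 2" using out unfolding cube_def by blast
      then have "rr \<tau> / 2 \<le> \<bar>x $ j - zz \<tau> $ j\<bar>" by simp
      then have "1 / 2 \<le> \<bar>Y x $ j\<bar>" using rr(2)[OF \<tau>] by (simp add: Y_def abs_mult field_simps)
      then show ?thesis using bump_outside[of "Y x" j] by (simp add: F_def)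
    qed
    have Fc: "continuous_on S (F i)" for S i unfolding F_def Y_def
      by (intro continuous_intros continuous_on_compose2[OF bump_continuous[of UNIV]]) auto
    have gi: "continuous_on ubox (\<lambda>x. grad w x $ i)" for i
      using wc(2) V(2) by (intro continuous_intros) (auto intro: continuous_on_subset)
    have Hc: "continuous_on ubox H" unfolding H_def
      by (intro continuous_intros Fc gi)
    have "integral ubox (fx \<tau>) = integral ubox (\<lambda>y. H (zz \<tau> + rr \<tau> *\<^sub>R y))"
    proof (rule Henstock_Kurzweil_Integration.integral_cong)
      fix y :: "real^'n"
      have "Y (zz \<tau> + rr \<tau> *\<^sub>R y) = y" using rr(2)[OF \<tau>] by (simp add: Y_def)
      then show "fx \<tau> y = H (zz \<tau> + rr \<tau> *\<^sub>R y)"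
        unfolding fx_def H_def F_def by (simp add: inner_vec_def sum_distrib_right sum_distrib_left algebra_simps)
    qed
    also have "\<dots> = (LINT x|lebesgue_on (cube (zz \<tau>) (rr \<tau>)). H x) / rr \<tau> ^ CARD('n)"
      by (rule integral_ubox_affine[OF rr(2)[OF \<tau>] continuous_on_subset[OF Hc csub[OF \<tau>]]])
    \<comment> \<open>The intermediate cube is not triadic in general, but the weights vanish
      outside it. The integral may thus be taken over the parent, where the coarse-grained bounds
      hold.\<close>
    also have "(LINT x|lebesgue_on (cube (zz \<tau>) (rr \<tau>)). H x) = (LINT x|lebesgue_on (tcube n z). H x)"
      by (rule integral_lebesgue_on_zero_outside[symmetric]) (use sub[OF \<tau>] F0 in \<open>auto simp: H_def\<close>)
    also have "(LINT x|lebesgue_on (tcube n z). H x) = (\<Sum>i\<in>UNIV. LINT x|lebesgue_on (tcube n z). F i x * grad w x $ i)"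
      unfolding H_def
    proof (rule Bochner_Integration.integral_sum)
      fix i
      have "continuous_on ubox (\<lambda>x. F i x * grad w x $ i)" by (intro continuous_intros Fc gi)
      from absolutely_integrable_imp_integrable[OF absolutely_integrable_continuous[OF this]]
      show "integrable (lebesgue_on (tcube n z)) (\<lambda>x. F i x * grad w x $ i)"
        by (rule integrable_lebesgue_on_subset)
          (use node_subset[OF z] closure_subset[of "cube 0 1 :: (real^'n) set"] closure_unit_cube in \<open>auto; blast\<close>)+
    qed
    finally have "\<bar>integral ubox (fx \<tau>)\<bar> = \<bar>\<Sum>i\<in>UNIV. LINT x|lebesgue_on (tcube n z). F i x * grad w x $ i\<bar> / rr \<tau> ^ CARD('n)"
      using rr(2)[OF \<tau>] by (simp add: abs_divide)
    also have "\<dots> \<le> (\<Sum>i\<in>(UNIV :: 'n set). (side n + 3 * const_lip TYPE('n) t * side n) * (PB * (3 powr t) ^ n) * (sqrt (vol TYPE('n) n) * sqrt ?E)) / (side n / 3) ^ CARD('n)"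
    proof (intro frac_le)
      show "\<bar>\<Sum>i\<in>UNIV. LINT x|lebesgue_on (tcube n z). F i x * grad w x $ i\<bar> \<le> (\<Sum>i\<in>(UNIV :: 'n set). (side n + 3 * const_lip TYPE('n) t * side n) * (PB * (3 powr t) ^ n) * (sqrt (vol TYPE('n) n) * sqrt ?E))"
      proof (rule order_trans[OF sum_abs sum_mono])
        fix i
        have "\<bar>LINT x|lebesgue_on (tcube n z). F i x * grad w x $ i\<bar> \<le>
          (\<bar>F i z\<bar> + const_lip TYPE('n) t * 3 * side n) * (PB * (3 powr t) ^ n) * (sqrt (vol TYPE('n) n) * sqrt ?E)"
          by (rule lipschitz_pairing[OF w z Flip]) simp
        also have "\<dots> \<le> (side n + 3 * const_lip TYPE('n) t * side n) * (PB * (3 powr t) ^ n) * (sqrt (vol TYPE('n) n) * sqrt ?E)"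
          using Fb[of i z] PB energy_tcube_nonneg[OF field_unit z] by (intro mult_right_mono) auto
        finally show "\<bar>LINT x|lebesgue_on (tcube n z). F i x * grad w x $ i\<bar> \<le> (side n + 3 * const_lip TYPE('n) t * side n) * (PB * (3 powr t) ^ n) * (sqrt (vol TYPE('n) n) * sqrt ?E)" .
      qed
      show "0 \<le> (\<Sum>i\<in>(UNIV :: 'n set). (side n + 3 * const_lip TYPE('n) t * side n) * (PB * (3 powr t) ^ n) * (sqrt (vol TYPE('n) n) * sqrt ?E))"
        using PB energy_tcube_nonneg[OF field_unit z] const_lip_nonneg[OF t(2), where 'n='n] by (intro sum_nonneg mult_nonneg_nonneg add_nonneg_nonneg) auto
      show "(side n / 3) ^ CARD('n) \<le> rr \<tau> ^ CARD('n)" using rr(1)[OF \<tau>] by (intro power_mono) auto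
    qed auto
    also have "\<dots> = Bd" by (simp add: Bd_def vol_def power_divide)
    finally show ?thesis .
  qed
  have "norm (g 1 - g 0) \<le> Bd * norm (1 - 0 :: real)"
    by (rule field_differentiable_bound[OF _ deriv]) (use bound in auto)
  then have gb: "\<bar>g 1 - g 0\<bar> \<le> Bd" by simp
  have wu: "continuous_on ubox w" using wc(1) V(2) continuous_on_subset by blast
  have "mavg w n z = g 0 / ?I" unfolding mavg_smooth[OF wu z] g_def by (simp add: zz_def rr_def)
  moreover have "mavg w (Suc n) z' = g 1 / ?I"
    unfolding mavg_smooth[OF wu node.kid[OF z z']] g_def by (simp add: zz_def rr_def r'_def \<zeta>_def)
  ultimately have "\<bar>mavg w (Suc n) z' - mavg w n z\<bar> = \<bar>g 1 - g 0\<bar> / ?I"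
    using bump_mass_pos[where 'n='n] by (simp add: diff_divide_distrib[symmetric] abs_divide)
  also have "\<dots> \<le> Bd / ?I" using gb bump_mass_pos[where 'n='n] by (intro divide_right_mono) auto
  also have "\<dots> = const_avg TYPE('n) t * ((3 powr t) ^ n * side n) * PB * (sqrt ?E * (sqrt (vol TYPE('n) n) / vol TYPE('n) n))"
    by (simp add: Bd_def const_avg_def algebra_simps)
  also have "sqrt (vol TYPE('n) n) / vol TYPE('n) n = 1 / sqrt (vol TYPE('n) n)"
    using real_div_sqrt[of "vol TYPE('n) n"] by (simp add: divide_simps)
  finally show ?thesis unfolding powr_side by simp
qed

end

text \<open>The product w g is telescoped through the averages of w times the values of g at the
  centres. The increment of the averages gains 3^(t-1) per generation, the means of f lose 3^s, so
  the series converges exactly because s + t < 1. It is used twice: with f = w, g = 1 and s = 0 for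
  the Poincare inequality, and with f a component of a flux and g a derivative of the cutoff for the
  Caccioppoli inequality.\<close>

lemma (in lower_coarse) pairing_bound:
  fixes f g :: "real^'n \<Rightarrow> real" and ef :: "nat \<Rightarrow> real^'n \<Rightarrow> real"
  assumes w: "w \<in> smooth_up_to_boundary (cube 0 1)"
    and f: "integrable (lebesgue_on (cube 0 1)) f"
    and fb: "\<And>n z. node n z \<Longrightarrow> \<bar>LINT x|lebesgue_on (tcube n z). f x\<bar> \<le>
      sqrt (vol TYPE('n) n) * (P * (3 powr s) ^ n) * sqrt (ef n z)"
    and ef: "\<And>n z. node n z \<Longrightarrow> 0 \<le> ef n z" "\<And>n z. node n z \<Longrightarrow> (\<Sum>z'\<in>kids n z. ef (Suc n) z') \<le> ef n z"
    and P: "0 \<le> P" and s: "0 \<le> s" "s + t < 1"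
    and g: "\<And>x. \<bar>g x\<bar> \<le> G0" "\<And>x y. \<bar>g x - g y\<bar> \<le> G1 * norm (x - y)" "0 \<le> G1"
    and z: "node n z"
  shows "\<bar>(LINT x|lebesgue_on (tcube n z). (w x * g x) * f x) - mavg w n z * g z * (LINT x|lebesgue_on (tcube n z). f x)\<bar> \<le>
    const_pair TYPE('n) s t * (3 powr (s + t - 1)) ^ n *
      (P * (G0 * PB * sqrt (energy a (tcube n z) (grad w)) + G1 * sqrt (LINT x|lebesgue_on (tcube n z). (w x)\<^sup>2)) * sqrt (ef n z))"
proof -
  let ?q = "3 powr (s + t - 1)" and ?d = "real CARD('n)" and ?I = "bump_mass TYPE('n)" and ?N = "real (card (offsets :: (real^'n) set))"
  define E where "E n z = energy a (tcube n z) (grad w)" for n z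
  define l where "l n z = (LINT x|lebesgue_on (tcube n z). (w x)\<^sup>2)" for n z
  define e where "e n z = (if node n z then P * (G0 * PB * sqrt (E n z) + G1 * sqrt (l n z)) * sqrt (ef n z) else 0)" for n z
  define B where "B = const_avg TYPE('n) t + ?d / (2 * ?I)"
  have fw: "fin_energy a (cube 0 1) (grad w)" by (rule smooth_fin_energy[OF w])
  have wL2: "w \<in> L2 (cube 0 1)" by (rule smooth_L2[OF w])
  have G0: "0 \<le> G0" using g(1)[of 0] by simp
  have q: "?q < 1" "0 \<le> ?q" using s powr_less_one by auto
  have E0: "0 \<le> E n z" if "node n z" for n z using energy_tcube_nonneg[OF field_unit that] by (simp add: E_def)
  have l0: "0 \<le> l n z" for n z by (simp add: l_def)
  have I: "0 < ?I" by (rule bump_mass_pos)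
  have B0: "0 \<le> B" unfolding B_def using const_avg_nonneg[OF t(2), where 'n='n] I by simp
  have e_kids: "(\<Sum>z'\<in>kids n z. e (Suc n) z') \<le> e n z" if z: "node n z" for n z
  proof -
    have "(\<Sum>z'\<in>kids n z. e (Suc n) z') = (\<Sum>z'\<in>kids n z. P * G0 * PB * (sqrt (E (Suc n) z') * sqrt (ef (Suc n) z')) + P * G1 * (sqrt (l (Suc n) z') * sqrt (ef (Suc n) z')))"
      by (rule sum.cong) (use node.kid[OF z] in \<open>auto simp: e_def algebra_simps simp del: power_Suc\<close>)
    also have "\<dots> = P * G0 * PB * (\<Sum>z'\<in>kids n z. sqrt (E (Suc n) z') * sqrt (ef (Suc n) z')) + P * G1 * (\<Sum>z'\<in>kids n z. sqrt (l (Suc n) z') * sqrt (ef (Suc n) z'))"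
      by (simp add: sum.distrib sum_distrib_left)
    also have "\<dots> \<le> P * G0 * PB * (sqrt (E n z) * sqrt (ef n z)) + P * G1 * (sqrt (l n z) * sqrt (ef n z))"
    proof (intro add_mono mult_left_mono)
      show "(\<Sum>z'\<in>kids n z. sqrt (E (Suc n) z') * sqrt (ef (Suc n) z')) \<le> sqrt (E n z) * sqrt (ef n z)"
        by (rule sum_sqrt_mult_le[OF E0[OF node.kid[OF z]] ef(1)[OF node.kid[OF z]] _ ef(2)[OF z]])
          (use energy_kids[OF field_unit fw z] in \<open>auto simp: E_def\<close>)
      show "(\<Sum>z'\<in>kids n z. sqrt (l (Suc n) z') * sqrt (ef (Suc n) z')) \<le> sqrt (l n z) * sqrt (ef n z)"
        by (rule sum_sqrt_mult_le[OF l0 ef(1)[OF node.kid[OF z]] _ ef(2)[OF z]])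
          (use L2_kids[OF wL2 z] in \<open>auto simp: l_def\<close>)
    qed (use P G0 PB g(3) in auto)
    finally show ?thesis using z by (simp add: e_def algebra_simps)
  qed
  obtain D where D: "D \<ge> 0" "\<And>n z x. node n z \<Longrightarrow> x \<in> tcube n z \<Longrightarrow> \<bar>w x - mavg w n z\<bar> \<le> D * side n"
    using mavg_close[OF w] by metis
  obtain W where W: "W > 0" "\<And>x. x \<in> cube 0 1 \<Longrightarrow> \<bar>w x\<bar> \<le> W"
    using smooth_up_to_boundary_bounded[OF w U_bounded] by metis
  have m_bd: "\<bar>mavg w n z\<bar> \<le> W + D" if z: "node n z" for n z
  proof -
    have zz: "z \<in> tcube n z" by (rule cube_centre) simp
    have "D * side n \<le> D * 1" using D(1) by (intro mult_left_mono power_le_one) auto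
    then show ?thesis using D(2)[OF z zz] W(2)[of z] node_subset[OF z] zz by fastforce
  qed
  have "\<bar>(LINT x|lebesgue_on (tcube n z). (w x * g x) * f x) - mavg w n z * g z * (LINT x|lebesgue_on (tcube n z). f x)\<bar> \<le>
    (3 * ?N * B) * ?q ^ n / (1 - ?q) * e n z"
  proof (rule multiscale_pairing[where c="\<lambda>n z. mavg w n z * g z" and D="D * G0 + (W + D) * (G1 * ?d)", OF f])
    have "continuous_on UNIV g"
      by (rule lipschitz_on_continuous_on[of G1]) (use g in \<open>auto simp: lipschitz_on_def dist_norm\<close>)
    then have "g \<in> borel_measurable (lebesgue_on (cube 0 1))"
      by (intro continuous_imp_measurable_on_sets_lebesgue) (auto intro: continuous_on_subset)
    then show "(\<lambda>x. w x * g x) \<in> borel_measurable (lebesgue_on (cube 0 1))"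
      using smooth_measurable[OF w] by auto
    show "\<bar>w x * g x - mavg w n z * g z\<bar> \<le> (D * G0 + (W + D) * (G1 * ?d)) * side n" if z: "node n z" and x: "x \<in> tcube n z" for n z x
    proof -
      have "\<bar>w x * g x - mavg w n z * g z\<bar> = \<bar>(w x - mavg w n z) * g x + mavg w n z * (g x - g z)\<bar>"
        by (simp add: algebra_simps)
      also have "\<dots> \<le> \<bar>w x - mavg w n z\<bar> * \<bar>g x\<bar> + \<bar>mavg w n z\<bar> * \<bar>g x - g z\<bar>"
        unfolding abs_mult[symmetric] by (rule abs_triangle_ineq)
      also have "\<dots> \<le> (D * side n) * G0 + (W + D) * (G1 * (?d * side n))"
        using D W order_trans[OF g(2) mult_left_mono[OF tcube_norm[OF x] g(3)]]
        by (intro add_mono mult_mono g(1) m_bd[OF z] D(2)[OF z x]) auto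
      finally show ?thesis by (simp add: algebra_simps)
    qed
    show "(\<Sum>z'\<in>kids n z. \<bar>mavg w (Suc n) z' * g z' - mavg w n z * g z\<bar> * \<bar>LINT x|lebesgue_on (tcube (Suc n) z'). f x\<bar>) \<le> (3 * ?N * B) * ?q ^ n * e n z"
      if z: "node n z" for n z
    proof -
      define v where "v = vol TYPE('n) n"
      have v: "0 < v" by (simp add: v_def)
      have mz: "\<bar>mavg w n z\<bar> \<le> sqrt (l n z) / (2 * ?I * sqrt v)"
      proof -
        have "\<bar>mavg w n z\<bar> \<le> sqrt (l n z) * sqrt v / (2 * ?I * v)"
          using mavg_L2[OF L2_subset[OF wL2 node_subset[OF z]], of "tcube n z"] by (simp add: l_def v_def measure_tcube)
        also have "\<dots> = sqrt (l n z) / (2 * ?I) * (sqrt v / v)" by simp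
        also have "sqrt v / v = 1 / sqrt v" using v real_div_sqrt[of v] by (simp add: divide_simps)
        also have "sqrt (l n z) / (2 * ?I) * (1 / sqrt v) = sqrt (l n z) / (2 * ?I * sqrt v)" by simp
        finally show ?thesis .
      qed
      have S3: "3 powr s \<le> 3" using powr_mono[of s 1 "3::real"] s t by simp
      have term_le: "\<bar>mavg w (Suc n) z' * g z' - mavg w n z * g z\<bar> * \<bar>LINT x|lebesgue_on (tcube (Suc n) z'). f x\<bar> \<le> (3 * B) * ?q ^ n * e n z"
        if z': "z' \<in> kids n z" for z'
      proof -
        note n' = node.kid[OF z z']
        define X where "X = G0 * PB * sqrt (E n z)"
        define Y where "Y = G1 * sqrt (l n z)"
        have XY: "0 \<le> X" "0 \<le> Y" using G0 PB g(3) E0[OF z] l0 by (auto simp: X_def Y_def)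
        have "\<bar>mavg w (Suc n) z' * g z' - mavg w n z * g z\<bar> = \<bar>(mavg w (Suc n) z' - mavg w n z) * g z' + mavg w n z * (g z' - g z)\<bar>"
          by (simp add: algebra_simps)
        also have "\<dots> \<le> \<bar>mavg w (Suc n) z' - mavg w n z\<bar> * \<bar>g z'\<bar> + \<bar>mavg w n z\<bar> * \<bar>g z' - g z\<bar>"
          unfolding abs_mult[symmetric] by (rule abs_triangle_ineq)
        also have "\<dots> \<le> (const_avg TYPE('n) t * (3 powr (t - 1)) ^ n * PB * sqrt (E n z) / sqrt v) * G0 + (sqrt (l n z) / (2 * ?I * sqrt v)) * (G1 * (?d * side n))"
          using mavg_kid[OF w z z'] mz order_trans[OF g(2) mult_left_mono[OF kids_norm[OF z'] g(3)]]
            const_avg_nonneg[OF t(2), where 'n='n] PB E0[OF z] I v l0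
          by (intro add_mono mult_mono g(1)) (auto simp: E_def v_def)
        also have "\<dots> = (const_avg TYPE('n) t * (3 powr (t - 1)) ^ n * X + ?d / (2 * ?I) * side n * Y) / sqrt v"
          using v I by (simp add: X_def Y_def add_divide_distrib mult_ac)
        finally have 1: "\<bar>mavg w (Suc n) z' * g z' - mavg w n z * g z\<bar> \<le> (const_avg TYPE('n) t * (3 powr (t - 1)) ^ n * X + ?d / (2 * ?I) * side n * Y) / sqrt v" .
        \<comment> \<open>The increment of the averages is bounded by the energy of the parent, so
          the sum over the children is estimated by their number times a bound in terms of the
          parent.\<close>
        have efle: "ef (Suc n) z' \<le> ef n z"
          using member_le_sum[of z' "kids n z" "ef (Suc n)"] z' ef(1)[OF node.kid[OF z]] ef(2)[OF z] by force
        have "\<bar>LINT x|lebesgue_on (tcube (Suc n) z'). f x\<bar> \<le> sqrt (vol TYPE('n) (Suc n)) * (P * (3 powr s) ^ Suc n) * sqrt (ef (Suc n) z')"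
          by (rule fb[OF n'])
        also have "\<dots> \<le> sqrt v * (P * (3 * (3 powr s) ^ n)) * sqrt (ef n z)"
          using vol_Suc_le[where T="TYPE('n)" and n=n] efle S3 P ef(1)[OF n'] unfolding v_def power_Suc[of "3 powr s"]
          by (intro mult_mono mult_left_mono real_sqrt_le_mono mult_right_mono) auto
        finally have 2: "\<bar>LINT x|lebesgue_on (tcube (Suc n) z'). f x\<bar> \<le> sqrt v * (P * (3 * (3 powr s) ^ n)) * sqrt (ef n z)" .
        have Q1: "(3 powr (t - 1)) ^ n * (3 powr s) ^ n = ?q ^ n"
          by (simp add: power_mult_distrib[symmetric] powr_add[symmetric] algebra_simps)
        \<comment> \<open>The increment of g has the better rate 3^(s-1), which is weakened to the
          common ratio.\<close>
        have Q2: "side n * (3 powr s) ^ n \<le> ?q ^ n"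
          unfolding mult.commute[of "side n"] powr_side using t by (intro power_mono powr_mono) auto
        have "\<bar>mavg w (Suc n) z' * g z' - mavg w n z * g z\<bar> * \<bar>LINT x|lebesgue_on (tcube (Suc n) z'). f x\<bar> \<le>
          (const_avg TYPE('n) t * (3 powr (t - 1)) ^ n * X + ?d / (2 * ?I) * side n * Y) / sqrt v * (sqrt v * (P * (3 * (3 powr s) ^ n)) * sqrt (ef n z))"
          using 1 2 by (intro mult_mono) (auto intro: order_trans[OF abs_ge_zero])
        also have "\<dots> = 3 * P * sqrt (ef n z) * (const_avg TYPE('n) t * ((3 powr (t - 1)) ^ n * (3 powr s) ^ n) * X + ?d / (2 * ?I) * (side n * (3 powr s) ^ n) * Y)"
        proof -
          have cancel: "Z / r * (r * p * c) = Z * (p * c)" if "r \<noteq> 0" for Z r p c :: real using that by simp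
          show ?thesis using v by (subst cancel) (simp_all add: algebra_simps)
        qed
        also have "\<dots> \<le> 3 * P * sqrt (ef n z) * (const_avg TYPE('n) t * ?q ^ n * X + ?d / (2 * ?I) * ?q ^ n * Y)"
          unfolding Q1 using P ef(1)[OF z] Q2 I XY
          by (intro mult_left_mono add_left_mono mult_right_mono) auto
        also have "\<dots> \<le> 3 * P * sqrt (ef n z) * (B * ?q ^ n * (X + Y))"
        proof (rule mult_left_mono)
          have "const_avg TYPE('n) t * (?q ^ n * X) \<le> B * (?q ^ n * X)" "?d / (2 * ?I) * (?q ^ n * Y) \<le> B * (?q ^ n * Y)"
            unfolding B_def using XY q I const_avg_nonneg[OF t(2), where 'n='n] by (intro mult_right_mono; simp)+
          then show "const_avg TYPE('n) t * ?q ^ n * X + ?d / (2 * ?I) * ?q ^ n * Y \<le> B * ?q ^ n * (X + Y)"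
            by (simp add: algebra_simps)
        qed (use P ef(1)[OF z] in auto)
        also have "\<dots> = (3 * B) * ?q ^ n * e n z" using z by (simp add: e_def X_def Y_def mult_ac)
        finally show ?thesis .
      qed
      have "0 \<le> (3 * B) * ?q ^ n * e n z"
        using B0 q z P ef(1)[OF z] G0 PB g(3) E0[OF z] l0 by (auto simp: e_def)
      then have "(\<Sum>z'\<in>kids n z. (3 * B) * ?q ^ n * e n z) \<le> ?N * ((3 * B) * ?q ^ n * e n z)"
        using kids_card_le[of n z] by (simp add: mult_right_mono)
      have "(\<Sum>z'\<in>kids n z. \<bar>mavg w (Suc n) z' * g z' - mavg w n z * g z\<bar> * \<bar>LINT x|lebesgue_on (tcube (Suc n) z'). f x\<bar>) \<le> (\<Sum>z'\<in>kids n z. (3 * B) * ?q ^ n * e n z)"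
        by (rule sum_mono) (rule term_le)
      also have "\<dots> \<le> ?N * ((3 * B) * ?q ^ n * e n z)" by fact
      finally show ?thesis by (simp only: mult_ac)
    qed
    show "0 \<le> e n z" for n z
      using P G0 PB g(3) E0 l0 ef(1) by (auto simp: e_def)
  qed (use e_kids q B0 D(1) G0 W(1) g(3) z in auto)
  also have "(3 * ?N * B) * ?q ^ n / (1 - ?q) * e n z = const_pair TYPE('n) s t * ?q ^ n *
      (P * (G0 * PB * sqrt (E n z) + G1 * sqrt (l n z)) * sqrt (ef n z))"
    using z by (simp add: const_pair_def B_def e_def)
  finally show ?thesis by (simp add: E_def l_def)
qed

lemma (in coefficients) approximates_subset:
  assumes ap: "approximates \<phi> u G" and u: "u \<in> L2 U" "fin_energy a U G" and W: "W \<subseteq> U" "open W"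
  shows "coefficients.approximates a W \<phi> u G"
proof -
  interpret W: coefficients a W using coefficients_subset[OF _ W] coefficients_axioms by blast
  note \<phi> = approximates_smooth[OF ap]
  have "(\<lambda>k. LINT x|lebesgue_on W. (\<phi> k x - u x)\<^sup>2) \<longlonglongrightarrow> 0"
  proof (rule tendsto_sandwich[OF _ _ tendsto_const])
    show "\<forall>\<^sub>F k in sequentially. (LINT x|lebesgue_on W. (\<phi> k x - u x)\<^sup>2) \<le> (LINT x|lebesgue_on U. (\<phi> k x - u x)\<^sup>2)"
      using integral_lebesgue_on_mono_set[OF L2_integrable_square[OF L2_diff[OF \<phi>(3) u(1)]] W(1) U_sets W.U_sets] by auto
    show "(\<lambda>k. LINT x|lebesgue_on U. (\<phi> k x - u x)\<^sup>2) \<longlonglongrightarrow> 0" using ap by (simp add: approximates_def)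
  qed simp
  moreover have "(\<lambda>k. energy a W (\<lambda>x. grad (\<phi> k) x - G x)) \<longlonglongrightarrow> 0"
  proof (rule tendsto_sandwich[OF _ _ tendsto_const])
    show "\<forall>\<^sub>F k in sequentially. energy a W (\<lambda>x. grad (\<phi> k) x - G x) \<le> energy a U (\<lambda>x. grad (\<phi> k) x - G x)"
      using energy_subset_le[OF coefficients_axioms fin_diff[OF \<phi>(4) u(2)] W(1) W.U_sets] by auto
    show "(\<lambda>k. energy a U (\<lambda>x. grad (\<phi> k) x - G x)) \<longlonglongrightarrow> 0" using ap by (simp add: approximates_def)
  qed (simp add: W.energy_nonneg)
  moreover have "AE x in lebesgue_on W. (\<lambda>k. \<phi> k x) \<longlonglongrightarrow> u x"
    by (rule AE_lebesgue_on_subset[OF _ W(1) U_sets W.U_sets]) (use ap in \<open>simp add: approximates_def\<close>)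
  moreover have "\<phi> k \<in> smooth_up_to_boundary W" for k by (rule smooth_up_to_boundary_subset[OF \<phi>(1) W(1)])
  ultimately show ?thesis unfolding W.approximates_def by blast
qed

lemma (in coefficients) approximates_limits:
  assumes ap: "approximates \<phi> u G" and u: "u \<in> L2 U" "fin_energy a U G"
  shows "(\<lambda>k. energy a U (grad (\<phi> k))) \<longlonglongrightarrow> energy a U G"
    and "\<And>g. g \<in> L2 U \<Longrightarrow> (\<lambda>k. LINT x|lebesgue_on U. \<phi> k x * g x) \<longlonglongrightarrow> (LINT x|lebesgue_on U. u x * g x)"
    and "(\<lambda>k. LINT x|lebesgue_on U. (\<phi> k x)\<^sup>2) \<longlonglongrightarrow> (LINT x|lebesgue_on U. (u x)\<^sup>2)"
proof -
  note \<phi> = approximates_smooth[OF ap]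
  have l2: "(\<lambda>k. LINT x|lebesgue_on U. (\<phi> k x - u x)\<^sup>2) \<longlonglongrightarrow> 0"
    and en: "(\<lambda>k. energy a U (\<lambda>x. grad (\<phi> k) x - G x)) \<longlonglongrightarrow> 0" using ap by (auto simp: approximates_def)
  show "(\<lambda>k. energy a U (grad (\<phi> k))) \<longlonglongrightarrow> energy a U G" by (rule energy_tendsto[OF \<phi>(4) u(2) en])
  show conv: "(\<lambda>k. LINT x|lebesgue_on U. \<phi> k x * g x) \<longlonglongrightarrow> (LINT x|lebesgue_on U. u x * g x)" if g: "g \<in> L2 U" for g
  proof (rule Lim_null[THEN iffD2], rule Lim_null_comparison)
    have "(LINT x|lebesgue_on U. \<phi> k x * g x) - (LINT x|lebesgue_on U. u x * g x) = (LINT x|lebesgue_on U. (\<phi> k x - u x) * g x)" for k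
      using L2_mult_integrable[OF u(1) g] L2_mult_integrable[OF \<phi>(3) g] by (simp add: left_diff_distrib)
    then show "\<forall>\<^sub>F k in sequentially. norm ((LINT x|lebesgue_on U. \<phi> k x * g x) - (LINT x|lebesgue_on U. u x * g x)) \<le>
      sqrt (LINT x|lebesgue_on U. (\<phi> k x - u x)\<^sup>2) * sqrt (LINT x|lebesgue_on U. (g x)\<^sup>2)"
      using L2_Cauchy_Schwarz[OF L2_diff[OF \<phi>(3) u(1)] g] by simp
    have "(\<lambda>k. sqrt (LINT x|lebesgue_on U. (\<phi> k x - u x)\<^sup>2) * sqrt (LINT x|lebesgue_on U. (g x)\<^sup>2)) \<longlonglongrightarrow> sqrt 0 * sqrt (LINT x|lebesgue_on U. (g x)\<^sup>2)"
      by (intro tendsto_intros l2)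
    then show "(\<lambda>k. sqrt (LINT x|lebesgue_on U. (\<phi> k x - u x)\<^sup>2) * sqrt (LINT x|lebesgue_on U. (g x)\<^sup>2)) \<longlonglongrightarrow> 0" by simp
  qed
  have "(LINT x|lebesgue_on U. (\<phi> k x)\<^sup>2) = (LINT x|lebesgue_on U. (\<phi> k x - u x)\<^sup>2) + 2 * (LINT x|lebesgue_on U. \<phi> k x * u x) - (LINT x|lebesgue_on U. (u x)\<^sup>2)" for k
  proof -
    have "(LINT x|lebesgue_on U. (\<phi> k x - u x)\<^sup>2) = (LINT x|lebesgue_on U. (\<phi> k x)\<^sup>2 + (u x)\<^sup>2 - 2 * (\<phi> k x * u x))"
      by (simp add: power2_diff mult.assoc)
    also have "\<dots> = (LINT x|lebesgue_on U. (\<phi> k x)\<^sup>2) + (LINT x|lebesgue_on U. (u x)\<^sup>2) - 2 * (LINT x|lebesgue_on U. \<phi> k x * u x)"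
      using L2_integrable_square[OF \<phi>(3)] L2_integrable_square[OF u(1)] L2_mult_integrable[OF \<phi>(3) u(1)] by simp
    finally show ?thesis by simp
  qed
  moreover have "(\<lambda>k. (LINT x|lebesgue_on U. (\<phi> k x - u x)\<^sup>2) + 2 * (LINT x|lebesgue_on U. \<phi> k x * u x) - (LINT x|lebesgue_on U. (u x)\<^sup>2))
      \<longlonglongrightarrow> 0 + 2 * (LINT x|lebesgue_on U. u x * u x) - (LINT x|lebesgue_on U. (u x)\<^sup>2)"
    by (intro tendsto_intros l2 conv u)
  ultimately show "(\<lambda>k. LINT x|lebesgue_on U. (\<phi> k x)\<^sup>2) \<longlonglongrightarrow> (LINT x|lebesgue_on U. (u x)\<^sup>2)"
    by (simp add: power2_eq_square)
qed

text \<open>For the smooth approximants, \<open>pairing_bound\<close> with f = w and g = 1 estimates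
  the L2 norm up to the product of the weighted average and the integral. In the limit this product
  is absorbed, since v is supported in a small set. The approximants need not share the small
  support, so the absorption happens after the limit.\<close>

lemma (in lower_coarse) poincare_small_support:
  assumes v: "has_H1a_grad a (cube 0 1) v V" and z: "node n z"
    and A: "A \<in> sets lebesgue" "A \<subseteq> tcube n z" "\<And>x. x \<in> tcube n z - A \<Longrightarrow> v x = 0"
      "measure lebesgue A \<le> bump_mass TYPE('n) * vol TYPE('n) n"
  shows "(LINT x|lebesgue_on (tcube n z). (v x)\<^sup>2) \<le>
    (2 * const_pair TYPE('n) 0 t * PB * (3 powr (t - 1)) ^ n)\<^sup>2 * energy a (tcube n z) V"
proof -
  let ?I = "bump_mass TYPE('n)" and ?v = "vol TYPE('n) n" and ?c = "const_pair TYPE('n) 0 t" and ?q = "(3 powr (t - 1)) ^ n"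
  interpret Q: coefficients a "tcube n z" by (rule coefficients_tcube[OF field_unit z])
  let ?M = "lebesgue_on (tcube n z)"
  obtain \<phi> where ap: "approximates \<phi> v V" using H1a_approximates[OF v] by metis
  note fV = H1a_fin_energy[OF v] and v2 = H1a_L2[OF v]
  note \<phi> = approximates_smooth[OF ap]
  note apQ = approximates_subset[OF ap v2 fV node_subset[OF z] cube_open]
  have fVQ: "fin_energy a (tcube n z) V" by (rule fin_energy_subset[OF fV node_subset[OF z]]) auto
  have v2Q: "v \<in> L2 (tcube n z)" by (rule L2_subset[OF v2 node_subset[OF z]]) auto
  note lim = Q.approximates_limits[OF apQ v2Q fVQ]
  have one: "(\<lambda>x. 1) \<in> L2 (tcube n z)" by (rule Q.bounded_L2[where C=1]) auto
  have bL: "(\<lambda>x. bump ((1 / side n) *\<^sub>R (x - z))) \<in> L2 (tcube n z)"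
  proof (rule Q.bounded_L2[where C="1/2"])
    show "(\<lambda>x. bump ((1 / side n) *\<^sub>R (x - z))) \<in> borel_measurable ?M"
      by (intro continuous_imp_measurable_on_sets_lebesgue continuous_on_compose2[OF bump_continuous[of UNIV]] continuous_intros) auto
    show "\<bar>bump ((1 / side n) *\<^sub>R (x - z))\<bar> \<le> 1 / 2" for x
      using bump_bounds[of "(1 / side n) *\<^sub>R (x - z)"] by (simp only: abs_of_nonneg)
  qed
  have mlim: "(\<lambda>k. mavg (\<phi> k) n z) \<longlonglongrightarrow> mavg v n z"
    unfolding mavg_def
    by (intro tendsto_divide lim(2)[OF bL] tendsto_const
        less_imp_neq[OF mult_pos_pos[OF bump_mass_pos[where 'n='n] vol_pos(1)], THEN not_sym])
  define L where "L = (LINT x|?M. (v x)\<^sup>2)"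
  define E where "E = energy a (tcube n z) V"
  have E0: "0 \<le> E" by (simp add: E_def Q.energy_nonneg)
  have L0: "0 \<le> L" by (simp add: L_def)
  have "L - mavg v n z * (LINT x|?M. v x * 1) \<le> ?c * ?q * (PB * sqrt E * sqrt L)"
  proof (rule LIMSEQ_le)
    show "(\<lambda>k. (LINT x|?M. (\<phi> k x)\<^sup>2) - mavg (\<phi> k) n z * (LINT x|?M. \<phi> k x * 1)) \<longlonglongrightarrow> L - mavg v n z * (LINT x|?M. v x * 1)"
      unfolding L_def by (intro tendsto_intros lim(2)[OF one] lim(3) mlim)
    show "(\<lambda>k. ?c * ?q * (PB * sqrt (energy a (tcube n z) (grad (\<phi> k))) * sqrt (LINT x|?M. (\<phi> k x)\<^sup>2))) \<longlonglongrightarrow> ?c * ?q * (PB * sqrt E * sqrt L)"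
      unfolding E_def L_def by (intro tendsto_intros lim(1) lim(3))
    have "(LINT x|?M. (\<phi> k x)\<^sup>2) - mavg (\<phi> k) n z * (LINT x|?M. \<phi> k x * 1) \<le> ?c * ?q * (PB * sqrt (energy a (tcube n z) (grad (\<phi> k))) * sqrt (LINT x|?M. (\<phi> k x)\<^sup>2))" for k
    proof -
      have fb: "\<bar>LINT x|lebesgue_on (tcube n z). \<phi> k x\<bar> \<le> sqrt (vol TYPE('n) n) * (1 * (3 powr 0) ^ n) * sqrt (LINT x|lebesgue_on (tcube n z). (\<phi> k x)\<^sup>2)" if z: "node n z" for n z
      proof -
        interpret R: coefficients a "tcube n z" by (rule coefficients_tcube[OF field_unit z])
        have 1: "(\<lambda>x. 1) \<in> L2 (tcube n z)" by (rule R.bounded_L2[where C=1]) auto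
        have 2: "\<phi> k \<in> L2 (tcube n z)" by (rule L2_subset[OF \<phi>(3) node_subset[OF z]]) auto
        have m: "(LINT x|lebesgue_on (tcube n z). (1::real)\<^sup>2) = vol TYPE('n) n"
          by (simp add: measure_restrict_space measure_tcube)
        show ?thesis using R.L2_Cauchy_Schwarz[OF 2 1] unfolding m by (simp add: mult.commute)
      qed
      have "\<bar>(LINT x|?M. (\<phi> k x * 1) * \<phi> k x) - mavg (\<phi> k) n z * 1 * (LINT x|?M. \<phi> k x)\<bar> \<le>
        ?c * (3 powr (0 + t - 1)) ^ n * (1 * (1 * PB * sqrt (energy a (tcube n z) (grad (\<phi> k))) + 0 * sqrt (LINT x|?M. (\<phi> k x)\<^sup>2)) * sqrt (LINT x|?M. (\<phi> k x)\<^sup>2))"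
        by (rule pairing_bound[OF \<phi>(1) L2_integrable[OF \<phi>(3)] fb]) (use L2_kids[OF \<phi>(3)] t z in auto)
      then show ?thesis by (simp add: power2_eq_square)
    qed
    then show "\<exists>N. \<forall>k\<ge>N. (LINT x|?M. (\<phi> k x)\<^sup>2) - mavg (\<phi> k) n z * (LINT x|?M. \<phi> k x * 1) \<le> ?c * ?q * (PB * sqrt (energy a (tcube n z) (grad (\<phi> k))) * sqrt (LINT x|?M. (\<phi> k x)\<^sup>2))"
      by blast
  qed
  moreover have "mavg v n z * (LINT x|?M. v x * 1) \<le> L / 2"
  proof -
    \<comment> \<open>The average and the integral of v each gain the square root of m. The assumed
      bound for m is exactly what makes their product at most L / 2.\<close>
    define m where "m = measure lebesgue A"
    have m0: "0 \<le> m" by (simp add: m_def)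
    have Am: "A \<in> sets ?M" using A by (auto simp: sets_restrict_space_iff)
    have iA: "(\<lambda>x. indicator A x) \<in> L2 (tcube n z)" by (rule Q.bounded_L2[where C=1]) (use Am in \<open>auto simp: indicator_def\<close>)
    have "(LINT x|?M. v x * 1) = (LINT x|?M. v x * indicator A x)"
      by (rule Bochner_Integration.integral_cong) (use A(3) in \<open>auto simp: indicator_def\<close>)
    moreover have "\<bar>LINT x|?M. v x * indicator A x\<bar> \<le> sqrt L * sqrt (LINT x|?M. (indicator A x)\<^sup>2)"
      unfolding L_def by (rule Q.L2_Cauchy_Schwarz[OF v2Q iA])
    moreover have "(LINT x|?M. (indicator A x)\<^sup>2) = m"
    proof -
      have "(LINT x|?M. (indicat_real A x)\<^sup>2) = (LINT x|?M. indicat_real A x)"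
        by (rule Bochner_Integration.integral_cong) (auto simp: indicator_def)
      also have "\<dots> = measure ?M A" using Am by (simp add: Int_absorb2[OF A(2)])
      also have "\<dots> = m" unfolding m_def using A by (intro measure_restrict_space) auto
      finally show ?thesis .
    qed
    ultimately have 1: "\<bar>LINT x|?M. v x * 1\<bar> \<le> sqrt L * sqrt m" by simp
    have 2: "\<bar>mavg v n z\<bar> \<le> sqrt L * sqrt m / (2 * ?I * ?v)"
      using mavg_L2[OF v2Q A(1-3)] by (simp add: L_def m_def)
    have "mavg v n z * (LINT x|?M. v x * 1) \<le> \<bar>mavg v n z\<bar> * \<bar>LINT x|?M. v x * 1\<bar>"
      unfolding abs_mult[symmetric] by (rule abs_ge_self)
    also have "\<dots> \<le> (sqrt L * sqrt m / (2 * ?I * ?v)) * (sqrt L * sqrt m)"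
      using 1 2 by (intro mult_mono) (auto intro: order_trans[OF abs_ge_zero])
    also have "\<dots> = L * (m / (?I * ?v)) / 2" using L0 m0 by (simp add: field_simps)
    also have "\<dots> \<le> L * 1 / 2"
      using A(4) L0 bump_mass_pos[where 'n='n] by (intro divide_right_mono mult_left_mono) (auto simp: m_def)
    finally show ?thesis by simp
  qed
  ultimately have "L \<le> (2 * ?c * PB * ?q * sqrt E) * sqrt L" by (simp add: algebra_simps)
  then have "sqrt L * sqrt L \<le> (2 * ?c * PB * ?q * sqrt E) * sqrt L" using L0 by simp
  have "sqrt L \<le> 2 * ?c * PB * ?q * sqrt E"
  proof (cases "L = 0")
    case True
    then show ?thesis using const_pair_nonneg[of 0 t, where 'n='n] t PB E0 by simp
  next
    case False
    then have "0 < sqrt L" using L0 by simp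
    then show ?thesis using \<open>sqrt L * sqrt L \<le> (2 * ?c * PB * ?q * sqrt E) * sqrt L\<close> by (rule mult_right_le_imp_le[rotated])
  qed
  then have "(sqrt L)\<^sup>2 \<le> (2 * ?c * PB * ?q * sqrt E)\<^sup>2" using L0 by (intro power_mono) auto
  then show ?thesis using L0 E0 by (simp add: L_def E_def power_mult_distrib)
qed

subsection \<open>Cutoff functions\<close>

lemma power_exp_le: "0 \<le> y \<Longrightarrow> y ^ k * exp (- y) \<le> fact k" for y :: real
proof -
  assume y: "0 \<le> y"
  have "(\<Sum>n\<in>{k}. inverse (fact n) *\<^sub>R y ^ n) \<le> (\<Sum>n. inverse (fact n) *\<^sub>R y ^ n)"
    by (rule sum_le_suminf) (use y summable_exp_generic[of y] in auto)
  then have "y ^ k \<le> fact k * exp y" by (simp add: exp_def field_simps)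
  then show ?thesis by (simp add: exp_minus field_simps)
qed

abbreviation pexp' :: "real \<Rightarrow> real" where "pexp' \<equiv> pexp [:0,0,1:]"

lemma pexp_one_DERIV: "(pexp 1 has_real_derivative pexp' x) (at x)"
  using pexp_DERIV[of 1 x] by simp

lemma pexp'_DERIV: "(pexp' has_real_derivative pexp [:0,0,0,-2,1:] x) (at x)"
  using pexp_DERIV[of "[:0,0,1:]" x] by (simp add: pderiv_pCons)

lemma pexp'_bound: "\<bar>pexp' x\<bar> \<le> 36"
proof (cases "x > 0")
  case True
  have "(1/x) ^ 2 * exp (- (1/x)) \<le> fact 2" using True by (intro power_exp_le) simp
  then show ?thesis using True by (simp add: pexp_def fact_numeral power2_eq_square)
qed (simp add: pexp_def)

lemma pexp''_bound: "\<bar>pexp [:0,0,0,-2,1:] x\<bar> \<le> 36"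
proof (cases "x > 0")
  case True
  define y where "y = 1 / x"
  have y: "0 \<le> y" using True by (simp add: y_def)
  have 1: "y ^ 4 * exp (- y) \<le> 24" "y ^ 3 * exp (- y) \<le> 6"
    using power_exp_le[OF y, of 4] power_exp_le[OF y, of 3] by (simp_all add: fact_numeral)
  have 2: "0 \<le> y ^ 4 * exp (- y)" "0 \<le> y ^ 3 * exp (- y)" using y by auto
  have "pexp [:0,0,0,-2,1:] x = y ^ 4 * exp (- y) - 2 * (y ^ 3 * exp (- y))"
    using True by (simp add: pexp_def y_def[symmetric] algebra_simps power_numeral_reduce)
  then show ?thesis using 1 2 by linarith
qed (simp add: pexp_def)

lemma pexp_one_lipschitz: "\<bar>pexp 1 x - pexp 1 y\<bar> \<le> 36 * \<bar>x - y\<bar>"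
proof -
  have "norm (pexp 1 x - pexp 1 y) \<le> 36 * norm (x - y)"
    by (rule field_differentiable_bound[where S=UNIV and f'=pexp'])
      (auto intro: has_field_derivative_at_within[OF pexp_one_DERIV] pexp'_bound)
  then show ?thesis by simp
qed

lemma pexp'_lipschitz: "\<bar>pexp' x - pexp' y\<bar> \<le> 36 * \<bar>x - y\<bar>"
proof -
  have "norm (pexp' x - pexp' y) \<le> 36 * norm (x - y)"
    by (rule field_differentiable_bound[where S=UNIV and f'="pexp [:0,0,0,-2,1:]"])
      (auto intro: has_field_derivative_at_within[OF pexp'_DERIV] pexp''_bound)
  then show ?thesis by simp
qed

lemma mult_lipschitz:
  fixes f g :: "real \<Rightarrow> real"
  assumes "\<And>x. \<bar>f x\<bar> \<le> A" "\<And>x. \<bar>g x\<bar> \<le> B" "\<And>x y. \<bar>f x - f y\<bar> \<le> L * \<bar>x - y\<bar>" "\<And>x y. \<bar>g x - g y\<bar> \<le> M * \<bar>x - y\<bar>"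
  shows "\<bar>f x * g x - f y * g y\<bar> \<le> (L * B + A * M) * \<bar>x - y\<bar>"
proof -
  have A: "0 \<le> A" using assms(1)[of 0] by simp
  have LM: "0 \<le> L" using assms(3)[of 0 1] by simp
  have "f x * g x - f y * g y = (f x - f y) * g x + f y * (g x - g y)" by (simp add: algebra_simps)
  also have "\<bar>\<dots>\<bar> \<le> \<bar>f x - f y\<bar> * \<bar>g x\<bar> + \<bar>f y\<bar> * \<bar>g x - g y\<bar>"
    unfolding abs_mult[symmetric] by (rule abs_triangle_ineq)
  also have "\<dots> \<le> (L * \<bar>x - y\<bar>) * B + A * (M * \<bar>x - y\<bar>)"
    using A LM by (intro add_mono mult_mono assms) auto
  finally show ?thesis by (simp add: algebra_simps)
qed

definition cut1 :: "real \<Rightarrow> real \<Rightarrow> real \<Rightarrow> real" where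
  "cut1 m u y = pexp 1 (m * (u - y) - 1) * pexp 1 (m * (y + u) - 1)"

definition cut1' :: "real \<Rightarrow> real \<Rightarrow> real \<Rightarrow> real" where
  "cut1' m u y = m * (pexp 1 (m * (u - y) - 1) * pexp' (m * (y + u) - 1)) - m * (pexp' (m * (u - y) - 1) * pexp 1 (m * (y + u) - 1))"

lemma cut1_DERIV: "(cut1 m u has_real_derivative cut1' m u y) (at y)"
proof -
  have 1: "((\<lambda>y. pexp 1 (m * (u - y) - 1)) has_real_derivative pexp' (m * (u - y) - 1) * (- m)) (at y)"
    by (rule DERIV_chain2[OF pexp_one_DERIV]) (auto intro!: derivative_eq_intros)
  have 2: "((\<lambda>y. pexp 1 (m * (y + u) - 1)) has_real_derivative pexp' (m * (y + u) - 1) * m) (at y)"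
    by (rule DERIV_chain2[OF pexp_one_DERIV]) (auto intro!: derivative_eq_intros)
  show ?thesis unfolding cut1_def[abs_def] cut1'_def
    by (rule DERIV_cong[OF DERIV_mult[OF 1 2]]) (simp add: algebra_simps)
qed

lemma cut1_bounds:
  assumes m: "0 \<le> m"
  shows "0 \<le> cut1 m u y" "cut1 m u y \<le> 1" "\<bar>cut1' m u y\<bar> \<le> 72 * m"
    "\<bar>cut1 m u x - cut1 m u y\<bar> \<le> 72 * m * \<bar>x - y\<bar>" "\<bar>cut1' m u x - cut1' m u y\<bar> \<le> 72 * m * (72 * m * \<bar>x - y\<bar>)"
proof -
  show "0 \<le> cut1 m u y" "cut1 m u y \<le> 1"
    using pexp_one_bounds by (auto simp: cut1_def intro: mult_le_one)
  define A where "A y = pexp 1 (m * (u - y) - 1)" for y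
  define B where "B y = pexp 1 (m * (y + u) - 1)" for y
  define A' where "A' y = pexp' (m * (u - y) - 1)" for y
  define B' where "B' y = pexp' (m * (y + u) - 1)" for y
  have lin: "\<bar>(m * (u - x) - 1) - (m * (u - y) - 1)\<bar> = m * \<bar>x - y\<bar>" "\<bar>(m * (x + u) - 1) - (m * (y + u) - 1)\<bar> = m * \<bar>x - y\<bar>" for x y
  proof -
    have "(m * (u - x) - 1) - (m * (u - y) - 1) = m * (y - x)" "(m * (x + u) - 1) - (m * (y + u) - 1) = m * (x - y)"
      by (simp_all add: algebra_simps)
    then show "\<bar>(m * (u - x) - 1) - (m * (u - y) - 1)\<bar> = m * \<bar>x - y\<bar>" "\<bar>(m * (x + u) - 1) - (m * (y + u) - 1)\<bar> = m * \<bar>x - y\<bar>"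
      using m by (simp_all only: abs_mult abs_of_nonneg abs_minus_commute)
  qed
  have b: "\<bar>A y\<bar> \<le> 1" "\<bar>B y\<bar> \<le> 1" "\<bar>A' y\<bar> \<le> 36" "\<bar>B' y\<bar> \<le> 36" for y
    using pexp_one_bounds pexp'_bound by (auto simp: A_def B_def A'_def B'_def abs_of_nonneg)
  have l: "\<bar>A x - A y\<bar> \<le> (36 * m) * \<bar>x - y\<bar>" "\<bar>B x - B y\<bar> \<le> (36 * m) * \<bar>x - y\<bar>"
    "\<bar>A' x - A' y\<bar> \<le> (36 * m) * \<bar>x - y\<bar>" "\<bar>B' x - B' y\<bar> \<le> (36 * m) * \<bar>x - y\<bar>" for x y
    using pexp_one_lipschitz[of "m * (u - x) - 1" "m * (u - y) - 1"] pexp_one_lipschitz[of "m * (x + u) - 1" "m * (y + u) - 1"]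
      pexp'_lipschitz[of "m * (u - x) - 1" "m * (u - y) - 1"] pexp'_lipschitz[of "m * (x + u) - 1" "m * (y + u) - 1"]
    unfolding A_def B_def A'_def B'_def lin by (simp_all only: mult.assoc)
  have c: "cut1 m u y = A y * B y" "cut1' m u y = m * (A y * B' y) - m * (A' y * B y)" for y
    by (simp_all add: cut1_def cut1'_def A_def B_def A'_def B'_def)
  have AB: "\<bar>A y * B' y\<bar> \<le> 1 * 36" "\<bar>A' y * B y\<bar> \<le> 36 * 1"
    unfolding abs_mult by (intro mult_mono b; simp)+
  have "\<bar>m * (A y * B' y)\<bar> \<le> m * 36" "\<bar>m * (A' y * B y)\<bar> \<le> m * 36"
    unfolding abs_mult[of m] using m AB by (auto intro!: mult_left_mono)
  then show "\<bar>cut1' m u y\<bar> \<le> 72 * m" unfolding c by linarith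
  show "\<bar>cut1 m u x - cut1 m u y\<bar> \<le> 72 * m * \<bar>x - y\<bar>"
    unfolding c using mult_lipschitz[OF b(1,2) l(1,2), of x y] by (simp add: algebra_simps)
  define dx where "dx = m * \<bar>x - y\<bar>"
  have dx: "0 \<le> dx" using m by (simp add: dx_def)
  \<comment> \<open>Lipschitz constants 1332 m come out; 2592 is half of 72^2, so that the two
    products together give the square of the constant 72 m of the function itself.\<close>
  have p: "\<bar>A x * B' x - A y * B' y\<bar> \<le> 2592 * dx" "\<bar>A' x * B x - A' y * B y\<bar> \<le> 2592 * dx"
    using mult_lipschitz[OF b(1,4) l(1,4), of x y] mult_lipschitz[OF b(3,2) l(3,2), of x y] dx
    by (simp_all add: algebra_simps dx_def)
  have "cut1' m u x - cut1' m u y = m * (A x * B' x - A y * B' y) - m * (A' x * B x - A' y * B y)"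
    unfolding c by (simp add: algebra_simps)
  also have "\<bar>\<dots>\<bar> \<le> \<bar>m * (A x * B' x - A y * B' y)\<bar> + \<bar>m * (A' x * B x - A' y * B y)\<bar>" by (rule abs_triangle_ineq4)
  also have "\<dots> \<le> m * (2592 * dx) + m * (2592 * dx)"
    unfolding abs_mult[of m] using p m by (intro add_mono mult_mono) auto
  also have "\<dots> = 72 * m * (72 * m * \<bar>x - y\<bar>)" by (simp add: dx_def)
  finally show "\<bar>cut1' m u x - cut1' m u y\<bar> \<le> 72 * m * (72 * m * \<bar>x - y\<bar>)" .
qed

definition cutoff :: "nat \<Rightarrow> real \<Rightarrow> real^'n \<Rightarrow> real" where
  "cutoff m u = box_bump (\<chi> i. - u) (\<chi> i. u) m"

lemma cutoff_prod: "cutoff m u x = (\<Prod>i\<in>UNIV. cut1 (real m) u (x $ i))"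
  by (simp add: cutoff_def box_bump_def cut1_def)

lemma cutoff_grad: "grad (cutoff m u) x $ i = cut1' (real m) u (x $ i) * (\<Prod>j\<in>UNIV - {i}. cut1 (real m) u (x $ j))"
proof (rule GDERIV_partial_eq[where f="cutoff m u" and x=x])
  have sm: "smooth_on UNIV (cutoff m u)" unfolding cutoff_def by (rule box_bump_smooth)
  show "GDERIV (cutoff m u) x :> grad (cutoff m u) x" by (rule smooth_on_GDERIV[OF sm]) simp
  have eq: "cutoff m u (x + \<tau> *\<^sub>R axis i 1) = cut1 (real m) u (x $ i + \<tau>) * (\<Prod>j\<in>UNIV - {i}. cut1 (real m) u (x $ j))" for \<tau>
  proof -
    have "cutoff m u (x + \<tau> *\<^sub>R axis i 1) = cut1 (real m) u ((x + \<tau> *\<^sub>R axis i 1) $ i) * (\<Prod>j\<in>UNIV - {i}. cut1 (real m) u ((x + \<tau> *\<^sub>R axis i 1) $ j))"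
      unfolding cutoff_prod by (rule prod.remove) auto
    also have "(\<Prod>j\<in>UNIV - {i}. cut1 (real m) u ((x + \<tau> *\<^sub>R axis i 1) $ j)) = (\<Prod>j\<in>UNIV - {i}. cut1 (real m) u (x $ j))"
      by (rule prod.cong) (auto simp: axis_def)
    finally show ?thesis by simp
  qed
  have "((\<lambda>\<tau>. cut1 (real m) u (x $ i + \<tau>)) has_real_derivative cut1' (real m) u (x $ i + 0) * 1) (at 0)"
    by (rule DERIV_chain2[OF cut1_DERIV]) (auto intro!: derivative_eq_intros)
  from DERIV_cmult_right[OF this, of "\<Prod>j\<in>UNIV - {i}. cut1 (real m) u (x $ j)"]
  show "((\<lambda>\<tau>. cutoff m u (x + \<tau> *\<^sub>R axis i 1)) has_real_derivative cut1' (real m) u (x $ i) * (\<Prod>j\<in>UNIV - {i}. cut1 (real m) u (x $ j))) (at 0)"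
    unfolding eq by simp
qed

lemma cutoff_grad_bounds:
  fixes x y :: "real^'n"
  shows "\<bar>grad (cutoff m u) x $ i\<bar> \<le> 72 * real m"
    and "\<bar>grad (cutoff m u) x $ i - grad (cutoff m u) y $ i\<bar> \<le> real CARD('n) * (72 * real m)\<^sup>2 * norm (x - y)"
proof -
  \<comment> \<open>Dividing the differentiated factor by 72 m makes all factors bounded by 1 and
    Lipschitz with constant 72 m, so one estimate for differences of products covers them
    all.\<close>
  define \<kappa> where "\<kappa> j v = (if j = i then cut1' (real m) u v / (72 * real m) else cut1 (real m) u v)" for j and v :: real
  have eq: "grad (cutoff m u) x $ i = 72 * real m * (\<Prod>j\<in>UNIV. \<kappa> j (x $ j))" for x :: "real^'n"
  proof (cases "m = 0")
    case True then show ?thesis by (simp add: cutoff_grad cut1'_def)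
  next
    case False
    have "(\<Prod>j\<in>UNIV. \<kappa> j (x $ j)) = \<kappa> i (x $ i) * (\<Prod>j\<in>UNIV - {i}. \<kappa> j (x $ j))" by (rule prod.remove) auto
    also have "(\<Prod>j\<in>UNIV - {i}. \<kappa> j (x $ j)) = (\<Prod>j\<in>UNIV - {i}. cut1 (real m) u (x $ j))"
      by (rule prod.cong) (auto simp: \<kappa>_def)
    finally show ?thesis using False by (simp add: cutoff_grad \<kappa>_def)
  qed
  have b: "\<bar>\<kappa> j v\<bar> \<le> 1" for j v
    using cut1_bounds(1,2,3)[of "real m" u v] by (auto simp: \<kappa>_def abs_divide divide_le_eq_1)
  have l: "\<bar>\<kappa> j v - \<kappa> j v'\<bar> \<le> 72 * real m * \<bar>v - v'\<bar>" for j v v'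
  proof (cases "j = i \<and> m \<noteq> 0")
    case True
    then have "\<bar>\<kappa> j v - \<kappa> j v'\<bar> = \<bar>cut1' (real m) u v - cut1' (real m) u v'\<bar> / (72 * real m)"
      by (simp add: \<kappa>_def diff_divide_distrib[symmetric] abs_divide)
    also have "\<dots> \<le> 72 * real m * (72 * real m * \<bar>v - v'\<bar>) / (72 * real m)"
      by (intro divide_right_mono cut1_bounds(5)) auto
    finally show ?thesis using True by simp
  next
    case False
    then show ?thesis using cut1_bounds(4)[of "real m" u v v'] by (auto simp: \<kappa>_def)
  qed
  have "\<bar>\<Prod>j\<in>UNIV. \<kappa> j (x $ j)\<bar> \<le> 1"
    unfolding abs_prod by (rule prod_le_1) (use b in auto)
  then show "\<bar>grad (cutoff m u) x $ i\<bar> \<le> 72 * real m"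
    unfolding eq abs_mult by (simp add: mult_left_le)
  have "norm ((\<Prod>j\<in>UNIV. \<kappa> j (x $ j)) - (\<Prod>j\<in>UNIV. \<kappa> j (y $ j))) \<le> (\<Sum>j\<in>UNIV. norm (\<kappa> j (x $ j) - \<kappa> j (y $ j)))"
    by (rule norm_prod_diff) (use b in auto)
  also have "\<dots> \<le> (\<Sum>j\<in>(UNIV :: 'n set). 72 * real m * norm (x - y))"
  proof (rule sum_mono)
    fix j
    have "\<bar>x $ j - y $ j\<bar> \<le> norm (x - y)" using component_le_norm_cart[of "x - y" j] by simp
    then show "norm (\<kappa> j (x $ j) - \<kappa> j (y $ j)) \<le> 72 * real m * norm (x - y)"
      unfolding real_norm_def by (intro order_trans[OF l] mult_left_mono) auto
  qed
  finally have P: "\<bar>(\<Prod>j\<in>UNIV. \<kappa> j (x $ j)) - (\<Prod>j\<in>UNIV. \<kappa> j (y $ j))\<bar> \<le> real CARD('n) * (72 * real m * norm (x - y))" by simp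
  have "\<bar>grad (cutoff m u) x $ i - grad (cutoff m u) y $ i\<bar> = 72 * real m * \<bar>(\<Prod>j\<in>UNIV. \<kappa> j (x $ j)) - (\<Prod>j\<in>UNIV. \<kappa> j (y $ j))\<bar>"
    unfolding eq right_diff_distrib[symmetric] abs_mult by simp
  also have "\<dots> \<le> 72 * real m * (real CARD('n) * (72 * real m * norm (x - y)))" using P by (intro mult_left_mono) auto
  finally show "\<bar>grad (cutoff m u) x $ i - grad (cutoff m u) y $ i\<bar> \<le> real CARD('n) * (72 * real m)\<^sup>2 * norm (x - y)"
    by (simp add: power2_eq_square mult_ac)
qed

lemma cutoff_bounds: "0 \<le> cutoff m u x" "cutoff m u x \<le> 1"
  unfolding cutoff_def by (rule box_bump_bounds)+

text \<open>The cutoff never attains the value 1. Each of its 2 CARD('n) factors is at least exp(-1)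
  on the inner cube, and such a fixed lower bound is enough for a lower estimate of the weighted
  energy.\<close>

lemma cutoff_lower:
  fixes x :: "real^'n"
  assumes "\<And>i. \<bar>x $ i\<bar> \<le> \<rho> / 2" "real m * (u - \<rho> / 2) \<ge> 2"
  shows "exp (- 2 * real CARD('n)) \<le> cutoff m u x"
proof -
  have p: "exp (- 1) \<le> pexp 1 y" if "1 \<le> y" for y using that by (simp add: pexp_def)
  have "exp (- 2) \<le> cut1 (real m) u (x $ i)" for i
  proof -
    have "x $ i \<le> \<rho> / 2" "- (\<rho> / 2) \<le> x $ i" using assms(1)[of i] by (auto simp: abs_le_iff)
    then have "real m * (u - \<rho> / 2) \<le> real m * (u - x $ i)" "real m * (u - \<rho> / 2) \<le> real m * (x $ i + u)"
      by (intro mult_left_mono; linarith)+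
    then have "exp (- 1) * exp (- 1) \<le> cut1 (real m) u (x $ i)"
      unfolding cut1_def using assms(2) by (intro mult_mono p pexp_one_bounds) auto
    then show ?thesis by (simp add: mult_exp_exp)
  qed
  then have "(\<Prod>i\<in>(UNIV :: 'n set). exp (- 2)) \<le> (\<Prod>i\<in>UNIV. cut1 (real m) u (x $ i))" by (intro prod_mono) auto
  then show ?thesis by (simp add: cutoff_prod exp_of_nat_mult[symmetric] mult.commute)
qed

lemma cutoff_test:
  assumes "2 * u < R" shows "(cutoff m u :: real^'n \<Rightarrow> real) \<in> test_functions (cube 0 R)"
  unfolding cutoff_def
proof (rule box_bump_test, rule subsetI)
  fix x :: "real^'n" assume x: "x \<in> cbox (\<chi> i. - u) (\<chi> i. u)"
  have "\<bar>x $ i\<bar> < R / 2" for i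
  proof -
    have "- u \<le> x $ i" "x $ i \<le> u" using x by (auto simp: mem_box_cart)
    then show ?thesis using assms unfolding abs_less_iff by linarith
  qed
  then show "x \<in> cube 0 R" by (simp add: cube_def)
qed

lemma cutoff_grad_outside: "x \<notin> cube 0 (2 * u) \<Longrightarrow> grad (cutoff m u) x $ i = 0"
proof -
  assume "x \<notin> cube 0 (2 * u)"
  then obtain j where "u \<le> \<bar>x $ j\<bar>" by (force simp: cube_def not_less)
  then have j: "u \<le> x $ j \<or> x $ j \<le> - u" by linarith
  have "real m * (u - x $ j) \<le> 0 \<or> real m * (x $ j + u) \<le> 0"
    using j by (auto simp: mult_nonneg_nonpos)
  then have "cut1 (real m) u (x $ j) = 0" "cut1' (real m) u (x $ j) = 0"
    by (auto simp: cut1_def cut1'_def pexp_def)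
  then show ?thesis unfolding cutoff_grad by (cases "j = i") (auto intro!: prod_zero)
qed

subsection \<open>The Caccioppoli inequality\<close>

text \<open>PA is the counterpart of PB for the fluxes of subsolutions, from the multiscale sum in
  \<open>Lambda_up\<close> over \<open>K_sub\<close>. The parameter X = PA PB, at least 1, is the
  square root of \<open>Theta\<close> up to a constant.\<close>

locale coarse_elliptic = lower_coarse a t PB for a :: "real^'n \<Rightarrow> real^'n^'n" and t PB :: real +
  fixes s PA :: real
  assumes s: "0 < s" "s + t < 1" and PA: "0 \<le> PA" and ratio: "1 \<le> PA * PB"
    and coflux_mean: "\<And>n z v V i. node n z \<Longrightarrow> subsol a (cube 0 1) v V \<Longrightarrow>
      \<bar>LINT x|lebesgue_on (tcube n z). (a x *v V x) $ i\<bar> \<le>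
        sqrt (vol TYPE('n) n) * (PA * (3 powr s) ^ n) * sqrt (energy a (tcube n z) V)"
begin

text \<open>The cross term is split over the triadic cubes of generation N, and
  \<open>pairing_bound\<close> is applied on each of them. Starting at depth N instead of the root
  puts the factor 3^((s+t-1)N) in front of the energy, which makes absorption possible; the price is
  the factor 3^(s N) in the L2 term.\<close>

lemma caccioppoli_step:
  assumes v: "subsol a (cube 0 1) v V" and ap: "approximates \<phi> v V"
    and nonneg: "\<And>k x. x \<in> cube 0 1 \<Longrightarrow> 0 \<le> \<phi> k x"
    and R: "\<rho> < R" "R \<le> 1" and m: "8 \<le> real m * (R - \<rho>)" and N: "4 * side N \<le> R - \<rho>"
  shows "exp (- 2 * real CARD('n)) * energy a (cube 0 \<rho>) V \<le> real CARD('n) *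
    ((const_pair TYPE('n) s t * (3 powr (s + t - 1)) ^ N * PA * (72 * real m) * PB) * energy a (cube 0 R) V +
     (PA * (const_pair TYPE('n) s t * (real CARD('n) * (72 * real m)\<^sup>2) + 72 * real m * (3 powr s) ^ N / (2 * bump_mass TYPE('n)))) *
      sqrt (LINT x|lebesgue_on (cube 0 R). (v x)\<^sup>2) * sqrt (energy a (cube 0 R) V))"
proof -
  let ?d = "real CARD('n)" and ?I = "bump_mass TYPE('n)" and ?cp = "const_pair TYPE('n) s t" and ?q = "3 powr (s + t - 1)"
  define G0 where "G0 = 72 * real m"
  define G1 where "G1 = ?d * (72 * real m)\<^sup>2"
  define C1 where "C1 = ?cp * ?q ^ N * PA * G0 * PB"
  define C2 where "C2 = PA * (?cp * G1 + G0 * (3 powr s) ^ N / (2 * ?I))"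
  have m0: "0 < real m"
  proof (rule ccontr)
    assume "\<not> 0 < real m" then show False using m by simp
  qed
  \<comment> \<open>The half-width is chosen so that m (u - rho/2) = 2, as
    \<open>cutoff_lower\<close> asks. The assumption on m leaves a margin of (R - rho)/4 to the
    faces of the outer cube.\<close>
  define u where "u = \<rho> / 2 + 2 / real m"
  have u1: "2 / real m \<le> (R - \<rho>) / 4" using m m0 by (simp add: field_simps)
  have u2: "2 * u < R" "u + (R - \<rho>) / 4 \<le> R / 2" using u1 R by (simp_all add: u_def field_simps)
  have u3: "2 \<le> real m * (u - \<rho> / 2)" using m0 by (simp add: u_def)
  define \<eta> where "\<eta> = (cutoff m u :: real^'n \<Rightarrow> real)"
  have sub1: "cube 0 R \<subseteq> cube (0::real^'n) 1" and sub\<rho>: "cube 0 \<rho> \<subseteq> cube (0::real^'n) 1"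
    using R by (auto intro!: cube_subset)
  have \<eta>t: "\<eta> \<in> test_functions (cube 0 1)"
    unfolding \<eta>_def by (rule test_functions_mono[OF sub1 cutoff_test[OF u2(1)]])
  have \<eta>b: "0 \<le> \<eta> x" "\<eta> x \<le> 1" for x unfolding \<eta>_def by (rule cutoff_bounds)+
  note vH = subsol_H1a[OF v]
  note fV = H1a_fin_energy[OF vH] and v2 = H1a_L2[OF vH]
  note \<phi> = approximates_smooth[OF ap]
  note \<eta>m = smooth_measurable[OF test_smooth_up[OF \<eta>t]]
  have f\<eta>: "fin_energy a (cube 0 1) (\<lambda>x. \<eta> x *\<^sub>R V x)"
    by (rule fin_mult(1)[OF fV \<eta>m, of 1]) (use \<eta>b in \<open>auto simp: abs_of_nonneg\<close>)
  have cpn: "0 \<le> ?cp" by (rule const_pair_nonneg) (use s in auto)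
  have q: "0 \<le> ?q ^ N" "?q ^ N \<le> 1" using powr_less_one[of "s + t - 1"] s by (auto intro!: power_le_one)
  have I: "0 < ?I" by (rule bump_mass_pos)
  have G: "0 \<le> G0" "0 \<le> G1" by (auto simp: G0_def G1_def)
  have C: "0 \<le> C1" "0 \<le> C2" unfolding C1_def C2_def using cpn q PA PB G I by auto
  \<comment> \<open>Weighting with the indicator of the outer cube keeps these quantities additive
    along the tree of the unit cube, although the outer cube need not be a union of triadic
    cubes.\<close>
  define ER where "ER F n z = (LINT x|lebesgue_on (tcube n z). indicator (cube 0 R) x * (F x \<bullet> (a x *v F x)))" for F n z
  define lR where "lR w n z = (LINT x|lebesgue_on (tcube n z). indicator (cube 0 R) x * (w x)\<^sup>2)" for w :: "real^'n \<Rightarrow> real" and n z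
  have lower: "exp (- 2 * ?d) * energy a (cube 0 \<rho>) V \<le> bil a (cube 0 1) V (\<lambda>x. \<eta> x *\<^sub>R V x)"
  proof -
    have iV: "integrable (lebesgue_on (cube 0 1)) (\<lambda>x. V x \<bullet> (a x *v V x))" using fV by (simp add: fin_energy_def)
    have i\<eta>: "integrable (lebesgue_on (cube 0 1)) (\<lambda>x. V x \<bullet> (a x *v (\<eta> x *\<^sub>R V x)))" by (rule bil_integrable[OF fV f\<eta>])
    have "exp (- 2 * ?d) * energy a (cube 0 \<rho>) V = (LINT x|lebesgue_on (cube 0 \<rho>). exp (- 2 * ?d) * (V x \<bullet> (a x *v V x)))"
      by (simp add: bil_def)
    also have "\<dots> \<le> (LINT x|lebesgue_on (cube 0 \<rho>). V x \<bullet> (a x *v (\<eta> x *\<^sub>R V x)))"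
    proof (rule integral_mono)
      show "integrable (lebesgue_on (cube 0 \<rho>)) (\<lambda>x. exp (- 2 * ?d) * (V x \<bullet> (a x *v V x)))"
        using integrable_lebesgue_on_subset[OF iV sub\<rho> cube_sets cube_sets] by simp
      show "integrable (lebesgue_on (cube 0 \<rho>)) (\<lambda>x. V x \<bullet> (a x *v (\<eta> x *\<^sub>R V x)))"
        by (rule integrable_lebesgue_on_subset[OF i\<eta> sub\<rho> cube_sets cube_sets])
      fix x :: "real^'n" assume x: "x \<in> space (lebesgue_on (cube 0 \<rho>))"
      have "\<bar>x $ i\<bar> \<le> \<rho> / 2" for i using x by (auto simp: cube_def less_imp_le)
      then have "exp (- 2 * ?d) \<le> \<eta> x" unfolding \<eta>_def by (rule cutoff_lower[OF _ u3])
      moreover have "0 \<le> V x \<bullet> (a x *v V x)" using x sub\<rho> by (intro a_psd) auto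
      ultimately show "exp (- 2 * ?d) * (V x \<bullet> (a x *v V x)) \<le> V x \<bullet> (a x *v (\<eta> x *\<^sub>R V x))"
        by (simp add: matrix_vector_mult_scaleR mult_right_mono)
    qed
    also have "\<dots> \<le> (LINT x|lebesgue_on (cube 0 1). V x \<bullet> (a x *v (\<eta> x *\<^sub>R V x)))"
      by (rule integral_lebesgue_on_mono_set[OF i\<eta> sub\<rho> cube_sets cube_sets])
        (use \<eta>b(1) a_psd in \<open>auto simp: matrix_vector_mult_scaleR\<close>)
    finally show ?thesis by (simp add: bil_def)
  qed
  have upper: "\<bar>bil a (cube 0 1) V (\<lambda>x. \<phi> k x *\<^sub>R grad \<eta> x)\<bar> \<le>
    ?d * (C1 * (sqrt (energy a (cube 0 R) (grad (\<phi> k))) * sqrt (energy a (cube 0 R) V)) +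
          C2 * (sqrt (LINT x|lebesgue_on (cube 0 R). (\<phi> k x)\<^sup>2) * sqrt (energy a (cube 0 R) V)))" for k
  proof -
    define w where "w = \<phi> k"
    have w: "w \<in> smooth_up_to_boundary (cube 0 1)" unfolding w_def by (rule \<phi>(1))
    have fw: "fin_energy a (cube 0 1) (grad w)" and w2: "w \<in> L2 (cube 0 1)" using smooth_fin_energy[OF w] smooth_L2[OF w] by auto
    have RI: "integrable (lebesgue_on (cube 0 1)) (\<lambda>x. indicator (cube 0 R) x * (h x :: real))" if "integrable (lebesgue_on (cube 0 1)) h" for h :: "real^'n \<Rightarrow> real"
      using integrable_mult_indicator[of "cube 0 R" "lebesgue_on (cube 0 1)" h] that sub1 by (simp add: sets_restrict_space_iff)
    have RT: "(LINT x|lebesgue_on (cube 0 1). indicator (cube 0 R) x * (h x :: real)) = (LINT x|lebesgue_on (cube 0 R). h x)" for h :: "real^'n \<Rightarrow> real"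
    proof -
      have "(LINT x|lebesgue_on (cube 0 1). indicator (cube 0 R) x * h x) = (LINT x|lebesgue_on (cube 0 R). indicator (cube 0 R) x * h x)"
        by (rule integral_lebesgue_on_zero_outside[OF sub1 cube_sets cube_sets]) (auto simp: indicator_def)
      also have "\<dots> = (LINT x|lebesgue_on (cube 0 R). h x)" by (rule Bochner_Integration.integral_cong) auto
      finally show ?thesis .
    qed
    have fi: "integrable (lebesgue_on (cube 0 1)) (\<lambda>x. F x \<bullet> (a x *v F x))" if "fin_energy a (cube 0 1) F" for F
      using that by (simp add: fin_energy_def)
    have w2i: "integrable (lebesgue_on (cube 0 1)) (\<lambda>x. (w x)\<^sup>2)" using w2 by (simp add: L2_def)
    have ER_kids: "(\<Sum>z'\<in>kids n z. ER F (Suc n) z') = ER F n z" if "fin_energy a (cube 0 1) F" "node n z" for F n z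
      unfolding ER_def by (rule integral_kids[symmetric, OF integrable_tcube[OF RI[OF fi[OF that(1)]] that(2)]])
    have lR_kids: "(\<Sum>z'\<in>kids n z. lR w (Suc n) z') = lR w n z" if "node n z" for n z
      unfolding lR_def by (rule integral_kids[symmetric, OF integrable_tcube[OF RI[OF w2i] that]])
    have ER0: "0 \<le> ER F n z" if z: "node n z" for F n z
      unfolding ER_def by (rule Bochner_Integration.integral_nonneg) (use node_subset[OF z] a_psd in \<open>auto intro!: mult_nonneg_nonneg\<close>)
    have lR0: "0 \<le> lR w n z" for n z unfolding lR_def by simp
    define e where "e n z = C1 * (sqrt (ER (grad w) n z) * sqrt (ER V n z)) + C2 * (sqrt (lR w n z) * sqrt (ER V n z))" for n z
    have e_kids: "(\<Sum>z'\<in>kids n z. e (Suc n) z') \<le> e n z" if z: "node n z" for n z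
    proof -
      have "(\<Sum>z'\<in>kids n z. e (Suc n) z') = C1 * (\<Sum>z'\<in>kids n z. sqrt (ER (grad w) (Suc n) z') * sqrt (ER V (Suc n) z')) + C2 * (\<Sum>z'\<in>kids n z. sqrt (lR w (Suc n) z') * sqrt (ER V (Suc n) z'))"
        by (simp only: e_def sum.distrib sum_distrib_left)
      also have "\<dots> \<le> C1 * (sqrt (ER (grad w) n z) * sqrt (ER V n z)) + C2 * (sqrt (lR w n z) * sqrt (ER V n z))"
        by (intro add_mono mult_left_mono C
            sum_sqrt_mult_le[OF ER0[OF node.kid[OF z]] ER0[OF node.kid[OF z]] eq_refl[OF ER_kids[OF fw z]] eq_refl[OF ER_kids[OF fV z]]]
            sum_sqrt_mult_le[OF lR0 ER0[OF node.kid[OF z]] eq_refl[OF lR_kids[OF z]] eq_refl[OF ER_kids[OF fV z]]])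
      finally show ?thesis by (simp only: e_def)
    qed
    have comp: "\<bar>LINT x|lebesgue_on (cube 0 1). (w x * grad \<eta> x $ i) * (a x *v V x) $ i\<bar> \<le> e 0 0"
      and int_i: "integrable (lebesgue_on (cube 0 1)) (\<lambda>x. (w x * grad \<eta> x $ i) * (a x *v V x) $ i)" for i
    proof -
      have fI: "integrable (lebesgue_on (cube 0 1)) (\<lambda>x. (a x *v V x) $ i)" by (rule energy_integrable_nth[OF fV])
      obtain W where W: "W > 0" "\<And>x. x \<in> cube 0 1 \<Longrightarrow> \<bar>w x\<bar> \<le> W"
        using smooth_up_to_boundary_bounded[OF w U_bounded] by metis
      have gb: "\<bar>grad \<eta> x $ i\<bar> \<le> G0" "\<bar>grad \<eta> x $ i - grad \<eta> y $ i\<bar> \<le> G1 * norm (x - y)" for x y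
        unfolding \<eta>_def G0_def G1_def by (rule cutoff_grad_bounds)+
      show iI: "integrable (lebesgue_on (cube 0 1)) (\<lambda>x. (w x * grad \<eta> x $ i) * (a x *v V x) $ i)"
      proof (rule Bochner_Integration.integrable_bound)
        show "integrable (lebesgue_on (cube 0 1)) (\<lambda>x. W * G0 * (a x *v V x) $ i)" using fI by auto
        show "(\<lambda>x. (w x * grad \<eta> x $ i) * (a x *v V x) $ i) \<in> borel_measurable (lebesgue_on (cube 0 1))"
          using smooth_measurable[OF w] borel_measurable_vec_nth[OF smooth_grad_measurable[OF test_smooth_up[OF \<eta>t]]] fI by auto
        show "AE x in lebesgue_on (cube 0 1). norm ((w x * grad \<eta> x $ i) * (a x *v V x) $ i) \<le> norm (W * G0 * (a x *v V x) $ i)"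
        proof (rule AE_I2)
          fix x :: "real^'n" assume "x \<in> space (lebesgue_on (cube 0 1))"
          then have "\<bar>w x\<bar> * \<bar>grad \<eta> x $ i\<bar> * \<bar>(a x *v V x) $ i\<bar> \<le> W * G0 * \<bar>(a x *v V x) $ i\<bar>"
            using W gb(1)[of x] by (intro mult_right_mono mult_mono) auto
          then show "norm ((w x * grad \<eta> x $ i) * (a x *v V x) $ i) \<le> norm (W * G0 * (a x *v V x) $ i)"
            using W(1) G by (simp add: abs_mult)
        qed
      qed
      have leaf: "\<bar>LINT x|lebesgue_on (tcube N z). (w x * grad \<eta> x $ i) * (a x *v V x) $ i\<bar> \<le> e N z" if z: "node N z" for z
      proof (cases "\<forall>x\<in>tcube N z. grad \<eta> x $ i = 0")
        case True
        then have "(LINT x|lebesgue_on (tcube N z). (w x * grad \<eta> x $ i) * (a x *v V x) $ i) = (LINT x|lebesgue_on (tcube N z). 0)"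
          by (intro Bochner_Integration.integral_cong) auto
        then show ?thesis using C ER0[OF z] lR0 by (simp add: e_def)
      next
        case False
        then obtain x0 where x0: "x0 \<in> tcube N z" "grad \<eta> x0 $ i \<noteq> 0" by blast
        have x0u: "x0 \<in> cube 0 (2 * u)" using x0(2) cutoff_grad_outside[of x0 u m i] unfolding \<eta>_def by blast
        \<comment> \<open>A leaf on which the cutoff varies lies inside the outer cube because its
          side fits into the margin; on such leaves the localised quantities are the full
          ones.\<close>
        have subR: "tcube N z \<subseteq> cube 0 R"
        proof
          fix y assume y: "y \<in> tcube N z"
          have "\<bar>y $ j\<bar> < R / 2" for j
          proof -
            have "\<bar>x0 $ j\<bar> < u" using x0u by (simp add: cube_def)
            moreover have "\<bar>x0 $ j - z $ j\<bar> < side N / 2" "\<bar>y $ j - z $ j\<bar> < side N / 2" using x0(1) y by (auto simp: cube_def)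
            moreover have "\<bar>y $ j\<bar> \<le> \<bar>x0 $ j\<bar> + \<bar>x0 $ j - z $ j\<bar> + \<bar>y $ j - z $ j\<bar>"
              using abs_triangle_ineq[of "y $ j - z $ j" "z $ j"] abs_triangle_ineq4[of "x0 $ j" "x0 $ j - z $ j"] by simp
            ultimately have "\<bar>y $ j\<bar> < u + side N" by linarith
            also have "\<dots> \<le> u + (R - \<rho>) / 4" using N by simp
            also note u2(2)
            finally show ?thesis .
          qed
          then show "y \<in> cube 0 R" by (simp add: cube_def)
        qed
        have eER: "ER F N z = energy a (tcube N z) F" for F
          unfolding ER_def bil_def by (rule Bochner_Integration.integral_cong) (use subR in \<open>auto simp: indicator_def\<close>)
        have elR: "lR w N z = (LINT x|lebesgue_on (tcube N z). (w x)\<^sup>2)"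
          unfolding lR_def by (rule Bochner_Integration.integral_cong) (use subR in \<open>auto simp: indicator_def\<close>)
        define EV where "EV = sqrt (ER V N z)"
        define Ew where "Ew = sqrt (ER (grad w) N z)"
        define lw where "lw = sqrt (lR w N z)"
        have nn: "0 \<le> EV" "0 \<le> Ew" "0 \<le> lw" using ER0[OF z] lR0 by (auto simp: EV_def Ew_def lw_def)
        let ?f = "LINT x|lebesgue_on (tcube N z). (a x *v V x) $ i"
        have pb: "\<bar>(LINT x|lebesgue_on (tcube N z). (w x * grad \<eta> x $ i) * (a x *v V x) $ i) - mavg w N z * grad \<eta> z $ i * ?f\<bar> \<le>
          ?cp * ?q ^ N * (PA * (G0 * PB * sqrt (energy a (tcube N z) (grad w)) + G1 * sqrt (LINT x|lebesgue_on (tcube N z). (w x)\<^sup>2)) * sqrt (energy a (tcube N z) V))"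
          by (rule pairing_bound[where ef="\<lambda>n z. energy a (tcube n z) V", OF w fI coflux_mean[OF _ v] energy_tcube_nonneg[OF field_unit]
                eq_refl[OF energy_kids[OF field_unit fV]] PA less_imp_le[OF s(1)] s(2) gb G(2) z])
        \<comment> \<open>The product of means subtracted in \<open>pairing_bound\<close> is put
          back. Estimated by the L2 norm and the flux bound on the leaf, it is the origin of the
          factor (3^s)^N in C2.\<close>
        have "\<bar>mavg w N z\<bar> \<le> lw * sqrt (vol TYPE('n) N) / (2 * ?I * vol TYPE('n) N)"
          using mavg_L2[OF L2_subset[OF w2 node_subset[OF z]], of "tcube N z"] by (simp add: lw_def elR measure_tcube)
        moreover have "\<bar>?f\<bar> \<le> sqrt (vol TYPE('n) N) * (PA * (3 powr s) ^ N) * EV"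
          using coflux_mean[OF z v] by (simp add: EV_def eER)
        ultimately have "\<bar>mavg w N z * grad \<eta> z $ i * ?f\<bar> \<le> (lw * sqrt (vol TYPE('n) N) / (2 * ?I * vol TYPE('n) N)) * G0 * (sqrt (vol TYPE('n) N) * (PA * (3 powr s) ^ N) * EV)"
          unfolding abs_mult using gb(1)[of z] nn PA I G by (intro mult_mono) auto
        also have "\<dots> = (sqrt (vol TYPE('n) N) * sqrt (vol TYPE('n) N) / vol TYPE('n) N) * (PA * (G0 * (3 powr s) ^ N / (2 * ?I)) * lw * EV)"
          by (simp only: times_divide_eq_left times_divide_eq_right divide_divide_eq_left mult_ac)
        also have "sqrt (vol TYPE('n) N) * sqrt (vol TYPE('n) N) / vol TYPE('n) N = 1"
          using vol_pos(1)[of "TYPE('n)" N] by (simp del: vol_pos)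
        finally have mb: "\<bar>mavg w N z * grad \<eta> z $ i * ?f\<bar> \<le> PA * (G0 * (3 powr s) ^ N / (2 * ?I)) * lw * EV" by simp
        have "?cp * ?q ^ N * (PA * (G0 * PB * Ew + G1 * lw) * EV) = C1 * (Ew * EV) + (?q ^ N) * (?cp * PA * G1 * lw * EV)"
          by (simp add: C1_def algebra_simps)
        \<comment> \<open>The small factor is kept in front of the energy, where it drives the
          absorption, and bounded by 1 in front of the L2 norm.\<close>
        also have "\<dots> \<le> C1 * (Ew * EV) + 1 * (?cp * PA * G1 * lw * EV)"
          using q cpn PA G nn by (intro add_left_mono mult_right_mono) auto
        finally have "?cp * ?q ^ N * (PA * (G0 * PB * Ew + G1 * lw) * EV) \<le> C1 * (Ew * EV) + ?cp * PA * G1 * lw * EV" by simp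
        with pb mb have "\<bar>LINT x|lebesgue_on (tcube N z). (w x * grad \<eta> x $ i) * (a x *v V x) $ i\<bar> \<le>
          C1 * (Ew * EV) + ?cp * PA * G1 * lw * EV + PA * (G0 * (3 powr s) ^ N / (2 * ?I)) * lw * EV"
          unfolding Ew_def EV_def lw_def eER elR by linarith
        also have "\<dots> = e N z" by (simp add: e_def C2_def Ew_def EV_def lw_def algebra_simps)
        finally show ?thesis .
      qed
      have "\<bar>LINT x|lebesgue_on (tcube 0 0). (w x * grad \<eta> x $ i) * (a x *v V x) $ i\<bar> \<le> e 0 0"
      proof (rule tree_aggregate[where node=node and kids=kids and N=N and R="\<lambda>n z. \<bar>LINT x|lebesgue_on (tcube n z). (w x * grad \<eta> x $ i) * (a x *v V x) $ i\<bar>" and e=e])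
        show "node (Suc n) z'" if "node n z" "z' \<in> kids n z" for n and z z' :: "real^'n" by (rule node.kid[OF that])
        show "\<bar>LINT x|lebesgue_on (tcube n z). (w x * grad \<eta> x $ i) * (a x *v V x) $ i\<bar> \<le> (\<Sum>z'\<in>kids n z. \<bar>LINT x|lebesgue_on (tcube (Suc n) z'). (w x * grad \<eta> x $ i) * (a x *v V x) $ i\<bar>)" if "node n z" for n z
          unfolding integral_kids[OF integrable_tcube[OF iI that]] by (rule sum_abs)
      qed (use e_kids leaf node.root in auto)
      then show "\<bar>LINT x|lebesgue_on (cube 0 1). (w x * grad \<eta> x $ i) * (a x *v V x) $ i\<bar> \<le> e 0 0" by simp
    qed
    have "bil a (cube 0 1) V (\<lambda>x. w x *\<^sub>R grad \<eta> x) = (LINT x|lebesgue_on (cube 0 1). (\<Sum>i\<in>UNIV. (w x * grad \<eta> x $ i) * (a x *v V x) $ i))"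
      unfolding bil_def
    proof (rule Bochner_Integration.integral_cong[OF refl])
      fix x :: "real^'n" assume "x \<in> space (lebesgue_on (cube 0 1))"
      then have "V x \<bullet> (a x *v (w x *\<^sub>R grad \<eta> x)) = (w x *\<^sub>R grad \<eta> x) \<bullet> (a x *v V x)" by (intro symmetric_form a_sym) simp
      then show "V x \<bullet> (a x *v (w x *\<^sub>R grad \<eta> x)) = (\<Sum>i\<in>UNIV. (w x * grad \<eta> x $ i) * (a x *v V x) $ i)"
        by (simp only: inner_vec_def inner_real_def vector_scaleR_component real_scaleR_def)
    qed
    also have "\<dots> = (\<Sum>i\<in>UNIV. LINT x|lebesgue_on (cube 0 1). (w x * grad \<eta> x $ i) * (a x *v V x) $ i)"
      by (rule Bochner_Integration.integral_sum) (rule int_i)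
    also have "\<bar>\<dots>\<bar> \<le> (\<Sum>i\<in>(UNIV :: 'n set). e 0 0)" by (rule order_trans[OF sum_abs sum_mono]) (rule comp)
    also have "\<dots> = ?d * e 0 0" by simp
    also have "e 0 0 = C1 * (sqrt (energy a (cube 0 R) (grad w)) * sqrt (energy a (cube 0 R) V)) +
          C2 * (sqrt (LINT x|lebesgue_on (cube 0 R). (w x)\<^sup>2) * sqrt (energy a (cube 0 R) V))"
      by (simp only: e_def ER_def lR_def power_0 RT bil_def)
    finally show ?thesis by (simp only: w_def)
  qed
  define L where "L k = - (?d * (C1 * (sqrt (energy a (cube 0 R) (grad (\<phi> k))) * sqrt (energy a (cube 0 R) V)) +
          C2 * (sqrt (LINT x|lebesgue_on (cube 0 R). (\<phi> k x)\<^sup>2) * sqrt (energy a (cube 0 R) V))))" for k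
  have key: "exp (- 2 * ?d) * energy a (cube 0 \<rho>) V \<le> - L k + sqrt (energy a (cube 0 1) V) * sqrt (energy a (cube 0 1) (\<lambda>x. grad (\<phi> k) x - V x))" for k
    using subsol_energy_test[OF v \<phi>(1)[of k] nonneg \<eta>t \<eta>b] lower upper[of k] unfolding L_def by linarith
  interpret C: coefficients a "cube 0 R" by (rule coefficients_subset[OF field_unit sub1 cube_open])
  note lim = C.approximates_limits[OF approximates_subset[OF ap v2 fV sub1 cube_open] L2_subset[OF v2 sub1 cube_sets cube_sets] fin_energy_subset[OF fV sub1 cube_sets cube_sets]]
  have en: "(\<lambda>k. energy a (cube 0 1) (\<lambda>x. grad (\<phi> k) x - V x)) \<longlonglongrightarrow> 0" using ap by (simp add: approximates_def)
  have "(\<lambda>k. - L k + sqrt (energy a (cube 0 1) V) * sqrt (energy a (cube 0 1) (\<lambda>x. grad (\<phi> k) x - V x))) \<longlonglongrightarrow>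
    - (- (?d * (C1 * (sqrt (energy a (cube 0 R) V) * sqrt (energy a (cube 0 R) V)) +
          C2 * (sqrt (LINT x|lebesgue_on (cube 0 R). (v x)\<^sup>2) * sqrt (energy a (cube 0 R) V))))) + sqrt (energy a (cube 0 1) V) * sqrt 0"
    unfolding L_def by (intro tendsto_intros lim(1) lim(3) en)
  then have "exp (- 2 * ?d) * energy a (cube 0 \<rho>) V \<le> - (- (?d * (C1 * (sqrt (energy a (cube 0 R) V) * sqrt (energy a (cube 0 R) V)) +
          C2 * (sqrt (LINT x|lebesgue_on (cube 0 R). (v x)\<^sup>2) * sqrt (energy a (cube 0 R) V))))) + sqrt (energy a (cube 0 1) V) * sqrt 0"
    by (rule LIMSEQ_le_const) (use key in blast)
  then show ?thesis using C.energy_nonneg[of V] by (simp add: C1_def C2_def G0_def G1_def mult.assoc)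
qed

end

subsection \<open>Absorption of the energy\<close>

text \<open>The base of the power is the first gap between consecutive radii as a fraction of the
  whole gap; the denominator sums the geometric series of ratio sqrt 2 / 2.\<close>

definition hole_const :: "real \<Rightarrow> real" where
  "hole_const \<gamma> = (1 - 2 powr (- 1 / (2 * \<gamma>))) powr (- \<gamma>) / (1 - sqrt 2 / 2)"

text \<open>Along radii whose gaps shrink by the factor \<open>2\<^sup>-\<^sup>1\<^sup>/\<^sup>(\<^sup>2\<^sup>\<gamma>\<^sup>)\<close> the error terms grow only like
  \<open>sqrt 2\<close> per step, while each step gains a factor 2.\<close>

lemma hole_filling:
  fixes f :: "real \<Rightarrow> real"
  assumes f: "\<And>\<rho> R. \<lbrakk>\<rho>0 \<le> \<rho>; \<rho> < R; R \<le> R0\<rbrakk> \<Longrightarrow> f \<rho> \<le> f R / 2 + A * (R - \<rho>) powr (- \<gamma>)"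
    and M: "\<And>\<rho>. \<lbrakk>\<rho>0 \<le> \<rho>; \<rho> \<le> R0\<rbrakk> \<Longrightarrow> f \<rho> \<le> M"
    and A: "0 \<le> A" and \<gamma>: "0 < \<gamma>" and R: "\<rho>0 < R0"
  shows "f \<rho>0 \<le> hole_const \<gamma> * A * (R0 - \<rho>0) powr (- \<gamma>)"
proof -
  define \<kappa> :: real where "\<kappa> = 2 powr (- 1 / (2 * \<gamma>))"
  define \<theta> where "\<theta> = sqrt 2 / 2"
  have \<kappa>: "0 < \<kappa>" "\<kappa> < 1" unfolding \<kappa>_def using \<gamma> powr_less_mono[of "- 1 / (2 * \<gamma>)" 0 "2::real"] by auto
  have "sqrt 2 < 2" using real_sqrt_less_mono[of 2 4] by simp
  then have \<theta>: "0 \<le> \<theta>" "\<theta> < 1" by (simp_all add: \<theta>_def)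
  have \<kappa>\<gamma>: "\<kappa> powr (- \<gamma>) = sqrt 2" using \<gamma> by (simp add: \<kappa>_def powr_powr powr_half_sqrt[symmetric])
  define \<Delta> where "\<Delta> = R0 - \<rho>0"
  have \<Delta>: "0 < \<Delta>" using R by (simp add: \<Delta>_def)
  define r where "r i = R0 - \<Delta> * \<kappa> ^ i" for i :: nat
  have \<kappa>i: "0 < \<kappa> ^ i" "\<kappa> ^ i \<le> 1" for i using \<kappa> by (auto intro!: power_le_one)
  have r0: "r 0 = \<rho>0" by (simp add: r_def \<Delta>_def)
  have rb: "\<rho>0 \<le> r i" "r i \<le> R0" for i
  proof -
    have "\<Delta> * \<kappa> ^ i \<le> \<Delta> * 1" "0 \<le> \<Delta> * \<kappa> ^ i" using mult_left_mono[OF \<kappa>i(2)[of i], of \<Delta>] \<Delta> \<kappa>i(1)[of i] by auto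
    moreover have "\<rho>0 = R0 - \<Delta>" by (simp add: \<Delta>_def)
    ultimately show "\<rho>0 \<le> r i" "r i \<le> R0" unfolding r_def by linarith+
  qed
  have rd: "r (Suc i) - r i = (\<Delta> * (1 - \<kappa>)) * \<kappa> ^ i" for i by (simp add: r_def algebra_simps)
  have rlt: "r i < r (Suc i)" for i
  proof -
    have "0 < (\<Delta> * (1 - \<kappa>)) * \<kappa> ^ i" using \<Delta> \<kappa> \<kappa>i(1)[of i] by simp
    then show ?thesis using rd[of i] by linarith
  qed
  define B where "B = A * (\<Delta> * (1 - \<kappa>)) powr (- \<gamma>)"
  have B: "0 \<le> B" using A by (simp add: B_def)
  have step: "f (r i) \<le> f (r (Suc i)) / 2 + B * sqrt 2 ^ i" for i
  proof -
    have "(r (Suc i) - r i) powr (- \<gamma>) = (\<Delta> * (1 - \<kappa>)) powr (- \<gamma>) * (\<kappa> ^ i) powr (- \<gamma>)"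
      unfolding rd using \<Delta> \<kappa> by (simp add: powr_mult)
    also have "(\<kappa> ^ i) powr (- \<gamma>) = sqrt 2 ^ i"
      using \<kappa> \<kappa>\<gamma> by (metis powr_realpow powr_powr powr_gt_zero mult.commute)
    finally show ?thesis using f[OF rb(1) rlt rb(2), of i] by (simp add: B_def mult.assoc)
  qed
  have claim: "f \<rho>0 \<le> f (r n) / 2 ^ n + B * (\<Sum>i<n. \<theta> ^ i)" for n
  proof (induction n)
    case 0 then show ?case by (simp add: r0)
  next
    case (Suc n)
    have "f (r n) / 2 ^ n \<le> (f (r (Suc n)) / 2 + B * sqrt 2 ^ n) / 2 ^ n" by (intro divide_right_mono step) auto
    also have "\<dots> = f (r (Suc n)) / 2 ^ Suc n + B * \<theta> ^ n" by (simp add: \<theta>_def power_divide add_divide_distrib)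
    finally show ?case using Suc by (simp add: algebra_simps)
  qed
  have le: "f \<rho>0 \<le> M / 2 ^ n + B * (1 / (1 - \<theta>))" for n
  proof -
    have "(\<Sum>i<n. \<theta> ^ i) \<le> 1 / (1 - \<theta>)"
      using \<theta> by (subst sum_gp_strict) (auto simp: divide_right_mono)
    then have "B * (\<Sum>i<n. \<theta> ^ i) \<le> B * (1 / (1 - \<theta>))" using B by (rule mult_left_mono)
    moreover have "f (r n) / 2 ^ n \<le> M / 2 ^ n" by (intro divide_right_mono M rb) auto
    ultimately show ?thesis using claim[of n] by linarith
  qed
  have "(\<lambda>n. M * (1 / 2) ^ n + B * (1 / (1 - \<theta>))) \<longlonglongrightarrow> M * 0 + B * (1 / (1 - \<theta>))"
    by (intro tendsto_intros LIMSEQ_power_zero) auto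
  then have "f \<rho>0 \<le> M * 0 + B * (1 / (1 - \<theta>))"
    by (rule LIMSEQ_le_const) (use le in \<open>simp add: power_divide\<close>)
  also have "\<dots> = hole_const \<gamma> * A * \<Delta> powr (- \<gamma>)"
  proof -
    have h: "hole_const \<gamma> = (1 - \<kappa>) powr (- \<gamma>) / (1 - \<theta>)" by (simp only: hole_const_def \<kappa>_def \<theta>_def)
    show ?thesis unfolding h B_def powr_mult by (simp only: times_divide_eq_left times_divide_eq_right mult_zero_right add_0_left mult_1_right mult_ac)
  qed
  finally show ?thesis by (simp only: \<Delta>_def)
qed

lemma triadic_scale:
  fixes T :: real
  assumes "1 \<le> T"
  obtains N where "T \<le> 3 ^ N" "3 ^ N \<le> 3 * T"
proof -
  have ex: "\<exists>N. T \<le> 3 ^ N" using real_arch_pow[of 3 T] by (auto intro: less_imp_le)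
  define N where "N = (LEAST N. T \<le> 3 ^ N)"
  have N: "T \<le> 3 ^ N" unfolding N_def by (rule LeastI_ex[OF ex])
  have "3 ^ N \<le> 3 * T"
  proof (cases N)
    case 0 then show ?thesis using assms by simp
  next
    case (Suc M)
    then have "\<not> T \<le> 3 ^ M" using not_less_Least[of M "\<lambda>N. T \<le> 3 ^ N"] by (simp add: N_def)
    then show ?thesis by (simp add: Suc)
  qed
  with N show thesis by (rule that)
qed

lemma powr_nat_power: "(3 powr x) ^ N = (3 ^ N) powr (x::real)"
  by (simp add: powr_realpow[symmetric] powr_powr mult.commute)

lemma absorb_quarter:
  fixes E E' L C1 C2 K M c :: real
  assumes step: "E \<le> c * (C1 * E' + C2 * sqrt L * sqrt E')"
    and C: "c * C1 \<le> 1 / 4" "c * C2 \<le> M" and nn: "0 \<le> E'" "0 \<le> L"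
  shows "E \<le> E' / 2 + M\<^sup>2 * L"
proof -
  have "c * (C1 * E' + C2 * sqrt L * sqrt E') = (c * C1) * E' + (c * C2) * (sqrt L * sqrt E')"
    by (simp add: algebra_simps)
  also have "\<dots> \<le> 1 / 4 * E' + M * (sqrt L * sqrt E')"
    by (intro add_mono mult_right_mono C nn mult_nonneg_nonneg real_sqrt_ge_zero)
  also have "M * (sqrt L * sqrt E') \<le> (sqrt E')\<^sup>2 / 4 + (M * sqrt L)\<^sup>2"
    using zero_le_power2[of "sqrt E' / 2 - M * sqrt L"] by (simp add: power2_diff power_divide algebra_simps)
  finally show ?thesis using step nn by (simp add: power_mult_distrib)
qed

text \<open>The second entry of the maximum makes the coefficient of the energy at most 1/4 in
  \<open>caccioppoli_absorbed\<close>, where 648 / (R - rho) bounds the slope of the cutoff. The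
  entry 4 guarantees that four leaves fit into the gap R - rho.\<close>

definition scale_const :: "'n::finite itself \<Rightarrow> real \<Rightarrow> real \<Rightarrow> real" where
  "scale_const T s t = max 4 (4 * 648 * (exp (2 * real CARD('n)) * real CARD('n)) * const_pair T s t)"

text \<open>648^2 comes from the squared slope of the cutoff. 972 is 3 * 648 / 2, with 3 from
  rounding the scale to a power of 3 and 2 from the denominator in
  \<open>caccioppoli_step\<close>.\<close>

definition step_const :: "'n::finite itself \<Rightarrow> real \<Rightarrow> real \<Rightarrow> real" where
  "step_const T s t = exp (2 * real CARD('n)) * real CARD('n) *
     (const_pair T s t * real CARD('n) * 648\<^sup>2 + 972 * scale_const T s t powr (s / (1 - s - t)) / bump_mass T)"

definition caccioppoli_const :: "'n::finite itself \<Rightarrow> real \<Rightarrow> real \<Rightarrow> real" where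
  "caccioppoli_const T s t = hole_const (4 + 2 * (s / (1 - s - t))) * (step_const T s t)\<^sup>2"

context coarse_elliptic
begin

text \<open>Write D = R - rho, X = PA PB and e = s / (1 - s - t). The scale satisfies 3^N ~
  (X/D)^(1/sigma), so the loss (3^s)^N is of order (X/D)^e. The coefficient of the L2 norm is then
  of order PA X^e D^(-2-e), and its square gives the powers in the statement.\<close>

lemma caccioppoli_absorbed:
  assumes v: "subsol a (cube 0 1) v V" and ap: "approximates \<phi> v V"
    and nonneg: "\<And>k x. x \<in> cube 0 1 \<Longrightarrow> 0 \<le> \<phi> k x"
    and R: "0 \<le> \<rho>" "\<rho> < R" "R \<le> 1"
  shows "energy a (cube 0 \<rho>) V \<le> energy a (cube 0 R) V / 2 +
    ((step_const TYPE('n) s t)\<^sup>2 * PA\<^sup>2 * (PA * PB) powr (2 * (s / (1 - s - t)))) *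
      (LINT x|lebesgue_on (cube 0 R). (v x)\<^sup>2) * (R - \<rho>) powr (- (4 + 2 * (s / (1 - s - t))))"
proof -
  define D where "D = R - \<rho>"
  define X where "X = PA * PB"
  define \<sigma> where "\<sigma> = 1 - s - t"
  define e where "e = s / \<sigma>"
  define d where "d = real CARD('n)"
  define K where "K = exp (2 * d) * d"
  define Cp where "Cp = const_pair TYPE('n) s t"
  define I where "I = bump_mass TYPE('n)"
  define A1 where "A1 = scale_const TYPE('n) s t"
  define B where "B = A1 * X / D"
  have D: "0 < D" "D \<le> 1" using R by (auto simp: D_def)
  have X: "1 \<le> X" using ratio by (simp add: X_def)
  have \<sigma>: "0 < \<sigma>" "\<sigma> \<le> 1" using s t by (auto simp: \<sigma>_def)
  have e: "0 < e" using s \<sigma> by (simp add: e_def)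
  have d: "0 < d" by (simp add: d_def)
  have K: "0 < K" using d by (simp add: K_def)
  have Cp: "0 \<le> Cp" unfolding Cp_def by (rule const_pair_nonneg) (use s in auto)
  have I: "0 < I" unfolding I_def by (rule bump_mass_pos)
  have A1: "4 \<le> A1" "4 * 648 * K * Cp \<le> A1" by (auto simp: A1_def scale_const_def K_def d_def Cp_def)
  have "4 * 1 / D \<le> B" unfolding B_def using A1 X D by (intro divide_right_mono mult_mono) auto
  moreover have "4 * 1 \<le> 4 * 1 / D" using D by (simp add: field_simps)
  ultimately have B: "4 / D \<le> B" "4 \<le> B" by auto
  \<comment> \<open>The scale \<open>3\<^sup>N \<approx> B\<^sup>1\<^sup>/\<^sup>\<sigma>\<close> makes the coefficient of the energy on the right at most 1/4.\<close>
  define T where "T = B powr (1 / \<sigma>)"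
  have TB: "B \<le> T" using powr_mono[of 1 "1 / \<sigma>" B] \<sigma> B by (simp add: T_def)
  obtain N where N: "T \<le> 3 ^ N" "3 ^ N \<le> 3 * T" using triadic_scale[of T] TB B by auto
  \<comment> \<open>The steepness is 8/D rounded up. As D <= 1 this is at most 9/D, and 72 * 9 =
    648.\<close>
  define m where "m = nat \<lceil>8 / D\<rceil>"
  have m: "8 / D \<le> real m" "real m \<le> 8 / D + 1" using D by (auto simp: m_def of_nat_nat) 
  have "1 \<le> 1 / D" using D by simp
  then have m9: "72 * real m \<le> 648 / D" using m(2) by simp
  have mD: "8 \<le> real m * (R - \<rho>)" using m(1) D by (simp add: D_def[symmetric] field_simps)
  have "side N = 1 / 3 ^ N" by (simp add: power_one_over)
  also have "\<dots> \<le> 1 / (4 / D)" using N(1) TB B D by (intro divide_left_mono) auto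
  finally have sN: "4 * side N \<le> R - \<rho>" by (simp add: D_def)
  have q: "(3 powr (s + t - 1)) ^ N \<le> 1 / B"
  proof -
    have "(3 powr (s + t - 1)) ^ N = (3 ^ N) powr (- \<sigma>)"
    proof -
      have "s + t - 1 = - \<sigma>" by (simp add: \<sigma>_def)
      then show ?thesis by (simp only: powr_nat_power)
    qed
    also have "\<dots> \<le> T powr (- \<sigma>)" by (rule powr_mono2') (use \<sigma> TB B N in auto)
    also have "\<dots> = 1 / B" using \<sigma> B by (simp add: T_def powr_powr powr_minus_divide)
    finally show ?thesis .
  qed
  have qs: "(3 powr s) ^ N \<le> 3 * B powr e"
  proof -
    have "(3 powr s) ^ N = (3 ^ N) powr s" by (simp only: powr_nat_power)
    also have "\<dots> \<le> (3 * T) powr s" by (rule powr_mono2) (use s N in auto)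
    also have "\<dots> = 3 powr s * B powr e" using B by (simp add: T_def powr_mult powr_powr e_def)
    also have "\<dots> \<le> 3 powr 1 * B powr e" using s t by (intro mult_right_mono powr_mono) auto
    finally show ?thesis by simp
  qed
  \<comment> \<open>Z dominates both kinds of terms in C2: D^-2 from the Lipschitz constant of the
    gradient of the cutoff, and D^-1 B^e from the means on the leaves.\<close>
  define Z where "Z = X powr e * D powr (- (2 + e))"
  have Xe: "1 \<le> X powr e" using X e by (simp add: ge_one_powr_ge_zero)
  have Be: "B powr e = A1 powr e * (X powr e * D powr (- e))"
    using D X A1 by (simp add: B_def powr_divide powr_mult powr_minus_divide)
  have Z1: "1 / D\<^sup>2 \<le> Z"
  proof -
    have "1 / D\<^sup>2 = 1 * D powr (- 2)" using D by (simp add: powr_minus_divide)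
    also have "\<dots> \<le> Z" unfolding Z_def using D e Xe by (intro mult_mono powr_mono') auto
    finally show ?thesis .
  qed
  have Z2: "1 / D * B powr e \<le> A1 powr e * Z"
  proof -
    have "D powr (- (1 + e)) = D powr (- 1 + - e)" by simp
    also have "\<dots> = D powr (- 1) * D powr (- e)" by (rule powr_add)
    also have "\<dots> = 1 / D * D powr (- e)" using D by (simp add: powr_minus_divide[of D 1])
    finally have "1 / D * D powr (- e) = D powr (- (1 + e))" ..
    also have "\<dots> \<le> D powr (- (2 + e))" using D by (intro powr_mono') auto
    finally have "A1 powr e * X powr e * (1 / D * D powr (- e)) \<le> A1 powr e * X powr e * D powr (- (2 + e))"
      by (intro mult_left_mono) auto
    then show ?thesis by (simp only: Be Z_def mult_ac)
  qed
  define C1 where "C1 = Cp * (3 powr (s + t - 1)) ^ N * PA * (72 * real m) * PB"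
  define C2 where "C2 = PA * (Cp * (d * (72 * real m)\<^sup>2) + 72 * real m * (3 powr s) ^ N / (2 * I))"
  have C1: "K * C1 \<le> 1 / 4"
  proof -
    have "K * C1 = K * Cp * X * ((3 powr (s + t - 1)) ^ N * (72 * real m))" by (simp add: C1_def X_def mult_ac)
    also have "\<dots> \<le> K * Cp * X * (1 / B * (648 / D))"
      using K Cp X B by (intro mult_left_mono mult_mono q m9) auto
    also have "\<dots> = (4 * 648 * K * Cp) / A1 / 4" using X D A1 by (simp add: B_def field_simps)
    also have "\<dots> \<le> 1 / 4" using A1 by (simp add: mult_ac)
    finally show ?thesis .
  qed
  have C2: "K * C2 \<le> step_const TYPE('n) s t * PA * Z"
  proof -
    have "(72 * real m)\<^sup>2 \<le> (648 / D)\<^sup>2" by (rule power_mono[OF m9]) simp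
    also have "\<dots> = 648\<^sup>2 * (1 / D\<^sup>2)" by (simp add: power_divide)
    also have "\<dots> \<le> 648\<^sup>2 * Z" by (intro mult_left_mono Z1) auto
    finally have 1: "(72 * real m)\<^sup>2 \<le> 648\<^sup>2 * Z" .
    have "72 * real m * (3 powr s) ^ N \<le> 648 / D * (3 * B powr e)" using D by (intro mult_mono m9 qs) auto
    also have "\<dots> = 1944 * (1 / D * B powr e)" by simp
    also have "\<dots> \<le> 1944 * (A1 powr e * Z)" by (intro mult_left_mono Z2) auto
    finally have 2: "72 * real m * (3 powr s) ^ N \<le> 1944 * (A1 powr e * Z)" .
    have "C2 \<le> PA * (Cp * (d * (648\<^sup>2 * Z)) + 1944 * (A1 powr e * Z) / (2 * I))"
      unfolding C2_def using PA Cp d I by (intro mult_left_mono add_mono divide_right_mono 1 2) auto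
    then have "K * C2 \<le> K * (PA * (Cp * (d * (648\<^sup>2 * Z)) + 1944 * (A1 powr e * Z) / (2 * I)))"
      using K by (intro mult_left_mono) auto
    also have "\<dots> = step_const TYPE('n) s t * PA * Z"
      by (simp add: step_const_def K_def d_def Cp_def I_def A1_def e_def \<sigma>_def field_simps)
    finally show ?thesis .
  qed
  let ?L = "LINT x|lebesgue_on (cube 0 R). (v x)\<^sup>2"
  note fV = H1a_fin_energy[OF subsol_H1a[OF v]]
  have sub: "cube 0 R \<subseteq> cube (0::real^'n) 1" using R by (auto intro!: cube_subset)
  have E0: "0 \<le> energy a (cube 0 R) V"
    using coefficients.energy_nonneg[OF coefficients_subset[OF field_unit sub cube_open]] by blast
  have step: "exp (- 2 * d) * energy a (cube 0 \<rho>) V \<le> d * (C1 * energy a (cube 0 R) V + C2 * sqrt ?L * sqrt (energy a (cube 0 R) V))"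
    unfolding d_def C1_def C2_def Cp_def I_def by (rule caccioppoli_step[OF v ap nonneg R(2,3) mD sN])
  have "energy a (cube 0 \<rho>) V = exp (2 * d) * (exp (- 2 * d) * energy a (cube 0 \<rho>) V)"
    by (simp add: mult.assoc[symmetric] exp_add[symmetric])
  also have "\<dots> \<le> exp (2 * d) * (d * (C1 * energy a (cube 0 R) V + C2 * sqrt ?L * sqrt (energy a (cube 0 R) V)))"
    by (intro mult_left_mono step) auto
  finally have "energy a (cube 0 \<rho>) V \<le> K * (C1 * energy a (cube 0 R) V + C2 * sqrt ?L * sqrt (energy a (cube 0 R) V))"
    by (simp only: K_def mult.assoc)
  then have "energy a (cube 0 \<rho>) V \<le> energy a (cube 0 R) V / 2 + (step_const TYPE('n) s t * PA * Z)\<^sup>2 * ?L"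
    by (rule absorb_quarter[OF _ C1 C2 E0]) simp
  moreover have "Z\<^sup>2 = X powr (2 * e) * D powr (- (4 + 2 * e))"
  proof -
    have sq: "(x powr y)\<^sup>2 = x powr (2 * y)" for x y :: real by (simp add: power2_eq_square powr_add[symmetric])
    have "2 * (- (2 + e)) = - (4 + 2 * e)" by simp
    then show ?thesis by (simp only: Z_def power_mult_distrib sq)
  qed
  ultimately show ?thesis
    by (simp only: power_mult_distrib X_def D_def e_def \<sigma>_def mult_ac)
qed

lemma caccioppoli:
  assumes v: "subsol a (cube 0 1) v V" and ap: "approximates \<phi> v V"
    and nonneg: "\<And>k x. x \<in> cube 0 1 \<Longrightarrow> 0 \<le> \<phi> k x"
    and R: "0 \<le> \<rho>" "\<rho> < R" "R \<le> 1"
  shows "energy a (cube 0 \<rho>) V \<le> caccioppoli_const TYPE('n) s t * PA\<^sup>2 * (PA * PB) powr (2 * (s / (1 - s - t))) *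
    (R - \<rho>) powr (- (4 + 2 * (s / (1 - s - t)))) * (LINT x|lebesgue_on (cube 0 R). (v x)\<^sup>2)"
proof -
  define A0 where "A0 = (step_const TYPE('n) s t)\<^sup>2 * PA\<^sup>2 * (PA * PB) powr (2 * (s / (1 - s - t)))"
  let ?\<gamma> = "4 + 2 * (s / (1 - s - t))"
  let ?L = "\<lambda>R. LINT x|lebesgue_on (cube 0 R). (v x)\<^sup>2"
  have A0: "0 \<le> A0" by (simp add: A0_def)
  note vH = subsol_H1a[OF v]
  note fV = H1a_fin_energy[OF vH] and v2 = H1a_L2[OF vH]
  have sub: "cube 0 r \<subseteq> cube (0::real^'n) r'" if "r \<le> r'" for r r' using that by (auto intro!: cube_subset)
  have L_mono: "?L r \<le> ?L R" if "r \<le> R" for r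
    by (rule integral_lebesgue_on_mono_set[OF _ sub[OF that] cube_sets cube_sets])
      (use L2_subset[OF v2 sub[OF R(3)] cube_sets cube_sets] in \<open>auto simp: L2_def\<close>)
  have "energy a (cube 0 \<rho>) V \<le> hole_const ?\<gamma> * (A0 * ?L R) * (R - \<rho>) powr (- ?\<gamma>)"
  proof (rule hole_filling[where M="energy a (cube 0 1) V"])
    fix r r' assume r: "\<rho> \<le> r" "r < r'" "r' \<le> R"
    have "energy a (cube 0 r) V \<le> energy a (cube 0 r') V / 2 + A0 * ?L r' * (r' - r) powr (- ?\<gamma>)"
      unfolding A0_def by (rule caccioppoli_absorbed[OF v ap nonneg]) (use r R in auto)
    also have "\<dots> \<le> energy a (cube 0 r') V / 2 + A0 * ?L R * (r' - r) powr (- ?\<gamma>)"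
      by (intro add_left_mono mult_right_mono mult_left_mono L_mono A0 r) auto
    finally show "energy a (cube 0 r) V \<le> energy a (cube 0 r') V / 2 + A0 * ?L R * (r' - r) powr (- ?\<gamma>)" .
  next
    fix r assume "r \<le> R"
    then show "energy a (cube 0 r) V \<le> energy a (cube 0 1) V"
      by (intro energy_subset_le[OF field_unit fV] sub cube_sets) (use R in auto)
  next
    show "0 \<le> A0 * ?L R" using A0 by simp
    have "0 < s / (1 - s - t)" using s by simp
    then show "0 < ?\<gamma>" by simp
  qed (use R in auto)
  then show ?thesis by (simp only: caccioppoli_const_def A0_def mult_ac)
qed

end

subsection \<open>De Giorgi iteration\<close>

lemma measure_superlevel_le:
  fixes v :: "real^'n \<Rightarrow> real"
  assumes S: "S \<in> lmeasurable" and v: "integrable (lebesgue_on S) (\<lambda>x. (v x)\<^sup>2)"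
    and A: "A \<in> sets lebesgue" "A \<subseteq> S" and c: "\<And>x. x \<in> A \<Longrightarrow> c \<le> (v x)\<^sup>2"
  shows "c * measure lebesgue A \<le> (LINT x|lebesgue_on S. (v x)\<^sup>2)"
proof -
  have Ss: "S \<in> sets lebesgue" using S by auto
  have As: "A \<in> sets (lebesgue_on S)" using A Ss by (simp add: sets_restrict_space_iff)
  have i: "integrable (lebesgue_on S) (\<lambda>x. indicat_real A x * c)"
    using integrable_mult_indicator[OF As finite_measure.integrable_const[OF finite_measure_lebesgue_on[OF S], of c]] by simp
  have "c * measure lebesgue A = c * measure (lebesgue_on S) A"
    using A Ss by (simp add: measure_restrict_space)
  also have "\<dots> = (LINT x|lebesgue_on S. indicat_real A x * c)"
  proof -
    have "A \<inter> S = A" using A by blast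
    then show ?thesis by simp
  qed
  also have "\<dots> \<le> (LINT x|lebesgue_on S. (v x)\<^sup>2)"
    by (rule integral_mono[OF i v]) (use c in \<open>auto simp: indicator_def\<close>)
  finally show ?thesis .
qed

text \<open>Smooth stand-in for the truncation max (y - l) 0, lying between it and max (y - l - h)
  0. The argument is written in the shape that \<open>Ck_affine\<close> expects.\<close>

definition ramp :: "real \<Rightarrow> real \<Rightarrow> real \<Rightarrow> real" where
  "ramp h l y = h * sramp (1 / h * y + (- l / h))"

lemma ramp_bounds:
  assumes "0 < h"
  shows "0 \<le> ramp h l y" "ramp h l y \<le> max (y - l) 0" "max (y - l - h) 0 \<le> ramp h l y"
    and "l + h \<le> y \<Longrightarrow> h * exp (- 1) \<le> ramp h l y"
proof -
  have r: "ramp h l y = h * sramp ((y - l) / h)" by (simp add: ramp_def diff_divide_distrib)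
  have hm: "h * max (w / h) 0 = max w 0" for w using assms by (auto simp: max_def divide_le_0_iff)
  show "0 \<le> ramp h l y" using sramp_bounds(1) assms by (simp add: ramp_def)
  have "h * sramp ((y - l) / h) \<le> h * max ((y - l) / h) 0" using assms by (intro mult_left_mono sramp_bounds) auto
  then show "ramp h l y \<le> max (y - l) 0" by (simp only: r hm)
  have m1: "(y - l) / h - 1 = (y - l - h) / h" using assms by (simp add: diff_divide_distrib)
  have "h * max ((y - l) / h - 1) 0 \<le> h * sramp ((y - l) / h)" using assms by (intro mult_left_mono sramp_bounds) auto
  then show "max (y - l - h) 0 \<le> ramp h l y" by (simp only: r hm m1)
  assume y: "l + h \<le> y"
  define z where "z = (y - l) / h"
  have z: "1 \<le> z" using assms y by (simp add: z_def field_simps)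
  then have "1 * exp (- 1) \<le> z * exp (- (1 / z))" by (intro mult_mono) (auto simp: field_simps)
  then have "exp (- 1) \<le> sramp z" using z by (simp add: sramp_def)
  then show "h * exp (- 1) \<le> ramp h l y" using assms unfolding r z_def[symmetric] by (intro mult_left_mono) auto
qed

text \<open>Besides the subsolution property this provides approximants that are nonnegative
  everywhere, obtained by composing those of u with \<open>ramp\<close>. The Caccioppoli argument
  multiplies them with the cutoff to form admissible test functions.\<close>

lemma (in coefficients) subsol_ramp:
  assumes u: "subsol a U u G" and h: "0 < h"
  obtains V \<phi> where "subsol a U (\<lambda>x. ramp h l (u x)) V" "approximates \<phi> (\<lambda>x. ramp h l (u x)) V" "\<And>k x. 0 \<le> \<phi> k x"
proof -
  let ?g = "\<lambda>y. 1 / h * y + (- l / h)"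
  let ?F' = "\<lambda>y. 1 * pexp [:1,1:] (?g y)" and ?F'' = "\<lambda>y. 1 / h * pexp [:0,0,0,1:] (?g y)"
  have Ck: "Ck k (ramp h l)" "Ck k ?F'" for k
    using Ck_affine[OF Ck_sramp, of k h "1 / h" "- l / h"] Ck_affine[OF Ck_pexp, of k 1 "[:1,1:]" "1 / h" "- l / h"]
    by (simp_all add: ramp_def[abs_def])
  have g: "(?g has_real_derivative 1 / h) (at y)" for y using h by (auto intro!: derivative_eq_intros)
  have D1: "(ramp h l has_real_derivative ?F' y) (at y)" for y
    using DERIV_cmult[OF DERIV_chain2[OF sramp_DERIV g], of h y] h by (simp add: ramp_def[abs_def])
  have D2: "(?F' has_real_derivative ?F'' y) (at y)" for y
    using DERIV_chain2[OF sramp_deriv_DERIV g, of y] by (simp add: mult.commute)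
  have c1: "continuous_on UNIV ?F'" using D2 by (auto intro!: continuous_at_imp_continuous_on DERIV_isCont)
  have c2: "continuous_on UNIV ?F''"
  proof -
    have "continuous_on UNIV (pexp [:0,0,0,1:])" by (auto intro!: continuous_at_imp_continuous_on DERIV_isCont[OF pexp_DERIV])
    then have "continuous_on UNIV (\<lambda>y. pexp [:0,0,0,1:] (?g y))" by (rule continuous_on_compose2) (use h in \<open>auto intro!: continuous_intros\<close>)
    then show ?thesis by (intro continuous_intros)
  qed
  have b1: "0 \<le> ?F' y" "?F' y \<le> 1" "\<bar>?F' y\<bar> \<le> 1" for y using sramp_deriv_bounds[of "?g y"] by auto
  have b2: "0 \<le> ?F'' y" "?F'' y \<le> 1 / h * 6" for y using sramp_deriv2_bounds[of "?g y"] h by (auto intro!: mult_left_mono divide_right_mono)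
  obtain \<phi> where ap: "approximates \<phi> u G" using H1a_approximates[OF subsol_H1a[OF u]] by blast
  show thesis
  proof (rule that)
    show "subsol a U (\<lambda>x. ramp h l (u x)) (\<lambda>x. ?F' (u x) *\<^sub>R G x)"
      by (rule subsol_compose[OF u Ck D1 D2 c1 b1(1,2) c2 b2])
    show "approximates (\<lambda>k x. ramp h l (\<phi> k x)) (\<lambda>x. ramp h l (u x)) (\<lambda>x. ?F' (u x) *\<^sub>R G x)"
      by (rule approximates_compose(1)[OF ap subsol_H1a[OF u] Ck(1) D1 c1 b1(3)])
    show "0 \<le> ramp h l (\<phi> k x)" for k x by (rule ramp_bounds[OF h])
  qed
qed

text \<open>The Poincare constant squared times the Caccioppoli constant. The power of 2 appears
  because the Caccioppoli inequality has only half of the gap at its disposal.\<close>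

definition decay_const :: "'n::finite itself \<Rightarrow> real \<Rightarrow> real \<Rightarrow> real" where
  "decay_const T s t = (2 * const_pair T 0 t)\<^sup>2 * caccioppoli_const T s t * 2 powr (4 + 2 * (s / (1 - s - t)))"

text \<open>The number of generations by which each De Giorgi step refines the scale. The quotient
  makes the gain 3^(2(1-t)) per generation compensate the factor 2^gamma, gamma = 4 + 2s/(1-s-t),
  lost whenever the gap between the cubes is halved. \<open>Suc\<close> ensures that the scale
  really becomes finer.\<close>

definition level_gap :: "real \<Rightarrow> real \<Rightarrow> nat" where
  "level_gap s t = Suc (nat \<lceil>(4 + 2 * (s / (1 - s - t))) / (2 * (1 - t))\<rceil>)"

text \<open>16 makes four cubes of the starting generation fit into the first gap, which is 1/4. The
  other entry makes the decay factor of the first step at most a quarter of the volume ratio of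
  \<open>level_gap\<close> generations.\<close>

definition start_const :: "'n::finite itself \<Rightarrow> real \<Rightarrow> real \<Rightarrow> real" where
  "start_const T s t = max 16 ((4 * decay_const T s t * (2 powr (4 + 2 * (s / (1 - s - t))))\<^sup>2 * 3 ^ (level_gap s t * CARD('n))) powr (1 / (2 * (1 - t))))"

text \<open>3 \<open>start_const\<close> bounds the starting scale 3^N0 relative to X^(1/sigma). The
  prefactor solves the smallness condition of \<open>level_bound\<close> for K, where exp 1 offsets
  the value exp(-1) in \<open>ramp_bounds\<close>.\<close>

definition sup_const :: "'n::finite itself \<Rightarrow> real \<Rightarrow> real \<Rightarrow> real" where
  "sup_const T s t = 2 * exp 1 / sqrt (bump_mass T) * (3 * start_const T s t) powr (real CARD('n) / 2)"

context coarse_elliptic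
begin

lemma integral_cube_indicator:
  fixes h :: "real^'n \<Rightarrow> real"
  assumes "R \<le> 1"
  shows "(LINT x|lebesgue_on (cube 0 1). indicator (cube 0 R) x * h x) = (LINT x|lebesgue_on (cube 0 R). h x)"
proof -
  have sub: "cube 0 R \<subseteq> cube (0::real^'n) 1" using assms by (auto intro!: cube_subset)
  have "(LINT x|lebesgue_on (cube 0 1). indicator (cube 0 R) x * h x) = (LINT x|lebesgue_on (cube 0 R). indicator (cube 0 R) x * h x)"
    by (rule integral_lebesgue_on_zero_outside[OF sub cube_sets cube_sets]) (auto simp: indicator_def)
  also have "\<dots> = (LINT x|lebesgue_on (cube 0 R). h x)" by (rule Bochner_Integration.integral_cong) auto
  finally show ?thesis .
qed

text \<open>The Poincare inequality is summed over the cubes of generation N that meet the inner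
  cube. They lie inside the cube of intermediate side (rho + R)/2, which leaves the second half of
  the gap for the Caccioppoli inequality. The smallness of the support is required on the outer cube
  as a whole and so holds on each small cube.\<close>

lemma poincare_cubes:
  assumes v: "has_H1a_grad a (cube 0 1) v V"
    and R: "0 \<le> \<rho>" "\<rho> < R" "R \<le> 1" and N: "4 * side N \<le> R - \<rho>"
    and supp: "measure lebesgue {x \<in> cube 0 R. v x \<noteq> 0} \<le> bump_mass TYPE('n) * vol TYPE('n) N"
  shows "(LINT x|lebesgue_on (cube 0 \<rho>). (v x)\<^sup>2) \<le>
    (2 * const_pair TYPE('n) 0 t * PB * (3 powr (t - 1)) ^ N)\<^sup>2 * energy a (cube 0 ((\<rho> + R) / 2)) V"
proof -
  define M where "M = (\<rho> + R) / 2"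
  define c where "c = (2 * const_pair TYPE('n) 0 t * PB * (3 powr (t - 1)) ^ N)\<^sup>2"
  have M1: "M \<le> 1" "\<rho> \<le> 1" and RM: "M \<le> R" using R by (auto simp: M_def)
  note fV = H1a_fin_energy[OF v] and v2 = H1a_L2[OF v]
  have sub: "cube 0 r \<subseteq> cube (0::real^'n) r'" if "r \<le> r'" for r r' using that by (auto intro!: cube_subset)
  have RI: "integrable (lebesgue_on (cube 0 1)) (\<lambda>x. indicator (cube 0 r) x * (h x :: real))"
    if "integrable (lebesgue_on (cube 0 1)) h" "r \<le> 1" for h :: "real^'n \<Rightarrow> real" and r
    using integrable_mult_indicator[of "cube 0 r" "lebesgue_on (cube 0 1)" h] that(1) sub[OF that(2)] by (simp add: sets_restrict_space_iff)
  have vi: "integrable (lebesgue_on (cube 0 1)) (\<lambda>x. (v x)\<^sup>2)" using v2 by (simp add: L2_def)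
  have Vi: "integrable (lebesgue_on (cube 0 1)) (\<lambda>x. V x \<bullet> (a x *v V x))" using fV by (simp add: fin_energy_def)
  define A where "A n z = (LINT x|lebesgue_on (tcube n z). indicator (cube 0 \<rho>) x * (v x)\<^sup>2)" for n z
  define B where "B n z = (LINT x|lebesgue_on (tcube n z). indicator (cube 0 M) x * (V x \<bullet> (a x *v V x)))" for n z
  have A_kids: "A n z = (\<Sum>z'\<in>kids n z. A (Suc n) z')" if "node n z" for n z
    unfolding A_def by (rule integral_kids[OF integrable_tcube[OF RI[OF vi M1(2)] that]])
  have B_kids: "B n z = (\<Sum>z'\<in>kids n z. B (Suc n) z')" if "node n z" for n z
    unfolding B_def by (rule integral_kids[OF integrable_tcube[OF RI[OF Vi M1(1)] that]])
  have leaf: "A N z \<le> c * B N z" if z: "node N z" for z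
  proof (cases "tcube N z \<inter> cube 0 \<rho> = {}")
    case True
    then have "A N z = (LINT x|lebesgue_on (tcube N z). 0)"
      unfolding A_def by (intro Bochner_Integration.integral_cong) (auto simp: indicator_def)
    moreover have "0 \<le> B N z" unfolding B_def
      by (rule Bochner_Integration.integral_nonneg) (use node_subset[OF z] a_psd in \<open>auto intro!: mult_nonneg_nonneg\<close>)
    ultimately show ?thesis by (simp add: c_def)
  next
    case False
    then obtain x0 where x0: "x0 \<in> tcube N z" "x0 \<in> cube 0 \<rho>" by blast
    have subM: "tcube N z \<subseteq> cube 0 M"
    proof
      fix y assume y: "y \<in> tcube N z"
      have "\<bar>y $ j\<bar> < M / 2" for j
      proof -
        have "\<bar>x0 $ j\<bar> < \<rho> / 2" using x0(2) by (simp add: cube_def)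
        moreover have "\<bar>x0 $ j - z $ j\<bar> < side N / 2" "\<bar>y $ j - z $ j\<bar> < side N / 2" using x0(1) y by (auto simp: cube_def)
        moreover have "\<bar>y $ j\<bar> \<le> \<bar>x0 $ j\<bar> + \<bar>x0 $ j - z $ j\<bar> + \<bar>y $ j - z $ j\<bar>"
          using abs_triangle_ineq[of "y $ j - z $ j" "z $ j"] abs_triangle_ineq4[of "x0 $ j" "x0 $ j - z $ j"] by simp
        ultimately have "\<bar>y $ j\<bar> < \<rho> / 2 + side N" by linarith
        also have "\<dots> \<le> \<rho> / 2 + (R - \<rho>) / 4" using N by simp
        also have "\<dots> = M / 2" by (simp add: M_def field_simps)
        finally show ?thesis .
      qed
      then show "y \<in> cube 0 M" by (simp add: cube_def)
    qed
    define S where "S = {x \<in> tcube N z. v x \<noteq> 0}"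
    have S: "S \<in> sets lebesgue" "S \<subseteq> tcube N z" "S \<subseteq> {x \<in> cube 0 R. v x \<noteq> 0}"
    proof -
      have "v \<in> borel_measurable (lebesgue_on (tcube N z))"
        using L2_subset[OF v2 node_subset[OF z] cube_sets cube_sets] by (simp add: L2_def)
      then have "{x \<in> space (lebesgue_on (tcube N z)). v x \<noteq> 0} \<in> sets (lebesgue_on (tcube N z))" by measurable
      then show "S \<in> sets lebesgue" by (simp add: S_def sets_restrict_space_iff)
      show "S \<subseteq> tcube N z" by (auto simp: S_def)
      show "S \<subseteq> {x \<in> cube 0 R. v x \<noteq> 0}" using subM sub[OF RM] by (auto simp: S_def)
    qed
    have mR: "{x \<in> cube 0 R. v x \<noteq> 0} \<in> lmeasurable"
    proof -
      have "v \<in> borel_measurable (lebesgue_on (cube 0 R))"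
        using L2_subset[OF v2 sub[OF R(3)] cube_sets cube_sets] by (simp add: L2_def)
      then have "{x \<in> space (lebesgue_on (cube 0 R)). v x \<noteq> 0} \<in> sets (lebesgue_on (cube 0 R))" by measurable
      then have "{x \<in> cube 0 R. v x \<noteq> 0} \<in> sets lebesgue" by (simp add: sets_restrict_space_iff)
      then show ?thesis by (intro fmeasurableI2[OF cube_lmeasurable[of 0 R]]) auto
    qed
    have "measure lebesgue S \<le> measure lebesgue {x \<in> cube 0 R. v x \<noteq> 0}"
      by (rule measure_mono_fmeasurable[OF S(3,1) mR])
    with supp have mS: "measure lebesgue S \<le> bump_mass TYPE('n) * vol TYPE('n) N" by simp
    have "A N z \<le> (LINT x|lebesgue_on (tcube N z). (v x)\<^sup>2)" unfolding A_def
      by (rule integral_mono[OF integrable_tcube[OF RI[OF vi M1(2)] z] integrable_tcube[OF vi z]]) (auto simp: indicator_def)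
    also have "\<dots> \<le> c * energy a (tcube N z) V"
      unfolding c_def by (rule poincare_small_support[OF v z S(1,2) _ mS]) (auto simp: S_def)
    also have "energy a (tcube N z) V = B N z"
      unfolding B_def bil_def by (rule Bochner_Integration.integral_cong) (use subM in \<open>auto simp: indicator_def\<close>)
    finally show ?thesis .
  qed
  have "A 0 0 \<le> c * B 0 0"
  proof (rule tree_aggregate[where node=node and kids=kids and N=N and R=A and e="\<lambda>n z. c * B n z"])
    show "node (Suc n) z'" if "node n z" "z' \<in> kids n z" for n and z z' :: "real^'n" by (rule node.kid[OF that])
    show "A n z \<le> (\<Sum>z'\<in>kids n z. A (Suc n) z')" if "node n z" for n z using A_kids[OF that] by simp
    show "(\<Sum>z'\<in>kids n z. c * B (Suc n) z') \<le> c * B n z" if "node n z" for n z using B_kids[OF that] by (simp add: sum_distrib_left)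
  qed (use leaf node.root in auto)
  moreover have "A 0 0 = (LINT x|lebesgue_on (cube 0 \<rho>). (v x)\<^sup>2)" by (simp only: A_def power_0 integral_cube_indicator[OF M1(2)])
  moreover have "B 0 0 = energy a (cube 0 M) V" by (simp only: B_def bil_def power_0 integral_cube_indicator[OF M1(1)])
  ultimately show ?thesis by (simp only: c_def M_def)
qed

text \<open>Poincare on small cubes followed by Caccioppoli. The result involves the L2 norm of the
  same function on a larger cube; it yields decay because the cubes are finer than
  X^(-1/sigma).\<close>

lemma level_decay:
  assumes v: "subsol a (cube 0 1) v V" and ap: "approximates \<phi> v V"
    and nonneg: "\<And>k x. 0 \<le> \<phi> k x"
    and R: "0 \<le> \<rho>" "\<rho> < R" "R \<le> 1" and N: "4 * side N \<le> R - \<rho>"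
    and supp: "measure lebesgue {x \<in> cube 0 R. v x \<noteq> 0} \<le> bump_mass TYPE('n) * vol TYPE('n) N"
  shows "(LINT x|lebesgue_on (cube 0 \<rho>). (v x)\<^sup>2) \<le>
    decay_const TYPE('n) s t * ((PA * PB) powr (1 / (1 - s - t)) / 3 ^ N) powr (2 * (1 - t)) *
    (R - \<rho>) powr (- (4 + 2 * (s / (1 - s - t)))) * (LINT x|lebesgue_on (cube 0 R). (v x)\<^sup>2)"
proof -
  define X where "X = PA * PB"
  define e where "e = s / (1 - s - t)"
  define M where "M = (\<rho> + R) / 2"
  define Q where "Q = const_pair TYPE('n) 0 t"
  let ?L = "LINT x|lebesgue_on (cube 0 R). (v x)\<^sup>2"
  have X: "1 \<le> X" using ratio by (simp add: X_def)
  have M: "0 \<le> M" "M < R" using R by (auto simp: M_def)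
  have "(LINT x|lebesgue_on (cube 0 \<rho>). (v x)\<^sup>2) \<le> (2 * Q * PB * (3 powr (t - 1)) ^ N)\<^sup>2 * energy a (cube 0 M) V"
    unfolding M_def Q_def by (rule poincare_cubes[OF subsol_H1a[OF v] R N supp])
  also have "\<dots> \<le> (2 * Q * PB * (3 powr (t - 1)) ^ N)\<^sup>2 * (caccioppoli_const TYPE('n) s t * PA\<^sup>2 * X powr (2 * e) * (R - M) powr (- (4 + 2 * e)) * ?L)"
    unfolding X_def e_def by (intro mult_left_mono caccioppoli[OF v ap nonneg M R(3)]) auto
  also have "\<dots> = (2 * Q)\<^sup>2 * caccioppoli_const TYPE('n) s t * (((3 powr (t - 1)) ^ N)\<^sup>2 * (X\<^sup>2 * X powr (2 * e))) * (R - M) powr (- (4 + 2 * e)) * ?L"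
    by (simp only: power_mult_distrib X_def mult_ac)
  also have "(R - M) powr (- (4 + 2 * e)) = 2 powr (4 + 2 * e) * (R - \<rho>) powr (- (4 + 2 * e))"
  proof -
    have RM: "R - M = (R - \<rho>) / 2" by (simp add: M_def field_simps)
    have gen: "(w / 2) powr (- g) = 2 powr g * w powr (- g)" if "0 < w" for w g :: real
      using that by (simp add: powr_divide powr_minus_divide)
    show ?thesis unfolding RM by (rule gen) (use R in simp)
  qed
  \<comment> \<open>All powers merge into one because 2 + 2s/(1-s-t) = 2(1-t)/(1-s-t): only the
    ratio of the scale 3^N to X^(1/(1-s-t)) matters.\<close>
  also have "((3 powr (t - 1)) ^ N)\<^sup>2 * (X\<^sup>2 * X powr (2 * e)) = (X powr (1 / (1 - s - t)) / 3 ^ N) powr (2 * (1 - t))"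
  proof -
    have "((3 powr (t - 1)) ^ N)\<^sup>2 = ((3 ^ N) powr (t - 1))\<^sup>2" by (simp only: powr_nat_power)
    also have "\<dots> = (3 ^ N) powr ((t - 1) + (t - 1))" by (simp only: power2_eq_square powr_add)
    also have "\<dots> = (3 ^ N) powr (- (2 * (1 - t)))" by (simp add: algebra_simps)
    finally have 1: "((3 powr (t - 1)) ^ N)\<^sup>2 = (3 ^ N) powr (- (2 * (1 - t)))" .
    have "X\<^sup>2 * X powr (2 * e) = X powr 2 * X powr (2 * e)" using X by simp
    also have "\<dots> = X powr (2 + 2 * e)" by (simp only: powr_add)
    also have "2 + 2 * e = 1 / (1 - s - t) * (2 * (1 - t))" using s t by (simp add: e_def field_simps)
    finally have 2: "X\<^sup>2 * X powr (2 * e) = (X powr (1 / (1 - s - t))) powr (2 * (1 - t))" by (simp only: powr_powr)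
    have gen: "M powr (- p) * y powr p = (y / M) powr p" if "0 < M" "0 \<le> y" for M y p :: real
      using that by (simp add: powr_divide powr_minus_divide)
    show ?thesis unfolding 1 2 by (rule gen) auto
  qed
  finally show ?thesis by (simp only: decay_const_def X_def e_def Q_def mult_ac)
qed

text \<open>In step j the gap 2^(-j-2) costs 2^(gamma (j+2)), and refining by j times
  \<open>level_gap\<close> generations gains at least 2^(gamma j). What remains does not depend on j
  and is paid for by \<open>start_const\<close>.\<close>

lemma level_factor:
  fixes N0 :: nat
  assumes N0: "start_const TYPE('n) s t * (PA * PB) powr (1 / (1 - s - t)) \<le> 3 ^ N0"
  shows "decay_const TYPE('n) s t * ((PA * PB) powr (1 / (1 - s - t)) / 3 ^ (N0 + j * level_gap s t)) powr (2 * (1 - t)) *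
    ((1 / 2) ^ (j + 2)) powr (- (4 + 2 * (s / (1 - s - t)))) \<le> side (level_gap s t) ^ CARD('n) / 4"
proof -
  define \<gamma> where "\<gamma> = 4 + 2 * (s / (1 - s - t))"
  define \<tau> where "\<tau> = 2 * (1 - t)"
  define b where "b = level_gap s t"
  define Y where "Y = (PA * PB) powr (1 / (1 - s - t))"
  define c where "c = decay_const TYPE('n) s t"
  define C3 where "C3 = start_const TYPE('n) s t"
  have e: "0 < s / (1 - s - t)" using s by simp
  have \<gamma>: "0 < \<gamma>" using e by (simp add: \<gamma>_def)
  have \<tau>: "0 < \<tau>" using t by (simp add: \<tau>_def)
  have Y: "0 < Y"
  proof -
    have "PA * PB \<noteq> 0" using ratio by linarith
    then show ?thesis unfolding Y_def powr_gt_zero .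
  qed
  have pw: "(x ^ n) powr y = (x powr y) ^ n" if "0 \<le> x" for x y :: real and n
    using that by (induction n) (simp_all add: powr_mult)
  have c: "0 \<le> c"
  proof -
    have "sqrt 2 < 2" using real_sqrt_less_mono[of 2 4] by simp
    then show ?thesis by (simp add: c_def decay_const_def caccioppoli_const_def hole_const_def)
  qed
  have C3: "16 \<le> C3" "(4 * c * (2 powr \<gamma>)\<^sup>2 * 3 ^ (b * CARD('n))) powr (1 / \<tau>) \<le> C3"
    by (auto simp: C3_def start_const_def c_def \<gamma>_def \<tau>_def b_def)
  have W: "4 * c * (2 powr \<gamma>)\<^sup>2 * 3 ^ (b * CARD('n)) \<le> C3 powr \<tau>"
  proof -
    have "((4 * c * (2 powr \<gamma>)\<^sup>2 * 3 ^ (b * CARD('n))) powr (1 / \<tau>)) powr \<tau> \<le> C3 powr \<tau>"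
      using C3 \<tau> by (intro powr_mono2) auto
    then show ?thesis using \<tau> c by (simp add: powr_powr)
  qed
  have "\<gamma> / \<tau> \<le> real b" unfolding b_def level_gap_def \<gamma>_def[symmetric] \<tau>_def[symmetric]
    using le_of_int_ceiling[of "\<gamma> / \<tau>"] by linarith
  then have "\<gamma> \<le> real b * \<tau>" using \<tau> by (simp add: field_simps)
  then have "2 powr \<gamma> \<le> 3 powr (real b * \<tau>)" using \<gamma> powr_mono2[of \<gamma> 2 3] powr_mono[of \<gamma> "real b * \<tau>" "3::real"] by linarith
  also have "3 powr (real b * \<tau>) = (3 ^ b) powr \<tau>" by (simp add: powr_realpow[symmetric] powr_powr)
  finally have b2: "2 powr \<gamma> \<le> (3 ^ b) powr \<tau>" .
  have "Y / 3 ^ (N0 + j * b) = Y / 3 ^ N0 / (3 ^ b) ^ j" by (simp add: power_add power_mult mult.commute[of j b])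
  also have "\<dots> powr \<tau> = (Y / 3 ^ N0) powr \<tau> / ((3 ^ b) ^ j) powr \<tau>" by (rule powr_divide)
  also have "((3 ^ b) ^ j) powr \<tau> = ((3 ^ b) powr \<tau>) ^ j" by (rule pw) simp
  finally have eq1: "(Y / 3 ^ (N0 + j * b)) powr \<tau> = (Y / 3 ^ N0) powr \<tau> / ((3 ^ b) powr \<tau>) ^ j" .
  have "Y / 3 ^ N0 \<le> 1 / C3"
  proof -
    have "C3 * Y \<le> 3 ^ N0" using N0 by (simp add: C3_def Y_def)
    then show ?thesis using C3(1) by (simp add: field_simps)
  qed
  then have "(Y / 3 ^ N0) powr \<tau> \<le> (1 / C3) powr \<tau>" using Y \<tau> by (intro powr_mono2) auto
  also have "\<dots> = 1 / C3 powr \<tau>" using C3 by (simp add: powr_divide)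
  finally have y: "(Y / 3 ^ N0) powr \<tau> \<le> 1 / C3 powr \<tau>" .
  have eq2: "((1 / 2) ^ (j + 2)) powr (- \<gamma>) = (2 powr \<gamma>) ^ j * (2 powr \<gamma>)\<^sup>2"
  proof -
    have "((1 / 2) ^ (j + 2)) powr (- \<gamma>) = ((1 / 2) powr (- \<gamma>)) ^ (j + 2)" by (rule pw) simp
    also have "(1 / 2) powr (- \<gamma>) = 2 powr \<gamma>" by (simp add: powr_minus powr_divide)
    finally show ?thesis by (simp only: power_add)
  qed
  have "c * (Y / 3 ^ (N0 + j * b)) powr \<tau> * ((1 / 2) ^ (j + 2)) powr (- \<gamma>) =
     c * (2 powr \<gamma>)\<^sup>2 * (Y / 3 ^ N0) powr \<tau> * ((2 powr \<gamma>) ^ j / ((3 ^ b) powr \<tau>) ^ j)"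
    unfolding eq1 eq2 by (simp only: times_divide_eq_left times_divide_eq_right mult_ac)
  also have "\<dots> \<le> c * (2 powr \<gamma>)\<^sup>2 * (1 / C3 powr \<tau>) * 1"
  proof (intro mult_mono y order_refl)
    have "(2 powr \<gamma>) ^ j \<le> ((3 ^ b) powr \<tau>) ^ j" by (intro power_mono b2) auto
    then show "(2 powr \<gamma>) ^ j / ((3 ^ b) powr \<tau>) ^ j \<le> 1" by (simp add: divide_le_eq)
  qed (use c in auto)
  also have "\<dots> \<le> side b ^ CARD('n) / 4"
  proof -
    have "0 < C3 powr \<tau>" using C3 by simp
    moreover have "side b ^ CARD('n) = 1 / 3 ^ (b * CARD('n))" by (simp add: power_one_over power_mult)
    ultimately show ?thesis using W by (simp add: field_simps)
  qed
  finally show ?thesis by (simp only: c_def Y_def b_def \<tau>_def \<gamma>_def)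
qed

text \<open>De Giorgi iteration with levels increasing to K, cubes shrinking to half the unit cube,
  and scales refined by \<open>level_gap\<close> generations per step. The invariant is Y j <= H j;
  as H tends to 0, the excess of u over K has L2 norm zero.\<close>

lemma level_bound:
  fixes K :: real and N0 :: nat
  assumes u: "subsol a (cube 0 1) u G" and K: "0 < K"
    and N0: "start_const TYPE('n) s t * (PA * PB) powr (1 / (1 - s - t)) \<le> 3 ^ N0"
    and KY: "(LINT x|lebesgue_on (cube 0 1). (max (u x) 0)\<^sup>2) \<le> bump_mass TYPE('n) * (K / 2 * exp (- 1))\<^sup>2 * vol TYPE('n) N0"
  shows "AE x in lebesgue_on (cube 0 (1 / 2)). u x \<le> K"
proof -
  define \<rho> :: "nat \<Rightarrow> real" where "\<rho> j = 1 / 2 + (1 / 2) ^ Suc j" for j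
  define h where "h j = K * (1 / 2) ^ Suc j" for j
  define l where "l j = K * (1 - (1 / 2) ^ j)" for j
  define v where "v j x = ramp (h j) (l j) (u x)" for j x
  define Nj where "Nj j = N0 + j * level_gap s t" for j
  define Y where "Y j = (LINT x|lebesgue_on (cube 0 (\<rho> j)). (v j x)\<^sup>2)" for j
  \<comment> \<open>Where v (j+1) is nonzero, v j is at least h j exp(-1). Hence Y j <= H j is, by
    Chebyshev, precisely the smallness of the support that the Poincare inequality on cubes of
    generation Nj j needs.\<close>
  define H where "H j = bump_mass TYPE('n) * (h j * exp (- 1))\<^sup>2 * vol TYPE('n) (Nj j)" for j
  have \<rho>: "0 \<le> \<rho> j" "1 / 2 \<le> \<rho> j" "\<rho> (Suc j) < \<rho> j" "\<rho> j \<le> 1" "\<rho> j - \<rho> (Suc j) = (1 / 2) ^ (j + 2)" for j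
  proof -
    have p: "0 < (1 / 2 :: real) ^ j" "(1 / 2 :: real) ^ j \<le> 1" by (auto intro: power_le_one)
    then show "0 \<le> \<rho> j" "1 / 2 \<le> \<rho> j" "\<rho> (Suc j) < \<rho> j" "\<rho> j \<le> 1" "\<rho> j - \<rho> (Suc j) = (1 / 2) ^ (j + 2)"
      by (simp_all add: \<rho>_def)
  qed
  have h: "0 < h j" for j using K by (simp add: h_def)
  have lh: "l (Suc j) = l j + h j" "l j \<le> K" for j using K by (auto simp: l_def h_def algebra_simps)
  have sub: "cube 0 r \<subseteq> cube (0::real^'n) r'" if "r \<le> r'" for r r' using that by (auto intro!: cube_subset)
  have vb: "0 \<le> v j x" "v j x \<le> max (u x - l j) 0" "max (u x - l (Suc j)) 0 \<le> v j x" for j x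
    unfolding v_def lh using ramp_bounds[OF h[of j], where l="l j" and y="u x"] by (auto simp: diff_diff_add)
  have vdec: "v (Suc j) x \<le> v j x" for j x using vb(2)[where j="Suc j" and x=x] vb(3)[where j=j and x=x] by linarith
  have vL2: "v j \<in> L2 (cube 0 1)" for j
  proof -
    obtain V \<phi> where "subsol a (cube 0 1) (\<lambda>x. ramp (h j) (l j) (u x)) V" using subsol_ramp[OF u h] by blast
    from H1a_L2[OF subsol_H1a[OF this]] show ?thesis by (simp add: v_def[abs_def])
  qed
  have vint: "integrable (lebesgue_on (cube 0 r)) (\<lambda>x. (v j x)\<^sup>2)" if "r \<le> 1" for r j
    using L2_subset[OF vL2 sub[OF that] cube_sets cube_sets] by (simp add: L2_def)
  have YH: "Y j \<le> H j" for j
  proof (induction j)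
    case 0
    have ui: "integrable (lebesgue_on (cube 0 1)) (\<lambda>x. (max (u x) 0)\<^sup>2)"
    proof (rule Bochner_Integration.integrable_bound)
      show "integrable (lebesgue_on (cube 0 1)) (\<lambda>x. (u x)\<^sup>2)" using H1a_L2[OF subsol_H1a[OF u]] by (simp add: L2_def)
      show "(\<lambda>x. (max (u x) 0)\<^sup>2) \<in> borel_measurable (lebesgue_on (cube 0 1))"
        using H1a_L2[OF subsol_H1a[OF u]] by (auto simp: L2_def)
    qed (auto simp: max_def)
    have "Y 0 = (LINT x|lebesgue_on (cube 0 1). (v 0 x)\<^sup>2)" by (simp add: Y_def \<rho>_def)
    also have "\<dots> \<le> (LINT x|lebesgue_on (cube 0 1). (max (u x) 0)\<^sup>2)"
      by (rule integral_mono[OF vint ui]) (use vb(1,2)[where j=0] in \<open>auto intro!: power_mono simp: l_def\<close>)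
    also have "\<dots> \<le> H 0" using KY by (simp add: H_def h_def Nj_def)
    finally show ?case .
  next
    case (Suc j)
    obtain V \<phi> where V: "subsol a (cube 0 1) (v (Suc j)) V" "approximates \<phi> (v (Suc j)) V" "\<And>k x. 0 \<le> \<phi> k x"
      using subsol_ramp[OF u h, of "Suc j" "l (Suc j)"] unfolding v_def[abs_def] by blast
    let ?S = "{x \<in> cube 0 (\<rho> j). v (Suc j) x \<noteq> 0}"
    have Sm: "?S \<in> sets lebesgue"
    proof -
      have "v (Suc j) \<in> borel_measurable (lebesgue_on (cube 0 (\<rho> j)))"
        using L2_subset[OF vL2 sub[OF \<rho>(4)] cube_sets cube_sets] by (simp add: L2_def)
      then have "{x \<in> space (lebesgue_on (cube 0 (\<rho> j))). v (Suc j) x \<noteq> 0} \<in> sets (lebesgue_on (cube 0 (\<rho> j)))" by measurable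
      then show ?thesis by (simp add: sets_restrict_space_iff)
    qed
    have "(h j * exp (- 1))\<^sup>2 * measure lebesgue ?S \<le> Y j" unfolding Y_def
    proof (rule measure_superlevel_le[OF cube_lmeasurable vint[OF \<rho>(4)] Sm])
      fix x assume x: "x \<in> ?S"
      then have "l j + h j \<le> u x" using vb(1,2)[where j="Suc j" and x=x] by (auto simp: lh)
      then have "h j * exp (- 1) \<le> v j x" unfolding v_def by (rule ramp_bounds(4)[OF h])
      then show "(h j * exp (- 1))\<^sup>2 \<le> (v j x)\<^sup>2" using h[of j] by (intro power_mono) auto
    qed auto
    also have "\<dots> \<le> (h j * exp (- 1))\<^sup>2 * (bump_mass TYPE('n) * vol TYPE('n) (Nj j))" using Suc by (simp add: H_def mult_ac)
    finally have supp: "measure lebesgue ?S \<le> bump_mass TYPE('n) * vol TYPE('n) (Nj j)"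
      by (rule mult_left_le_imp_le) (use h[of j] in simp)
    have sN: "4 * side (Nj j) \<le> \<rho> j - \<rho> (Suc j)"
    proof -
      have X: "1 \<le> (PA * PB) powr (1 / (1 - s - t))" using ratio s by (intro ge_one_powr_ge_zero) auto
      have "16 * 1 \<le> start_const TYPE('n) s t * (PA * PB) powr (1 / (1 - s - t))"
        by (intro mult_mono X) (auto simp: start_const_def)
      then have "16 \<le> (3::real) ^ N0" using N0 by linarith
      then have "side N0 \<le> 1 / 16" by (simp add: power_one_over divide_simps)
      moreover have "side (j * level_gap s t) \<le> (1 / 2) ^ j"
      proof -
        have "side (j * level_gap s t) \<le> side j" by (intro power_decreasing) (auto simp: level_gap_def)
        also have "\<dots> \<le> (1 / 2) ^ j" by (intro power_mono) auto
        finally show ?thesis .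
      qed
      ultimately have "side N0 * side (j * level_gap s t) \<le> 1 / 16 * (1 / 2) ^ j" by (intro mult_mono) auto
      then show ?thesis unfolding \<rho>(5) Nj_def power_add by (simp add: power2_eq_square)
    qed
    let ?f = "decay_const TYPE('n) s t * ((PA * PB) powr (1 / (1 - s - t)) / 3 ^ Nj j) powr (2 * (1 - t)) *
      ((1 / 2) ^ (j + 2)) powr (- (4 + 2 * (s / (1 - s - t))))"
    have "Y (Suc j) \<le> ?f * (LINT x|lebesgue_on (cube 0 (\<rho> j)). (v (Suc j) x)\<^sup>2)"
      using level_decay[OF V \<rho>(1) \<rho>(3) \<rho>(4) sN supp] unfolding Y_def \<rho>(5) .
    also have "\<dots> \<le> side (level_gap s t) ^ CARD('n) / 4 * (LINT x|lebesgue_on (cube 0 (\<rho> j)). (v (Suc j) x)\<^sup>2)"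
      unfolding Nj_def by (intro mult_right_mono level_factor N0) simp
    also have "\<dots> \<le> side (level_gap s t) ^ CARD('n) / 4 * Y j"
      unfolding Y_def by (intro mult_left_mono integral_mono[OF vint[OF \<rho>(4)] vint[OF \<rho>(4)]] power_mono vdec vb) auto
    also have "\<dots> \<le> side (level_gap s t) ^ CARD('n) / 4 * H j" by (intro mult_left_mono Suc) auto
    \<comment> \<open>The quarter is the ratio of the squared heights h, the power of the side is
      the ratio of the volumes.\<close>
    also have "\<dots> = H (Suc j)"
      by (simp add: H_def h_def Nj_def vol_def power_add power_mult_distrib field_simps)
    finally show ?case .
  qed
  have hu: "cube 0 (1 / 2) \<subseteq> cube (0::real^'n) 1" by (rule sub) simp
  have um: "u \<in> borel_measurable (lebesgue_on (cube 0 (1 / 2)))"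
    using L2_subset[OF H1a_L2[OF subsol_H1a[OF u]] hu cube_sets cube_sets] by (simp add: L2_def)
  have wm: "(\<lambda>x. (max (u x - K) 0)\<^sup>2) \<in> borel_measurable (lebesgue_on (cube 0 (1 / 2)))" using um by measurable
  \<comment> \<open>The levels stay below K, so every v j dominates the excess over K.\<close>
  have wv: "(max (u x - K) 0)\<^sup>2 \<le> (v j x)\<^sup>2" for x j
  proof (rule power_mono)
    show "max (u x - K) 0 \<le> v j x" using vb(3)[where j=j and x=x] lh(2)[of "Suc j"] by linarith
  qed simp
  have wi: "integrable (lebesgue_on (cube 0 (1 / 2))) (\<lambda>x. (max (u x - K) 0)\<^sup>2)"
    by (rule Bochner_Integration.integrable_bound[OF vint[of "1 / 2" 0] wm]) (use wv[of _ 0] in auto)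
  have le: "(LINT x|lebesgue_on (cube 0 (1 / 2)). (max (u x - K) 0)\<^sup>2) \<le> bump_mass TYPE('n) * (K * exp (- 1))\<^sup>2 * (1 / 2) ^ j" for j
  proof -
    have "(LINT x|lebesgue_on (cube 0 (1 / 2)). (max (u x - K) 0)\<^sup>2) \<le> (LINT x|lebesgue_on (cube 0 (1 / 2)). (v j x)\<^sup>2)"
      by (rule integral_mono[OF wi vint wv]) simp
    also have "\<dots> \<le> Y j" unfolding Y_def
      by (rule integral_lebesgue_on_mono_set[OF vint[OF \<rho>(4)] sub[OF \<rho>(2)] cube_sets cube_sets]) simp
    also have "\<dots> \<le> H j" by (rule YH)
    also have "\<dots> \<le> bump_mass TYPE('n) * ((K * exp (- 1))\<^sup>2 * (1 / 2) ^ j) * 1" unfolding H_def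
    proof (intro mult_mono)
      have "(h j * exp (- 1))\<^sup>2 = (K * exp (- 1))\<^sup>2 * ((1 / 2) ^ Suc j * (1 / 2) ^ Suc j)" by (simp add: h_def power2_eq_square)
      also have "\<dots> \<le> (K * exp (- 1))\<^sup>2 * (1 * (1 / 2) ^ j)"
      proof (intro mult_left_mono mult_mono)
        show "(1 / 2 :: real) ^ Suc j \<le> 1" by (rule power_le_one) auto
        show "(1 / 2 :: real) ^ Suc j \<le> (1 / 2) ^ j" by simp
      qed auto
      finally show "(h j * exp (- 1))\<^sup>2 \<le> (K * exp (- 1))\<^sup>2 * (1 / 2) ^ j" by simp
      show "vol TYPE('n) (Nj j) \<le> 1" unfolding vol_def by (intro power_le_one) auto
    qed (use bump_mass_pos[where 'n='n] in \<open>auto intro: less_imp_le\<close>)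
    finally show ?thesis by simp
  qed
  have "(\<lambda>j. bump_mass TYPE('n) * (K * exp (- 1))\<^sup>2 * (1 / 2) ^ j) \<longlonglongrightarrow> bump_mass TYPE('n) * (K * exp (- 1))\<^sup>2 * 0"
    by (intro tendsto_intros LIMSEQ_power_zero) auto
  then have "(LINT x|lebesgue_on (cube 0 (1 / 2)). (max (u x - K) 0)\<^sup>2) \<le> bump_mass TYPE('n) * (K * exp (- 1))\<^sup>2 * 0"
    by (rule LIMSEQ_le_const) (use le in blast)
  moreover have "0 \<le> (LINT x|lebesgue_on (cube 0 (1 / 2)). (max (u x - K) 0)\<^sup>2)" by simp
  ultimately have "(LINT x|lebesgue_on (cube 0 (1 / 2)). (max (u x - K) 0)\<^sup>2) = 0" by linarith
  then have "AE x in lebesgue_on (cube 0 (1 / 2)). (max (u x - K) 0)\<^sup>2 = 0"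
    using integral_nonneg_eq_0_iff_AE[OF wi] by simp
  then show ?thesis by (rule AE_mp) (auto intro!: AE_I2 simp: max_def split: if_splits)
qed

lemma local_maximum:
  assumes u: "subsol a (cube 0 1) u G"
  shows "AE x in lebesgue_on (cube 0 (1 / 2)). u x \<le>
    sup_const TYPE('n) s t * (PA * PB) powr (real CARD('n) / (2 * (1 - s - t))) * L2_norm_on (cube 0 1) (\<lambda>x. max (u x) 0)"
proof -
  define \<sigma> where "\<sigma> = 1 - s - t"
  define d where "d = real CARD('n)"
  define X where "X = PA * PB"
  define C3 where "C3 = start_const TYPE('n) s t"
  define I where "I = bump_mass TYPE('n)"
  define W where "W = L2_norm_on (cube 0 1) (\<lambda>x. max (u x) 0)"
  have X: "1 \<le> X" using ratio by (simp add: X_def)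
  have C3: "16 \<le> C3" by (simp add: C3_def start_const_def)
  have \<sigma>: "0 < \<sigma>" using s by (simp add: \<sigma>_def)
  have I: "0 < I" unfolding I_def by (rule bump_mass_pos)
  have X1: "1 \<le> X powr (1 / \<sigma>)" using X \<sigma> by (simp add: ge_one_powr_ge_zero)
  have "1 * 1 \<le> C3 * X powr (1 / \<sigma>)" using C3 X1 by (intro mult_mono) auto
  then obtain N0 where N0: "C3 * X powr (1 / \<sigma>) \<le> 3 ^ N0" "3 ^ N0 \<le> 3 * (C3 * X powr (1 / \<sigma>))"
    using triadic_scale[of "C3 * X powr (1 / \<sigma>)"] by auto
  have W0: "0 \<le> W" by (simp add: W_def L2_norm_on_def)
  have W2: "(LINT x|lebesgue_on (cube 0 1). (max (u x) 0)\<^sup>2) = W\<^sup>2" by (simp add: W_def L2_norm_on_def)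
  \<comment> \<open>The value of K for which the smallness condition of \<open>level_bound\<close>
    holds with equality.\<close>
  define K0 where "K0 = 2 * exp 1 / sqrt I * (3 ^ N0) powr (d / 2) * W"
  have K0: "0 \<le> K0" using I W0 by (simp add: K0_def)
  have K0sq: "I * (K0 / 2 * exp (- 1))\<^sup>2 * vol TYPE('n) N0 = W\<^sup>2"
  proof -
    have "K0 / 2 * exp (- 1) = (3 ^ N0) powr (d / 2) * W / sqrt I" by (simp add: K0_def exp_minus field_simps)
    then have "(K0 / 2 * exp (- 1))\<^sup>2 = ((3 ^ N0) powr (d / 2))\<^sup>2 * W\<^sup>2 / I" using I by (simp add: power_mult_distrib power_divide)
    also have "((3 ^ N0) powr (d / 2))\<^sup>2 = (3 ^ N0) powr (d / 2 + d / 2)" by (simp only: power2_eq_square powr_add)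
    also have "\<dots> = (3 ^ N0) ^ CARD('n)" by (simp add: d_def powr_realpow)
    finally show ?thesis using I by (simp add: vol_def power_one_over field_simps power_divide)
  qed
  \<comment> \<open>K0 vanishes if the positive part of u does, whereas \<open>level_bound\<close>
    needs a positive level; hence the small addition, removed by a limit.\<close>
  have "AE x in lebesgue_on (cube 0 (1 / 2)). u x \<le> K0 + 1 / real (Suc n)" for n
  proof (rule level_bound[OF u])
    show "start_const TYPE('n) s t * (PA * PB) powr (1 / (1 - s - t)) \<le> 3 ^ N0" using N0(1) by (simp only: C3_def X_def \<sigma>_def)
    show "0 < K0 + 1 / real (Suc n)" using K0 by (intro add_nonneg_pos) auto
    have "W\<^sup>2 = I * (K0 / 2 * exp (- 1))\<^sup>2 * vol TYPE('n) N0" by (rule K0sq[symmetric])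
    also have "\<dots> \<le> I * ((K0 + 1 / real (Suc n)) / 2 * exp (- 1))\<^sup>2 * vol TYPE('n) N0"
      using K0 I by (intro mult_right_mono mult_left_mono power_mono divide_right_mono) auto
    finally show "(LINT x|lebesgue_on (cube 0 1). (max (u x) 0)\<^sup>2) \<le> bump_mass TYPE('n) * ((K0 + 1 / real (Suc n)) / 2 * exp (- 1))\<^sup>2 * vol TYPE('n) N0"
      unfolding W2 I_def .
  qed
  then have "AE x in lebesgue_on (cube 0 (1 / 2)). \<forall>n. u x \<le> K0 + 1 / real (Suc n)" by (simp add: AE_all_countable)
  then have AE0: "AE x in lebesgue_on (cube 0 (1 / 2)). u x \<le> K0"
  proof (rule AE_mp, intro AE_I2 impI)
    fix x assume "\<forall>n. u x \<le> K0 + 1 / real (Suc n)"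
    then have "u x \<le> K0 + inverse (real (Suc n))" for n by (simp add: inverse_eq_divide)
    moreover have "(\<lambda>n. K0 + inverse (real (Suc n))) \<longlonglongrightarrow> K0 + 0" by (intro tendsto_intros LIMSEQ_inverse_real_of_nat)
    ultimately show "u x \<le> K0" using LIMSEQ_le_const[of "\<lambda>n. K0 + inverse (real (Suc n))" "K0 + 0" "u x"] by auto
  qed
  have "K0 \<le> 2 * exp 1 / sqrt I * (3 * (C3 * X powr (1 / \<sigma>))) powr (d / 2) * W"
    unfolding K0_def using N0(2) I W0 by (intro mult_right_mono mult_left_mono powr_mono2) (auto simp: d_def)
  also have "(3 * (C3 * X powr (1 / \<sigma>))) powr (d / 2) = (3 * C3) powr (d / 2) * X powr (d / (2 * \<sigma>))"
    using C3 X by (simp add: powr_mult powr_powr mult.assoc mult.commute)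
  finally have "K0 \<le> sup_const TYPE('n) s t * X powr (d / (2 * \<sigma>)) * W"
    by (simp add: sup_const_def I_def C3_def d_def mult.assoc)
  with AE0 show ?thesis unfolding X_def d_def \<sigma>_def W_def by (auto elim: AE_mp intro: AE_I2)
qed

end

subsection \<open>The multiscale ellipticity constants\<close>

lemma finite_triadic_cube: "finite (triadic k \<inter> cube 0 r :: (real^'n) set)"
proof -
  define c :: real where "c = 3 powi k"
  have c: "0 < c" by (simp add: c_def)
  define J where "J = {- \<lceil>r / (2 * c)\<rceil>..\<lceil>r / (2 * c)\<rceil>}"
  have "(triadic k \<inter> cube 0 r :: (real^'n) set) \<subseteq> vec_lambda ` (UNIV \<rightarrow>\<^sub>E (\<lambda>j. c * of_int j) ` J)"
  proof
    fix z :: "real^'n" assume z: "z \<in> triadic k \<inter> cube 0 r"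
    have "z $ i \<in> (\<lambda>j. c * of_int j) ` J" for i
    proof -
      obtain j :: int where j: "z $ i = c * of_int j" using z unfolding triadic_def c_def by blast
      have "\<bar>z $ i\<bar> < r / 2" using z by (simp add: cube_def)
      then have "\<bar>c * of_int j\<bar> < r / 2" unfolding j .
      then have "c * \<bar>of_int j\<bar> < r / 2" using c by (simp add: abs_mult)
      then have "\<bar>of_int j\<bar> < r / (2 * c)" using c by (simp add: field_simps)
      then have "\<bar>j\<bar> \<le> \<lceil>r / (2 * c)\<rceil>" by linarith
      then have "j \<in> J" by (auto simp: J_def)
      then show ?thesis using j by blast
    qed
    then have "vec_nth z \<in> UNIV \<rightarrow>\<^sub>E (\<lambda>j. c * of_int j) ` J" by auto
    then show "z \<in> vec_lambda ` (UNIV \<rightarrow>\<^sub>E (\<lambda>j. c * of_int j) ` J)" by (metis imageI vec_nth_inverse)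
  qed
  then show ?thesis by (rule finite_subset) (intro finite_imageI finite_PiE; simp add: J_def)
qed

lemma ennreal_term_le_infsum:
  fixes f :: "'i \<Rightarrow> ennreal"
  assumes "k \<in> S" shows "f k \<le> infsum f S"
proof -
  have "sum f {k} \<le> (SUP F\<in>{F. finite F \<and> F \<subseteq> S}. sum f F)" by (rule SUP_upper) (use assms in auto)
  then show ?thesis by (simp add: nonneg_infsum_complete)
qed

text \<open>The sum shared by \<open>Lambda_up\<close> and \<open>lambda_low\<close> for m = 0,
  without the normalising factor. The forms \<open>0 - k\<close> and \<open>3 powi 0\<close> are
  left as they are so that both unfold to it literally.\<close>

definition multiscale_sum :: "((real^'n) set \<Rightarrow> ennreal) \<Rightarrow> real \<Rightarrow> ennreal" where
  "multiscale_sum q s = (\<Sum>\<^sub>\<infinity>k\<in>{..0::int}. ennreal (3 powr (- s * of_int (0 - k))) *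
     (MAX z\<in>triadic k \<inter> cube 0 (3 powi 0). q (cube z (3 powi k))))"

lemma node_le_multiscale_sum:
  assumes "node n z"
  shows "ennreal (3 powr (- s * real n)) * q (tcube n z) \<le> multiscale_sum q s"
proof -
  have side: "3 powi (- int n) = side n" by (simp add: power_int_minus power_one_over inverse_eq_divide)
  have fin: "finite (triadic (- int n) \<inter> cube 0 (3 powi 0) :: (real^'n) set)" by (rule finite_triadic_cube)
  have "q (cube z (3 powi (- int n))) \<le> (MAX z\<in>triadic (- int n) \<inter> cube 0 (3 powi 0). q (cube z (3 powi (- int n))))"
    by (rule Max_ge[OF finite_imageI[OF fin]]) (use node_triadic[OF assms] in \<open>auto intro!: imageI\<close>)
  then have "ennreal (3 powr (- s * of_int (0 - - int n))) * q (tcube n z) \<le>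
      ennreal (3 powr (- s * of_int (0 - - int n))) * (MAX z\<in>triadic (- int n) \<inter> cube 0 (3 powi 0). q (cube z (3 powi (- int n))))"
    unfolding side by (rule mult_left_mono) simp
  also have "\<dots> \<le> multiscale_sum q s" unfolding multiscale_sum_def
    by (rule ennreal_term_le_infsum[where f="\<lambda>k. ennreal (3 powr (- s * of_int (0 - k))) * (MAX z\<in>triadic k \<inter> cube 0 (3 powi 0). q (cube z (3 powi k)))"]) simp
  finally show ?thesis by simp
qed

lemma node_le_real:
  assumes z: "node n z" and fin: "multiscale_sum q s < \<infinity>" and q: "q (tcube n z) = ennreal x" and x: "0 \<le> x"
  shows "x \<le> enn2real (multiscale_sum q s) * (3 powr s) ^ n"
proof -
  have "ennreal (3 powr (- s * real n) * x) \<le> multiscale_sum q s"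
    using node_le_multiscale_sum[OF z, of s q] x by (simp add: q ennreal_mult)
  then have "enn2real (ennreal (3 powr (- s * real n) * x)) \<le> enn2real (multiscale_sum q s)"
    by (intro enn2real_mono) (use fin in auto)
  then have "3 powr (- s * real n) * x \<le> enn2real (multiscale_sum q s)" using x by simp
  then have "3 powr (s * real n) * (3 powr (- s * real n) * x) \<le> 3 powr (s * real n) * enn2real (multiscale_sum q s)"
    by (intro mult_left_mono) auto
  also have "3 powr (s * real n) * (3 powr (- s * real n) * x) = x"
    by (simp add: mult.assoc[symmetric] powr_add[symmetric])
  also have "3 powr (s * real n) = (3 powr s) ^ n" by (simp add: powr_realpow[symmetric] powr_powr)
  finally show ?thesis by (simp only: mult.commute)
qed

lemma inverse_inverse_ennreal: "inverse (inverse x) = (x :: ennreal)"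
proof (cases x)
  case (real r)
  then show ?thesis by (cases "r = 0") (auto simp: inverse_ennreal)
qed simp

lemma Theta_multiscale_sum:
  fixes a :: "real^'n \<Rightarrow> real^'n^'n"
  shows "Theta a K s t 0 = (ennreal (1 - 3 powr (- s)) * multiscale_sum (\<lambda>U. esqrt (coarse_norm a K U)) s)\<^sup>2 *
    (ennreal (1 - 3 powr (- t)) * multiscale_sum (\<lambda>U. ennreal (sqrt (spectral_norm (a_star_inv a U)))) t)\<^sup>2"
  unfolding Theta_def Lambda_up_def lambda_low_def multiscale_sum_def divide_ennreal_def inverse_inverse_ennreal ..

text \<open>In \<open>ennreal\<close> zero times infinity is zero, so finiteness of the product
  \<open>Theta\<close> bounds one factor only if the other is known to be positive. Positivity
  follows from the coordinate functions, whose mean gradient is nonzero.\<close>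

lemma (in coefficients) spectral_norm_a_star_inv_pos:
  assumes \<mu>: "measure lebesgue U > 0" shows "0 < spectral_norm (a_star_inv a U)"
proof (rule ccontr)
  assume "\<not> 0 < spectral_norm (a_star_inv a U)"
  then have s: "spectral_norm (a_star_inv a U) = 0" using spectral_norm_nonneg[of "a_star_inv a U"] by linarith
  fix i :: 'n
  have w: "(\<lambda>x. x $ i) \<in> smooth_up_to_boundary U" by (rule smooth_up_to_boundary_UNIV[OF smooth_on_coord])
  have gw: "grad (\<lambda>x::real^'n. x $ i) = (\<lambda>x. axis i 1)" using grad_coord by blast
  have "(LINT x|lebesgue_on U. grad (\<lambda>x. x $ i) x $ i) = measure lebesgue U"
    unfolding gw by (simp add: measure_restrict_space)
  then show False using smooth_flux_bound[OF \<mu> w, of i] \<mu> by (simp add: s)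
qed

text \<open>Finiteness of \<open>Theta\<close> is translated into bounds on every triadic cube. A
  single term of the multiscale sum is bounded by the whole sum, which gives the factor 3^(s n) or
  3^(t n) on generation n. Gradients are handled by \<open>smooth_flux_bound\<close>, fluxes by
  restricting the subsolution to the cube.\<close>

lemma coarse_ellipticI:
  fixes a :: "real^'n \<Rightarrow> real^'n^'n"
  assumes field: "coefficient_field (cube 0 1) a" and st: "0 < s" "0 < t" "t < 1" "s + t < 1"
    and \<Theta>: "Theta a (K_sub a) s t 0 < \<infinity>"
  obtains PA PB where "coarse_elliptic a t PB s PA"
    "enn2real (Theta a (K_sub a) s t 0) = ((1 - 3 powr (- s)) * (1 - 3 powr (- t)) * (PA * PB))\<^sup>2"
proof -
  interpret coefficients a "cube 0 1"
    by unfold_locales (use field in \<open>auto simp: cube_open cube_bounded\<close>)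
  define qA where "qA U = esqrt (coarse_norm a (K_sub a) U)" for U
  define qB where "qB U = ennreal (sqrt (spectral_norm (a_star_inv a U)))" for U
  define SA where "SA = multiscale_sum qA s"
  define SB where "SB = multiscale_sum qB t"
  define cs where "cs = 1 - 3 powr (- s)"
  define ct where "ct = 1 - 3 powr (- t)"
  have c: "0 < cs" "0 < ct" using powr_less_one[of "- s"] powr_less_one[of "- t"] st by (auto simp: cs_def ct_def)
  have \<Theta>eq: "Theta a (K_sub a) s t 0 = (ennreal cs * SA)\<^sup>2 * (ennreal ct * SB)\<^sup>2"
    unfolding Theta_multiscale_sum SA_def SB_def qA_def[abs_def] qB_def[abs_def] cs_def ct_def ..
  have co: "coefficients a (tcube n z)" if "node n z" for n z
    by (rule coefficients_tcube[OF _ that]) unfold_locales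
  have \<mu>: "0 < measure lebesgue (tcube n z :: (real^'n) set)" for n z by (simp add: measure_tcube)
  have root: "node 0 (0::real^'n)" by (rule node.root)
  have SB0: "SB \<noteq> 0"
  proof -
    have "0 < qB (tcube 0 0)" using coefficients.spectral_norm_a_star_inv_pos[OF co[OF root] \<mu>] by (simp add: qB_def)
    also have "\<dots> \<le> SB" using node_le_multiscale_sum[OF root, of t qB] by (simp add: SB_def)
    finally show ?thesis by simp
  qed
  have SA: "SA < \<infinity>"
  proof (rule ccontr)
    assume "\<not> SA < \<infinity>"
    then have "SA = top" by (simp add: not_less top_unique)
    then have "Theta a (K_sub a) s t 0 = top" unfolding \<Theta>eq using SB0 c by (simp add: ennreal_mult_eq_top_iff power2_eq_square)
    then show False using \<Theta> by simp
  qed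
  have fin: "\<exists>A. coarse_norm a (K_sub a) (tcube n z) = ereal A \<and> 0 \<le> A" if z: "node n z" for n z
  proof -
    have "qA (tcube n z) \<noteq> \<infinity>"
    proof
      assume "qA (tcube n z) = \<infinity>"
      then have "SA = top" using node_le_multiscale_sum[OF z, of s qA] by (simp add: SA_def ennreal_mult_eq_top_iff top_unique)
      then show False using SA by simp
    qed
    then have "coarse_norm a (K_sub a) (tcube n z) \<noteq> \<infinity>" by (auto simp: qA_def esqrt_def)
    moreover have "0 \<le> coarse_norm a (K_sub a) (tcube n z)" by (rule coefficients.coarse_norm_nonneg[OF co[OF z]])
    ultimately show ?thesis by (cases "coarse_norm a (K_sub a) (tcube n z)") auto
  qed
  obtain A0 where A0: "coarse_norm a (K_sub a) (tcube 0 0) = ereal A0" "0 \<le> A0" using fin[OF root] by blast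
  define B0 where "B0 = spectral_norm (a_star_inv a (tcube 0 0))"
  have ratio0: "1 \<le> sqrt A0 * sqrt B0"
    unfolding B0_def by (rule coefficients.coarse_ellipticity_ratio_ge_1[OF co[OF root] \<mu> A0(1)])
  have SA0: "SA \<noteq> 0"
  proof -
    have "0 < sqrt A0" using ratio0 A0(2) by (cases "A0 = 0") auto
    then have "0 < qA (tcube 0 0)" by (simp only: qA_def esqrt_def A0(1)) simp
    also have "\<dots> \<le> SA" using node_le_multiscale_sum[OF root, of s qA] by (simp add: SA_def)
    finally show ?thesis by simp
  qed
  have SB: "SB < \<infinity>"
  proof (rule ccontr)
    assume "\<not> SB < \<infinity>"
    then have "SB = top" by (simp add: not_less top_unique)
    then have "Theta a (K_sub a) s t 0 = top" unfolding \<Theta>eq using SA0 c by (simp add: ennreal_mult_eq_top_iff power2_eq_square)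
    then show False using \<Theta> by simp
  qed
  \<comment> \<open>The normalising factors are left out of PA and PB; they reappear in the formula
    for \<open>Theta\<close> and end up in the final constant.\<close>
  define PA where "PA = enn2real SA"
  define PB where "PB = enn2real SB"
  have P: "0 \<le> PA" "0 \<le> PB" by (simp_all add: PA_def PB_def)
  have bA: "sqrt A \<le> PA * (3 powr s) ^ n" if "node n z" "coarse_norm a (K_sub a) (tcube n z) = ereal A" "0 \<le> A" for n z A
    unfolding PA_def SA_def by (rule node_le_real[OF that(1)]) (use SA that in \<open>auto simp: SA_def qA_def esqrt_def\<close>)
  have bB: "sqrt (spectral_norm (a_star_inv a (tcube n z))) \<le> PB * (3 powr t) ^ n" if "node n z" for n z
    unfolding PB_def SB_def by (rule node_le_real[OF that]) (use SB spectral_norm_nonneg in \<open>auto simp: SB_def qB_def\<close>)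
  have ce: "coarse_elliptic a t PB s PA"
  proof unfold_locales
    show "\<bar>LINT x|lebesgue_on (tcube n z). grad w x $ i\<bar> \<le> sqrt (vol TYPE('n) n) * (PB * (3 powr t) ^ n) * sqrt (energy a (tcube n z) (grad w))"
      if z: "node n z" and w: "w \<in> smooth_up_to_boundary (cube 0 1)" for n z w i
    proof -
      have "\<bar>LINT x|lebesgue_on (tcube n z). grad w x $ i\<bar> \<le>
          sqrt (measure lebesgue (tcube n z) * spectral_norm (a_star_inv a (tcube n z))) * sqrt (energy a (tcube n z) (grad w))"
        by (rule coefficients.smooth_flux_bound[OF co[OF z] \<mu> smooth_up_to_boundary_subset[OF w node_subset[OF z]]])
      also have "\<dots> = sqrt (vol TYPE('n) n) * sqrt (spectral_norm (a_star_inv a (tcube n z))) * sqrt (energy a (tcube n z) (grad w))"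
        by (simp only: measure_tcube real_sqrt_mult)
      also have "\<dots> \<le> sqrt (vol TYPE('n) n) * (PB * (3 powr t) ^ n) * sqrt (energy a (tcube n z) (grad w))"
        by (intro mult_right_mono mult_left_mono bB[OF z] real_sqrt_ge_zero coefficients.energy_nonneg[OF co[OF z]] vol_pos)
      finally show ?thesis .
    qed
    show "\<bar>LINT x|lebesgue_on (tcube n z). (a x *v V x) $ i\<bar> \<le> sqrt (vol TYPE('n) n) * (PA * (3 powr s) ^ n) * sqrt (energy a (tcube n z) V)"
      if z: "node n z" and v: "subsol a (cube 0 1) v V" for n z v V i
    proof -
      obtain A where A: "coarse_norm a (K_sub a) (tcube n z) = ereal A" "0 \<le> A" using fin[OF z] by blast
      have "\<bar>LINT x|lebesgue_on (tcube n z). (a x *v V x) $ i\<bar> \<le>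
          sqrt (measure lebesgue (tcube n z) * A) * sqrt (energy a (tcube n z) V)"
        by (rule coefficients.coflux_bound[OF co[OF z] \<mu> A(1) subsol_subset[OF _ v node_subset[OF z] cube_open]]) unfold_locales
      also have "\<dots> = sqrt (vol TYPE('n) n) * sqrt A * sqrt (energy a (tcube n z) V)"
        by (simp only: measure_tcube real_sqrt_mult)
      also have "\<dots> \<le> sqrt (vol TYPE('n) n) * (PA * (3 powr s) ^ n) * sqrt (energy a (tcube n z) V)"
        by (intro mult_right_mono mult_left_mono bA[OF z A] real_sqrt_ge_zero coefficients.energy_nonneg[OF co[OF z]] vol_pos)
      finally show ?thesis .
    qed
    have "sqrt A0 \<le> PA" "sqrt B0 \<le> PB" using bA[OF root A0] bB[OF root] by (simp_all add: B0_def)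
    then have "sqrt A0 * sqrt B0 \<le> PA * PB" using A0(2) P spectral_norm_nonneg by (intro mult_mono) (auto simp: B0_def)
    then show "1 \<le> PA * PB" using ratio0 by linarith
  qed (use st P in auto)
  have "SA = ennreal PA" "SB = ennreal PB" using SA SB by (simp_all add: PA_def PB_def)
  then have "Theta a (K_sub a) s t 0 = (ennreal (cs * PA))\<^sup>2 * (ennreal (ct * PB))\<^sup>2"
    unfolding \<Theta>eq using P c by (simp add: ennreal_mult)
  also have "\<dots> = ennreal ((cs * PA)\<^sup>2 * (ct * PB)\<^sup>2)"    by (simp only: ennreal_power[OF mult_nonneg_nonneg[OF less_imp_le[OF c(1)] P(1)]]
      ennreal_power[OF mult_nonneg_nonneg[OF less_imp_le[OF c(2)] P(2)]] ennreal_mult[OF zero_le_power2 zero_le_power2])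
  finally have "enn2real (Theta a (K_sub a) s t 0) = (cs * PA)\<^sup>2 * (ct * PB)\<^sup>2" by simp
  also have "\<dots> = (cs * ct * (PA * PB))\<^sup>2" by (simp add: power_mult_distrib)
  finally show thesis using that[OF ce] unfolding cs_def ct_def by blast
qed

theorem theorem1p1:
  fixes s t \<sigma> :: real
  assumes "2 \<le> CARD('n::finite)"
    and "0 < s" "s < 1" "0 < t" "t < 1" "s + t < 1"
    and "\<sigma> = 1 - s - t"
  shows "\<exists>C::real. \<forall>a :: real ^ 'n \<Rightarrow> real ^ 'n ^ 'n.
    coarse_grained_elliptic a 0 \<longrightarrow>
    (\<forall>u \<in> subsolutions a (cube 0 1).
      Theta a (K_sub a) s t 0 < \<infinity> \<longrightarrow>
      esssup (lebesgue_on (cube 0 (1/2))) (\<lambda>x. ereal (u x))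
        \<le> ereal (C * enn2real (Theta a (K_sub a) s t 0) powr (real CARD('n) / (4 * \<sigma>))
                   * L2_norm_on (cube 0 1) (\<lambda>x. max (u x) 0)))"
\<comment> \<open>\<open>local_maximum\<close> is stated in terms of PA PB, which is the square root
  of \<open>Theta\<close> divided by the two normalising factors. Raising this to the power d/(2
  sigma) gives the extra factor of the witness and halves the exponent of \<open>Theta\<close> to
  d/(4 sigma).\<close>
proof (intro exI[where x="sup_const TYPE('n) s t * ((1 - 3 powr (- s)) * (1 - 3 powr (- t))) powr (- (real CARD('n) / (2 * \<sigma>)))"] allI impI ballI)
  fix a :: "real ^ 'n \<Rightarrow> real ^ 'n ^ 'n" and u
  assume ell: "coarse_grained_elliptic a 0" and u: "u \<in> subsolutions a (cube 0 1)"
    and \<Theta>: "Theta a (K_sub a) s t 0 < \<infinity>"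
  let ?\<Theta> = "enn2real (Theta a (K_sub a) s t 0)" and ?c = "(1 - 3 powr (- s)) * (1 - 3 powr (- t))" and ?d = "real CARD('n)"
  have "coefficient_field (cube 0 1) a" using ell by (simp add: coarse_grained_elliptic_def)
  then obtain PA PB where ce: "coarse_elliptic a t PB s PA" and eq: "?\<Theta> = (?c * (PA * PB))\<^sup>2"
    using coarse_ellipticI[of a s t] assms \<Theta> by blast
  interpret coarse_elliptic a t PB s PA by (rule ce)
  obtain G where G: "subsol a (cube 0 1) u G" using u unfolding subsolutions_iff by blast
  have c: "0 < ?c" using powr_less_one[of "- s"] powr_less_one[of "- t"] assms by simp
  have "0 \<le> PA * PB" using ratio by linarith
  then have "0 \<le> ?c * (PA * PB)" by (rule mult_nonneg_nonneg[OF less_imp_le[OF c]])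
  then have "sqrt ?\<Theta> = ?c * (PA * PB)" unfolding eq by simp
  then have "PA * PB = sqrt ?\<Theta> / ?c" using c by (metis less_irrefl nonzero_mult_div_cancel_left)
  then have "(PA * PB) powr (?d / (2 * \<sigma>)) = sqrt ?\<Theta> powr (?d / (2 * \<sigma>)) / ?c powr (?d / (2 * \<sigma>))"
    by (simp only: powr_divide)
  also have "sqrt ?\<Theta> powr (?d / (2 * \<sigma>)) = ?\<Theta> powr (1 / 2 * (?d / (2 * \<sigma>)))"
    by (simp only: powr_half_sqrt[symmetric] enn2real_nonneg powr_powr)
  also have "1 / 2 * (?d / (2 * \<sigma>)) = ?d / (4 * \<sigma>)" by simp
  also have "?\<Theta> powr (?d / (4 * \<sigma>)) / ?c powr (?d / (2 * \<sigma>)) = ?c powr (- (?d / (2 * \<sigma>))) * ?\<Theta> powr (?d / (4 * \<sigma>))"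
    by (simp only: powr_minus_divide times_divide_eq_left mult_1_left)
  finally have X: "(PA * PB) powr (?d / (2 * \<sigma>)) = ?c powr (- (?d / (2 * \<sigma>))) * ?\<Theta> powr (?d / (4 * \<sigma>))" .
  have hu: "cube 0 (1 / 2) \<subseteq> cube (0::real^'n) 1" by (rule cube_subset) simp
  have "u \<in> borel_measurable (lebesgue_on (cube 0 (1 / 2)))"
    using L2_subset[OF H1a_L2[OF subsol_H1a[OF G]] hu cube_sets cube_sets] by (simp add: L2_def)
  then have "(\<lambda>x. ereal (u x)) \<in> borel_measurable (lebesgue_on (cube 0 (1 / 2)))" by measurable
  then show "esssup (lebesgue_on (cube 0 (1 / 2))) (\<lambda>x. ereal (u x)) \<le>
      ereal (sup_const TYPE('n) s t * ?c powr (- (?d / (2 * \<sigma>))) * ?\<Theta> powr (?d / (4 * \<sigma>)) * L2_norm_on (cube 0 1) (\<lambda>x. max (u x) 0))"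
  proof (rule esssup_I)
    show "AE x in lebesgue_on (cube 0 (1 / 2)). ereal (u x) \<le>
      ereal (sup_const TYPE('n) s t * ?c powr (- (?d / (2 * \<sigma>))) * ?\<Theta> powr (?d / (4 * \<sigma>)) * L2_norm_on (cube 0 1) (\<lambda>x. max (u x) 0))"
      using local_maximum[OF G] unfolding assms(7)[symmetric] X by (simp only: ereal_less_eq mult.assoc)
  qed
qed

end
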